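(* Fix a real-valued $\phi\in L^\infty(B)$. (i) Let $\alpha\in[0,1)$ and a nonzero $g\in H^2_\alpha$ be given. If $T^\alpha_\phi g=0$, then $g$ is outer and moreover there exists a nonzero $c\in\mathbb R$ such that $$\phi\,|g|^2=c\log\left|\chi q^{-1/2}\right|\quad\text{on } B.\qquad( * )$$ (ii) If there are an $\alpha\in[0,1)$ and an outer function $g\in H^2_\alpha$ such that $( * )$ holds for some nonzero $c\in\mathbb R$, then $T^\alpha_\phi g=0$, where $\alpha$ is necessarily the index of $g$. Thus $\alpha$ is congruent modulo $1$ to $$\frac{1}{4\pi\log q}\left(\int_{B_1}\log|\phi|\,d\mu_1-\int_{B_q}\log|\phi|\,d\mu_q\right).$$ (iii) In particular, there exists at most one $\alpha\in[0,1)$ such that $T^\alpha_\phi$ has eigenvalue $0$, and the dimension of this eigenspace is at most one.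
   Context: Fix $0<q<1$ and let $\mathbb A=\{z\in\mathbb C: q<|z|<1\}$, with boundary $B=B_1\cup B_q$, where $B_1=\{|z|=1\}$ and $B_q=\{|z|=q\}$. For $j\in\{1,q\}$, $\mu_j$ is the multiple of arclength measure on $B_j$ with $\mu_j(B_j)=2\pi$, and $\mu=\mu_1+\mu_q$. The spaces $L^p(B)$ are taken with respect to $\mu$, and equalities between functions on $B$ are understood $\mu$-almost everywhere. Write $\chi(z)=z$. The annulus algebra $A(\mathbb A)$ is the algebra of functions continuous on the closure of $\mathbb A$ and analytic in $\mathbb A$. Hardy spaces: $H^2_0$ is the closure in $L^2(B)$ of the Laurent polynomials. For $\alpha\in[0,1)$, $H^2_\alpha=\{\chi^\alpha f: f\in H^2_0\}$, regarded as a closed subspace of $L^2(B)$ by fixing the branch $\chi^\alpha(re^{it})=r^\alpha e^{i\alpha t}$, $0\le t<2\pi$. Elements of $H^2_\alpha$ are the boundary values of multivalued analytic functions on $\mathbb A$ with single-valued modulus that are multiplied by $e^{2\pi i\alpha}$ under continuation once counterclockwise around the annulus; a nonzero function in $H^2_\alpha$ is said to have index $\alpha$. Each $H^2_\alpha$ is invariant under multiplication by elements of $A(\mathbb A)$. A function $g\in H^2_\alpha$ is outer if $\{ag: a\in A(\mathbb A)\}$ is dense in $H^2_\alpha$. Toeplitz operators: for real-valued $\phi\in L^\infty(B)$, $T^\alpha_\phi:H^2_\alpha\to H^2_\alpha$ is $T^\alpha_\phi f=P_\alpha(\phi f)$, where $P_\alpha$ is the orthogonal projection of $L^2(B)$ onto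 $H^2_\alpha$.
   Formalization: In (i) and (iii) φ is assumed not almost everywhere zero: for φ = 0 every nonzero g satisfies T g = 0, while ( * ) fails for every nonzero c, and 0 is an eigenvalue for every α with infinite-dimensional eigenspace. *)

theory Defs
  imports "HOL-Complex_Analysis.Complex_Analysis" "HOL-Library.Real_Mod"
begin

definition annulus :: "real \<Rightarrow> complex set" where
  "annulus q = {z. q < cmod z \<and> cmod z < 1}"

definition bdry :: "real \<Rightarrow> complex set" where
  "bdry q = sphere 0 1 \<union> sphere 0 q"

text \<open>Arclength on the circle of radius \<open>r\<close>, rescaled to total mass \<open>2 * pi\<close>:
  the image of Lebesgue measure on \<open>[0, 2 * pi)\<close> under \<open>t \<mapsto> r * cis t\<close>.\<close>

definition circle_measure :: "real \<Rightarrow> complex measure" where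
  "circle_measure r =
     distr (restrict_space lborel {0..<2*pi}) (restrict_space borel (sphere 0 r))
       (\<lambda>t. complex_of_real r * cis t)"

text \<open>The underlying space of the measure is the boundary itself, so measurability and
  integrability never depend on values of a function off the boundary.\<close>

definition bdry_measure :: "real \<Rightarrow> complex measure" where
  "bdry_measure q =
     measure_of (bdry q) (sets (restrict_space borel (bdry q)))
       (\<lambda>X. emeasure (circle_measure 1) (X \<inter> sphere 0 1)
          + emeasure (circle_measure q) (X \<inter> sphere 0 q))"

lemma space_bdry_measure [simp]: "space (bdry_measure q) = bdry q"
  unfolding bdry_measure_def
  by (subst space_measure_of) (auto simp: sets_restrict_space)

lemma sets_bdry_measure [simp, measurable_cong]:
  "sets (bdry_measure q) = sets (restrict_space borel (bdry q))"
proof -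
  have "sigma_sets (bdry q) (sets (restrict_space borel (bdry q))) = sets (restrict_space borel (bdry q))"
    using sets.sigma_sets_eq[of "restrict_space borel (bdry q)"]
    by (simp add: space_restrict_space)
  then show ?thesis
    unfolding bdry_measure_def
    by (subst sets_measure_of) (auto simp: sets_restrict_space)
qed

lemma bdry_trace_sets:
  assumes "X \<in> sets (restrict_space borel (bdry q))" "r = 1 \<or> r = q"
  shows "X \<inter> sphere 0 r \<in> sets (circle_measure r)"
proof -
  obtain Y where Y: "Y \<in> sets borel" "X = bdry q \<inter> Y"
    using assms(1) by (auto simp: sets_restrict_space)
  then have "X \<inter> sphere 0 r = sphere 0 r \<inter> Y"
    using assms(2) by (auto simp: bdry_def)
  then show ?thesis
    using Y by (auto simp: circle_measure_def sets_restrict_space)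
qed

lemma emeasure_bdry_measure:
  assumes "X \<in> sets (bdry_measure q)"
  shows "emeasure (bdry_measure q) X =
    emeasure (circle_measure 1) (X \<inter> sphere 0 1) + emeasure (circle_measure q) (X \<inter> sphere 0 q)"
proof (rule emeasure_measure_of[OF bdry_measure_def])
  show "sets (restrict_space borel (bdry q)) \<subseteq> Pow (bdry q)"
    by (auto simp: sets_restrict_space)
  show "X \<in> sets (bdry_measure q)" by fact
  show "positive (sets (bdry_measure q)) (\<lambda>X. emeasure (circle_measure 1) (X \<inter> sphere 0 1)
          + emeasure (circle_measure q) (X \<inter> sphere 0 q))"
    by (simp add: positive_def)
  show "countably_additive (sets (bdry_measure q)) (\<lambda>X. emeasure (circle_measure 1) (X \<inter> sphere 0 1)
          + emeasure (circle_measure q) (X \<inter> sphere 0 q))"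
  proof (rule countably_additiveI)
    fix F :: "nat \<Rightarrow> complex set"
    assume F: "range F \<subseteq> sets (bdry_measure q)" and disj: "disjoint_family F"
    have *: "(\<Sum>i. emeasure (circle_measure r) (F i \<inter> sphere 0 r)) =
        emeasure (circle_measure r) ((\<Union>i. F i) \<inter> sphere 0 r)" if "r = 1 \<or> r = q" for r
    proof -
      have "(\<Sum>i. emeasure (circle_measure r) (F i \<inter> sphere 0 r)) =
          emeasure (circle_measure r) (\<Union>i. F i \<inter> sphere 0 r)"
        using F disj bdry_trace_sets[OF _ that]
        by (intro suminf_emeasure) (auto simp: disjoint_family_on_def)
      then show ?thesis by (simp only: Int_UN_distrib2 UN_extend_simps)
    qed
    show "(\<Sum>i. emeasure (circle_measure 1) (F i \<inter> sphere 0 1)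
          + emeasure (circle_measure q) (F i \<inter> sphere 0 q)) =
        emeasure (circle_measure 1) ((\<Union>i. F i) \<inter> sphere 0 1)
          + emeasure (circle_measure q) ((\<Union>i. F i) \<inter> sphere 0 q)"
      using *[of 1] *[of q] suminf_add[OF summableI summableI,
          of "\<lambda>i. emeasure (circle_measure 1) (F i \<inter> sphere 0 1)"
            "\<lambda>i. emeasure (circle_measure q) (F i \<inter> sphere 0 q)"]
      by simp
  qed
qed

text \<open>Elements of the Lebesgue spaces are represented by functions; equality of elements is
  equality almost everywhere with respect to \<open>bdry_measure q\<close>.\<close>

definition L2_bdry :: "real \<Rightarrow> (complex \<Rightarrow> complex) set" where
  "L2_bdry q = {f. f \<in> borel_measurable (bdry_measure q) \<and>
     integrable (bdry_measure q) (\<lambda>z. (cmod (f z))\<^sup>2)}"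

definition Linf_real_bdry :: "real \<Rightarrow> (complex \<Rightarrow> real) set" where
  "Linf_real_bdry q = {\<phi>. \<phi> \<in> borel_measurable (bdry_measure q) \<and>
     (\<exists>C. AE z in bdry_measure q. \<bar>\<phi> z\<bar> \<le> C)}"

definition L2_inner :: "real \<Rightarrow> (complex \<Rightarrow> complex) \<Rightarrow> (complex \<Rightarrow> complex) \<Rightarrow> complex" where
  "L2_inner q f g = (\<integral>z. f z * cnj (g z) \<partial>bdry_measure q)"

definition L2_norm :: "real \<Rightarrow> (complex \<Rightarrow> complex) \<Rightarrow> real" where
  "L2_norm q f = sqrt (\<integral>z. (cmod (f z))\<^sup>2 \<partial>bdry_measure q)"

text \<open>Meaningful only for \<open>S \<subseteq> L2_bdry q\<close>.\<close>

definition L2_closure :: "real \<Rightarrow> (complex \<Rightarrow> complex) set \<Rightarrow> (complex \<Rightarrow> complex) set" where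
  "L2_closure q S = {f \<in> L2_bdry q. \<forall>e>0. \<exists>s\<in>S. L2_norm q (\<lambda>z. f z - s z) < e}"

definition laurent_polys :: "(complex \<Rightarrow> complex) set" where
  "laurent_polys = {(\<lambda>z. \<Sum>n\<in>F. c n * z powi n) |c (F :: int set). finite F}"

definition annulus_algebra :: "real \<Rightarrow> (complex \<Rightarrow> complex) set" where
  "annulus_algebra q =
     {a. continuous_on (closure (annulus q)) a \<and> a analytic_on annulus q}"

text \<open>The branch of \<open>z\<close> to the power \<open>\<alpha>\<close> with argument taken in \<open>[0, 2 * pi)\<close>.\<close>

definition chi_pow :: "real \<Rightarrow> complex \<Rightarrow> complex" where
  "chi_pow \<alpha> z = complex_of_real (cmod z powr \<alpha>) * cis (\<alpha> * Arg2pi z)"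

definition Hardy0 :: "real \<Rightarrow> (complex \<Rightarrow> complex) set" where
  "Hardy0 q = L2_closure q laurent_polys"

definition Hardy :: "real \<Rightarrow> real \<Rightarrow> (complex \<Rightarrow> complex) set" where
  "Hardy q \<alpha> = {h \<in> L2_bdry q. \<exists>f\<in>Hardy0 q. AE z in bdry_measure q. h z = chi_pow \<alpha> z * f z}"

definition has_index :: "real \<Rightarrow> (complex \<Rightarrow> complex) \<Rightarrow> real \<Rightarrow> bool" where
  "has_index q g \<alpha> \<longleftrightarrow> 0 \<le> \<alpha> \<and> \<alpha> < 1 \<and> g \<in> Hardy q \<alpha> \<and> \<not> (AE z in bdry_measure q. g z = 0)"

definition is_outer :: "real \<Rightarrow> real \<Rightarrow> (complex \<Rightarrow> complex) \<Rightarrow> bool" where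
  "is_outer q \<alpha> g \<longleftrightarrow> g \<in> Hardy q \<alpha> \<and>
     Hardy q \<alpha> \<subseteq> L2_closure q {(\<lambda>z. a z * g z) |a. a \<in> annulus_algebra q}"

text \<open>The orthogonal projection onto \<open>Hardy q \<alpha>\<close>; the value is determined up to equality
  almost everywhere.\<close>

definition Hardy_proj :: "real \<Rightarrow> real \<Rightarrow> (complex \<Rightarrow> complex) \<Rightarrow> complex \<Rightarrow> complex" where
  "Hardy_proj q \<alpha> f =
     (SOME h. h \<in> Hardy q \<alpha> \<and> (\<forall>k\<in>Hardy q \<alpha>. L2_inner q (\<lambda>z. f z - h z) k = 0))"

definition toeplitz ::
    "real \<Rightarrow> (complex \<Rightarrow> real) \<Rightarrow> real \<Rightarrow> (complex \<Rightarrow> complex) \<Rightarrow> complex \<Rightarrow> complex" where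
  "toeplitz q \<phi> \<alpha> f = Hardy_proj q \<alpha> (\<lambda>z. complex_of_real (\<phi> z) * f z)"

definition toeplitz_eigenspace ::
    "real \<Rightarrow> (complex \<Rightarrow> real) \<Rightarrow> real \<Rightarrow> complex \<Rightarrow> (complex \<Rightarrow> complex) set" where
  "toeplitz_eigenspace q \<phi> \<alpha> \<kappa> =
     {f \<in> Hardy q \<alpha>. AE z in bdry_measure q. toeplitz q \<phi> \<alpha> f z = \<kappa> * f z}"

definition toeplitz_eigenvalue ::
    "real \<Rightarrow> (complex \<Rightarrow> real) \<Rightarrow> real \<Rightarrow> complex \<Rightarrow> bool" where
  "toeplitz_eigenvalue q \<phi> \<alpha> \<kappa> \<longleftrightarrow>
     (\<exists>f\<in>toeplitz_eigenspace q \<phi> \<alpha> \<kappa>. \<not> (AE z in bdry_measure q. f z = 0))"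

text \<open>Dimension over the complex numbers, modulo equality almost everywhere: the set is
  spanned by at most one of its elements.\<close>

definition dim_le_one :: "real \<Rightarrow> (complex \<Rightarrow> complex) set \<Rightarrow> bool" where
  "dim_le_one q E \<longleftrightarrow>
     (\<exists>e\<in>E. \<forall>f\<in>E. \<exists>c :: complex. AE z in bdry_measure q. f z = c * e z)"

end

theory Submission
  imports Defs
begin

text \<open>If \<open>T\<^sup>\<alpha>\<^sub>\<phi> g = 0\<close>, then \<open>\<phi> * \<bar>g\<bar>\<^sup>2\<close> annihilates all \<open>z\<^sup>n\<close> and, being real, all
  \<open>cnj z\<^sup>n\<close>. Comparing Fourier coefficients on the two circles shows that it equals a constant \<open>k\<close>
  on the outer circle and \<open>- k\<close> on the inner one, a multiple of \<open>ln \<bar>z * q powr (-1/2)\<bar>\<close>; the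
  constant is not zero because a nonzero Hardy function cannot vanish on a boundary set of positive
  measure. Writing \<open>g = \<chi>\<^sup>\<alpha> * G\<close>, the orthogonality of \<open>\<phi> * g = \<plusminus> k / cnj g\<close> to \<open>\<chi>\<^sup>\<alpha> * z\<^sup>n\<close> is
  exactly the coefficient relation that puts \<open>1 / G\<close> into the Hardy space of index \<open>0\<close>. A function
  invertible in the Hardy space is outer, its index is determined by comparing coefficients with
  \<open>\<chi>\<^sup>\<gamma>\<close>, and the difference of the logarithmic means of \<open>\<bar>G\<bar>\<close> over the two circles is an integer
  multiple of \<open>2 * pi * ln q\<close> by the argument principle. The Hardy spaces enter only through their
  Laurent coefficients.\<close>

section \<open>Square-integrable functions\<close>

text \<open>Nontangential limits, factorization and harmonic measure on the annulus are all avoided;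
  two devices replace them. The first is evaluation: the value of a Laurent polynomial at an
  interior point is bounded by its mean modulus on the boundary, and this bound survives
  multiplication by \<open>exp (poly P z)\<close>. The second is the choice of \<open>P\<close>: a
  bounded measurable real function on the unit circle is an almost everywhere limit of uniformly
  bounded real parts of polynomials, so \<open>exp (poly P z)\<close> is entire with almost
  prescribed modulus on one circle. The obstacle is the other circle, where only the maximum
  principle is at hand; a power of \<open>z\<close>, or a second multiplier in the variable
  \<open>q / z\<close>, takes care of it. For the index, \<open>ln \<bar>G\<bar>\<close> on the
  boundary has to be reached from circles inside the annulus; convergence in the mean suffices there
  because \<open>1 / G\<close>, itself a Hardy function, controls the logarithm where
  \<open>G\<close> is small. The symbol 0 is excluded in (i) and (iii): its kernel is the whole
  space, and the weight equation would force \<open>c = 0\<close>.\<close>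

definition square_integrable :: "'a measure \<Rightarrow> ('a \<Rightarrow> complex) \<Rightarrow> bool" where
  "square_integrable M f \<longleftrightarrow> f \<in> borel_measurable M \<and> integrable M (\<lambda>x. (cmod (f x))\<^sup>2)"

text \<open>The measure is a parameter because the same estimates serve the boundary measure and
  single circles parametrized by the angle.\<close>

definition l2norm :: "'a measure \<Rightarrow> ('a \<Rightarrow> complex) \<Rightarrow> real" where
  "l2norm M f = sqrt (\<integral>x. (cmod (f x))\<^sup>2 \<partial>M)"

lemma square_integrable_measurable [measurable_dest]:
  "square_integrable M f \<Longrightarrow> f \<in> borel_measurable M"
  by (simp add: square_integrable_def)

lemma square_integrable_integrable:
  "square_integrable M f \<Longrightarrow> integrable M (\<lambda>x. (cmod (f x))\<^sup>2)"
  by (simp add: square_integrable_def)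

lemma l2norm_nonneg [simp]: "0 \<le> l2norm M f"
  by (simp add: l2norm_def)

lemma l2norm_power2: "(l2norm M f)\<^sup>2 = (\<integral>x. (cmod (f x))\<^sup>2 \<partial>M)"
  by (simp add: l2norm_def)

lemma l2norm_cong_AE:
  assumes "AE x in M. f x = g x" "f \<in> borel_measurable M" "g \<in> borel_measurable M"
  shows "l2norm M f = l2norm M g"
proof -
  have "(\<integral>x. (cmod (f x))\<^sup>2 \<partial>M) = (\<integral>x. (cmod (g x))\<^sup>2 \<partial>M)"
    using assms by (intro integral_cong_AE) auto
  then show ?thesis by (simp add: l2norm_def)
qed

lemma square_integrable_bound:
  assumes "square_integrable M f" "g \<in> borel_measurable M" "AE x in M. cmod (g x) \<le> C * cmod (f x)"
  shows "square_integrable M g"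
  unfolding square_integrable_def
proof
  have [measurable]: "f \<in> borel_measurable M" "g \<in> borel_measurable M"
    using assms by (auto simp: square_integrable_def)
  show "g \<in> borel_measurable M" by fact
  show "integrable M (\<lambda>x. (cmod (g x))\<^sup>2)"
  proof (rule Bochner_Integration.integrable_bound)
    show "integrable M (\<lambda>x. C\<^sup>2 * (cmod (f x))\<^sup>2)"
      using assms(1) by (auto simp: square_integrable_def)
    show "AE x in M. norm ((cmod (g x))\<^sup>2) \<le> norm (C\<^sup>2 * (cmod (f x))\<^sup>2)"
      using assms(3)
    proof eventually_elim
      case (elim x)
      then have "(cmod (g x))\<^sup>2 \<le> (C * cmod (f x))\<^sup>2" by (intro power_mono) auto
      then show ?case by (simp add: power_mult_distrib)
    qed
  qed measurable
qed

lemma square_integrable_cmult: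
  "square_integrable M f \<Longrightarrow> square_integrable M (\<lambda>x. c * f x)"
  by (rule square_integrable_bound[where C = "cmod c"]) (auto simp: norm_mult)

lemma square_integrable_uminus:
  "square_integrable M f \<Longrightarrow> square_integrable M (\<lambda>x. - f x)"
  by (rule square_integrable_bound[where C = 1]) auto

lemma square_integrable_add:
  assumes "square_integrable M f" "square_integrable M g"
  shows "square_integrable M (\<lambda>x. f x + g x)"
  unfolding square_integrable_def
proof
  have [measurable]: "f \<in> borel_measurable M" "g \<in> borel_measurable M"
    using assms by (auto simp: square_integrable_def)
  show "(\<lambda>x. f x + g x) \<in> borel_measurable M" by measurable
  show "integrable M (\<lambda>x. (cmod (f x + g x))\<^sup>2)"
  proof (rule Bochner_Integration.integrable_bound)
    show "integrable M (\<lambda>x. 2 * (cmod (f x))\<^sup>2 + 2 * (cmod (g x))\<^sup>2)"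
      using assms by (auto simp: square_integrable_def)
    show "AE x in M. norm ((cmod (f x + g x))\<^sup>2) \<le> norm (2 * (cmod (f x))\<^sup>2 + 2 * (cmod (g x))\<^sup>2)"
    proof (rule AE_I2)
      fix x
      have "(cmod (f x + g x))\<^sup>2 \<le> (cmod (f x) + cmod (g x))\<^sup>2"
        by (intro power_mono norm_triangle_ineq) auto
      also have "\<dots> \<le> 2 * (cmod (f x))\<^sup>2 + 2 * (cmod (g x))\<^sup>2"
        using zero_le_power2[of "cmod (f x) - cmod (g x)"] by (simp add: power2_eq_square algebra_simps)
      finally show "norm ((cmod (f x + g x))\<^sup>2) \<le> norm (2 * (cmod (f x))\<^sup>2 + 2 * (cmod (g x))\<^sup>2)"
        by simp
    qed
  qed measurable
qed

lemma square_integrable_diff: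
  assumes "square_integrable M f" "square_integrable M g"
  shows "square_integrable M (\<lambda>x. f x - g x)"
  using square_integrable_add[OF assms(1) square_integrable_uminus[OF assms(2)]] by simp

lemma square_integrable_cnj:
  "square_integrable M f \<Longrightarrow> square_integrable M (\<lambda>x. cnj (f x))"
  by (rule square_integrable_bound[where C = 1])
     (auto intro: measurable_compose[OF _ borel_measurable_continuous_onI]
       continuous_intros simp: square_integrable_def)

lemma square_integrable_0 [simp]: "square_integrable M (\<lambda>x. 0)"
  by (simp add: square_integrable_def)

lemma square_integrable_norm_mult:
  assumes "square_integrable M f" "square_integrable M g"
  shows "integrable M (\<lambda>x. cmod (f x) * cmod (g x))"
proof (rule Bochner_Integration.integrable_bound)
  have [measurable]: "f \<in> borel_measurable M" "g \<in> borel_measurable M"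
    using assms by (auto simp: square_integrable_def)
  show "integrable M (\<lambda>x. (cmod (f x))\<^sup>2 + (cmod (g x))\<^sup>2)"
    using assms by (auto simp: square_integrable_def)
  show "(\<lambda>x. cmod (f x) * cmod (g x)) \<in> borel_measurable M" by measurable
  show "AE x in M. norm (cmod (f x) * cmod (g x)) \<le> norm ((cmod (f x))\<^sup>2 + (cmod (g x))\<^sup>2)"
  proof (rule AE_I2)
    fix x
    have "2 * (cmod (f x) * cmod (g x)) \<le> (cmod (f x))\<^sup>2 + (cmod (g x))\<^sup>2"
      using zero_le_power2[of "cmod (f x) - cmod (g x)"] by (simp add: power2_eq_square algebra_simps)
    moreover have nn: "0 \<le> cmod (f x) * cmod (g x)" by simp
    ultimately have "cmod (f x) * cmod (g x) \<le> (cmod (f x))\<^sup>2 + (cmod (g x))\<^sup>2" by linarith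
    then show "norm (cmod (f x) * cmod (g x)) \<le> norm ((cmod (f x))\<^sup>2 + (cmod (g x))\<^sup>2)"
      using nn by simp
  qed
qed

lemma square_integrable_mult:
  assumes "square_integrable M f" "square_integrable M g"
  shows "integrable M (\<lambda>x. f x * g x)"
proof (rule Bochner_Integration.integrable_bound[OF square_integrable_norm_mult[OF assms]])
  have [measurable]: "f \<in> borel_measurable M" "g \<in> borel_measurable M"
    using assms by (auto simp: square_integrable_def)
  show "(\<lambda>x. f x * g x) \<in> borel_measurable M" by measurable
qed (simp add: norm_mult)

lemma l2norm_zero_AE:
  assumes "square_integrable M f" "l2norm M f = 0"
  shows "AE x in M. f x = 0"
proof -
  have "(\<integral>x. (cmod (f x))\<^sup>2 \<partial>M) = 0" using assms(2) by (simp add: l2norm_def)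
  then have "AE x in M. (cmod (f x))\<^sup>2 = 0"
    using integral_nonneg_eq_0_iff_AE[of M "\<lambda>x. (cmod (f x))\<^sup>2"] assms(1)
    by (auto simp: square_integrable_def)
  then show ?thesis by simp
qed

text \<open>Pointwise this is the inequality of arithmetic and geometric mean, with weights chosen
  so that both integrated terms equal \<open>A * B / 2\<close>. Vanishing norms are split off first
  because the weights divide by them.\<close>

lemma L2_Cauchy_Schwarz:
  assumes "square_integrable M f" "square_integrable M g"
  shows "(\<integral>x. cmod (f x) * cmod (g x) \<partial>M) \<le> l2norm M f * l2norm M g"
proof (cases "l2norm M f = 0 \<or> l2norm M g = 0")
  case True
  then have "AE x in M. f x = 0 \<or> g x = 0"
    using l2norm_zero_AE assms by fastforce
  then have "AE x in M. cmod (f x) * cmod (g x) = 0" by eventually_elim auto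
  then have "(\<integral>x. cmod (f x) * cmod (g x) \<partial>M) = 0" by (rule integral_eq_zero_AE)
  then show ?thesis by simp
next
  case False
  define A B where "A = l2norm M f" and "B = l2norm M g"
  have pos: "A > 0" "B > 0" using False by (auto simp: A_def B_def less_le)
  have "(\<integral>x. cmod (f x) * cmod (g x) \<partial>M)
      \<le> (\<integral>x. (B / (2 * A)) * (cmod (f x))\<^sup>2 + (A / (2 * B)) * (cmod (g x))\<^sup>2 \<partial>M)"
  proof (rule integral_mono)
    show "integrable M (\<lambda>x. cmod (f x) * cmod (g x))" by (rule square_integrable_norm_mult[OF assms])
    show "integrable M (\<lambda>x. (B / (2 * A)) * (cmod (f x))\<^sup>2 + (A / (2 * B)) * (cmod (g x))\<^sup>2)"
      using assms by (auto simp: square_integrable_def)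
    fix x
    have "0 \<le> (B * cmod (f x) - A * cmod (g x))\<^sup>2 / (2 * A * B)" using pos by simp
    also have "\<dots> = (B / (2 * A)) * (cmod (f x))\<^sup>2 + (A / (2 * B)) * (cmod (g x))\<^sup>2 - cmod (f x) * cmod (g x)"
      using pos by (simp add: field_simps power2_eq_square)
    finally show "cmod (f x) * cmod (g x) \<le> (B / (2 * A)) * (cmod (f x))\<^sup>2 + (A / (2 * B)) * (cmod (g x))\<^sup>2"
      by simp
  qed
  also have "\<dots> = (B / (2 * A)) * A\<^sup>2 + (A / (2 * B)) * B\<^sup>2"
    using assms by (simp add: square_integrable_def A_def B_def l2norm_power2)
  also have "\<dots> = A * B" using pos by (simp add: field_simps power2_eq_square)
  finally show ?thesis by (simp add: A_def B_def)
qed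

lemma L2_Cauchy_Schwarz_complex:
  assumes "square_integrable M f" "square_integrable M g"
  shows "cmod (\<integral>x. f x * g x \<partial>M) \<le> l2norm M f * l2norm M g"
proof -
  have "cmod (\<integral>x. f x * g x \<partial>M) \<le> (\<integral>x. cmod (f x * g x) \<partial>M)"
    by (rule integral_norm_bound)
  then show ?thesis using L2_Cauchy_Schwarz[OF assms] by (simp add: norm_mult)
qed

lemma l2norm_power2_add:
  assumes "square_integrable M f" "square_integrable M g"
  shows "(l2norm M (\<lambda>x. f x + g x))\<^sup>2
    = (l2norm M f)\<^sup>2 + (l2norm M g)\<^sup>2 + 2 * Re (\<integral>x. f x * cnj (g x) \<partial>M)"
proof -
  have int: "integrable M (\<lambda>x. f x * cnj (g x))"
    by (intro square_integrable_mult square_integrable_cnj assms)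
  have eq: "(cmod (a + b))\<^sup>2 = (cmod a)\<^sup>2 + (cmod b)\<^sup>2 + 2 * Re (a * cnj b)" for a b
    unfolding cmod_power2 by (simp add: power2_eq_square algebra_simps)
  show ?thesis
    unfolding l2norm_power2 eq using assms int integral_Re[OF int]
    by (simp add: square_integrable_def del: times_complex.sel)
qed

lemma l2norm_uminus: "l2norm M (\<lambda>x. - f x) = l2norm M f"
  by (simp add: l2norm_def)

lemma l2norm_minus_commute: "l2norm M (\<lambda>x. f x - g x) = l2norm M (\<lambda>x. g x - f x)"
  by (simp add: l2norm_def norm_minus_commute)

lemma l2norm_cmult: "l2norm M (\<lambda>x. c * f x) = cmod c * l2norm M f"
  by (simp add: l2norm_def norm_mult power_mult_distrib real_sqrt_mult)

lemma l2norm_triangle: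
  assumes "square_integrable M f" "square_integrable M g"
  shows "l2norm M (\<lambda>x. f x + g x) \<le> l2norm M f + l2norm M g"
proof (rule power2_le_imp_le)
  have "Re (\<integral>x. f x * cnj (g x) \<partial>M) \<le> l2norm M f * l2norm M g"
    using L2_Cauchy_Schwarz_complex[OF assms(1) square_integrable_cnj[OF assms(2)]]
      complex_Re_le_cmod[of "\<integral>x. f x * cnj (g x) \<partial>M"]
    by (simp add: l2norm_def)
  then show "(l2norm M (\<lambda>x. f x + g x))\<^sup>2 \<le> (l2norm M f + l2norm M g)\<^sup>2"
    unfolding l2norm_power2_add[OF assms] by (simp add: power2_sum)
qed simp

lemma l2norm_triangle_diff:
  assumes "square_integrable M f" "square_integrable M g" "square_integrable M h"
  shows "l2norm M (\<lambda>x. f x - h x) \<le> l2norm M (\<lambda>x. f x - g x) + l2norm M (\<lambda>x. g x - h x)"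
  using l2norm_triangle[OF square_integrable_diff[OF assms(1,2)] square_integrable_diff[OF assms(2,3)]]
  by simp

lemma l2norm_mono:
  assumes "square_integrable M g" "f \<in> borel_measurable M" "AE x in M. cmod (f x) \<le> C * cmod (g x)" "0 \<le> C"
  shows "l2norm M f \<le> C * l2norm M g"
proof -
  have "l2norm M f \<le> l2norm M (\<lambda>x. C * g x)"
    unfolding l2norm_def
  proof (rule real_sqrt_le_mono, rule integral_mono_AE)
    show "integrable M (\<lambda>x. (cmod (f x))\<^sup>2)"
      using square_integrable_bound[OF assms(1-3)] by (rule square_integrable_integrable)
    show "integrable M (\<lambda>x. (cmod (C * g x))\<^sup>2)"
      using square_integrable_cmult[OF assms(1)] by (rule square_integrable_integrable)
    show "AE x in M. (cmod (f x))\<^sup>2 \<le> (cmod (C * g x))\<^sup>2"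
      using assms(3) by eventually_elim (use assms(4) in \<open>auto simp: norm_mult intro!: power_mono\<close>)
  qed
  then show ?thesis using assms(4) by (simp add: l2norm_cmult)
qed

context finite_measure
begin

lemma square_integrable_bounded:
  assumes "f \<in> borel_measurable M" "AE x in M. cmod (f x) \<le> C"
  shows "square_integrable M f"
  by (rule square_integrable_bound[of M "\<lambda>x. 1" f C]) (use assms in \<open>auto simp: square_integrable_def\<close>)

lemma integrable_of_square_integrable:
  assumes "square_integrable M f"
  shows "integrable M f"
  using square_integrable_mult[OF assms square_integrable_bounded[of "\<lambda>x. 1" 1]] by simp

lemma L1_le_l2norm:
  assumes "square_integrable M f"
  shows "(\<integral>x. cmod (f x) \<partial>M) \<le> sqrt (measure M (space M)) * l2norm M f"
  using L2_Cauchy_Schwarz[OF assms square_integrable_bounded[of "\<lambda>x. 1" 1]]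
  by (simp add: l2norm_def mult.commute)

text \<open>Riesz--Fischer: a rapidly converging subsequence converges almost everywhere, and Fatou's
  lemma identifies its pointwise limit with the limit in the mean.\<close>

lemma L2_complete:
  assumes u: "\<And>n. square_integrable M (u n)"
    and Cau: "\<And>e. 0 < e \<Longrightarrow> \<exists>N. \<forall>m\<ge>N. \<forall>n\<ge>N. l2norm M (\<lambda>x. u m x - u n x) < e"
  obtains f where "square_integrable M f" "(\<lambda>n. l2norm M (\<lambda>x. u n x - f x)) \<longlonglongrightarrow> 0"
proof -
  have [measurable]: "u n \<in> borel_measurable M" for n
    using u by (auto simp: square_integrable_def)
  have "\<exists>N. \<forall>m\<ge>N. \<forall>n\<ge>N. l2norm M (\<lambda>x. u m x - u n x) < (1/2)^k" for k
    by (rule Cau) simp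
  then obtain R where R: "\<And>k m n. m \<ge> R k \<Longrightarrow> n \<ge> R k \<Longrightarrow> l2norm M (\<lambda>x. u m x - u n x) < (1/2)^k"
    by metis
  \<comment> \<open>Partial sums make \<open>r\<close> monotone while \<open>r k\<close> still
    dominates \<open>R k\<close>, so consecutive members of the subsequence differ by less than
    \<open>(1/2)^k\<close>.\<close>
  define r where "r k = (\<Sum>i\<le>k. R i)" for k
  have rR: "R k \<le> r k" for k
    unfolding r_def by (rule member_le_sum) auto
  have rmono: "r j \<le> r k" if "j \<le> k" for j k
    unfolding r_def by (rule sum_mono2) (use that in auto)
  define v where "v k = u (r k)" for k
  have v[measurable]: "v k \<in> borel_measurable M" for k by (simp add: v_def)
  have vsi: "square_integrable M (v k)" for k by (simp add: v_def u)
  have step: "(\<integral>x. cmod (v (Suc k) x - v k x) \<partial>M) \<le> sqrt (measure M (space M)) * (1/2)^k" for k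
  proof -
    have "l2norm M (\<lambda>x. v (Suc k) x - v k x) < (1/2)^k"
      unfolding v_def by (rule R) (use rR[of k] rmono[of k "Suc k"] in auto)
    then show ?thesis
      using L1_le_l2norm[OF square_integrable_diff[OF vsi[of "Suc k"] vsi[of k]]]
      by (meson less_imp_le mult_left_mono order_trans real_sqrt_ge_zero measure_nonneg)
  qed
  have "(\<integral>\<^sup>+x. (\<Sum>k. ennreal (cmod (v (Suc k) x - v k x))) \<partial>M)
      = (\<Sum>k. \<integral>\<^sup>+x. ennreal (cmod (v (Suc k) x - v k x)) \<partial>M)"
    by (rule nn_integral_suminf) auto
  also have "\<dots> = (\<Sum>k. ennreal (\<integral>x. cmod (v (Suc k) x - v k x) \<partial>M))"
    by (intro suminf_cong nn_integral_eq_integral integrable_norm integrable_of_square_integrable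
        square_integrable_diff vsi) auto
  also have "\<dots> \<le> (\<Sum>k. ennreal (sqrt (measure M (space M)) * (1/2)^k))"
    by (intro suminf_le ennreal_leI step) auto
  also have "\<dots> = ennreal (\<Sum>k. sqrt (measure M (space M)) * (1/2)^k)"
    by (rule suminf_ennreal2) (auto intro!: summable_mult summable_geometric)
  finally have "(\<integral>\<^sup>+x. (\<Sum>k. ennreal (cmod (v (Suc k) x - v k x))) \<partial>M) < \<infinity>"
    by (rule order.strict_trans1) simp
  then have "AE x in M. (\<Sum>k. ennreal (cmod (v (Suc k) x - v k x))) \<noteq> \<infinity>"
    by (intro nn_integral_PInf_AE) auto
  then have conv: "AE x in M. (\<lambda>k. v k x) \<longlonglongrightarrow> lim (\<lambda>k. v k x)"
  proof eventually_elim
    case (elim x)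
    have "summable (\<lambda>k. cmod (v (Suc k) x - v k x))"
      by (rule summable_suminf_not_top) (use elim in auto)
    then have "summable (\<lambda>k. v (Suc k) x - v k x)"
      by (rule summable_norm_cancel)
    then have "(\<lambda>n. v 0 x + (\<Sum>k<n. v (Suc k) x - v k x)) \<longlonglongrightarrow> v 0 x + (\<Sum>k. v (Suc k) x - v k x)"
      by (intro tendsto_intros summable_LIMSEQ)
    moreover have "v 0 x + (\<Sum>k<n. v (Suc k) x - v k x) = v n x" for n
      using sum_lessThan_telescope[of "\<lambda>k. v k x" n] by simp
    ultimately have "convergent (\<lambda>n. v n x)"
      by (auto simp: convergent_def)
    then show ?case by (simp add: convergent_LIMSEQ_iff)
  qed
  define f where "f x = lim (\<lambda>k. v k x)" for x
  have fm[measurable]: "f \<in> borel_measurable M"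
    unfolding f_def by (rule borel_measurable_lim_metric) simp
  have key: "(\<integral>\<^sup>+x. ennreal ((cmod (u n x - f x))\<^sup>2) \<partial>M) \<le> ennreal (e\<^sup>2)"
    if e: "0 < e" and N: "\<And>m n. m \<ge> N \<Longrightarrow> n \<ge> N \<Longrightarrow> l2norm M (\<lambda>x. u m x - u n x) < e" and n: "n \<ge> N" for e N n
  proof -
    obtain K where K: "(1/2::real)^K < e" using real_arch_pow_inv[OF e, of "1/2"] by auto
    \<comment> \<open>An upper bound whose limit in \<open>k\<close> is exactly
      \<open>e\<^sup>2\<close>: once \<open>(1/2)^k\<close> is below \<open>e\<close>, its square is
      absorbed into the third copy of \<open>e * (1/2)^k\<close>.\<close>
    have ev: "\<forall>\<^sub>F k in sequentially. (\<integral>\<^sup>+x. ennreal ((cmod (u n x - v k x))\<^sup>2) \<partial>M) \<le> ennreal (e\<^sup>2 + 3 * e * (1/2)^k)"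
    proof -
      have "(\<integral>\<^sup>+x. ennreal ((cmod (u n x - v k x))\<^sup>2) \<partial>M) \<le> ennreal (e\<^sup>2 + 3 * e * (1/2)^k)" if k: "k \<ge> K" for k
      proof -
        define m where "m = max N (r k)"
        have "l2norm M (\<lambda>x. u n x - v k x) \<le> l2norm M (\<lambda>x. u n x - u m x) + l2norm M (\<lambda>x. u m x - v k x)"
          by (intro l2norm_triangle_diff u vsi)
        also have "\<dots> \<le> e + (1/2)^k"
          unfolding v_def
          by (intro add_mono order.strict_implies_order[OF N] order.strict_implies_order[OF R])
             (use n rR[of k] in \<open>auto simp: m_def\<close>)
        finally have "(l2norm M (\<lambda>x. u n x - v k x))\<^sup>2 \<le> (e + (1/2)^k)\<^sup>2"
          by (intro power_mono) auto
        also have "\<dots> = e\<^sup>2 + 2 * e * (1/2)^k + (1/2)^k * (1/2)^k"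
          by (simp add: power2_eq_square algebra_simps)
        also have "(1/2::real)^k * (1/2)^k \<le> e * (1/2)^k"
        proof (rule mult_right_mono)
          have "(1/2::real)^k \<le> (1/2)^K" using k by (intro power_decreasing) auto
          then show "(1/2::real)^k \<le> e" using K by linarith
        qed simp
        finally have "(l2norm M (\<lambda>x. u n x - v k x))\<^sup>2 \<le> e\<^sup>2 + 3 * e * (1/2)^k" by (simp add: mult_ac)
        moreover have "(\<integral>\<^sup>+x. ennreal ((cmod (u n x - v k x))\<^sup>2) \<partial>M) = ennreal ((l2norm M (\<lambda>x. u n x - v k x))\<^sup>2)"
          unfolding l2norm_power2
          by (intro nn_integral_eq_integral square_integrable_integrable square_integrable_diff u vsi) auto
        ultimately show ?thesis by (simp add: ennreal_leI)
      qed
      then show ?thesis using eventually_sequentially by blast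
    qed
    have "(\<integral>\<^sup>+x. ennreal ((cmod (u n x - f x))\<^sup>2) \<partial>M)
        = (\<integral>\<^sup>+x. liminf (\<lambda>k. ennreal ((cmod (u n x - v k x))\<^sup>2)) \<partial>M)"
    proof (rule nn_integral_cong_AE)
      show "AE x in M. ennreal ((cmod (u n x - f x))\<^sup>2) = liminf (\<lambda>k. ennreal ((cmod (u n x - v k x))\<^sup>2))"
        using conv
      proof eventually_elim
        case (elim x)
        then have L: "(\<lambda>k. ennreal ((cmod (u n x - v k x))\<^sup>2)) \<longlonglongrightarrow> ennreal ((cmod (u n x - f x))\<^sup>2)"
          unfolding f_def by (intro tendsto_intros)
        show ?case by (rule lim_imp_Liminf[OF _ L, symmetric]) simp
      qed
    qed
    also have "\<dots> \<le> liminf (\<lambda>k. \<integral>\<^sup>+x. ennreal ((cmod (u n x - v k x))\<^sup>2) \<partial>M)"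
      by (rule nn_integral_liminf) auto
    also have "\<dots> \<le> liminf (\<lambda>k. ennreal (e\<^sup>2 + 3 * e * (1/2)^k))"
      by (rule Liminf_mono) (rule ev)
    also have "\<dots> = ennreal (e\<^sup>2)"
    proof (rule lim_imp_Liminf)
      have "(\<lambda>k. e\<^sup>2 + 3 * e * (1/2)^k) \<longlonglongrightarrow> e\<^sup>2 + 3 * e * 0"
        by (intro tendsto_intros LIMSEQ_power_zero) auto
      then show "(\<lambda>k. ennreal (e\<^sup>2 + 3 * e * (1/2)^k)) \<longlonglongrightarrow> ennreal (e\<^sup>2)"
        by (intro tendsto_ennrealI) simp
    qed simp
    finally show ?thesis .
  qed
  obtain N0 where "\<And>m n. m \<ge> N0 \<Longrightarrow> n \<ge> N0 \<Longrightarrow> l2norm M (\<lambda>x. u m x - u n x) < 1"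
    using Cau[of 1] by auto
  from key[OF _ this, of N0] have "(\<integral>\<^sup>+x. ennreal ((cmod (u N0 x - f x))\<^sup>2) \<partial>M) \<le> 1"
    by simp
  then have "(\<integral>\<^sup>+x. ennreal ((cmod (u N0 x - f x))\<^sup>2) \<partial>M) < \<infinity>"
    by (rule order.strict_trans1) simp
  then have "square_integrable M (\<lambda>x. u N0 x - f x)"
    unfolding square_integrable_def by (auto simp: integrable_iff_bounded)
  from square_integrable_diff[OF u[of N0] this] have fsi: "square_integrable M f" by simp
  have "(\<lambda>n. l2norm M (\<lambda>x. u n x - f x)) \<longlonglongrightarrow> 0"
  proof (rule LIMSEQ_I)
    fix e :: real assume e: "0 < e"
    obtain N where N: "\<And>m n. m \<ge> N \<Longrightarrow> n \<ge> N \<Longrightarrow> l2norm M (\<lambda>x. u m x - u n x) < e/2"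
      using Cau[of "e/2"] e by auto
    show "\<exists>N. \<forall>n\<ge>N. norm (l2norm M (\<lambda>x. u n x - f x) - 0) < e"
    proof (intro exI[of _ N] allI impI)
      fix n assume n: "N \<le> n"
      have "ennreal ((l2norm M (\<lambda>x. u n x - f x))\<^sup>2) \<le> ennreal ((e/2)\<^sup>2)"
        unfolding l2norm_power2
        using key[OF _ N n] e
        by (subst nn_integral_eq_integral[symmetric])
           (auto intro!: square_integrable_integrable square_integrable_diff u fsi)
      then have "(l2norm M (\<lambda>x. u n x - f x))\<^sup>2 \<le> (e/2)\<^sup>2" by (simp add: ennreal_le_iff)
      then have "l2norm M (\<lambda>x. u n x - f x) \<le> e/2"
        by (rule power2_le_imp_le) (use e in simp)
      then show "norm (l2norm M (\<lambda>x. u n x - f x) - 0) < e" using e by simp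
    qed
  qed
  with fsi show ?thesis by (rule that)
qed

text \<open>The classical argument by a minimizing sequence: the parallelogram law makes it Cauchy,
  closedness keeps the limit in \<open>S\<close>, and the first variation of the distance gives
  orthogonality. \<open>S\<close> consists of functions rather than classes, so closedness is
  phrased by approximation in norm.\<close>

lemma L2_projection:
  assumes S0: "S \<noteq> {}" and Ssi: "\<And>s. s \<in> S \<Longrightarrow> square_integrable M s"
    and Sadd: "\<And>s t. s \<in> S \<Longrightarrow> t \<in> S \<Longrightarrow> (\<lambda>x. s x + t x) \<in> S"
    and Scmult: "\<And>c s. s \<in> S \<Longrightarrow> (\<lambda>x. c * s x) \<in> S"
    and Sclosed: "\<And>f. square_integrable M f \<Longrightarrow> (\<And>e. 0 < e \<Longrightarrow> \<exists>s\<in>S. l2norm M (\<lambda>x. f x - s x) < e) \<Longrightarrow> f \<in> S"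
    and f: "square_integrable M f"
  obtains h where "h \<in> S" "\<And>k. k \<in> S \<Longrightarrow> (\<integral>x. (f x - h x) * cnj (k x) \<partial>M) = 0"
proof -
  define D where "D = (\<lambda>s. (l2norm M (\<lambda>x. f x - s x))\<^sup>2) ` S"
  define d where "d = Inf D"
  have D0: "D \<noteq> {}" using S0 by (simp add: D_def)
  have bdd: "bdd_below D" by (rule bdd_belowI[of _ 0]) (auto simp: D_def)
  have dle: "d \<le> (l2norm M (\<lambda>x. f x - s x))\<^sup>2" if "s \<in> S" for s
    unfolding d_def by (rule cInf_lower[OF _ bdd]) (use that in \<open>auto simp: D_def\<close>)
  have "\<exists>s\<in>S. (l2norm M (\<lambda>x. f x - s x))\<^sup>2 < d + 1 / real (Suc n)" for n
  proof -
    have "Inf D < d + 1 / real (Suc n)" by (simp add: d_def)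
    from cInf_lessD[OF D0 this] show ?thesis by (auto simp: D_def)
  qed
  then obtain s where sS: "\<And>n. s n \<in> S"
    and s: "\<And>n. (l2norm M (\<lambda>x. f x - s n x))\<^sup>2 < d + 1 / real (Suc n)" by metis
  have ssi: "square_integrable M (s n)" for n by (rule Ssi[OF sS])
  \<comment> \<open>Parallelogram law for the two differences from \<open>f\<close>: their half sum
    is the distance vector to a midpoint, which lies in \<open>S\<close> and is therefore at squared
    distance at least \<open>d\<close>.\<close>
  have par: "(l2norm M (\<lambda>x. s m x - s n x))\<^sup>2 \<le> 2 / real (Suc m) + 2 / real (Suc n)" for m n
  proof -
    define a b where "a = (\<lambda>x. f x - s n x)" and "b = (\<lambda>x. f x - s m x)"
    have ab: "square_integrable M a" "square_integrable M b"
      unfolding a_def b_def by (intro square_integrable_diff f ssi)+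
    have 1: "(l2norm M (\<lambda>x. a x + b x))\<^sup>2 + (l2norm M (\<lambda>x. a x + - b x))\<^sup>2
        = 2 * (l2norm M a)\<^sup>2 + 2 * (l2norm M b)\<^sup>2"
      unfolding l2norm_power2_add[OF ab] l2norm_power2_add[OF ab(1) square_integrable_uminus[OF ab(2)]]
      by (simp add: l2norm_uminus)
    have "(\<lambda>x. (1/2) * (s m x + s n x)) \<in> S" by (intro Scmult Sadd sS)
    from dle[OF this] have 2: "4 * d \<le> 4 * (l2norm M (\<lambda>x. f x - (1/2) * (s m x + s n x)))\<^sup>2" by simp
    also have "\<dots> = (l2norm M (\<lambda>x. 2 * (f x - (1/2) * (s m x + s n x))))\<^sup>2"
      unfolding l2norm_cmult by (simp add: power_mult_distrib)
    also have "(\<lambda>x. 2 * (f x - (1/2) * (s m x + s n x))) = (\<lambda>x. a x + b x)"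
      by (auto simp: a_def b_def algebra_simps)
    finally have 2: "4 * d \<le> (l2norm M (\<lambda>x. a x + b x))\<^sup>2" .
    have 3: "(\<lambda>x. s m x - s n x) = (\<lambda>x. a x + - b x)" by (auto simp: a_def b_def)
    show ?thesis unfolding 3 using 1 2 s[of m] s[of n] unfolding a_def[symmetric] b_def[symmetric] by linarith
  qed
  obtain h where h: "square_integrable M h" and lim: "(\<lambda>n. l2norm M (\<lambda>x. s n x - h x)) \<longlonglongrightarrow> 0"
  proof (rule L2_complete[OF ssi])
    fix e :: real assume e: "0 < e"
    obtain N where N: "4 / e\<^sup>2 < real N" using reals_Archimedean2 by blast
    have "l2norm M (\<lambda>x. s m x - s n x) < e" if mn: "m \<ge> N" "n \<ge> N" for m n
    proof (rule power_less_imp_less_base)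
      have N': "4 < real (Suc N) * e\<^sup>2"
      proof -
        have "4 < real N * e\<^sup>2" using N e by (simp add: field_simps)
        also have "\<dots> \<le> real (Suc N) * e\<^sup>2" by (intro mult_right_mono) auto
        finally show ?thesis .
      qed
      have "(l2norm M (\<lambda>x. s m x - s n x))\<^sup>2 \<le> 2 / real (Suc m) + 2 / real (Suc n)" by (rule par)
      also have "\<dots> \<le> 2 / real (Suc N) + 2 / real (Suc N)"
        using mn by (intro add_mono divide_left_mono) auto
      also have "\<dots> = 4 / real (Suc N)" by simp
      also have "\<dots> < e\<^sup>2" using N' by (simp add: field_simps)
      finally show "(l2norm M (\<lambda>x. s m x - s n x))\<^sup>2 < e\<^sup>2" .
    qed (use e in simp)
    then show "\<exists>N. \<forall>m\<ge>N. \<forall>n\<ge>N. l2norm M (\<lambda>x. s m x - s n x) < e" by blast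
  qed
  have hS: "h \<in> S"
  proof (rule Sclosed[OF h])
    fix e :: real assume "0 < e"
    then obtain n where "l2norm M (\<lambda>x. s n x - h x) < e"
      using order_tendstoD(2)[OF lim, of e] by (auto simp: eventually_sequentially)
    then show "\<exists>s\<in>S. l2norm M (\<lambda>x. h x - s x) < e" using sS l2norm_minus_commute by metis
  qed
  have hd: "(l2norm M (\<lambda>x. f x - h x))\<^sup>2 \<le> d"
  proof (rule field_le_epsilon)
    fix e :: real assume e: "0 < e"
    have "(\<lambda>n. (sqrt (d + 1 / real (Suc n)) + l2norm M (\<lambda>x. s n x - h x))\<^sup>2) \<longlonglongrightarrow> (sqrt (d + 0) + 0)\<^sup>2"
      by (intro tendsto_intros lim LIMSEQ_Suc[OF lim_1_over_n])
    then have "(\<lambda>n. (sqrt (d + 1 / real (Suc n)) + l2norm M (\<lambda>x. s n x - h x))\<^sup>2) \<longlonglongrightarrow> d"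
    proof -
      have "0 \<le> d" unfolding d_def by (rule cInf_greatest[OF D0]) (auto simp: D_def)
      then show ?thesis using \<open>(\<lambda>n. _) \<longlonglongrightarrow> (sqrt (d + 0) + 0)\<^sup>2\<close> by simp
    qed
    then have "(l2norm M (\<lambda>x. f x - h x))\<^sup>2 \<le> d"
    proof (rule tendsto_lowerbound)
      show "\<forall>\<^sub>F n in sequentially. (l2norm M (\<lambda>x. f x - h x))\<^sup>2
          \<le> (sqrt (d + 1 / real (Suc n)) + l2norm M (\<lambda>x. s n x - h x))\<^sup>2"
      proof (intro always_eventually allI power_mono)
        fix n
        have "l2norm M (\<lambda>x. f x - s n x) \<le> sqrt (d + 1 / real (Suc n))"
          using s[of n] by (intro real_le_rsqrt) simp
        then show "l2norm M (\<lambda>x. f x - h x) \<le> sqrt (d + 1 / real (Suc n)) + l2norm M (\<lambda>x. s n x - h x)"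
          using l2norm_triangle_diff[OF f ssi[of n] h] by simp
      qed simp
    qed simp
    then show "(l2norm M (\<lambda>x. f x - h x))\<^sup>2 \<le> d + e" using e by simp
  qed
  show ?thesis
  proof (rule that[OF hS])
    fix k assume k: "k \<in> S"
    define I where "I = (\<integral>x. (f x - h x) * cnj (k x) \<partial>M)"
    have ksi: "square_integrable M k" by (rule Ssi[OF k])
    have fh: "square_integrable M (\<lambda>x. f x - h x)" by (intro square_integrable_diff f h)
    have ineq: "2 * (cmod I)\<^sup>2 \<le> t * (cmod I)\<^sup>2 * (l2norm M k)\<^sup>2" if t: "0 < t" for t
    proof -
      \<comment> \<open>Moving \<open>h\<close> by \<open>t * I * k\<close> changes the squared
        distance by \<open>- 2 * t * \<bar>I\<bar>\<^sup>2\<close> up to second order in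
        \<open>t\<close>. Minimality, division by \<open>t\<close> and \<open>t\<close> tending to 0
        leave \<open>I = 0\<close>.\<close>
      define c where "c = - (of_real t * I)"
      have "(\<lambda>x. h x + (- c) * k x) \<in> S" by (intro Sadd hS Scmult k)
      from dle[OF this] have "d \<le> (l2norm M (\<lambda>x. (f x - h x) + c * k x))\<^sup>2"
        by (simp add: algebra_simps)
      also have "\<dots> = (l2norm M (\<lambda>x. f x - h x))\<^sup>2 + (cmod c * l2norm M k)\<^sup>2
          + 2 * Re (\<integral>x. (f x - h x) * cnj (c * k x) \<partial>M)"
        unfolding l2norm_power2_add[OF fh square_integrable_cmult[OF ksi]] l2norm_cmult by simp
      also have "(\<integral>x. (f x - h x) * cnj (c * k x) \<partial>M) = cnj c * I"
        unfolding I_def by (subst integral_mult_right_zero[symmetric]) (simp add: mult_ac)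
      also have "Re (cnj c * I) = - t * (cmod I)\<^sup>2"
        unfolding c_def cmod_power2 by (simp add: power2_eq_square algebra_simps)
      finally have "2 * t * (cmod I)\<^sup>2 \<le> (cmod c * l2norm M k)\<^sup>2" using hd by simp
      also have "\<dots> = t * (t * (cmod I)\<^sup>2 * (l2norm M k)\<^sup>2)"
        using t by (simp add: c_def norm_mult power_mult_distrib power2_eq_square)
      finally have "t * (2 * (cmod I)\<^sup>2) \<le> t * (t * (cmod I)\<^sup>2 * (l2norm M k)\<^sup>2)" by (simp add: mult_ac)
      then show ?thesis using t by simp
    qed
    have "2 * (cmod I)\<^sup>2 \<le> 0"
    proof (rule tendsto_lowerbound)
      show "((\<lambda>t. t * (cmod I)\<^sup>2 * (l2norm M k)\<^sup>2) \<longlongrightarrow> 0) (at_right 0)"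
        by (auto intro!: tendsto_eq_intros)
      show "\<forall>\<^sub>F t in at_right 0. 2 * (cmod I)\<^sup>2 \<le> t * (cmod I)\<^sup>2 * (l2norm M k)\<^sup>2"
        using ineq eventually_at_right_less[of 0] by (auto elim: eventually_mono)
    qed simp
    then show "(\<integral>x. (f x - h x) * cnj (k x) \<partial>M) = 0" by (simp add: I_def)
  qed
qed

end

section \<open>Trigonometric approximation on the circle\<close>

abbreviation angle_measure :: "real measure" where
  "angle_measure \<equiv> restrict_space lborel {0..<2*pi}"

lemma finite_measure_angle_measure: "finite_measure angle_measure"
  by (rule finite_measureI) (simp add: space_restrict_space emeasure_restrict_space)

interpretation angle: finite_measure angle_measure
  by (rule finite_measure_angle_measure)

lemma space_angle_measure [simp]: "space angle_measure = {0..<2*pi}"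
  by (simp add: space_restrict_space)

lemma measure_angle_measure: "measure angle_measure {0..<2*pi} = 2 * pi"
  by (simp add: measure_restrict_space)

lemma continuous_on_borel_measurable_angle:
  "continuous_on UNIV f \<Longrightarrow> f \<in> borel_measurable angle_measure"
  by (intro measurable_restrict_space1) (simp add: borel_measurable_continuous_onI)

text \<open>The bridge to the gauge integral, where the fundamental theorem of calculus and contour
  integrals live. The missing endpoint \<open>2 * pi\<close> is a null set.\<close>

lemma angle_integral_continuous:
  fixes f :: "real \<Rightarrow> 'b::euclidean_space"
  assumes "continuous_on {0..2*pi} f"
  shows "integrable angle_measure f" "integral\<^sup>L angle_measure f = integral {0..2*pi} f"
proof -
  have int: "set_integrable lborel {0..2*pi} f"
    by (rule borel_integrable_compact[OF compact_Icc assms, folded set_integrable_def])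
  then have int': "set_integrable lborel {0..<2*pi} f"
    by (rule set_integrable_subset) auto
  then show "integrable angle_measure f"
    by (simp add: integrable_restrict_space set_integrable_def)
  have "integral\<^sup>L angle_measure f = (LINT t:{0..<2*pi}|lborel. f t)"
    by (simp add: integral_restrict_space set_lebesgue_integral_def)
  also have "\<dots> = (LINT t:{0..2*pi}|lborel. f t)"
    unfolding set_lebesgue_integral_def
  proof (rule integral_cong_AE)
    show "(\<lambda>x. indicat_real {0..<2*pi} x *\<^sub>R f x) \<in> borel_measurable lborel"
      using int' by (auto simp: set_integrable_def)
    show "(\<lambda>x. indicat_real {0..2*pi} x *\<^sub>R f x) \<in> borel_measurable lborel"
      using int by (auto simp: set_integrable_def)
    show "AE x in lborel. indicat_real {0..<2*pi} x *\<^sub>R f x = indicat_real {0..2*pi} x *\<^sub>R f x"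
      using AE_lborel_singleton[of "2*pi"] by eventually_elim (auto simp: indicator_def)
  qed
  also have "\<dots> = integral {0..2*pi} f"
    by (rule set_borel_integral_eq_integral(2)[OF int])
  finally show "integral\<^sup>L angle_measure f = integral {0..2*pi} f" .
qed

lemma angle_integral_cis:
  "integral\<^sup>L angle_measure (\<lambda>t. cis t powi n) = (if n = 0 then 2 * pi else 0)"
proof (cases "n = 0")
  case True
  then show ?thesis by (simp add: measure_angle_measure scaleR_conv_of_real)
next
  case False
  have eq: "cis t powi n = cis (of_int n * t)" for t by (simp add: cis_power_int)
  have "((\<lambda>t. cis (of_int n * t)) has_integral
      cis (of_int n * (2*pi)) / (\<i> * of_int n) - cis (of_int n * 0) / (\<i> * of_int n)) {0..2*pi}"
  proof (rule fundamental_theorem_of_calculus)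
    fix t :: real assume "t \<in> {0..2*pi}"
    show "((\<lambda>t. cis (of_int n * t) / (\<i> * of_int n)) has_vector_derivative cis (of_int n * t)) (at t within {0..2*pi})"
    proof -
      have "((\<lambda>z. exp (\<i> * (of_int n * z)) / (\<i> * of_int n)) has_field_derivative exp (\<i> * (of_int n * of_real t)))
          (at (of_real t))"
        using False by (auto intro!: derivative_eq_intros) (simp add: algebra_simps)
      from has_vector_derivative_real_field[OF this] show ?thesis
        by (simp add: cis_conv_exp)
    qed
  qed simp
  moreover have "cis (of_int n * (2*pi)) = 1"
    using cis_multiple_2pi[of "of_int n"] by (simp add: mult_ac)
  ultimately have "integral {0..2*pi} (\<lambda>t. cis (of_int n * t)) = 0"
    by (simp add: integral_unique)
  then show ?thesis unfolding eq using False
    by (subst angle_integral_continuous(2)) (auto intro!: continuous_intros)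
qed

lemma Arg2pi_cis: "0 \<le> t \<Longrightarrow> t < 2 * pi \<Longrightarrow> 0 < r \<Longrightarrow> Arg2pi (of_real r * cis t) = t"
  by (rule Arg2pi_unique) (auto simp: cis_conv_exp)

lemma polar_Arg2pi: "z = of_real (cmod z) * cis (Arg2pi z)"
  using Arg2pi_eq[of z] by (simp add: cis_conv_exp mult_ac)

text \<open>The angle jumps across the positive real axis, so measurability is read off from its
  closed sublevel sets instead of continuity.\<close>

lemma borel_measurable_Arg2pi [measurable]: "Arg2pi \<in> borel_measurable borel"
proof (rule borel_measurableI_le)
  fix y
  have "{z \<in> space borel. Arg2pi z \<le> y} = {z. Arg2pi z \<le> y}" by simp
  then show "{z \<in> space borel. Arg2pi z \<le> y} \<in> sets borel"
    using closed_Arg2pi2pi_le[of y] by (metis borel_closed)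
qed

text \<open>On the unit circle the product of two real parts is again a real part of a polynomial, because
  \<open>cnj z = inverse z\<close> there and \<open>Re (cnj w) = Re w\<close>.\<close>

lemma Re_poly_mult_cnj:
  "\<exists>R. \<forall>z. cmod z = 1 \<longrightarrow> Re (poly P z * cnj (poly Q z)) = Re (poly R z)"
proof (induction P Q rule: poly_induct2)
  case 0
  show ?case by (auto intro: exI[of _ 0])
next
  case (pCons a P b Q)
  then obtain R where R: "\<And>z. cmod z = 1 \<Longrightarrow> Re (poly P z * cnj (poly Q z)) = Re (poly R z)" by auto
  show ?case
  proof (intro exI allI impI)
    fix z :: complex assume z: "cmod z = 1"
    have zz: "z * cnj z = 1" using z by (simp add: complex_norm_square[symmetric])
    have "poly (pCons a P) z * cnj (poly (pCons b Q) z)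
        = a * cnj b + a * cnj (z * poly Q z) + z * poly P z * cnj b + (z * cnj z) * (poly P z * cnj (poly Q z))"
      by (simp add: algebra_simps)
    also have "Re \<dots> = Re (a * cnj b) + Re (cnj a * (z * poly Q z)) + Re (cnj b * (z * poly P z)) + Re (poly R z)"
      unfolding zz using R[OF z] by (simp add: algebra_simps)
    also have "\<dots> = Re (poly ([:a * cnj b:] + smult (cnj a) (pCons 0 Q) + smult (cnj b) (pCons 0 P) + R) z)"
      by (simp add: algebra_simps)
    finally show "Re (poly (pCons a P) z * cnj (poly (pCons b Q) z))
        = Re (poly ([:a * cnj b:] + smult (cnj a) (pCons 0 Q) + smult (cnj b) (pCons 0 P) + R) z)" .
  qed
qed

text \<open>Stone-Weierstrass provides polynomials in the real coordinates. Writing them on the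
  circle as \<open>Re (poly P z)\<close> gives at once a harmonic function in the disc and an entire
  function \<open>exp (poly P z)\<close> with known modulus. Products use
  \<open>Re a * Re b = Re (a * b) / 2 + Re (a * cnj b) / 2\<close>.\<close>

lemma real_polynomial_function_Re_poly:
  fixes g :: "complex \<Rightarrow> real"
  assumes "real_polynomial_function g"
  shows "\<exists>P. \<forall>z. cmod z = 1 \<longrightarrow> g z = Re (poly P z)"
  using assms
proof induction
  case (linear f)
  then interpret f: bounded_linear f .
  have "f z = Re (poly [:0, Complex (f 1) (- f \<i>):] z)" for z
  proof -
    have "f z = f (Re z *\<^sub>R 1 + Im z *\<^sub>R \<i>)"
      by (simp add: complex_eq[symmetric] scaleR_conv_of_real mult.commute)
    also have "\<dots> = Re z * f 1 + Im z * f \<i>" unfolding f.add f.scaleR by simp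
    finally show ?thesis by simp
  qed
  then show ?case by blast
next
  case (const c)
  show ?case by (auto intro!: exI[of _ "[:complex_of_real c:]"])
next
  case (add f g)
  then obtain P Q where "\<And>z. cmod z = 1 \<Longrightarrow> f z = Re (poly P z)" "\<And>z. cmod z = 1 \<Longrightarrow> g z = Re (poly Q z)"
    by metis
  then show ?case by (auto intro!: exI[of _ "P + Q"])
next
  case (mult f g)
  then obtain P Q where PQ: "\<And>z. cmod z = 1 \<Longrightarrow> f z = Re (poly P z)" "\<And>z. cmod z = 1 \<Longrightarrow> g z = Re (poly Q z)"
    by metis
  obtain R where R: "\<And>z. cmod z = 1 \<Longrightarrow> Re (poly P z * cnj (poly Q z)) = Re (poly R z)"
    using Re_poly_mult_cnj by metis
  have "Re a * Re b = Re (a * b) / 2 + Re (a * cnj b) / 2" for a b :: complex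
    by (simp add: field_simps)
  then have "f z * g z = Re (poly (smult (1/2) (P * Q) + smult (1/2) R) z)" if "cmod z = 1" for z
    using PQ[OF that] R[OF that] by (simp del: times_complex.sel)
  then show ?case by blast
qed

lemma Weierstrass_Re_poly:
  fixes f :: "complex \<Rightarrow> real"
  assumes "continuous_on (sphere 0 1) f" "0 < e"
  obtains P where "\<And>z. cmod z = 1 \<Longrightarrow> \<bar>f z - Re (poly P z)\<bar> < e" "Im (poly P 0) = 0"
proof -
  obtain g where g: "real_polynomial_function g" "\<And>z. z \<in> sphere 0 1 \<Longrightarrow> \<bar>f z - g z\<bar> < e"
    using Stone_Weierstrass_real_polynomial_function[OF compact_sphere assms] by metis
  obtain P where P: "\<And>z. cmod z = 1 \<Longrightarrow> g z = Re (poly P z)"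
    using real_polynomial_function_Re_poly[OF g(1)] by metis
  \<comment> \<open>Subtracting an imaginary constant leaves the real part alone and makes the value
    at 0 real, so that means of \<open>exp (- poly P z)\<close> are real as well.\<close>
  show ?thesis
    by (rule that[of "P - [:\<i> * of_real (Im (poly P 0)):]"]) (use g(2) P in auto)
qed

text \<open>The source of all multipliers: the bounds are uniform in \<open>k\<close>, so every
  later passage to the limit is by dominated convergence, and nonnegativity of the real parts makes
  \<open>exp (- poly (P k) z)\<close> bounded by 1 in the disc.\<close>

lemma bounded_measurable_Re_poly_approx:
  assumes v: "v \<in> borel_measurable angle_measure" and b: "\<And>t. 0 \<le> v t" "\<And>t. v t \<le> T"
  obtains P :: "nat \<Rightarrow> complex poly"
  where "\<And>k z. cmod z = 1 \<Longrightarrow> 0 \<le> Re (poly (P k) z)" "\<And>k z. cmod z = 1 \<Longrightarrow> Re (poly (P k) z) \<le> T + 1"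
    "AE t in angle_measure. (\<lambda>k. Re (poly (P k) (cis t))) \<longlonglongrightarrow> v t"
    "\<And>k. Im (poly (P k) 0) = 0"
proof -
  have T: "0 \<le> T" using b[of 0] by linarith
  define w where "w t = indicator {0..<2*pi} t *\<^sub>R v t" for t :: real
  have "w \<in> borel_measurable lborel"
    unfolding w_def by (rule borel_measurable_restrict_space_iff[THEN iffD1]) (use v in auto)
  then have "w \<in> borel_measurable lebesgue"
    using measurable_completion by blast
  then have "w measurable_on UNIV"
    using sets.top[of lebesgue] by (intro lebesgue_measurable_imp_measurable_on_real) simp_all
  then obtain N g where N: "negligible N" and g: "\<And>n. continuous_on UNIV (g n)"
    and lim: "\<And>t. t \<notin> N \<Longrightarrow> (\<lambda>n. g n t) \<longlonglongrightarrow> w t"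
    unfolding measurable_on_def by auto
  \<comment> \<open>Clamping to the interval from 0 to \<open>T\<close> preserves the bounds. The
    factor \<open>min 1 (real n * cmod (z - 1))\<close> vanishes at 1, where the angle jumps, and
    equals 1 eventually at every other point; it makes \<open>c n\<close> continuous on the
    circle.\<close>
  define c where "c n z = min 1 (real n * cmod (z - 1)) * max 0 (min T (g n (Arg2pi z)))" for n z
  have c0: "0 \<le> c n z" and cT: "c n z \<le> T" for n z
  proof -
    show "0 \<le> c n z" by (simp add: c_def)
    have "c n z \<le> 1 * T" unfolding c_def using T by (intro mult_mono) auto
    then show "c n z \<le> T" by simp
  qed
  have cc: "continuous_on (sphere 0 1) (c n)" for n
    unfolding continuous_on_eq_continuous_within
  proof
    fix z :: complex assume z: "z \<in> sphere 0 1"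
    show "continuous (at z within sphere 0 1) (c n)"
    proof (cases "z = 1")
      case True
      have "((\<lambda>x. c n x) \<longlongrightarrow> 0) (at 1 within sphere 0 1)"
      proof (rule Lim_null_comparison)
        show "\<forall>\<^sub>F x in at 1 within sphere 0 1. norm (c n x) \<le> real n * cmod (x - 1) * T"
        proof (intro always_eventually allI)
          fix x
          have "c n x \<le> (real n * cmod (x - 1)) * T"
            unfolding c_def using T by (intro mult_mono) auto
          then show "norm (c n x) \<le> real n * cmod (x - 1) * T" using c0 by simp
        qed
        show "((\<lambda>x. real n * cmod (x - 1) * T) \<longlongrightarrow> 0) (at 1 within sphere 0 1)"
          by (auto intro!: tendsto_eq_intros)
      qed
      moreover have "c n 1 = 0" by (simp add: c_def)
      ultimately show ?thesis by (simp add: True continuous_within)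
    next
      case False
      have "z \<notin> \<real>\<^sub>\<ge>\<^sub>0"
      proof
        assume "z \<in> \<real>\<^sub>\<ge>\<^sub>0"
        then obtain x where x: "z = of_real x" "0 \<le> x" by (auto simp: nonneg_Reals_def)
        with z False show False by simp
      qed
      then have "continuous (at z) Arg2pi"
        by (rule continuous_at_Arg2pi)
      moreover have "continuous (at (Arg2pi z)) (g n)"
        using g[of n] by (simp add: continuous_on_eq_continuous_at)
      ultimately have "continuous (at z) (\<lambda>z. g n (Arg2pi z))"
        by (rule isCont_o2)
      then have "continuous (at z) (c n)"
        unfolding c_def by (intro continuous_intros)
      then show ?thesis by (rule continuous_at_imp_continuous_within)
    qed
  qed
  have "\<exists>P. (\<forall>z. cmod z = 1 \<longrightarrow> \<bar>(c n z + 1 / real (n+2)) - Re (poly P z)\<bar> < 1 / real (n+2)) \<and> Im (poly P 0) = 0" for n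
    by (rule Weierstrass_Re_poly[of "\<lambda>z. c n z + 1 / real (n+2)" "1 / real (n+2)"])
       (auto intro!: continuous_intros cc)
  then obtain P where P: "\<And>n z. cmod z = 1 \<Longrightarrow> \<bar>(c n z + 1 / real (n+2)) - Re (poly (P n) z)\<bar> < 1 / real (n+2)"
    "\<And>n. Im (poly (P n) 0) = 0" by metis
  show ?thesis
  proof (rule that[of P])
    fix n and z :: complex assume z: "cmod z = 1"
    show "0 \<le> Re (poly (P n) z)" using P(1)[OF z, of n] c0[of n z] by linarith
    have "1 / real (n+2) \<le> 1 / 2" by (simp add: field_simps)
    then show "Re (poly (P n) z) \<le> T + 1" using P(1)[OF z, of n] cT[of n z] by linarith
  next
    fix n show "Im (poly (P n) 0) = 0" by (rule P(2))
  next
    have "AE t in lebesgue. t \<notin> N"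
      using N by (simp add: negligible_iff_null_sets AE_not_in)
    then have "AE t in lborel. t \<notin> N"
      by (simp only: AE_completion_iff)
    then have AE: "AE t in lborel. t \<in> {0..<2*pi} \<longrightarrow> (\<lambda>k. Re (poly (P k) (cis t))) \<longlonglongrightarrow> v t"
      using AE_lborel_singleton[of 0]
    proof eventually_elim
      case (elim t)
      show ?case
      proof
        assume t: "t \<in> {0..<2*pi}"
        have A: "Arg2pi (cis t) = t" using Arg2pi_cis[of t 1] t by simp
        have "(\<lambda>n. g n t) \<longlonglongrightarrow> v t" using lim[of t] elim(1) t by (simp add: w_def)
        then have "(\<lambda>n. max 0 (min T (g n t))) \<longlonglongrightarrow> max 0 (min T (v t))"
          by (intro tendsto_intros)
        then have 1: "(\<lambda>n. max 0 (min T (g n t))) \<longlonglongrightarrow> v t" using b[of t] by (simp add: max_def min_def split: if_splits)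
        have "cis t \<noteq> 1"
        proof
          assume "cis t = 1"
          then have "Arg2pi (cis t) = 0" by (simp add: Arg2pi_eq_0)
          then show False using A elim(2) by simp
        qed
        then have pos: "0 < cmod (cis t - 1)" by simp
        obtain n0 :: nat where n0: "1 / cmod (cis t - 1) < real n0" using reals_Archimedean2 by blast
        have "\<forall>\<^sub>F n in sequentially. max 0 (min T (g n t)) = c n (cis t)"
          using eventually_ge_at_top[of n0]
        proof eventually_elim
          case (elim n)
          have "1 / cmod (cis t - 1) \<le> real n" using n0 elim by linarith
          then have "1 \<le> real n * cmod (cis t - 1)" using pos by (simp add: field_simps)
          then show ?case by (simp add: c_def A)
        qed
        with 1 have 2: "(\<lambda>n. c n (cis t)) \<longlonglongrightarrow> v t" by (rule Lim_transform_eventually)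
        have "(\<lambda>n. 2 * (1 / real (n+2))) \<longlonglongrightarrow> 0"
          using tendsto_mult_right_zero[OF LIMSEQ_ignore_initial_segment[OF lim_1_over_n, of 2], of 2] by simp
        then have "(\<lambda>n. Re (poly (P n) (cis t)) - c n (cis t)) \<longlonglongrightarrow> 0"
        proof (rule Lim_null_comparison[rotated])
          show "\<forall>\<^sub>F n in sequentially. norm (Re (poly (P n) (cis t)) - c n (cis t)) \<le> 2 * (1 / real (n+2))"
          proof (intro always_eventually allI)
            fix n
            show "norm (Re (poly (P n) (cis t)) - c n (cis t)) \<le> 2 * (1 / real (n+2))"
              using P(1)[of "cis t" n] by (simp add: abs_if split: if_splits)
          qed
        qed
        from tendsto_add[OF this 2] show "(\<lambda>k. Re (poly (P k) (cis t))) \<longlonglongrightarrow> v t" by simp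
      qed
    qed
    show "AE t in angle_measure. (\<lambda>k. Re (poly (P k) (cis t))) \<longlonglongrightarrow> v t"
      by (subst AE_restrict_space_iff) (use AE in auto)
  qed
qed

text \<open>For functions that are merely integrable. Vanishing coefficients annihilate all real
  parts of polynomials, dominated convergence extends this to bounded measurable test functions, and
  the sign of the real or imaginary part is such a function.\<close>

lemma angle_Fourier_unique:
  assumes w: "integrable angle_measure w" and z: "\<And>n. (\<integral>t. w t * cis t powi n \<partial>angle_measure) = 0"
  shows "AE t in angle_measure. w t = 0"
proof -
  have [measurable]: "w \<in> borel_measurable angle_measure" using w by auto
  have cont [measurable]: "(\<lambda>t. poly P (cis t)) \<in> borel_measurable angle_measure" for P
    by (intro continuous_on_borel_measurable_angle continuous_intros)
  have powi [measurable]: "(\<lambda>t. cis t powi n) \<in> borel_measurable angle_measure" for n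
    by (intro continuous_on_borel_measurable_angle continuous_intros) auto
  have int: "integrable angle_measure (\<lambda>t. w t * b t)"
    if "b \<in> borel_measurable angle_measure" "\<And>t. cmod (b t) \<le> C" for b C
  proof (rule Bochner_Integration.integrable_bound[OF integrable_mult_right[OF w, of "of_real C"]])
    show "(\<lambda>t. w t * b t) \<in> borel_measurable angle_measure" using that(1) by measurable
    show "AE t in angle_measure. norm (w t * b t) \<le> norm (of_real C * w t)"
    proof (rule AE_I2)
      fix t
      have "cmod (b t) \<le> \<bar>C\<bar>" using that(2)[of t] by linarith
      then show "norm (w t * b t) \<le> norm (of_real C * w t)"
        by (simp add: norm_mult mult.commute mult_right_mono)
    qed
  qed
  have poly_bound: "\<exists>C. \<forall>t. cmod (poly P (cis t)) \<le> C" for P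
  proof -
    have "bounded ((\<lambda>z. poly P z) ` sphere 0 1)"
      by (intro compact_imp_bounded compact_continuous_image continuous_intros) auto
    then obtain C where "\<forall>x\<in>(\<lambda>z. poly P z) ` sphere 0 1. cmod x \<le> C" by (auto simp: bounded_iff)
    then show ?thesis by (intro exI[of _ C]) auto
  qed
  \<comment> \<open>The exponent \<open>n\<close> is kept general because on the unit circle
    multiplying by \<open>z\<close> or by \<open>cnj z\<close> shifts it up or down by one.\<close>
  have poly_pow: "(\<integral>t. w t * (poly P (cis t) * cis t powi n) \<partial>angle_measure) = 0
    \<and> (\<integral>t. w t * (cnj (poly P (cis t)) * cis t powi n) \<partial>angle_measure) = 0" for P n
  proof (induction P arbitrary: n)
    case 0
    show ?case by simp
  next
    case (pCons a P)
    obtain C where C: "\<And>t. cmod (poly P (cis t)) \<le> C" using poly_bound by blast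
    have i1: "integrable angle_measure (\<lambda>t. w t * cis t powi n)" for n
      by (rule int[where C = 1]) (auto simp: norm_power_int)
    have i2: "integrable angle_measure (\<lambda>t. w t * (poly P (cis t) * cis t powi n))" for n
      by (rule int[where C = C]) (auto simp: norm_mult norm_power_int C)
    have i3: "integrable angle_measure (\<lambda>t. w t * (cnj (poly P (cis t)) * cis t powi n))" for n
    proof (rule int[where C = C])
      have "(\<lambda>t. cnj (poly P (cis t))) \<in> borel_measurable angle_measure"
        by (intro continuous_on_borel_measurable_angle continuous_intros)
      then show "(\<lambda>t. cnj (poly P (cis t)) * cis t powi n) \<in> borel_measurable angle_measure" by measurable
    qed (auto simp: norm_mult norm_power_int C)
    have "w t * (poly (pCons a P) (cis t) * cis t powi n)
        = a * (w t * cis t powi n) + w t * (poly P (cis t) * cis t powi (n + 1))" for t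
    proof -
      have "cis t powi (n + 1) = cis t powi n * cis t"
        by (rule power_int_add_1) simp
      then show ?thesis by (simp add: algebra_simps)
    qed
    moreover have "w t * (cnj (poly (pCons a P) (cis t)) * cis t powi n)
        = cnj a * (w t * cis t powi n) + w t * (cnj (poly P (cis t)) * cis t powi (n - 1))" for t
    proof -
      have "cis t powi (n - 1) = cis t powi n * cnj (cis t)"
        by (simp add: power_int_diff cis_cnj cis_inverse divide_inverse)
      then show ?thesis by (simp add: algebra_simps)
    qed
    ultimately show ?case using i1 i2 i3 pCons.IH z by simp
  qed
  have Re0: "(\<integral>t. w t * of_real (Re (poly P (cis t))) \<partial>angle_measure) = 0" for P
  proof -
    obtain C where C: "\<And>t. cmod (poly P (cis t)) \<le> C" using poly_bound by blast
    have i2: "integrable angle_measure (\<lambda>t. w t * poly P (cis t))"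
      by (rule int[where C = C]) (auto simp: C)
    have i3: "integrable angle_measure (\<lambda>t. w t * cnj (poly P (cis t)))"
      by (rule int[where C = C]) (auto simp: C intro!: continuous_on_borel_measurable_angle continuous_intros)
    have eq: "w t * of_real (Re (poly P (cis t))) = (1/2) * (w t * poly P (cis t)) + (1/2) * (w t * cnj (poly P (cis t)))" for t
    proof -
      have "(1/2) * (w t * poly P (cis t)) + (1/2) * (w t * cnj (poly P (cis t)))
          = w t * ((poly P (cis t) + cnj (poly P (cis t))) / 2)" by (simp add: field_simps)
      then show ?thesis by (simp add: complex_add_cnj)
    qed
    show ?thesis unfolding eq using i2 i3 poly_pow[of P 0] by simp
  qed
  have bdd0: "(\<integral>t. w t * of_real (v t) \<partial>angle_measure) = 0"
    if v[measurable]: "v \<in> borel_measurable angle_measure" and b: "\<And>t. 0 \<le> v t" "\<And>t. v t \<le> 2" for v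
  proof -
    obtain P where P: "\<And>k z. cmod z = 1 \<Longrightarrow> 0 \<le> Re (poly (P k) z)" "\<And>k z. cmod z = 1 \<Longrightarrow> Re (poly (P k) z) \<le> 2 + 1"
      "AE t in angle_measure. (\<lambda>k. Re (poly (P k) (cis t))) \<longlonglongrightarrow> v t"
      by (rule bounded_measurable_Re_poly_approx[OF v b]) blast
    have "(\<lambda>k. \<integral>t. w t * of_real (Re (poly (P k) (cis t))) \<partial>angle_measure) \<longlonglongrightarrow> (\<integral>t. w t * of_real (v t) \<partial>angle_measure)"
    proof (rule integral_dominated_convergence[where w = "\<lambda>t. 3 * cmod (w t)"])
      show "AE t in angle_measure. (\<lambda>k. w t * of_real (Re (poly (P k) (cis t)))) \<longlonglongrightarrow> w t * of_real (v t)"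
        using P(3) by eventually_elim (intro tendsto_intros)
      show "AE t in angle_measure. norm (w t * of_real (Re (poly (P k) (cis t)))) \<le> 3 * cmod (w t)" for k
      proof (rule AE_I2)
        fix t
        have "\<bar>Re (poly (P k) (cis t))\<bar> \<le> 3" using P(1,2)[of "cis t" k] by simp
        then have "\<bar>Re (poly (P k) (cis t))\<bar> * cmod (w t) \<le> 3 * cmod (w t)" by (rule mult_right_mono) simp
        then show "norm (w t * of_real (Re (poly (P k) (cis t)))) \<le> 3 * cmod (w t)"
          by (simp add: norm_mult mult.commute)
      qed
      show "integrable angle_measure (\<lambda>t. 3 * cmod (w t))" using w by auto
      show "(\<lambda>t. w t * of_real (Re (poly (P k) (cis t)))) \<in> borel_measurable angle_measure" for k
        by (auto intro!: borel_measurable_times continuous_on_borel_measurable_angle continuous_intros)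
    qed measurable
    then show ?thesis unfolding Re0 by (simp add: LIMSEQ_const_iff)
  qed
  \<comment> \<open>The test function \<open>1 + sgn (h (w t))\<close> lies between 0 and 2, as
    \<open>bdd0\<close> demands. The summand 1 contributes nothing since the mean of
    \<open>w\<close> vanishes, so the integral of \<open>\<bar>h (w t)\<bar>\<close> is 0.\<close>
  have part: "AE t in angle_measure. h (w t) = 0"
    if h: "bounded_linear h" "h = Re \<or> h = Im" for h
  proof -
    have [measurable]: "(\<lambda>t. h (w t)) \<in> borel_measurable angle_measure" using h(2) by auto
    have i: "integrable angle_measure (\<lambda>t. w t * of_real (1 + sgn (h (w t))))"
      by (rule int[where C = 2]) (auto simp: sgn_if)
    have "(\<integral>t. h (w t * of_real (1 + sgn (h (w t)))) \<partial>angle_measure) = 0"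
    proof -
      have "(\<lambda>t. 1 + sgn (h (w t))) \<in> borel_measurable angle_measure" by measurable
      then have "(\<integral>t. w t * of_real (1 + sgn (h (w t))) \<partial>angle_measure) = 0"
        by (rule bdd0) (auto simp: sgn_if)
      then show ?thesis
        using integral_bounded_linear[OF h(1) i] linear_simps(3)[OF h(1)] by simp
    qed
    moreover have "h (w t * of_real (1 + sgn (h (w t)))) = h (w t) + \<bar>h (w t)\<bar>" for t
      using h(2) by (auto simp: algebra_simps abs_sgn)
    moreover have ih: "integrable angle_measure (\<lambda>t. h (w t))"
      by (rule integrable_bounded_linear[OF h(1) w])
    moreover have "(\<integral>t. h (w t) \<partial>angle_measure) = 0"
      using integral_bounded_linear[OF h(1) w] z[of 0] linear_simps(3)[OF h(1)] by simp
    ultimately have "(\<integral>t. \<bar>h (w t)\<bar> \<partial>angle_measure) = 0" by simp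
    then show ?thesis using integral_nonneg_eq_0_iff_AE[OF integrable_abs[OF ih]] by simp
  qed
  have "AE t in angle_measure. Re (w t) = 0" "AE t in angle_measure. Im (w t) = 0"
    using part[OF bounded_linear_Re] part[OF bounded_linear_Im] by simp_all
  then show ?thesis
    by eventually_elim (simp add: complex_eq_iff)
qed

section \<open>Boundary measure and Laurent coefficients\<close>

lemma space_circle_measure [simp]: "space (circle_measure r) = sphere 0 r"
  by (simp add: circle_measure_def space_restrict_space)

lemma sets_circle_measure [simp, measurable_cong]:
  "sets (circle_measure r) = sets (restrict_space borel (sphere 0 r))"
  by (simp add: circle_measure_def)

lemma measurable_circle_param:
  assumes "0 < r"
  shows "(\<lambda>t. complex_of_real r * cis t) \<in> measurable angle_measure (restrict_space borel (sphere 0 r))"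
  by (rule measurable_restrict_space2)
     (use assms in \<open>auto simp: norm_mult intro!: continuous_on_borel_measurable_angle continuous_intros\<close>)

lemma finite_measure_circle_measure: "0 < r \<Longrightarrow> finite_measure (circle_measure r)"
  unfolding circle_measure_def
  by (rule angle.finite_measure_distr) (rule measurable_circle_param)

lemma measure_circle_measure: "0 < r \<Longrightarrow> measure (circle_measure r) (sphere 0 r) = 2 * pi"
  unfolding circle_measure_def
  by (subst measure_distr[OF measurable_circle_param])
     (auto simp: sets_restrict_space norm_mult measure_angle_measure vimage_def Int_absorb1 subset_iff)

lemma integrable_circle_measure_iff:
  fixes f :: "complex \<Rightarrow> 'b::{banach, second_countable_topology}"
  assumes "0 < r" "f \<in> borel_measurable (circle_measure r)"
  shows "integrable (circle_measure r) f \<longleftrightarrow> integrable angle_measure (\<lambda>t. f (of_real r * cis t))"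
  using integrable_distr_eq[OF measurable_circle_param[OF assms(1)], of f] assms(2)
  by (simp add: circle_measure_def)

lemma integral_circle_measure:
  fixes f :: "complex \<Rightarrow> 'b::{banach, second_countable_topology}"
  assumes "0 < r" "f \<in> borel_measurable (circle_measure r)"
  shows "integral\<^sup>L (circle_measure r) f = (\<integral>t. f (of_real r * cis t) \<partial>angle_measure)"
  using integral_distr[OF measurable_circle_param[OF assms(1)], of f] assms(2)
  by (simp add: circle_measure_def)

lemma AE_circle_measure_iff:
  assumes "0 < r" "{z \<in> sphere 0 r. P z} \<in> sets (circle_measure r)"
  shows "(AE z in circle_measure r. P z) \<longleftrightarrow> (AE t in angle_measure. P (of_real r * cis t))"
  unfolding circle_measure_def
  by (subst AE_distr_iff[OF measurable_circle_param[OF assms(1)]])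
     (use assms(2) in \<open>simp_all add: space_restrict_space\<close>)

lemma AE_circle_measure_param:
  assumes "0 < r" "AE z in circle_measure r. P z"
  shows "AE t in angle_measure. P (of_real r * cis t)"
  using AE_distrD[OF measurable_circle_param[OF assms(1)]] assms(2) unfolding circle_measure_def .

lemma borel_measurable_circle_continuous:
  "continuous_on (sphere 0 r) f \<Longrightarrow> f \<in> borel_measurable (circle_measure r)"
  using borel_measurable_continuous_on_restrict[of "sphere 0 r" f]
    measurable_cong_sets[OF sets_circle_measure refl] by blast

lemma continuous_on_powi_sphere: "0 < r \<Longrightarrow> continuous_on (sphere 0 r) (\<lambda>z::complex. z powi n)"
  by (intro continuous_intros) auto

lemma integral_circle_powi:
  assumes "0 < r"
  shows "(\<integral>z. z powi n \<partial>circle_measure r) = (if n = 0 then 2 * pi else 0)"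
proof -
  have "(\<integral>z. z powi n \<partial>circle_measure r) = (\<integral>t. of_real r powi n * cis t powi n \<partial>angle_measure)"
    by (subst integral_circle_measure)
       (auto simp: assms power_int_mult_distrib intro!: borel_measurable_circle_continuous continuous_on_powi_sphere)
  also have "\<dots> = of_real r powi n * (if n = 0 then 2 * pi else 0)"
    by (simp add: angle_integral_cis)
  finally show ?thesis by simp
qed

lemma circle_Fourier_unique:
  assumes r: "0 < r" and u: "integrable (circle_measure r) u"
    and z: "\<And>n. (\<integral>z. u z * z powi n \<partial>circle_measure r) = 0"
  shows "AE z in circle_measure r. u z = 0"
proof -
  have um[measurable]: "u \<in> borel_measurable (circle_measure r)" using u by auto
  have [measurable]: "(\<lambda>z. z powi n) \<in> borel_measurable (circle_measure r)" for n
    by (intro borel_measurable_circle_continuous continuous_on_powi_sphere r)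
  have "AE t in angle_measure. u (of_real r * cis t) = 0"
  proof (rule angle_Fourier_unique)
    show "integrable angle_measure (\<lambda>t. u (of_real r * cis t))"
      using u integrable_circle_measure_iff[OF r um] by simp
    fix n
    have "0 = (\<integral>t. u (of_real r * cis t) * (of_real r * cis t) powi n \<partial>angle_measure)"
      using z[of n] by (subst (asm) integral_circle_measure[OF r]) auto
    also have "\<dots> = (\<integral>t. of_real r powi n * (u (of_real r * cis t) * cis t powi n) \<partial>angle_measure)"
      by (simp add: power_int_mult_distrib mult_ac)
    also have "\<dots> = of_real r powi n * (\<integral>t. u (of_real r * cis t) * cis t powi n \<partial>angle_measure)"
      by simp
    finally show "(\<integral>t. u (of_real r * cis t) * cis t powi n \<partial>angle_measure) = 0"
      using r by simp
  qed
  moreover have "{z \<in> sphere 0 r. u z = 0} \<in> sets (circle_measure r)"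
    using measurable_sets[OF um, of "{0}"] by (simp add: vimage_def Int_def conj_commute)
  ultimately show ?thesis by (simp only: AE_circle_measure_iff[OF r])
qed

lemma L2_norm_eq: "L2_norm q = l2norm (bdry_measure q)"
  by (simp add: fun_eq_iff L2_norm_def l2norm_def)

lemma L2_bdry_iff: "f \<in> L2_bdry q \<longleftrightarrow> square_integrable (bdry_measure q) f"
  by (simp add: L2_bdry_def square_integrable_def)

section \<open>Algebra of Laurent polynomials\<close>

lemma laurent_polysI: "finite F \<Longrightarrow> (\<lambda>z. \<Sum>n\<in>F. c n * z powi n) \<in> laurent_polys"
  unfolding laurent_polys_def by blast

lemma laurent_polys_add:
  assumes "p \<in> laurent_polys" "s \<in> laurent_polys"
  shows "(\<lambda>z. p z + s z) \<in> laurent_polys"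
proof -
  obtain c F d G where *: "p = (\<lambda>z. \<Sum>n\<in>F. c n * z powi n)" "finite F"
    "s = (\<lambda>z. \<Sum>n\<in>G. d n * z powi n)" "finite G"
    using assms unfolding laurent_polys_def by auto
  define c' d' where "c' n = (if n \<in> F then c n else 0)" and "d' n = (if n \<in> G then d n else 0)" for n
  have "p z + s z = (\<Sum>n\<in>F \<union> G. (c' n + d' n) * z powi n)" for z
  proof -
    have "p z = (\<Sum>n\<in>F \<union> G. c' n * z powi n)"
      unfolding *(1) by (rule sum.mono_neutral_cong_left) (use *(2,4) in \<open>auto simp: c'_def\<close>)
    moreover have "s z = (\<Sum>n\<in>F \<union> G. d' n * z powi n)"
      unfolding *(3) by (rule sum.mono_neutral_cong_left) (use *(2,4) in \<open>auto simp: d'_def\<close>)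
    ultimately show ?thesis by (simp add: distrib_right sum.distrib)
  qed
  then have "(\<lambda>z. p z + s z) = (\<lambda>z. \<Sum>n\<in>F \<union> G. (c' n + d' n) * z powi n)" by auto
  then show ?thesis using *(2,4) laurent_polysI[of "F \<union> G" "\<lambda>n. c' n + d' n"] by simp
qed

lemma laurent_polys_cmult:
  assumes "p \<in> laurent_polys"
  shows "(\<lambda>z. a * p z) \<in> laurent_polys"
proof -
  obtain c F where "p = (\<lambda>z. \<Sum>n\<in>F. c n * z powi n)" "finite F"
    using assms unfolding laurent_polys_def by auto
  then have "(\<lambda>z. a * p z) = (\<lambda>z. \<Sum>n\<in>F. (a * c n) * z powi n)" "finite F"
    by (auto simp: sum_distrib_left mult_ac)
  then show ?thesis using laurent_polysI[of F "\<lambda>n. a * c n"] by simp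
qed

lemma laurent_polys_diff:
  assumes "p \<in> laurent_polys" "s \<in> laurent_polys"
  shows "(\<lambda>z. p z - s z) \<in> laurent_polys"
  using laurent_polys_add[OF assms(1) laurent_polys_cmult[OF assms(2), of "-1"]] by simp

lemma laurent_polys_powi: "(\<lambda>z. z powi n) \<in> laurent_polys"
  using laurent_polysI[of "{n}" "\<lambda>k. 1"] by simp

lemma laurent_polys_0: "(\<lambda>z. 0) \<in> laurent_polys"
  using laurent_polys_cmult[OF laurent_polys_powi, of 0 0] by simp

lemma laurent_polys_const: "(\<lambda>z. c) \<in> laurent_polys"
  using laurent_polys_cmult[OF laurent_polys_powi, of c 0] by simp

lemma laurent_polys_induct [consumes 1, case_names zero add]:
  assumes "p \<in> laurent_polys" "P (\<lambda>z. 0)"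
    and "\<And>p c n. p \<in> laurent_polys \<Longrightarrow> P p \<Longrightarrow> P (\<lambda>z. c * z powi n + p z)"
  shows "P p"
proof -
  obtain c F where F: "p = (\<lambda>z. \<Sum>n\<in>F. c n * z powi n)" "finite F"
    using assms(1) unfolding laurent_polys_def by auto
  have "P (\<lambda>z. \<Sum>n\<in>F. c n * z powi n)" using F(2)
  proof induction
    case empty
    then show ?case using assms(2) by simp
  next
    case (insert k F)
    have "(\<lambda>z. \<Sum>n\<in>F. c n * z powi n) \<in> laurent_polys"
      by (rule laurent_polysI) (rule insert(1))
    from assms(3)[OF this insert.IH, of "c k" k] show ?case using insert(1,2) by simp
  qed
  then show ?thesis using F by simp
qed

text \<open>The point \<open>0\<close> is excluded because \<open>0 powi n\<close> is not multiplicative in \<open>n\<close>.\<close>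

lemma laurent_polys_mult:
  assumes "p \<in> laurent_polys" "s \<in> laurent_polys"
  shows "\<exists>t\<in>laurent_polys. \<forall>z. z \<noteq> 0 \<longrightarrow> t z = p z * s z"
  using assms(1)
proof (induction rule: laurent_polys_induct)
  case zero
  show ?case using laurent_polys_0 by force
next
  case (add p c n)
  then obtain t where t: "t \<in> laurent_polys" "\<And>z. z \<noteq> 0 \<Longrightarrow> t z = p z * s z" by blast
  have "\<exists>t\<in>laurent_polys. \<forall>z. z \<noteq> 0 \<longrightarrow> t z = z powi n * s z"
    using assms(2)
  proof (induction rule: laurent_polys_induct)
    case zero
    show ?case using laurent_polys_0 by force
  next
    case (add p c m)
    then obtain t where t: "t \<in> laurent_polys" "\<And>z. z \<noteq> 0 \<Longrightarrow> t z = z powi n * p z" by blast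
    have "(\<lambda>z. c * z powi (n + m) + t z) \<in> laurent_polys"
      by (intro laurent_polys_add laurent_polys_cmult laurent_polys_powi t)
    moreover have "c * z powi (n + m) + t z = z powi n * (c * z powi m + p z)" if "z \<noteq> 0" for z
      using that t(2) by (simp add: power_int_add algebra_simps)
    ultimately show ?case by (intro bexI[of _ "\<lambda>z. c * z powi (n + m) + t z"]) auto
  qed
  then obtain t' where t': "t' \<in> laurent_polys" "\<And>z. z \<noteq> 0 \<Longrightarrow> t' z = z powi n * s z" by blast
  have "(\<lambda>z. c * t' z + t z) \<in> laurent_polys"
    by (intro laurent_polys_add laurent_polys_cmult t t')
  moreover have "c * t' z + t z = (c * z powi n + p z) * s z" if "z \<noteq> 0" for z
    using that t(2) t'(2) by (simp add: algebra_simps)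
  ultimately show ?case by (intro bexI[of _ "\<lambda>z. c * t' z + t z"]) auto
qed

lemma continuous_on_laurent_poly:
  assumes "p \<in> laurent_polys" "0 \<notin> A"
  shows "continuous_on A p"
  using assms(1) by (induction rule: laurent_polys_induct) (use assms(2) in \<open>auto intro!: continuous_intros\<close>)

lemma holomorphic_on_laurent_poly:
  assumes "p \<in> laurent_polys" "0 \<notin> A"
  shows "p holomorphic_on A"
  using assms(1) by (induction rule: laurent_polys_induct) (use assms(2) in \<open>auto intro!: holomorphic_intros\<close>)

section \<open>Integration over the two boundary circles\<close>

locale annulus_boundary =
  fixes q :: real
  assumes q0: "0 < q" and q1: "q < 1"
begin

abbreviation "M \<equiv> bdry_measure q"

lemma zero_notin_bdry [simp]: "0 \<notin> bdry q"
  using q0 by (simp add: bdry_def)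

lemma compact_bdry: "compact (bdry q)"
  by (simp add: bdry_def compact_Un)

lemma sphere_sets_bdry: "r = 1 \<or> r = q \<Longrightarrow> sphere 0 r \<inter> space M \<in> sets M"
  by (auto simp: sets_restrict_space bdry_def intro!: image_eqI[of _ _ "sphere 0 r"])

text \<open>Through this identity measurability, integrals and null sets on the boundary reduce to
  the two circles; that these are disjoint uses \<open>q < 1\<close>.\<close>

lemma restrict_bdry_measure:
  assumes "r = 1 \<or> r = q"
  shows "restrict_space M (sphere 0 r) = circle_measure r"
proof (rule measure_eqI)
  have sub: "sphere 0 r \<subseteq> bdry q" using assms by (auto simp: bdry_def)
  have "sets (restrict_space M (sphere 0 r)) = sets (restrict_space (restrict_space borel (bdry q)) (sphere 0 r))"
    by (rule sets_restrict_space_cong) simp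
  also have "\<dots> = sets (restrict_space borel (sphere 0 r))"
    using sub by (simp add: sets_restrict_restrict_space Int_absorb1)
  finally show S: "sets (restrict_space M (sphere 0 r)) = sets (circle_measure r)" by simp
  fix A assume A: "A \<in> sets (restrict_space M (sphere 0 r))"
  then have Ar: "A \<subseteq> sphere 0 r" by (auto simp: sets_restrict_space)
  have AM: "A \<in> sets M"
    using A sphere_sets_bdry[OF assms] by (auto simp: sets_restrict_space_iff)
  have "emeasure (restrict_space M (sphere 0 r)) A = emeasure M A"
    by (rule emeasure_restrict_space) (use sphere_sets_bdry[OF assms] Ar in auto)
  also have "\<dots> = emeasure (circle_measure 1) (A \<inter> sphere 0 1) + emeasure (circle_measure q) (A \<inter> sphere 0 q)"
    by (rule emeasure_bdry_measure[OF AM])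
  also have "\<dots> = emeasure (circle_measure r) A"
  proof -
    have A: "A \<inter> sphere 0 r = A" using Ar by blast
    have E: "A \<inter> sphere 0 s = {}" if "s \<noteq> r" for s using Ar that by auto
    from assms show ?thesis
    proof
      assume r: "r = 1"
      show ?thesis using A E[of q] q1 by (simp add: r)
    next
      assume r: "r = q"
      show ?thesis using A E[of 1] q1 by (simp add: r)
    qed
  qed
  finally show "emeasure (restrict_space M (sphere 0 r)) A = emeasure (circle_measure r) A" .
qed

lemma borel_measurable_bdry_circle:
  assumes "f \<in> borel_measurable M" "r = 1 \<or> r = q"
  shows "f \<in> borel_measurable (circle_measure r)"
  using measurable_restrict_space1[OF assms(1), of "sphere 0 r"] restrict_bdry_measure[OF assms(2)] by simp

lemma indicator_bdry_split:
  fixes f :: "complex \<Rightarrow> 'b::real_vector"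
  assumes "z \<in> bdry q"
  shows "f z = indicat_real (sphere 0 1) z *\<^sub>R f z + indicat_real (sphere 0 q) z *\<^sub>R f z"
  using assms q1 by (auto simp: bdry_def indicator_def)

lemma integrable_bdry_iff:
  fixes f :: "complex \<Rightarrow> 'b::{banach, second_countable_topology}"
  shows "integrable M f \<longleftrightarrow> integrable (circle_measure 1) f \<and> integrable (circle_measure q) f"
proof
  assume f: "integrable M f"
  have "integrable (restrict_space M (sphere 0 r)) f" if "r = 1 \<or> r = q" for r
  proof -
    have "sphere 0 r \<inter> space M = sphere 0 r" using that by (auto simp: bdry_def)
    with sphere_sets_bdry[OF that] have "sphere 0 r \<in> sets M" by simp
    from integrable_mult_indicator[OF this f] show ?thesis
      by (simp only: integrable_restrict_space[OF sphere_sets_bdry[OF that]])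
  qed
  then show "integrable (circle_measure 1) f \<and> integrable (circle_measure q) f"
    using restrict_bdry_measure by metis
next
  assume "integrable (circle_measure 1) f \<and> integrable (circle_measure q) f"
  then have "integrable M (\<lambda>z. indicat_real (sphere 0 1) z *\<^sub>R f z)" "integrable M (\<lambda>z. indicat_real (sphere 0 q) z *\<^sub>R f z)"
    using integrable_restrict_space[OF sphere_sets_bdry, of _ f] restrict_bdry_measure by metis+
  then have "integrable M (\<lambda>z. indicat_real (sphere 0 1) z *\<^sub>R f z + indicat_real (sphere 0 q) z *\<^sub>R f z)" by simp
  then show "integrable M f"
    by (rule Bochner_Integration.integrable_cong[THEN iffD1, rotated -1])
       (simp_all add: indicator_bdry_split[of _ f, symmetric])
qed

lemma integral_bdry:
  fixes f :: "complex \<Rightarrow> 'b::{banach, second_countable_topology}"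
  assumes "integrable M f"
  shows "integral\<^sup>L M f = integral\<^sup>L (circle_measure 1) f + integral\<^sup>L (circle_measure q) f"
proof -
  have i: "integrable M (\<lambda>z. indicat_real (sphere 0 r) z *\<^sub>R f z)"
    and e: "integral\<^sup>L M (\<lambda>z. indicat_real (sphere 0 r) z *\<^sub>R f z) = integral\<^sup>L (circle_measure r) f"
    if "r = 1 \<or> r = q" for r
    using integrable_restrict_space[OF sphere_sets_bdry[OF that], of f]
      integral_restrict_space[OF sphere_sets_bdry[OF that], of f] restrict_bdry_measure[OF that]
      assms integrable_bdry_iff[of f] that by auto
  have "integral\<^sup>L M f = integral\<^sup>L M (\<lambda>z. indicat_real (sphere 0 1) z *\<^sub>R f z + indicat_real (sphere 0 q) z *\<^sub>R f z)"
    by (rule Bochner_Integration.integral_cong) (use indicator_bdry_split in auto)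
  then show ?thesis using i[of 1] i[of q] e[of 1] e[of q] by simp
qed

lemma AE_bdry_iff:
  "(AE z in M. P z) \<longleftrightarrow> (AE z in circle_measure 1. P z) \<and> (AE z in circle_measure q. P z)"
proof -
  have "(AE z in circle_measure r. P z) \<longleftrightarrow> (AE z in M. z \<in> sphere 0 r \<longrightarrow> P z)" if "r = 1 \<or> r = q" for r
    by (rule AE_restrict_space_iff[OF sphere_sets_bdry[OF that], of P, unfolded restrict_bdry_measure[OF that]])
  then have "(AE z in circle_measure 1. P z) \<and> (AE z in circle_measure q. P z) \<longleftrightarrow>
      (AE z in M. (z \<in> sphere 0 1 \<longrightarrow> P z) \<and> (z \<in> sphere 0 q \<longrightarrow> P z))" by simp
  also have "\<dots> \<longleftrightarrow> (AE z in M. P z)"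
    by (rule AE_cong) (auto simp: bdry_def)
  finally show ?thesis by simp
qed

text \<open>Gives access to completeness, projections and the embedding of square integrable into
  integrable functions.\<close>

sublocale finite_measure M
proof
  have fin: "emeasure (circle_measure r) A \<noteq> \<infinity>" if "r = 1 \<or> r = q" for r A
  proof -
    interpret C: finite_measure "circle_measure r"
      by (rule finite_measure_circle_measure) (use that q0 in auto)
    show ?thesis by simp
  qed
  show "emeasure M (space M) \<noteq> \<infinity>"
    by (subst emeasure_bdry_measure[OF sets.top]) (use fin[of 1] fin[of q] in auto)
qed

lemma measure_bdry: "measure M (bdry q) = 4 * pi"
proof -
  have i: "integrable M (\<lambda>z. 1::real)" by simp
  have "measure (circle_measure r) (space (circle_measure r)) = 2 * pi" if "0 < r" for r
    using measure_circle_measure[OF that] by simp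
  with integral_bdry[OF i] q0 show ?thesis by simp
qed

lemma borel_measurable_bdry_continuous:
  "continuous_on (bdry q) f \<Longrightarrow> f \<in> borel_measurable M"
  using borel_measurable_continuous_on_restrict[of "bdry q" f]
    measurable_cong_sets[OF sets_bdry_measure refl] by blast

lemma borel_measurable_continuous_mult:
  fixes f a :: "complex \<Rightarrow> complex"
  assumes "f \<in> borel_measurable M" "continuous_on (bdry q) a"
  shows "(\<lambda>z. f z * a z) \<in> borel_measurable M"
  by (rule borel_measurable_times[OF assms(1) borel_measurable_bdry_continuous[OF assms(2)]])

lemma continuous_bdry_bounded:
  fixes a :: "complex \<Rightarrow> complex"
  assumes "continuous_on (bdry q) a"
  obtains C where "0 < C" "\<And>z. z \<in> bdry q \<Longrightarrow> cmod (a z) \<le> C"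
proof -
  have "bounded (a ` bdry q)"
    by (intro compact_imp_bounded compact_continuous_image assms compact_bdry)
  then show ?thesis using that unfolding bounded_pos by (metis imageI)
qed

lemma continuous_on_powi_bdry: "continuous_on (bdry q) (\<lambda>z. z powi n)"
  by (intro continuous_on_laurent_poly laurent_polys_powi) simp

lemma square_integrable_continuous_mult:
  assumes "square_integrable M f" "continuous_on (bdry q) a"
  shows "square_integrable M (\<lambda>z. a z * f z)"
proof -
  obtain C where C: "\<And>z. z \<in> bdry q \<Longrightarrow> cmod (a z) \<le> C"
    by (rule continuous_bdry_bounded[OF assms(2)]) blast
  show ?thesis
  proof (rule square_integrable_bound[OF assms(1)])
    show "(\<lambda>z. a z * f z) \<in> borel_measurable M"
      by (intro borel_measurable_times borel_measurable_bdry_continuous assms(2)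
          square_integrable_measurable[OF assms(1)])
    show "AE z in M. cmod (a z * f z) \<le> C * cmod (f z)"
    proof (rule AE_I2)
      fix z assume "z \<in> space M"
      then show "cmod (a z * f z) \<le> C * cmod (f z)"
        unfolding norm_mult by (intro mult_right_mono C) simp_all
    qed
  qed
qed

lemma square_integrable_continuous:
  "continuous_on (bdry q) a \<Longrightarrow> square_integrable M a"
  using square_integrable_continuous_mult[OF square_integrable_bounded[of "\<lambda>z. 1" 1], of a] by simp

lemma square_integrable_laurent: "p \<in> laurent_polys \<Longrightarrow> square_integrable M p"
  by (intro square_integrable_continuous continuous_on_laurent_poly) auto

lemma integrable_continuous_mult:
  fixes f a :: "complex \<Rightarrow> complex"
  assumes "integrable M f" "continuous_on (bdry q) a"
  shows "integrable M (\<lambda>z. f z * a z)"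
proof -
  obtain C where C: "0 < C" "\<And>z. z \<in> bdry q \<Longrightarrow> cmod (a z) \<le> C"
    by (rule continuous_bdry_bounded[OF assms(2)]) blast
  show ?thesis
  proof (rule Bochner_Integration.integrable_bound)
    show "integrable M (\<lambda>z. of_real C * f z)" using assms(1) by simp
    show "(\<lambda>z. f z * a z) \<in> borel_measurable M"
      by (rule borel_measurable_continuous_mult[OF borel_measurable_integrable[OF assms(1)] assms(2)])
    show "AE z in M. cmod (f z * a z) \<le> cmod (of_real C * f z)"
    proof (rule AE_I2)
      fix z assume "z \<in> space M"
      then have "cmod (f z) * cmod (a z) \<le> cmod (f z) * C" by (intro mult_left_mono C) auto
      then show "cmod (f z * a z) \<le> cmod (of_real C * f z)" using C(1) by (simp add: norm_mult mult.commute)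
    qed
  qed
qed

lemma L1_le_l2norm_bdry:
  "square_integrable M f \<Longrightarrow> (\<integral>z. cmod (f z) \<partial>M) \<le> sqrt (4 * pi) * l2norm M f"
  using L1_le_l2norm[of f] measure_bdry by simp

text \<open>The relation between the Laurent coefficients on the two circles that characterizes boundary
  values of analytic functions on the annulus, stated for integrable functions.\<close>

definition balanced :: "(complex \<Rightarrow> complex) \<Rightarrow> bool" where
  "balanced f \<longleftrightarrow> integrable M f \<and>
     (\<forall>n. (\<integral>z. f z * z powi n \<partial>circle_measure 1) = (\<integral>z. f z * z powi n \<partial>circle_measure q))"

section \<open>Stability of the coefficient relation\<close>

lemma balanced_add:
  assumes "balanced f" "balanced g"
  shows "balanced (\<lambda>z. f z + g z)"
proof -
  have i: "integrable M (\<lambda>z. f z * z powi n)" "integrable M (\<lambda>z. g z * z powi n)" for n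
    using assms by (auto simp: balanced_def intro!: integrable_continuous_mult continuous_on_powi_bdry)
  show ?thesis
    using assms i unfolding balanced_def integrable_bdry_iff by (auto simp: distrib_right)
qed

lemma balanced_cmult: "balanced f \<Longrightarrow> balanced (\<lambda>z. c * f z)"
  by (auto simp: balanced_def mult.assoc)

lemma balanced_diff:
  "balanced f \<Longrightarrow> balanced g \<Longrightarrow> balanced (\<lambda>z. f z - g z)"
  using balanced_add[of f "\<lambda>z. (-1) * g z"] balanced_cmult[of g "-1"] by simp

lemma balanced_powi_mult:
  assumes "balanced f"
  shows "balanced (\<lambda>z. z powi m * f z)"
proof -
  have "(\<integral>z. (z powi m * f z) * z powi n \<partial>circle_measure r) = (\<integral>z. f z * z powi (m + n) \<partial>circle_measure r)"
    if "r = 1 \<or> r = q" for r n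
  proof (rule Bochner_Integration.integral_cong)
    fix z assume "z \<in> space (circle_measure r)"
    then have "z \<noteq> 0" using that q0 by auto
    then show "(z powi m * f z) * z powi n = f z * z powi (m + n)" by (simp add: power_int_add)
  qed simp
  then show ?thesis
    using assms integrable_continuous_mult[OF _ continuous_on_powi_bdry, of f m]
    by (auto simp: balanced_def mult.commute)
qed

lemma balanced_powi: "balanced (\<lambda>z. z powi m)"
proof -
  have "balanced (\<lambda>z. 1)"
    using q0 by (auto simp: balanced_def integral_circle_powi)
  from balanced_powi_mult[OF this, of m] show ?thesis by simp
qed

lemma balanced_laurent_mult:
  assumes "p \<in> laurent_polys" "balanced f"
  shows "balanced (\<lambda>z. p z * f z)"
  using assms(1)
proof (induction rule: laurent_polys_induct)
  case zero
  show ?case by (simp add: balanced_def)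
next
  case (add p c n)
  have "balanced (\<lambda>z. c * (z powi n * f z) + p z * f z)"
    by (intro balanced_add balanced_cmult balanced_powi_mult assms add)
  then show ?case by (simp add: algebra_simps)
qed

lemma balanced_laurent: "p \<in> laurent_polys \<Longrightarrow> balanced p"
  using balanced_laurent_mult[of p "\<lambda>z. 1"] balanced_powi[of 0] by simp

lemma balanced_cong_AE:
  assumes "balanced f" "AE z in M. g z = f z" "g \<in> borel_measurable M"
  shows "balanced g"
proof -
  have i: "integrable M g"
    by (rule integrable_cong_AE_imp[of M f]) (use assms in \<open>auto simp: balanced_def\<close>)
  have "(\<integral>z. g z * z powi n \<partial>circle_measure r) = (\<integral>z. f z * z powi n \<partial>circle_measure r)" if r: "r = 1 \<or> r = q" for r n
  proof (rule integral_cong_AE)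
    have "AE z in circle_measure r. g z = f z" using assms(2) r by (auto simp: AE_bdry_iff)
    then show "AE z in circle_measure r. g z * z powi n = f z * z powi n" by eventually_elim simp
    show "(\<lambda>z. g z * z powi n) \<in> borel_measurable (circle_measure r)"
      by (rule borel_measurable_bdry_circle[OF borel_measurable_continuous_mult r])
         (intro assms continuous_on_powi_bdry)+
    show "(\<lambda>z. f z * z powi n) \<in> borel_measurable (circle_measure r)"
      by (rule borel_measurable_bdry_circle[OF borel_measurable_continuous_mult r])
         (use assms in \<open>auto simp: balanced_def intro: continuous_on_powi_bdry\<close>)
  qed
  then show ?thesis using i assms(1) by (auto simp: balanced_def)
qed

lemma integral_circle_le_bdry:
  assumes "integrable M f" "\<And>z. 0 \<le> (f z :: real)" "r = 1 \<or> r = q"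
  shows "integral\<^sup>L (circle_measure r) f \<le> integral\<^sup>L M f"
  using assms integral_bdry[OF assms(1)] Bochner_Integration.integral_nonneg[of "circle_measure 1" f]
    Bochner_Integration.integral_nonneg[of "circle_measure q" f]
  by auto

lemma moment_bound:
  assumes f: "integrable M f" and r: "r = 1 \<or> r = q"
  shows "cmod (\<integral>z. f z * z powi n \<partial>circle_measure r) \<le> r powi n * (\<integral>z. cmod (f z) \<partial>M)"
proof -
  have r0: "0 < r" using r q0 by auto
  have "cmod (\<integral>z. f z * z powi n \<partial>circle_measure r) \<le> (\<integral>z. cmod (f z * z powi n) \<partial>circle_measure r)"
    by (rule integral_norm_bound)
  also have "\<dots> = (\<integral>z. r powi n * cmod (f z) \<partial>circle_measure r)"
    by (rule Bochner_Integration.integral_cong) (auto simp: norm_mult norm_power_int)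
  also have "\<dots> = r powi n * (\<integral>z. cmod (f z) \<partial>circle_measure r)" by simp
  also have "\<dots> \<le> r powi n * (\<integral>z. cmod (f z) \<partial>M)"
    using f r r0 by (intro mult_left_mono integral_circle_le_bdry) auto
  finally show ?thesis .
qed

text \<open>Each moment is continuous for convergence in the mean, so the relation between the
  circles passes to limits. Convergence in the mean, rather than in \<open>L2\<close>, is what
  products of two Hardy functions require.\<close>

lemma balanced_limit:
  assumes f: "integrable M f"
    and lim: "\<And>e. 0 < e \<Longrightarrow> \<exists>g. balanced g \<and> (\<integral>z. cmod (f z - g z) \<partial>M) < e"
  shows "balanced f"
  unfolding balanced_def
proof (intro conjI allI)
  fix n
  let ?m = "\<lambda>r f. \<integral>z. f z * z powi n \<partial>circle_measure r"
  have "cmod (?m 1 f - ?m q f) \<le> 0 + e" if e: "0 < e" for e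
  proof -
    \<comment> \<open>The modulus of \<open>z powi n\<close> is 1 on the outer circle and
      \<open>q powi n\<close> on the inner one; \<open>K\<close> bounds the two contributions
      together.\<close>
    define K where "K = 1 + q powi n"
    have K: "0 < K" using q0 by (simp add: K_def add_pos_pos)
    obtain g where g: "balanced g" "(\<integral>z. cmod (f z - g z) \<partial>M) < e / K"
      using lim[of "e / K"] e K by auto
    have gi: "integrable M g" and eq: "?m 1 g = ?m q g" using g by (auto simp: balanced_def)
    have d: "?m r f - ?m r g = ?m r (\<lambda>z. f z - g z)" if "r = 1 \<or> r = q" for r
    proof -
      have "integrable M (\<lambda>z. f z * z powi n)" "integrable M (\<lambda>z. g z * z powi n)"
        by (intro integrable_continuous_mult f gi continuous_on_powi_bdry)+
      then show ?thesis using that unfolding integrable_bdry_iff by (auto simp: left_diff_distrib)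
    qed
    have "cmod (?m 1 f - ?m q f) = cmod ((?m 1 f - ?m 1 g) - (?m q f - ?m q g))" by (simp add: eq)
    also have "\<dots> \<le> cmod (?m 1 f - ?m 1 g) + cmod (?m q f - ?m q g)" by (rule norm_triangle_ineq4)
    also have "\<dots> \<le> 1 powi n * (\<integral>z. cmod (f z - g z) \<partial>M) + q powi n * (\<integral>z. cmod (f z - g z) \<partial>M)"
      unfolding d[of 1, simplified] d[of q, simplified]
      by (intro add_mono moment_bound Bochner_Integration.integrable_diff f gi) auto
    also have "\<dots> = K * (\<integral>z. cmod (f z - g z) \<partial>M)" by (simp add: K_def algebra_simps)
    also have "\<dots> \<le> K * (e / K)" using K g by (intro mult_left_mono) auto
    finally show ?thesis using K by simp
  qed
  then have "cmod (?m 1 f - ?m q f) \<le> 0" by (rule field_le_epsilon)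
  then show "?m 1 f = ?m q f" by simp
qed (rule f)

section \<open>The Hardy space of index 0\<close>

lemma Hardy0_square_integrable: "f \<in> Hardy0 q \<Longrightarrow> square_integrable M f"
  by (simp add: Hardy0_def L2_closure_def L2_bdry_iff)

lemma Hardy0_laurent_approx:
  assumes "f \<in> Hardy0 q" "0 < e"
  obtains p where "p \<in> laurent_polys" "l2norm M (\<lambda>z. f z - p z) < e"
  using assms by (auto simp: Hardy0_def L2_closure_def L2_norm_eq)

lemma Hardy0_balanced:
  assumes f: "f \<in> Hardy0 q"
  shows "balanced f"
proof (rule balanced_limit)
  show "integrable M f" by (rule integrable_of_square_integrable[OF Hardy0_square_integrable[OF f]])
  fix e :: real assume e: "0 < e"
  obtain p where p: "p \<in> laurent_polys" "l2norm M (\<lambda>z. f z - p z) < e / sqrt (4 * pi)"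
    using Hardy0_laurent_approx[OF f, of "e / sqrt (4 * pi)"] e by auto
  have "(\<integral>z. cmod (f z - p z) \<partial>M) \<le> sqrt (4 * pi) * l2norm M (\<lambda>z. f z - p z)"
    by (intro L1_le_l2norm_bdry square_integrable_diff Hardy0_square_integrable f square_integrable_laurent p)
  also have "\<dots> < sqrt (4 * pi) * (e / sqrt (4 * pi))" by (rule mult_strict_left_mono[OF p(2)]) simp
  finally show "\<exists>g. balanced g \<and> (\<integral>z. cmod (f z - g z) \<partial>M) < e"
    using balanced_laurent[OF p(1)] by (intro exI[of _ p]) simp
qed

lemma laurent_in_Hardy0: "p \<in> laurent_polys \<Longrightarrow> p \<in> Hardy0 q"
  unfolding Hardy0_def L2_closure_def
  by (auto simp: L2_bdry_iff square_integrable_laurent L2_norm_eq l2norm_def intro!: bexI[of _ p])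

text \<open>On a circle conjugation is inversion up to the factor \<open>r\<^sup>2\<close>. Inner
  products with \<open>z powi n\<close> thus become moments weighted by
  \<open>r powi (2 * n)\<close>, and the different weights on the two circles are what makes
  comparisons of coefficients conclusive.\<close>

lemma cnj_powi_sphere:
  assumes "z \<in> sphere 0 r" "0 < r"
  shows "cnj (z powi n) = of_real (r powi (2 * n)) * z powi (- n)"
proof -
  have z: "z \<noteq> 0" using assms by auto
  have "z * cnj z = of_real (r\<^sup>2)" using assms by (simp add: complex_norm_square[symmetric])
  then have "cnj z = of_real (r\<^sup>2) * inverse z" using z by (simp add: field_simps)
  then have "cnj z powi n = of_real ((r\<^sup>2) powi n) * inverse z powi n"
    by (simp add: power_int_mult_distrib)
  also have "inverse z powi n = z powi (- n)" by (simp add: power_int_minus power_int_inverse)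
  also have "(r\<^sup>2) powi n = r powi (2 * n)" by (simp add: power_int_mult)
  finally show ?thesis by simp
qed

lemma moment_cnj:
  assumes "r = 1 \<or> r = q"
  shows "(\<integral>z. f z * cnj (z powi n) \<partial>circle_measure r)
    = of_real (r powi (2 * n)) * (\<integral>z. f z * z powi (- n) \<partial>circle_measure r)"
proof -
  have "(\<integral>z. f z * cnj (z powi n) \<partial>circle_measure r)
    = (\<integral>z. of_real (r powi (2 * n)) * (f z * z powi (- n)) \<partial>circle_measure r)"
  proof (rule Bochner_Integration.integral_cong)
    fix z assume "z \<in> space (circle_measure r)"
    then show "f z * cnj (z powi n) = of_real (r powi (2 * n)) * (f z * z powi (- n))"
      using assms q0 by (subst cnj_powi_sphere[of z r]) auto
  qed simp
  then show ?thesis by simp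
qed

lemma bdry_moment_cnj:
  assumes "integrable M u"
  shows "(\<integral>z. u z * cnj (z powi n) \<partial>M) = (\<integral>z. u z * z powi (- n) \<partial>circle_measure 1)
    + of_real (q powi (2 * n)) * (\<integral>z. u z * z powi (- n) \<partial>circle_measure q)"
proof -
  have "continuous_on (bdry q) (\<lambda>z. cnj (z powi n))"
    by (intro continuous_on_cnj continuous_on_powi_bdry)
  from integral_bdry[OF integrable_continuous_mult[OF assms this]] show ?thesis
    unfolding moment_cnj[OF disjI1[OF refl]] moment_cnj[OF disjI2[OF refl]] by simp
qed

text \<open>Trades a closure for countably many linear equations. For the harder direction,
  \<open>f\<close> is projected onto the space; the remainder \<open>u\<close> satisfies the
  coefficient relation and is orthogonal to every power of \<open>z\<close>, and both together
  annihilate all its moments.\<close>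

lemma Hardy0_iff: "f \<in> Hardy0 q \<longleftrightarrow> square_integrable M f \<and> balanced f"
proof
  assume "f \<in> Hardy0 q"
  then show "square_integrable M f \<and> balanced f" by (simp add: Hardy0_square_integrable Hardy0_balanced)
next
  assume f: "square_integrable M f \<and> balanced f"
  obtain h where h: "h \<in> Hardy0 q" and orth: "\<And>k. k \<in> Hardy0 q \<Longrightarrow> (\<integral>z. (f z - h z) * cnj (k z) \<partial>M) = 0"
  proof (rule L2_projection[of "Hardy0 q" f])
    show "Hardy0 q \<noteq> {}" using laurent_in_Hardy0[OF laurent_polys_0] by auto
    fix s assume s: "s \<in> Hardy0 q"
    show "square_integrable M s" by (rule Hardy0_square_integrable[OF s])
    fix c
    show "(\<lambda>x. c * s x) \<in> Hardy0 q"
      unfolding Hardy0_def L2_closure_def L2_bdry_iff L2_norm_eq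
    proof (intro CollectI conjI allI impI)
      show "square_integrable M (\<lambda>x. c * s x)" by (intro square_integrable_cmult Hardy0_square_integrable s)
      fix e :: real assume e: "0 < e"
      define K where "K = 1 + cmod c"
      have K: "0 < K" by (simp add: K_def add_pos_nonneg)
      obtain p where p: "p \<in> laurent_polys" "l2norm M (\<lambda>z. s z - p z) < e / K"
        using Hardy0_laurent_approx[OF s, of "e / K"] e K by auto
      have "l2norm M (\<lambda>z. c * s z - c * p z) = cmod c * l2norm M (\<lambda>z. s z - p z)"
        unfolding l2norm_cmult[symmetric] by (simp add: right_diff_distrib)
      also have "\<dots> \<le> K * l2norm M (\<lambda>z. s z - p z)" by (rule mult_right_mono) (auto simp: K_def)
      also have "\<dots> < K * (e / K)" by (rule mult_strict_left_mono[OF p(2) K])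
      finally have "l2norm M (\<lambda>z. c * s z - c * p z) < e" using K by simp
      then show "\<exists>p\<in>laurent_polys. l2norm M (\<lambda>z. c * s z - p z) < e"
        by (intro bexI[of _ "\<lambda>z. c * p z"] laurent_polys_cmult p)
    qed
  next
    fix s t assume st: "s \<in> Hardy0 q" "t \<in> Hardy0 q"
    show "(\<lambda>x. s x + t x) \<in> Hardy0 q"
      unfolding Hardy0_def L2_closure_def L2_bdry_iff L2_norm_eq
    proof (intro CollectI conjI allI impI)
      show "square_integrable M (\<lambda>x. s x + t x)" by (intro square_integrable_add Hardy0_square_integrable st)
      fix e :: real assume e: "0 < e"
      obtain p where p: "p \<in> laurent_polys" "l2norm M (\<lambda>z. s z - p z) < e / 2"
        using Hardy0_laurent_approx[OF st(1), of "e / 2"] e by auto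
      obtain u where u: "u \<in> laurent_polys" "l2norm M (\<lambda>z. t z - u z) < e / 2"
        using Hardy0_laurent_approx[OF st(2), of "e / 2"] e by auto
      have "l2norm M (\<lambda>z. (s z - p z) + (t z - u z)) < e"
        using l2norm_triangle[OF square_integrable_diff[OF Hardy0_square_integrable[OF st(1)] square_integrable_laurent[OF p(1)]]
            square_integrable_diff[OF Hardy0_square_integrable[OF st(2)] square_integrable_laurent[OF u(1)]]] p u by simp
      then have "l2norm M (\<lambda>z. s z + t z - (p z + u z)) < e" by (simp add: algebra_simps)
      then show "\<exists>p\<in>laurent_polys. l2norm M (\<lambda>z. s z + t z - p z) < e"
        by (intro bexI[of _ "\<lambda>z. p z + u z"] laurent_polys_add p u)
    qed
  next
    fix g assume g: "square_integrable M g" and lim: "\<And>e. 0 < e \<Longrightarrow> \<exists>s\<in>Hardy0 q. l2norm M (\<lambda>x. g x - s x) < e"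
    show "g \<in> Hardy0 q"
      unfolding Hardy0_def L2_closure_def L2_bdry_iff L2_norm_eq
    proof (intro CollectI conjI allI impI g)
      fix e :: real assume e: "0 < e"
      obtain s where s: "s \<in> Hardy0 q" "l2norm M (\<lambda>x. g x - s x) < e / 2" using lim[of "e / 2"] e by auto
      obtain p where p: "p \<in> laurent_polys" "l2norm M (\<lambda>z. s z - p z) < e / 2"
        using Hardy0_laurent_approx[OF s(1), of "e / 2"] e by auto
      have "l2norm M (\<lambda>z. g z - p z) < e"
        using l2norm_triangle_diff[OF g Hardy0_square_integrable[OF s(1)] square_integrable_laurent[OF p(1)]] s p by simp
      then show "\<exists>p\<in>laurent_polys. l2norm M (\<lambda>z. g z - p z) < e" using p by blast
    qed
  qed (use f in simp, rule that)
  define u where "u z = f z - h z" for z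
  have u: "balanced u" unfolding u_def using f by (intro balanced_diff[OF _ Hardy0_balanced[OF h]]) simp
  then have ui: "integrable M u" by (simp add: balanced_def)
  \<comment> \<open>Orthogonality is a weighted sum of the moments on the two circles with positive
    weights \<open>1\<close> and \<open>q powi (- 2 * n)\<close>. As the two moments agree, they
    vanish.\<close>
  have zero: "(\<integral>z. u z * z powi n \<partial>circle_measure 1) = 0" for n
  proof -
    let ?m = "\<lambda>r. \<integral>z. u z * z powi n \<partial>circle_measure r"
    have "0 = (\<integral>z. u z * cnj (z powi (- n)) \<partial>M)"
      using orth[OF laurent_in_Hardy0[OF laurent_polys_powi], of "- n"] by (simp add: u_def)
    also have "\<dots> = ?m 1 + of_real (q powi (- 2 * n)) * ?m q"
      using bdry_moment_cnj[OF ui, of "- n"] by simp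
    also have "?m q = ?m 1" using u by (simp add: balanced_def)
    finally have "?m 1 * of_real (1 + q powi (- 2 * n)) = 0" by (simp add: algebra_simps)
    moreover have "1 + q powi (- 2 * n) > 0" using q0 by (simp add: add_pos_pos)
    ultimately show ?thesis by (metis mult_eq_0_iff of_real_eq_0_iff less_irrefl)
  qed
  then have zq: "(\<integral>z. u z * z powi n \<partial>circle_measure q) = 0" for n using u by (simp add: balanced_def)
  have "AE z in M. u z = 0"
    unfolding AE_bdry_iff using ui zero zq q0
    by (auto simp: integrable_bdry_iff intro!: circle_Fourier_unique)
  then have fh: "AE z in M. f z = h z" by (simp add: u_def)
  show "f \<in> Hardy0 q"
    unfolding Hardy0_def L2_closure_def L2_bdry_iff L2_norm_eq
  proof (intro CollectI conjI allI impI)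
    show "square_integrable M f" using f by simp
    fix e :: real assume e: "0 < e"
    obtain p where p: "p \<in> laurent_polys" "l2norm M (\<lambda>z. h z - p z) < e"
      using Hardy0_laurent_approx[OF h e] by auto
    have "l2norm M (\<lambda>z. f z - p z) = l2norm M (\<lambda>z. h z - p z)"
    proof (rule l2norm_cong_AE)
      show "AE z in M. f z - p z = h z - p z" using fh by eventually_elim simp
      show "(\<lambda>z. f z - p z) \<in> borel_measurable M" "(\<lambda>z. h z - p z) \<in> borel_measurable M"
        using square_integrable_diff[OF _ square_integrable_laurent[OF p(1)]] f Hardy0_square_integrable[OF h]
        by (auto simp: square_integrable_def)
    qed
    then show "\<exists>p\<in>laurent_polys. l2norm M (\<lambda>z. f z - p z) < e" using p by (intro bexI[of _ p]) simp_all
  qed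
qed

text \<open>The product is only known to be integrable and so need not belong to
  \<open>Hardy0 q\<close>. Approximating one factor by Laurent polynomials in \<open>L2\<close>
  approximates the product in the mean, by Cauchy-Schwarz.\<close>

lemma balanced_mult:
  assumes f: "f \<in> Hardy0 q" and g: "g \<in> Hardy0 q"
  shows "balanced (\<lambda>z. f z * g z)"
proof (rule balanced_limit)
  note si = Hardy0_square_integrable[OF f] Hardy0_square_integrable[OF g]
  show "integrable M (\<lambda>z. f z * g z)" by (intro square_integrable_mult si)
  fix e :: real assume e: "0 < e"
  define K where "K = 1 + l2norm M g"
  have K: "0 < K" by (simp add: K_def add_pos_nonneg)
  obtain p where p: "p \<in> laurent_polys" "l2norm M (\<lambda>z. f z - p z) < e / K"
    using Hardy0_laurent_approx[OF f, of "e / K"] e K by auto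
  have "(\<integral>z. cmod (f z * g z - p z * g z) \<partial>M) = (\<integral>z. cmod (f z - p z) * cmod (g z) \<partial>M)"
    by (simp add: norm_mult[symmetric] left_diff_distrib)
  also have "\<dots> \<le> l2norm M (\<lambda>z. f z - p z) * l2norm M g"
    by (intro L2_Cauchy_Schwarz square_integrable_diff si square_integrable_laurent p)
  also have "\<dots> \<le> l2norm M (\<lambda>z. f z - p z) * K" by (rule mult_left_mono) (auto simp: K_def)
  also have "\<dots> < (e / K) * K" by (rule mult_strict_right_mono[OF p(2) K])
  finally have "(\<integral>z. cmod (f z * g z - p z * g z) \<partial>M) < e" using K by simp
  then show "\<exists>h. balanced h \<and> (\<integral>z. cmod (f z * g z - h z) \<partial>M) < e"
    using balanced_laurent_mult[OF p(1) Hardy0_balanced[OF g]] by blast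
qed

text \<open>The two families of conditions give for each \<open>n\<close> two linear equations in
  the moments on the two circles, with weights \<open>1, 1\<close> and
  \<open>1, q powi (- 2 * n)\<close>. They are independent unless \<open>n = 0\<close>, where only
  opposite means survive.\<close>

lemma annihilator_laurent_cnj:
  assumes u: "integrable M u"
    and z: "\<And>n. (\<integral>z. u z * z powi n \<partial>M) = 0" "\<And>n. (\<integral>z. u z * cnj (z powi n) \<partial>M) = 0"
  obtains k where "AE z in circle_measure 1. u z = k" "AE z in circle_measure q. u z = - k"
proof -
  let ?m = "\<lambda>r n. \<integral>z. u z * z powi n \<partial>circle_measure r"
  have 1: "?m 1 n + ?m q n = 0" for n
    using z(1)[of n] integrable_continuous_mult[OF u continuous_on_powi_bdry[of n]]
    by (subst (asm) integral_bdry) auto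
  have 2: "?m 1 n + of_real (q powi (- 2 * n)) * ?m q n = 0" for n
    using z(2)[of "- n"] bdry_moment_cnj[OF u, of "- n"] by simp
  have q: "?m q n = 0" if n: "n \<noteq> 0" for n
  proof -
    have "(of_real (q powi (- 2 * n)) - 1) * ?m q n = 0"
      using 1[of n] 2[of n] by (simp add: algebra_simps add_eq_0_iff)
    moreover have "q powi (- 2 * n) \<noteq> 1"
    proof
      assume "q powi (- 2 * n) = 1"
      then have "q powr (of_int (- 2 * n)) = 1" using q0 by (subst powr_real_of_int') auto
      then show False using n q0 q1 by (simp add: powr_eq_one_iff_gen)
    qed
    ultimately show ?thesis by (metis mult_eq_0_iff of_real_eq_1_iff right_minus_eq)
  qed
  \<comment> \<open>A mean: each circle has total mass \<open>2 * pi\<close>.\<close>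
  define k where "k = ?m 1 0 / (2 * pi)"
  have "AE z in circle_measure r. u z - s = 0"
    if r: "r = 1 \<or> r = q" and m: "\<And>n. n \<noteq> 0 \<Longrightarrow> ?m r n = 0" "?m r 0 = s * (2 * pi)" for r and s :: complex
  proof (rule circle_Fourier_unique)
    show r0: "0 < r" using r q0 by auto
    have ur: "integrable M (\<lambda>z. u z * z powi n)" "integrable M (\<lambda>z. s * z powi n)" for n
      by (rule integrable_continuous_mult[OF u continuous_on_powi_bdry],
          rule integrable_of_square_integrable[OF square_integrable_laurent[OF laurent_polys_cmult[OF laurent_polys_powi]]])
    have "integrable M (\<lambda>z. u z - s)" using u by simp
    then show "integrable (circle_measure r) (\<lambda>z. u z - s)" using r by (auto simp: integrable_bdry_iff)
    fix n
    have "(\<integral>z. (u z - s) * z powi n \<partial>circle_measure r) = ?m r n - (\<integral>z. s * z powi n \<partial>circle_measure r)"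
      unfolding left_diff_distrib using ur[of n] r
      by (intro Bochner_Integration.integral_diff) (auto simp: integrable_bdry_iff)
    also have "\<dots> = 0" using m by (cases "n = 0") (auto simp: integral_circle_powi[OF r0] measure_circle_measure[OF r0] scaleR_conv_of_real)
    finally show "(\<integral>z. (u z - s) * z powi n \<partial>circle_measure r) = 0" .
  qed
  from this[of 1 k] this[of q "- k"] show ?thesis
    using q 1 1[of 0] by (intro that[of k]) (auto simp: k_def add_eq_0_iff)
qed

end

section \<open>Analytic extension to the annulus\<close>

lemma angle_integral_holomorphic:
  fixes h :: "complex \<Rightarrow> complex"
  assumes "h holomorphic_on UNIV" "0 < r"
  shows "(\<integral>t. h (of_real r * cis t) \<partial>angle_measure) = 2 * pi * h 0"
proof -
  have "((\<lambda>u. h u / (u - 0)) has_contour_integral 2 * of_real pi * \<i> * h 0) (circlepath 0 r)"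
    using Cauchy_integral_circlepath_simple[of h 0 r 0] assms holomorphic_on_subset by auto
  then have "((\<lambda>t. h (of_real r * cis t) / (of_real r * cis t) * of_real r * \<i> * cis t)
      has_integral 2 * of_real pi * \<i> * h 0) {0..2*pi}"
    unfolding circlepath_def by (subst (asm) has_contour_integral_part_circlepath_iff) auto
  then have "((\<lambda>t. \<i> * h (of_real r * cis t)) has_integral 2 * of_real pi * \<i> * h 0) {0..2*pi}"
    by (rule has_integral_eq[rotated]) (use assms(2) in \<open>auto simp: field_simps\<close>)
  from has_integral_mult_right[OF this, of "- \<i>"]
  have "((\<lambda>t. h (of_real r * cis t)) has_integral 2 * of_real pi * h 0) {0..2*pi}"
    by (simp add: mult.assoc[symmetric]) (simp add: mult_ac)
  moreover have "continuous_on {0..2*pi} (\<lambda>t. h (of_real r * cis t))"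
    by (rule continuous_on_compose2[OF holomorphic_on_imp_continuous_on[OF assms(1)]])
       (auto intro!: continuous_intros)
  ultimately show ?thesis
    by (simp add: angle_integral_continuous(2) integral_unique)
qed

text \<open>The maximum principle for the harmonic function \<open>Re (poly P z)\<close>, read off
  from the modulus of \<open>exp (poly P z)\<close>.\<close>

lemma Re_poly_le_of_circle:
  assumes "\<And>z. cmod z = 1 \<Longrightarrow> Re (poly P z) \<le> C" "cmod z \<le> 1"
  shows "Re (poly P z) \<le> C"
proof -
  have "norm (exp (poly P z)) \<le> exp C"
  proof (rule maximum_modulus_frontier[of "\<lambda>z. exp (poly P z)" "cball 0 1"])
    show "(\<lambda>z. exp (poly P z)) holomorphic_on interior (cball 0 1)" by (intro holomorphic_intros)
    show "continuous_on (closure (cball 0 1)) (\<lambda>z. exp (poly P z))" by (intro continuous_intros)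
  qed (use assms in auto)
  then show ?thesis by simp
qed

text \<open>On every circle the moment selects the coefficient of \<open>z powi (- n)\<close>. This
  allows a moment on the boundary to be computed on a circle inside the annulus.\<close>

lemma laurent_moment:
  assumes "p \<in> laurent_polys" "0 < r" "0 < s"
  shows "(\<integral>z. p z * z powi n \<partial>circle_measure r) = (\<integral>z. p z * z powi n \<partial>circle_measure s)"
proof -
  have int: "integrable (circle_measure r) (\<lambda>z. p z * z powi n)" if "p \<in> laurent_polys" "0 < r" for r p
  proof -
    have "continuous_on {0..2*pi} (\<lambda>t. p (of_real r * cis t) * (of_real r * cis t) powi n)"
      by (intro continuous_on_mult continuous_on_compose2[OF continuous_on_laurent_poly[OF that(1), of "- {0}"]]
          continuous_on_power_int continuous_intros)
         (use that in auto)
    moreover have "(\<lambda>z. p z * z powi n) \<in> borel_measurable (circle_measure r)"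
      by (intro borel_measurable_circle_continuous continuous_on_mult continuous_on_laurent_poly that
          continuous_on_powi_sphere) (use that in auto)
    ultimately show ?thesis
      using integrable_circle_measure_iff[OF that(2)] angle_integral_continuous(1) by blast
  qed
  show ?thesis using assms(1)
  proof (induction rule: laurent_polys_induct)
    case zero
    show ?case by simp
  next
    case (add p c m)
    have eq: "(\<integral>z. (c * z powi m + p z) * z powi n \<partial>circle_measure r)
        = c * (if m + n = 0 then 2 * pi else 0) + (\<integral>z. p z * z powi n \<partial>circle_measure r)" if r: "0 < r" for r
    proof -
      have "(\<integral>z. (c * z powi m + p z) * z powi n \<partial>circle_measure r)
          = (\<integral>z. c * (z powi m * z powi n) + p z * z powi n \<partial>circle_measure r)"
        by (simp add: algebra_simps)
      also have "\<dots> = c * (\<integral>z. z powi m * z powi n \<partial>circle_measure r) + (\<integral>z. p z * z powi n \<partial>circle_measure r)"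
        using int[OF laurent_polys_powi r, of m] int[OF add(1) r] by simp
      also have "(\<integral>z. z powi m * z powi n \<partial>circle_measure r) = (\<integral>z. z powi (m + n) \<partial>circle_measure r)"
        by (rule Bochner_Integration.integral_cong) (use r in \<open>auto simp: power_int_add\<close>)
      finally show ?thesis by (simp only: integral_circle_powi[OF r])
    qed
    show ?case unfolding eq[OF assms(2)] eq[OF assms(3)] add.IH ..
  qed
qed

lemma laurent_coeff_moment:
  fixes c :: "int \<Rightarrow> complex"
  assumes "finite F" "m \<in> F" "0 < r"
  shows "(\<integral>z. (\<Sum>n\<in>F. c n * z powi n) * z powi (- m) \<partial>circle_measure r) = 2 * pi * c m"
proof -
  have r: "finite_measure (circle_measure r)" by (rule finite_measure_circle_measure[OF assms(3)])
  have "(\<integral>z. (\<Sum>n\<in>F. c n * z powi n) * z powi (- m) \<partial>circle_measure r)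
      = (\<integral>z. (\<Sum>n\<in>F. c n * z powi (n - m)) \<partial>circle_measure r)"
  proof (rule Bochner_Integration.integral_cong)
    fix z assume "z \<in> space (circle_measure r)"
    then have "z \<noteq> 0" using assms(3) by auto
    then show "(\<Sum>n\<in>F. c n * z powi n) * z powi (- m) = (\<Sum>n\<in>F. c n * z powi (n - m))"
      by (simp add: sum_distrib_right power_int_diff power_int_minus divide_inverse mult.assoc)
  qed simp
  also have "\<dots> = (\<Sum>n\<in>F. \<integral>z. c n * z powi (n - m) \<partial>circle_measure r)"
  proof (rule Bochner_Integration.integral_sum)
    fix n
    have "(\<lambda>z. c n * z powi (n - m)) \<in> borel_measurable (circle_measure r)"
      by (intro borel_measurable_circle_continuous continuous_on_mult continuous_on_const continuous_on_powi_sphere assms)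
    then show "integrable (circle_measure r) (\<lambda>z. c n * z powi (n - m))"
      by (intro finite_measure.integrable_const_bound[OF r, where B = "cmod (c n) * r powi (n - m)"])
         (auto simp: norm_mult norm_power_int)
  qed
  also have "\<dots> = (\<Sum>n\<in>F. c n * (if n = m then 2 * pi else 0))"
    by (simp add: integral_circle_powi[OF assms(3)])
  also have "\<dots> = (\<Sum>n\<in>F. if n = m then c n * (2 * pi) else 0)"
    by (rule sum.cong) auto
  also have "\<dots> = 2 * pi * c m" using assms by (simp add: sum.delta)
  finally show ?thesis .
qed

context annulus_boundary
begin

text \<open>The sum of two geometric series, with ratio \<open>x\<close> for the powers
  \<open>n \<ge> 0\<close> and ratio \<open>q / x\<close> for the negative ones. It stays bounded on
  compact subsets of the annulus.\<close>

definition eval_const :: "real \<Rightarrow> real" where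
  "eval_const x = 1 / (1 - x) + 1 / (1 - q / x)"

lemma annulusD: "z \<in> annulus q \<Longrightarrow> q < cmod z" "z \<in> annulus q \<Longrightarrow> cmod z < 1"
    "z \<in> annulus q \<Longrightarrow> z \<noteq> 0"
  using q0 by (auto simp: annulus_def)

lemma eval_const_nonneg: "q < x \<Longrightarrow> x < 1 \<Longrightarrow> 0 \<le> eval_const x"
proof -
  assume x: "q < x" "x < 1"
  then have "q / x < 1" using q0 by simp
  with x show ?thesis by (simp add: eval_const_def)
qed

text \<open>Coefficients are estimated by moments, on the outer circle for nonnegative powers and on
  the inner circle for negative ones, so that both parts of the Laurent series are dominated by
  convergent geometric series. The factor \<open>2 * pi\<close> gained in each coefficient is
  dropped.\<close>

lemma laurent_eval_bound:
  assumes p: "p \<in> laurent_polys" and z: "z \<in> annulus q"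
  shows "cmod (p z) \<le> eval_const (cmod z) * (\<integral>w. cmod (p w) \<partial>M)"
proof -
  obtain c F where F: "p = (\<lambda>z. \<Sum>n\<in>F. c n * z powi n)" "finite F"
    using p unfolding laurent_polys_def by auto
  define I where "I = (\<integral>w. cmod (p w) \<partial>M)"
  have I0: "0 \<le> I" by (simp add: I_def)
  define x where "x = cmod z"
  have x: "0 < x" "q < x" "x < 1" using annulusD[OF z] q0 by (auto simp: x_def)
  have pi: "integrable M p" by (rule integrable_of_square_integrable[OF square_integrable_laurent[OF p]])
  have coeff: "cmod (c n) \<le> r powi (- n) * I" if n: "n \<in> F" and r: "r = 1 \<or> r = q" for n r
  proof -
    have r0: "0 < r" using r q0 by auto
    have "2 * pi * cmod (c n) = cmod (\<integral>z. p z * z powi (- n) \<partial>circle_measure r)"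
      unfolding F(1) laurent_coeff_moment[OF F(2) n r0] by (simp add: norm_mult)
    also have "\<dots> \<le> r powi (- n) * I" unfolding I_def by (rule moment_bound[OF pi r])
    finally have "2 * pi * cmod (c n) \<le> r powi (- n) * I" .
    moreover have "1 * cmod (c n) \<le> 2 * pi * cmod (c n)"
      using pi_ge_two by (intro mult_right_mono) auto
    ultimately show ?thesis by linarith
  qed
  define b where "b n = (if 0 \<le> n then x ^ nat n else (q / x) ^ nat (- n))" for n :: int
  have term_le: "cmod (c n * z powi n) \<le> I * b n" if n: "n \<in> F" for n
  proof (cases "0 \<le> n")
    case True
    have "cmod (c n) \<le> I" using coeff[OF n, of 1] by simp
    then have "cmod (c n) * x ^ nat n \<le> I * x ^ nat n" using x by (intro mult_right_mono) auto
    then show ?thesis using True by (simp add: b_def norm_mult norm_power x_def power_int_def)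
  next
    case False
    have "cmod (c n) \<le> q ^ nat (- n) * I" using coeff[OF n, of q] False by (simp add: power_int_def)
    then have "cmod (c n) * x powi n \<le> q ^ nat (- n) * I * x powi n" using x by (intro mult_right_mono) auto
    also have "\<dots> = I * (q / x) ^ nat (- n)" using False by (simp add: power_int_def power_divide field_simps)
    finally show ?thesis using False by (simp add: b_def norm_mult norm_power_int x_def)
  qed
  have geo: "(\<Sum>n\<in>A. y ^ f n) \<le> 1 / (1 - y)" if "finite A" "inj_on f A" "0 \<le> y" "y < 1"
    for A :: "int set" and f :: "int \<Rightarrow> nat" and y :: real
  proof -
    have "(\<Sum>n\<in>A. y ^ f n) = (\<Sum>k\<in>f ` A. y ^ k)" using that by (simp add: sum.reindex)
    also have "\<dots> \<le> (\<Sum>k. y ^ k)" using that by (intro sum_le_suminf summable_geometric) auto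
    also have "\<dots> = 1 / (1 - y)" using that by (intro suminf_geometric) auto
    finally show ?thesis .
  qed
  have "sum b F = (\<Sum>n\<in>F \<inter> {n. 0 \<le> n}. x ^ nat n) + (\<Sum>n\<in>F \<inter> {n. \<not> 0 \<le> n}. (q / x) ^ nat (- n))"
    unfolding b_def using F(2) by (simp add: sum.If_cases Collect_neg_eq)
  also have "\<dots> \<le> 1 / (1 - x) + 1 / (1 - q / x)"
    using F(2) x q0 by (intro add_mono geo) (auto simp: inj_on_def)
  finally have bs: "sum b F \<le> eval_const x" by (simp add: eval_const_def)
  have "cmod (p z) \<le> (\<Sum>n\<in>F. cmod (c n * z powi n))" unfolding F(1) by (rule norm_sum)
  also have "\<dots> \<le> (\<Sum>n\<in>F. I * b n)" by (rule sum_mono) (rule term_le)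
  also have "\<dots> = I * sum b F" by (simp add: sum_distrib_left)
  also have "\<dots> \<le> I * eval_const x" by (rule mult_left_mono[OF bs I0])
  finally show ?thesis by (simp add: I_def x_def mult.commute)
qed

text \<open>The weight is not a Laurent polynomial, but the partial sums \<open>E N\<close> of its
  exponential series are polynomials, and off 0 their products with \<open>p\<close> agree with
  Laurent polynomials. Dominated convergence on the boundary removes the truncation.\<close>

lemma laurent_exp_poly_eval_bound:
  assumes p: "p \<in> laurent_polys" and z: "z \<in> annulus q"
  shows "cmod (exp (poly P z) * p z) \<le> eval_const (cmod z) * (\<integral>w. cmod (exp (poly P w) * p w) \<partial>M)"
proof -
  define E where "E N w = (\<Sum>k<N. inverse (fact k) * poly P w ^ k)" for N :: nat and w
  have polyL: "\<exists>t\<in>laurent_polys. \<forall>w. w \<noteq> 0 \<longrightarrow> t w = poly Q w * s w" if s: "s \<in> laurent_polys" for Q s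
  proof (induction Q)
    case 0
    show ?case using laurent_polys_0 by force
  next
    case (pCons a Q)
    then obtain t where t: "t \<in> laurent_polys" "\<And>w. w \<noteq> 0 \<Longrightarrow> t w = poly Q w * s w" by blast
    obtain u where u: "u \<in> laurent_polys" "\<And>w. w \<noteq> 0 \<Longrightarrow> u w = w powi 1 * t w"
      using laurent_polys_mult[OF laurent_polys_powi t(1)] by blast
    have "(\<lambda>w. a * s w + u w) \<in> laurent_polys" by (intro laurent_polys_add laurent_polys_cmult s u)
    then show ?case using t(2) u(2)
      by (intro bexI[of _ "\<lambda>w. a * s w + u w"]) (auto simp: algebra_simps)
  qed
  have EL: "\<exists>t\<in>laurent_polys. \<forall>w. w \<noteq> 0 \<longrightarrow> t w = E N w * p w" for N
    using polyL[OF p, of "\<Sum>k<N. smult (inverse (fact k)) (P ^ k)"]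
    by (simp add: E_def poly_sum poly_power)
  have bound: "cmod (E N z * p z) \<le> eval_const (cmod z) * (\<integral>w. cmod (E N w * p w) \<partial>M)" for N
  proof -
    obtain t where t: "t \<in> laurent_polys" "\<And>w. w \<noteq> 0 \<Longrightarrow> t w = E N w * p w" using EL by blast
    have "(\<integral>w. cmod (t w) \<partial>M) = (\<integral>w. cmod (E N w * p w) \<partial>M)"
    proof (rule Bochner_Integration.integral_cong)
      fix w assume "w \<in> space M"
      then have "w \<noteq> 0" using zero_notin_bdry by auto
      then show "cmod (t w) = cmod (E N w * p w)" by (simp add: t)
    qed simp
    then show ?thesis using laurent_eval_bound[OF t(1) z] t(2) annulusD(3)[OF z] by simp
  qed
  have Elim: "(\<lambda>N. E N w) \<longlonglongrightarrow> exp (poly P w)" for w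
    unfolding E_def using exp_converges[of "poly P w"] by (simp add: sums_def scaleR_conv_of_real)
  have Ebd: "cmod (E N w) \<le> exp (cmod (poly P w))" for N w
  proof -
    have "cmod (E N w) \<le> (\<Sum>k<N. inverse (fact k) * cmod (poly P w) ^ k)"
      unfolding E_def by (rule order_trans[OF norm_sum]) (simp add: norm_mult norm_power norm_inverse)
    also have "\<dots> \<le> (\<Sum>k. inverse (fact k) * cmod (poly P w) ^ k)"
      using summable_exp_generic[of "cmod (poly P w)"] by (intro sum_le_suminf) auto
    also have "\<dots> = exp (cmod (poly P w))" by (simp add: exp_def)
    finally show ?thesis .
  qed
  have pc: "continuous_on (bdry q) p" by (intro continuous_on_laurent_poly p) simp
  have "(\<lambda>N. \<integral>w. cmod (E N w * p w) \<partial>M) \<longlonglongrightarrow> (\<integral>w. cmod (exp (poly P w) * p w) \<partial>M)"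
  proof (rule integral_dominated_convergence[where w = "\<lambda>w. exp (cmod (poly P w)) * cmod (p w)"])
    show "(\<lambda>w. cmod (exp (poly P w) * p w)) \<in> borel_measurable M"
      by (intro borel_measurable_bdry_continuous continuous_intros pc)
    show "(\<lambda>w. cmod (E N w * p w)) \<in> borel_measurable M" for N
      unfolding E_def by (intro borel_measurable_bdry_continuous continuous_intros pc)
    have "square_integrable M (\<lambda>w. of_real (exp (cmod (poly P w))) * p w)"
      by (intro square_integrable_continuous continuous_intros pc)
    from integrable_norm[OF integrable_of_square_integrable[OF this]]
    show "integrable M (\<lambda>w. exp (cmod (poly P w)) * cmod (p w))" by (simp add: norm_mult)
    show "AE w in M. (\<lambda>N. cmod (E N w * p w)) \<longlonglongrightarrow> cmod (exp (poly P w) * p w)"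
      by (intro AE_I2 tendsto_intros Elim)
    show "AE w in M. norm (cmod (E N w * p w)) \<le> exp (cmod (poly P w)) * cmod (p w)" for N
      by (rule AE_I2) (auto simp: norm_mult intro: mult_right_mono[OF Ebd])
  qed
  then have "(\<lambda>N. eval_const (cmod z) * (\<integral>w. cmod (E N w * p w) \<partial>M))
      \<longlonglongrightarrow> eval_const (cmod z) * (\<integral>w. cmod (exp (poly P w) * p w) \<partial>M)"
    by (intro tendsto_intros)
  moreover have "(\<lambda>N. cmod (E N z * p z)) \<longlonglongrightarrow> cmod (exp (poly P z) * p z)"
    by (intro tendsto_intros Elim)
  ultimately show ?thesis using bound by (intro LIMSEQ_le) auto
qed

text \<open>\<open>F\<close> is the analytic function on the annulus with boundary values \<open>f\<close>.\<close>

definition extends :: "(complex \<Rightarrow> complex) \<Rightarrow> (complex \<Rightarrow> complex) \<Rightarrow> bool" where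
  "extends f F \<longleftrightarrow> F holomorphic_on annulus q \<and>
     (\<forall>p\<in>laurent_polys. \<forall>z\<in>annulus q. cmod (F z - p z) \<le> eval_const (cmod z) * (\<integral>w. cmod (f w - p w) \<partial>M))"

lemma open_annulus: "open (annulus q)"
proof -
  have "annulus q = cmod -` {q<..<1}" by (auto simp: annulus_def)
  then show ?thesis by (auto intro!: open_vimage continuous_intros)
qed

text \<open>One sequence with both kinds of convergence: evaluation in the annulus uses the mean,
  products and circle norms use \<open>L2\<close>.\<close>

lemma Hardy0_laurent_L1_approx:
  assumes f: "f \<in> Hardy0 q"
  obtains p where "\<And>k. p k \<in> laurent_polys" "(\<lambda>k. l2norm M (\<lambda>z. f z - p k z)) \<longlonglongrightarrow> 0"
    "(\<lambda>k. \<integral>z. cmod (f z - p k z) \<partial>M) \<longlonglongrightarrow> 0"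
proof -
  have "\<exists>p\<in>laurent_polys. l2norm M (\<lambda>z. f z - p z) < 1 / real (Suc k)" for k
    using Hardy0_laurent_approx[OF f, of "1 / real (Suc k)"] by auto
  then obtain p where p: "\<And>k. p k \<in> laurent_polys" "\<And>k. l2norm M (\<lambda>z. f z - p k z) < 1 / real (Suc k)"
    by metis
  have l2: "(\<lambda>k. l2norm M (\<lambda>z. f z - p k z)) \<longlonglongrightarrow> 0"
    by (rule tendsto_sandwich[OF _ _ tendsto_const LIMSEQ_Suc[OF lim_1_over_n]])
       (use p(2) in \<open>auto intro!: always_eventually less_imp_le\<close>)
  have "(\<lambda>k. \<integral>z. cmod (f z - p k z) \<partial>M) \<longlonglongrightarrow> 0"
  proof (rule tendsto_sandwich[OF _ _ tendsto_const])
    show "(\<lambda>k. sqrt (4 * pi) * l2norm M (\<lambda>z. f z - p k z)) \<longlonglongrightarrow> 0"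
      by (rule tendsto_mult_right_zero[OF l2])
    show "\<forall>\<^sub>F k in sequentially. (\<integral>z. cmod (f z - p k z) \<partial>M) \<le> sqrt (4 * pi) * l2norm M (\<lambda>z. f z - p k z)"
      by (intro always_eventually allI L1_le_l2norm_bdry square_integrable_diff Hardy0_square_integrable f
          square_integrable_laurent p)
  qed auto
  with p(1) l2 show ?thesis by (rule that)
qed

text \<open>Approximating Laurent polynomials are Cauchy in the mean on the boundary, hence locally
  uniformly Cauchy inside by the evaluation bound. Applying this bound to their difference from an
  arbitrary Laurent polynomial gives the second clause of \<open>extends\<close>.\<close>

lemma Hardy0_extends:
  assumes f: "f \<in> Hardy0 q"
  obtains F where "extends f F"
proof -
  obtain p where p: "\<And>k. p k \<in> laurent_polys" and L1: "(\<lambda>k. \<integral>z. cmod (f z - p k z) \<partial>M) \<longlonglongrightarrow> 0"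
    using Hardy0_laurent_L1_approx[OF f] by metis
  let ?e = "\<lambda>k. \<integral>z. cmod (f z - p k z) \<partial>M"
  have fi: "integrable M f" by (rule integrable_of_square_integrable[OF Hardy0_square_integrable[OF f]])
  have pi: "integrable M s" if "s \<in> laurent_polys" for s
    by (rule integrable_of_square_integrable[OF square_integrable_laurent[OF that]])
  have diff: "cmod (p k z - s z) \<le> eval_const (cmod z) * (?e k + (\<integral>w. cmod (f w - s w) \<partial>M))"
    if s: "s \<in> laurent_polys" and z: "z \<in> annulus q" for k s z
  proof -
    have "cmod (p k z - s z) \<le> eval_const (cmod z) * (\<integral>w. cmod (p k w - s w) \<partial>M)"
      by (rule laurent_eval_bound[OF laurent_polys_diff[OF p s] z])
    also have "(\<integral>w. cmod (p k w - s w) \<partial>M) \<le> (\<integral>w. cmod (f w - p k w) + cmod (f w - s w) \<partial>M)"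
    proof (rule integral_mono)
      fix w
      have "cmod (p k w - s w) = cmod ((f w - s w) - (f w - p k w))" by simp
      also have "\<dots> \<le> cmod (f w - s w) + cmod (f w - p k w)" by (rule norm_triangle_ineq4)
      finally show "cmod (p k w - s w) \<le> cmod (f w - p k w) + cmod (f w - s w)" by simp
    qed (intro integrable_norm Bochner_Integration.integrable_diff Bochner_Integration.integrable_add fi pi p s)+
    also have "\<dots> = ?e k + (\<integral>w. cmod (f w - s w) \<partial>M)"
      by (intro Bochner_Integration.integral_add integrable_norm Bochner_Integration.integrable_diff fi pi p s)
    finally show ?thesis using eval_const_nonneg annulusD[OF z] by (auto intro: mult_left_mono)
  qed
  define F where "F z = lim (\<lambda>k. p k z)" for z
  have conv: "(\<lambda>k. p k z) \<longlonglongrightarrow> F z" if z: "z \<in> annulus q" for z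
  proof -
    have "Cauchy (\<lambda>k. p k z)"
    proof (rule metric_CauchyI)
      fix e :: real assume e: "0 < e"
      define K where "K = eval_const (cmod z) + 1"
      have K: "0 < K" "0 \<le> eval_const (cmod z)"
        using eval_const_nonneg[OF annulusD(1)[OF z] annulusD(2)[OF z]] by (auto simp: K_def)
      have "\<forall>\<^sub>F k in sequentially. ?e k < e / (2 * K)"
        by (rule order_tendstoD(2)[OF L1]) (use e K in simp)
      then obtain N where N: "\<And>k. k \<ge> N \<Longrightarrow> ?e k < e / (2 * K)" by (auto simp: eventually_sequentially)
      show "\<exists>N. \<forall>m\<ge>N. \<forall>n\<ge>N. dist (p m z) (p n z) < e"
      proof (intro exI[of _ N] allI impI)
        fix m n assume mn: "N \<le> m" "N \<le> n"
        have "dist (p m z) (p n z) \<le> eval_const (cmod z) * (?e m + ?e n)"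
          unfolding dist_norm by (rule diff[OF p z])
        also have "\<dots> \<le> K * (?e m + ?e n)"
          by (rule mult_right_mono) (auto simp: K_def)
        also have "\<dots> < K * (e / (2 * K) + e / (2 * K))"
          using K N[OF mn(1)] N[OF mn(2)] by (intro mult_strict_left_mono add_strict_mono) auto
        also have "\<dots> = e" using K by (simp add: field_simps)
        finally show "dist (p m z) (p n z) < e" .
      qed
    qed
    then show ?thesis unfolding F_def
      using Cauchy_convergent convergent_LIMSEQ_iff by blast
  qed
  have bound: "cmod (F z - s z) \<le> eval_const (cmod z) * (\<integral>w. cmod (f w - s w) \<partial>M)"
    if s: "s \<in> laurent_polys" and z: "z \<in> annulus q" for s z
  proof (rule LIMSEQ_le)
    show "(\<lambda>k. cmod (p k z - s z)) \<longlonglongrightarrow> cmod (F z - s z)" by (intro tendsto_intros conv z)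
    have "(\<lambda>k. eval_const (cmod z) * (?e k + (\<integral>w. cmod (f w - s w) \<partial>M)))
        \<longlonglongrightarrow> eval_const (cmod z) * (0 + (\<integral>w. cmod (f w - s w) \<partial>M))"
      by (intro tendsto_intros L1)
    then show "(\<lambda>k. eval_const (cmod z) * (?e k + (\<integral>w. cmod (f w - s w) \<partial>M)))
        \<longlonglongrightarrow> eval_const (cmod z) * (\<integral>w. cmod (f w - s w) \<partial>M)" by simp
    show "\<exists>N. \<forall>k\<ge>N. cmod (p k z - s z) \<le> eval_const (cmod z) * (?e k + (\<integral>w. cmod (f w - s w) \<partial>M))"
      using diff[OF s z] by blast
  qed
  have "F holomorphic_on annulus q"
  proof (rule holomorphic_uniform_sequence[OF open_annulus])
    show "p k holomorphic_on annulus q" for k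
      by (rule holomorphic_on_laurent_poly[OF p]) (use annulusD(3) in blast)
    fix z assume z: "z \<in> annulus q"
    then obtain d where d: "0 < d" "cball z d \<subseteq> annulus q"
      using open_annulus open_contains_cball by blast
    \<comment> \<open>Continuity of the constant in the evaluation bound is what upgrades pointwise
      convergence to uniform convergence on the disc.\<close>
    have "continuous_on (cball z d) (\<lambda>w. eval_const (cmod w))"
      unfolding eval_const_def using annulusD d(2) q0
      by (intro continuous_intros) (fastforce simp: field_simps)+
    then obtain B where B: "\<And>w. w \<in> cball z d \<Longrightarrow> norm (eval_const (cmod w)) \<le> B"
      using compact_imp_bounded[OF compact_continuous_image[OF _ compact_cball]]
      by (metis bounded_iff imageI)
    have "uniform_limit (cball z d) p F sequentially"
    proof (rule uniform_limitI)
      fix e :: real assume e: "0 < e"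
      define B' where "B' = \<bar>B\<bar> + 1"
      have B': "0 < B'" by (simp add: B'_def)
      have "\<forall>\<^sub>F k in sequentially. ?e k < e / B'"
        by (rule order_tendstoD(2)[OF L1]) (use e B' in simp)
      then show "\<forall>\<^sub>F k in sequentially. \<forall>w\<in>cball z d. dist (p k w) (F w) < e"
      proof eventually_elim
        case (elim k)
        show ?case
        proof
          fix w assume w: "w \<in> cball z d"
          have "dist (p k w) (F w) \<le> eval_const (cmod w) * ?e k"
            using bound[OF p subsetD[OF d(2) w], of k] by (simp add: dist_norm norm_minus_commute)
          also have "\<dots> \<le> B' * ?e k"
            by (rule mult_right_mono) (use B[OF w] in \<open>auto simp: B'_def\<close>)
          also have "\<dots> < B' * (e / B')" by (rule mult_strict_left_mono[OF elim B'])
          finally show "dist (p k w) (F w) < e" using B' by simp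
        qed
      qed
    qed
    then show "\<exists>d>0. cball z d \<subseteq> annulus q \<and> uniform_limit (cball z d) p F sequentially"
      using d by blast
  qed
  with bound show ?thesis by (intro that[of F]) (auto simp: extends_def)
qed

lemma extends_tendsto:
  assumes "extends f F" "\<And>k. p k \<in> laurent_polys" "(\<lambda>k. \<integral>z. cmod (f z - p k z) \<partial>M) \<longlonglongrightarrow> 0" "z \<in> annulus q"
  shows "(\<lambda>k. p k z) \<longlonglongrightarrow> F z"
proof (rule Lim_transform2[of "\<lambda>_. F z"])
  show "(\<lambda>k. F z - p k z) \<longlonglongrightarrow> 0"
  proof (rule Lim_null_comparison)
    show "\<forall>\<^sub>F k in sequentially. norm (F z - p k z) \<le> eval_const (cmod z) * (\<integral>w. cmod (f w - p k w) \<partial>M)"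
      using assms(1,2,4) by (auto simp: extends_def)
    show "(\<lambda>k. eval_const (cmod z) * (\<integral>w. cmod (f w - p k w) \<partial>M)) \<longlonglongrightarrow> 0"
      by (rule tendsto_mult_right_zero[OF assms(3)])
  qed
qed simp

text \<open>The weight remains inside the integral, so that it can be small exactly where
  \<open>f\<close> lives. Only the error of approximating \<open>f\<close> is estimated with the
  maximum \<open>C\<close> of the weight, and that error tends to 0.\<close>

lemma extends_exp_poly_eval_bound:
  assumes f: "f \<in> Hardy0 q" and F: "extends f F" and z: "z \<in> annulus q"
  shows "cmod (exp (poly P z) * (z powi n * F z))
    \<le> eval_const (cmod z) * (\<integral>w. cmod (exp (poly P w) * (w powi n * f w)) \<partial>M)"
proof -
  obtain p where p: "\<And>k. p k \<in> laurent_polys" and L1: "(\<lambda>k. \<integral>z. cmod (f z - p k z) \<partial>M) \<longlonglongrightarrow> 0"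
    using Hardy0_laurent_L1_approx[OF f] by metis
  let ?a = "\<lambda>w. exp (poly P w) * w powi n"
  have fi: "integrable M f" by (rule integrable_of_square_integrable[OF Hardy0_square_integrable[OF f]])
  have pi: "integrable M s" if "s \<in> laurent_polys" for s
    by (rule integrable_of_square_integrable[OF square_integrable_laurent[OF that]])
  have ac: "continuous_on (bdry q) ?a" by (intro continuous_intros continuous_on_powi_bdry)
  obtain C where C: "\<And>w. w \<in> bdry q \<Longrightarrow> cmod (?a w) \<le> C"
    by (rule continuous_bdry_bounded[OF ac]) blast
  have bd: "cmod (?a z * p k z) \<le> eval_const (cmod z) *
      ((\<integral>w. cmod (?a w * f w) \<partial>M) + C * (\<integral>w. cmod (f w - p k w) \<partial>M))" for k
  proof -
    obtain t where t: "t \<in> laurent_polys" "\<And>w. w \<noteq> 0 \<Longrightarrow> t w = w powi n * p k w"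
      using laurent_polys_mult[OF laurent_polys_powi p] by blast
    have "cmod (?a z * p k z) = cmod (exp (poly P z) * t z)"
      using t(2)[OF annulusD(3)[OF z]] by (simp add: mult.assoc)
    also have "\<dots> \<le> eval_const (cmod z) * (\<integral>w. cmod (exp (poly P w) * t w) \<partial>M)"
      by (rule laurent_exp_poly_eval_bound[OF t(1) z])
    also have "(\<integral>w. cmod (exp (poly P w) * t w) \<partial>M) = (\<integral>w. cmod (?a w * p k w) \<partial>M)"
    proof (rule Bochner_Integration.integral_cong)
      fix w assume "w \<in> space M"
      then have "w \<noteq> 0" using zero_notin_bdry by auto
      then show "cmod (exp (poly P w) * t w) = cmod (?a w * p k w)" by (simp add: t mult.assoc)
    qed simp
    also have "\<dots> \<le> (\<integral>w. cmod (?a w * f w) + C * cmod (f w - p k w) \<partial>M)"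
    proof (rule integral_mono)
      show "integrable M (\<lambda>w. cmod (?a w * p k w))"
        using integrable_norm[OF integrable_continuous_mult[OF pi[OF p] ac]] by (simp add: mult.commute)
      show "integrable M (\<lambda>w. cmod (?a w * f w) + C * cmod (f w - p k w))"
      proof (rule Bochner_Integration.integrable_add)
        show "integrable M (\<lambda>w. cmod (?a w * f w))"
          using integrable_norm[OF integrable_continuous_mult[OF fi ac]] by (simp add: mult.commute)
        show "integrable M (\<lambda>w. C * cmod (f w - p k w))"
          by (intro integrable_mult_right integrable_norm Bochner_Integration.integrable_diff fi pi p)
      qed
      fix w assume w: "w \<in> space M"
      have "cmod (?a w * p k w) = cmod (?a w * f w - ?a w * (f w - p k w))" by (simp add: algebra_simps)
      also have "\<dots> \<le> cmod (?a w * f w) + cmod (?a w * (f w - p k w))" by (rule norm_triangle_ineq4)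
      also have "cmod (?a w * (f w - p k w)) \<le> C * cmod (f w - p k w)"
        unfolding norm_mult[of "?a w"] by (intro mult_right_mono C) (use w in auto)
      finally show "cmod (?a w * p k w) \<le> cmod (?a w * f w) + C * cmod (f w - p k w)" by simp
    qed
    also have "\<dots> = (\<integral>w. cmod (?a w * f w) \<partial>M) + C * (\<integral>w. cmod (f w - p k w) \<partial>M)"
    proof -
      have "integrable M (\<lambda>w. cmod (?a w * f w))"
        using integrable_norm[OF integrable_continuous_mult[OF fi ac]] by (simp add: mult.commute)
      moreover have "integrable M (\<lambda>w. cmod (f w - p k w))"
        by (intro integrable_norm Bochner_Integration.integrable_diff fi pi p)
      ultimately show ?thesis by simp
    qed
    finally show ?thesis using eval_const_nonneg annulusD[OF z] by (auto intro: mult_left_mono)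
  qed
  have "cmod (?a z * F z) \<le> eval_const (cmod z) * ((\<integral>w. cmod (?a w * f w) \<partial>M) + C * 0)"
  proof (rule LIMSEQ_le)
    show "(\<lambda>k. cmod (?a z * p k z)) \<longlonglongrightarrow> cmod (?a z * F z)"
      by (intro tendsto_intros extends_tendsto[OF F p L1 z])
    show "(\<lambda>k. eval_const (cmod z) * ((\<integral>w. cmod (?a w * f w) \<partial>M) + C * (\<integral>w. cmod (f w - p k w) \<partial>M)))
        \<longlonglongrightarrow> eval_const (cmod z) * ((\<integral>w. cmod (?a w * f w) \<partial>M) + C * 0)"
      by (intro tendsto_intros L1)
  qed (use bd in blast)
  then show ?thesis by (simp add: mult.assoc)
qed

text \<open>A moment of \<open>f\<close> on the outer circle is almost that of an approximating
  Laurent polynomial, which may be computed on the circle of radius \<open>s\<close> inside the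
  annulus. There the polynomials tend to the extension, that is to 0.\<close>

lemma extends_zero:
  assumes f: "f \<in> Hardy0 q" and F: "extends f F" and zero: "\<And>z. z \<in> annulus q \<Longrightarrow> F z = 0"
  shows "AE z in M. f z = 0"
proof -
  obtain p where p: "\<And>k. p k \<in> laurent_polys" and L1: "(\<lambda>k. \<integral>z. cmod (f z - p k z) \<partial>M) \<longlonglongrightarrow> 0"
    using Hardy0_laurent_L1_approx[OF f] by metis
  have fi: "integrable M f" by (rule integrable_of_square_integrable[OF Hardy0_square_integrable[OF f]])
  have pi: "integrable M s" if "s \<in> laurent_polys" for s
    by (rule integrable_of_square_integrable[OF square_integrable_laurent[OF that]])
  define s where "s = (1 + q) / 2"
  have s: "q < s" "s < 1" "0 < s" using q0 q1 by (auto simp: s_def)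
  have mom: "(\<integral>z. f z * z powi n \<partial>circle_measure 1) = 0" for n
  proof -
    let ?e = "\<lambda>k. \<integral>z. cmod (f z - p k z) \<partial>M"
    have "cmod (\<integral>z. f z * z powi n \<partial>circle_measure 1) \<le> (1 + eval_const s * s powi n * (2 * pi)) * ?e k" for k
    proof -
      interpret S: finite_measure "circle_measure s" by (rule finite_measure_circle_measure[OF s(3)])
      have "(\<integral>z. f z * z powi n \<partial>circle_measure 1)
          = (\<integral>z. (f z - p k z) * z powi n \<partial>circle_measure 1) + (\<integral>z. p k z * z powi n \<partial>circle_measure 1)"
        using integrable_continuous_mult[OF fi continuous_on_powi_bdry[of n]]
          integrable_continuous_mult[OF pi[OF p[of k]] continuous_on_powi_bdry[of n]]
        by (simp add: integrable_bdry_iff left_diff_distrib)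
      also have "(\<integral>z. p k z * z powi n \<partial>circle_measure 1) = (\<integral>z. p k z * z powi n \<partial>circle_measure s)"
        by (rule laurent_moment[OF p]) (use s in auto)
      also have "cmod ((\<integral>z. (f z - p k z) * z powi n \<partial>circle_measure 1) + \<dots>)
          \<le> 1 powi n * ?e k + (eval_const s * s powi n * (2 * pi)) * ?e k"
      proof (rule norm_triangle_mono)
        show "cmod (\<integral>z. (f z - p k z) * z powi n \<partial>circle_measure 1) \<le> 1 powi n * ?e k"
          by (rule moment_bound) (auto intro: fi pi p)
        have "cmod (\<integral>z. p k z * z powi n \<partial>circle_measure s) \<le> (\<integral>z. cmod (p k z * z powi n) \<partial>circle_measure s)"
          by (rule integral_norm_bound)
        also have "\<dots> \<le> (\<integral>z. eval_const s * ?e k * s powi n \<partial>circle_measure s)"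
        proof (rule integral_mono')
          show "integrable (circle_measure s) (\<lambda>z. eval_const s * ?e k * s powi n)" by simp
          fix z assume "z \<in> space (circle_measure s)"
          then have z: "z \<in> annulus q" "cmod z = s" using s by (auto simp: annulus_def)
          have "cmod (F z - p k z) \<le> eval_const (cmod z) * ?e k"
            using F p[of k] z(1) by (auto simp: extends_def)
          then have "cmod (p k z) \<le> eval_const s * ?e k"
            using zero[OF z(1)] z(2) by simp
          then have "cmod (p k z) * s powi n \<le> eval_const s * ?e k * s powi n"
            using s by (intro mult_right_mono) auto
          then show "cmod (p k z * z powi n) \<le> eval_const s * ?e k * s powi n"
            by (simp add: norm_mult norm_power_int z)
          show "0 \<le> eval_const s * ?e k * s powi n" using eval_const_nonneg[OF s(1,2)] s by simp
        qed
        also have "\<dots> = (eval_const s * s powi n * (2 * pi)) * ?e k"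
          using measure_circle_measure[OF s(3)] by simp
        finally show "cmod (\<integral>z. p k z * z powi n \<partial>circle_measure s) \<le> (eval_const s * s powi n * (2 * pi)) * ?e k" .
      qed
      finally show ?thesis by (simp add: algebra_simps)
    qed
    moreover have "(\<lambda>k. (1 + eval_const s * s powi n * (2 * pi)) * ?e k) \<longlonglongrightarrow> 0"
      by (rule tendsto_mult_right_zero[OF L1])
    ultimately have "cmod (\<integral>z. f z * z powi n \<partial>circle_measure 1) \<le> 0"
      by (intro tendsto_lowerbound[of _ 0 sequentially]) auto
    then show ?thesis by simp
  qed
  with Hardy0_balanced[OF f] have "(\<integral>z. f z * z powi n \<partial>circle_measure q) = 0" for n
    by (simp add: balanced_def)
  with mom fi q0 show ?thesis
    unfolding AE_bdry_iff by (auto simp: integrable_bdry_iff intro!: circle_Fourier_unique)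
qed

end

section \<open>Boundary zero sets\<close>

context annulus_boundary
begin

lemma mean_Re_poly:
  "(\<integral>t. Re (poly P (cis t)) \<partial>angle_measure) = 2 * pi * Re (poly P 0)"
proof -
  have "(\<integral>t. poly P (cis t) \<partial>angle_measure) = 2 * pi * poly P 0"
    using angle_integral_holomorphic[of "poly P" 1] by (simp add: holomorphic_intros)
  moreover have "integrable angle_measure (\<lambda>t. poly P (cis t))"
    by (intro angle_integral_continuous(1) continuous_intros)
  ultimately show ?thesis using integral_Re by fastforce
qed

text \<open>The maximum principle again. The point found depends on \<open>P\<close>, which is why a
  lower bound for the analytic extension on an entire circle is needed when this is applied.\<close>

lemma Re_poly_mean_le:
  assumes "0 < r"
  obtains z where "cmod z = r" "Re (poly P 0) \<le> Re (poly P z)"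
proof -
  have "continuous_on (sphere 0 r) (\<lambda>z. Re (poly P z))" by (intro continuous_intros)
  moreover have "sphere (0::complex) r \<noteq> {}" using assms by simp
  ultimately obtain z where z: "z \<in> sphere 0 r" "\<And>w. w \<in> sphere 0 r \<Longrightarrow> Re (poly P w) \<le> Re (poly P z)"
    using continuous_attains_sup[OF compact_sphere] by metis
  have "norm (exp (poly P 0)) \<le> exp (Re (poly P z))"
  proof (rule maximum_modulus_frontier[of "\<lambda>z. exp (poly P z)" "cball 0 r"])
    show "(\<lambda>z. exp (poly P z)) holomorphic_on interior (cball 0 r)" by (intro holomorphic_intros)
    show "continuous_on (closure (cball 0 r)) (\<lambda>z. exp (poly P z))" by (intro continuous_intros)
  qed (use assms z in auto)
  with z(1) show ?thesis by (intro that[of z]) auto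
qed

text \<open>If \<open>f\<close> vanishes on a set \<open>E\<close> of positive measure in the outer circle, multiply it by
  \<open>z\<^sup>N exp (S * P z)\<close> with \<open>Re P\<close> close to the indicator function of \<open>E\<close>. For \<open>N\<close> about
  \<open>2 * S / ln (1 / q)\<close> the norm stays bounded as \<open>S\<close> grows, whereas the values on a circle close to the
  outer one blow up exponentially unless the extension of \<open>f\<close> has a zero on that circle.\<close>

lemma Hardy0_nonvanishing_outer:
  assumes f: "f \<in> Hardy0 q" and E: "\<not> (AE z in circle_measure 1. f z \<noteq> 0)"
  shows "AE z in M. f z = 0"
proof (rule ccontr)
  assume nz: "\<not> (AE z in M. f z = 0)"
  have fsi: "square_integrable M f" by (rule Hardy0_square_integrable[OF f])
  have fi: "integrable M f" by (rule integrable_of_square_integrable[OF fsi])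
  have fi1: "integrable (circle_measure 1) f" and fiq: "integrable (circle_measure q) f"
    using fi by (auto simp: integrable_bdry_iff)
  have fm1: "f \<in> borel_measurable (circle_measure 1)" using fi1 by auto
  have ft: "integrable angle_measure (\<lambda>t. f (cis t))"
    using fi1 integrable_circle_measure_iff[OF _ fm1] by simp
  have ftm[measurable]: "(\<lambda>t. f (cis t)) \<in> borel_measurable angle_measure"
    using ft by auto
  obtain F where F: "extends f F" by (rule Hardy0_extends[OF f])
  have hol: "F holomorphic_on annulus q" using F by (simp add: extends_def)
  obtain z0 where z0: "z0 \<in> annulus q" "F z0 \<noteq> 0" using extends_zero[OF f F] nz by blast
  have conn: "connected (annulus q)"
    using connected_annulus(1)[where ?a = "0::complex" and ?r1.0 = q and ?r2.0 = 1] by (simp add: annulus_def)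
  \<comment> \<open>A nonzero analytic function has countably many zeros, so only countably many
    radii are spoiled and zero free circles exist arbitrarily close to the outer one.\<close>
  have cz: "countable {z \<in> annulus q. F z = 0}"
  proof (cases "F constant_on annulus q")
    case True
    then have empty: "{z \<in> annulus q. F z = 0} = {}" using z0 by (auto simp: constant_on_def)
    show ?thesis unfolding empty by simp
  next
    case False
    obtain C where C: "\<And>n::nat. compact (C n)" "\<Union>(range C) = annulus q"
    proof (rule open_Union_compact_subsets[OF open_annulus])
      fix C :: "nat \<Rightarrow> complex set"
      assume "\<And>n. compact (C n)" "\<Union>(range C) = annulus q"
      then show thesis by (rule that)
    qed
    have "range C \<subseteq> Collect compact" using C(1) by blast
    with C(2)[symmetric] have "fsigma (annulus q)" unfolding fsigma_Union_compact by blast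
    from holomorphic_countable_zeros[OF hol open_annulus conn this False] show ?thesis .
  qed
  define v where "v t = (if f (cis t) = 0 then 1 else 0 :: real)" for t
  have vm[measurable]: "v \<in> borel_measurable angle_measure"
    unfolding v_def by measurable
  obtain P where P0: "\<And>k z. cmod z = 1 \<Longrightarrow> 0 \<le> Re (poly (P k) z)"
    and P2: "\<And>k z. cmod z = 1 \<Longrightarrow> Re (poly (P k) z) \<le> 1 + 1"
    and Plim: "AE t in angle_measure. (\<lambda>k. Re (poly (P k) (cis t))) \<longlonglongrightarrow> v t"
    by (rule bounded_measurable_Re_poly_approx[OF vm, of 1]) (auto simp: v_def)
  have Pm[measurable]: "(\<lambda>t. Re (poly (P k) (cis t))) \<in> borel_measurable angle_measure" for k
    by (intro continuous_on_borel_measurable_angle continuous_intros)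
  define e where "e = (\<integral>t. v t \<partial>angle_measure)"
  have vi: "integrable angle_measure v"
    by (rule angle.integrable_const_bound[of _ 1]) (auto simp: v_def)
  have e: "0 < e"
  proof (rule ccontr)
    assume "\<not> 0 < e"
    moreover have "0 \<le> e" unfolding e_def by (rule Bochner_Integration.integral_nonneg) (simp add: v_def)
    ultimately have "e = 0" by simp
    then have "AE t in angle_measure. v t = 0"
      unfolding e_def using integral_nonneg_eq_0_iff_AE[OF vi] by (auto simp: v_def)
    then have ae: "AE t in angle_measure. f (of_real 1 * cis t) \<noteq> 0"
      by eventually_elim (auto simp: v_def split: if_splits)
    have "{z \<in> sphere 0 1. f z \<noteq> 0} = f -` (- {0}) \<inter> space (circle_measure 1)" by auto
    also have "\<dots> \<in> sets (circle_measure 1)" by (rule measurable_sets[OF fm1]) simp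
    finally have "AE z in circle_measure 1. f z \<noteq> 0"
      using ae AE_circle_measure_iff[of 1 "\<lambda>z. f z \<noteq> 0"] by simp
    with E show False ..
  qed
  \<comment> \<open>The indicator \<open>v\<close> has mean \<open>e / (2 * pi)\<close>; half of it
    is a lower bound for \<open>Re (poly (P k) 0)\<close> that holds for all large
    \<open>k\<close>.\<close>
  define m where "m = e / (4 * pi)"
  have m: "0 < m" using e by (simp add: m_def)
  define L where "L = ln (1 / q)"
  have L: "0 < L" using q0 q1 by (simp add: L_def)
  \<comment> \<open>Beyond \<open>r0\<close> the loss caused by \<open>r ^ N\<close> is at most
    \<open>exp (- (S * m / 2)) * r\<close>, half of the exponential gain \<open>exp (S * m)\<close>
    coming from \<open>P\<close>.\<close>
  define r0 where "r0 = max q (exp (- (m * L / 4)))"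
  have r0: "r0 < 1" "0 < r0" using q0 q1 m L by (auto simp: r0_def less_max_iff_disj)
  have "\<exists>r. r0 < r \<and> r < 1 \<and> (\<forall>z. cmod z = r \<longrightarrow> F z \<noteq> 0)"
  proof (rule ccontr)
    assume no: "\<not> ?thesis"
    have "{r0<..<1} \<subseteq> cmod ` {z \<in> annulus q. F z = 0}"
    proof
      fix r assume r: "r \<in> {r0<..<1}"
      then obtain z where z: "cmod z = r" "F z = 0" using no by auto
      then have "z \<in> annulus q" using r by (auto simp: annulus_def r0_def)
      with z show "r \<in> cmod ` {z \<in> annulus q. F z = 0}" by auto
    qed
    then have "countable {r0<..<1}" using cz by (meson countable_image countable_subset)
    then show False using r0 uncountable_open_interval by blast
  qed
  then obtain r where r: "r0 < r" "r < 1" and Fr: "\<And>z. cmod z = r \<Longrightarrow> F z \<noteq> 0" by blast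
  have rq: "q < r" "0 < r" using r q0 by (auto simp: r0_def)
  have rann: "z \<in> annulus q" if "cmod z = r" for z using that r rq by (auto simp: annulus_def)
  define l where "l = ln (1 / r)"
  have l: "0 < l" "l \<le> m * L / 4"
  proof -
    show "0 < l" using r rq by (simp add: l_def)
    have "exp (- (m * L / 4)) \<le> r" using r by (simp add: r0_def)
    then have "- (m * L / 4) \<le> ln r" using rq by (simp add: ln_ge_iff)
    then show "l \<le> m * L / 4" using rq by (simp add: l_def ln_div)
  qed
  obtain d where d: "0 < d" "\<And>z. cmod z = r \<Longrightarrow> d \<le> cmod (F z)"
  proof -
    have "continuous_on (sphere 0 r) (\<lambda>z. cmod (F z))"
      by (intro continuous_on_norm continuous_on_subset[OF holomorphic_on_imp_continuous_on[OF hol]])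
         (use rann in auto)
    moreover have "sphere (0::complex) r \<noteq> {}" using rq by simp
    ultimately obtain z where "z \<in> sphere 0 r" "\<And>w. w \<in> sphere 0 r \<Longrightarrow> cmod (F z) \<le> cmod (F w)"
      using continuous_attains_inf[OF compact_sphere] by metis
    then show ?thesis using Fr[of z] by (intro that[of "cmod (F z)"]) auto
  qed
  define I where "I = (\<integral>z. cmod (f z) \<partial>M)"
  have meanlim: "(\<lambda>k. 2 * pi * Re (poly (P k) 0)) \<longlonglongrightarrow> e"
    unfolding mean_Re_poly[symmetric] e_def
  proof (rule integral_dominated_convergence[where w = "\<lambda>_. 2"])
    show "AE t in angle_measure. norm (Re (poly (P k) (cis t))) \<le> 2" for k
      using P0[of "cis _" k] P2[of "cis _" k] by (intro AE_I2) simp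
    show "integrable angle_measure (\<lambda>_. 2::real)" by simp
  qed (use Plim in measurable)
  have main: "exp (S * m / 2) * (r * d) \<le> eval_const r * (I + 1)" if S: "0 < S" for S :: real
  proof -
    \<comment> \<open>On the inner circle \<open>Re P\<close> is at most 2, so
      \<open>exp (S * P)\<close> has modulus at most \<open>exp (S * 2)\<close> there; this is the
      smallest natural \<open>N\<close> for which \<open>q ^ N\<close> compensates it.\<close>
    define N where "N = nat \<lceil>2 * S / L\<rceil>"
    have N: "2 * S / L \<le> real N" "real N \<le> 2 * S / L + 1"
      using S L unfolding N_def by (auto simp: of_nat_nat ceiling_mono intro: less_imp_le)
    define a where "a k w = exp (poly (smult (of_real S) (P k)) w)" for k w
    have a: "cmod (a k w) = exp (S * Re (poly (P k) w))" for k w by (simp add: a_def)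
    have ac: "continuous_on A (a k)" for A k unfolding a_def by (intro continuous_intros)
    \<comment> \<open>Where \<open>f\<close> vanishes the weight does not matter, and elsewhere on
      the outer circle it tends to 1. The weighted norm therefore tends to the unweighted one,
      however large \<open>S\<close> is.\<close>
    have lim1: "(\<lambda>k. \<integral>t. exp (S * Re (poly (P k) (cis t))) * cmod (f (cis t)) \<partial>angle_measure)
        \<longlonglongrightarrow> (\<integral>t. cmod (f (cis t)) \<partial>angle_measure)"
    proof (rule integral_dominated_convergence[where w = "\<lambda>t. exp (S * 2) * cmod (f (cis t))"])
      show "AE t in angle_measure. (\<lambda>k. exp (S * Re (poly (P k) (cis t))) * cmod (f (cis t))) \<longlonglongrightarrow> cmod (f (cis t))"
        using Plim
      proof eventually_elim
        case (elim t)
        show ?case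
        proof (cases "f (cis t) = 0")
          case False
          then have "(\<lambda>k. Re (poly (P k) (cis t))) \<longlonglongrightarrow> 0" using elim by (simp add: v_def)
          then have "(\<lambda>k. exp (S * Re (poly (P k) (cis t))) * cmod (f (cis t))) \<longlonglongrightarrow> exp (S * 0) * cmod (f (cis t))"
            by (intro tendsto_intros)
          then show ?thesis by simp
        qed simp
      qed
      show "AE t in angle_measure. norm (exp (S * Re (poly (P k) (cis t))) * cmod (f (cis t))) \<le> exp (S * 2) * cmod (f (cis t))" for k
      proof (rule AE_I2)
        fix t
        have "exp (S * Re (poly (P k) (cis t))) \<le> exp (S * 2)"
          using P2[of "cis t" k] S by simp
        then show "norm (exp (S * Re (poly (P k) (cis t))) * cmod (f (cis t))) \<le> exp (S * 2) * cmod (f (cis t))"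
          by (simp add: mult_right_mono)
      qed
      show "integrable angle_measure (\<lambda>t. exp (S * 2) * cmod (f (cis t)))" using ft by simp
    qed measurable
    have bound: "(\<integral>w. cmod (a k w * (w powi int N * f w)) \<partial>M)
        \<le> (\<integral>t. exp (S * Re (poly (P k) (cis t))) * cmod (f (cis t)) \<partial>angle_measure)
          + (\<integral>z. cmod (f z) \<partial>circle_measure q)" for k
    proof -
      have gi: "integrable M (\<lambda>w. cmod (a k w * (w powi int N * f w)))"
        using integrable_norm[OF integrable_continuous_mult[OF fi continuous_on_mult[OF ac continuous_on_powi_bdry]], of k "int N"]
        by (simp add: mult_ac)
      have 1: "(\<integral>w. cmod (a k w * (w powi int N * f w)) \<partial>circle_measure 1)
          = (\<integral>t. exp (S * Re (poly (P k) (cis t))) * cmod (f (cis t)) \<partial>angle_measure)"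
        using gi by (subst integral_circle_measure) (auto simp: integrable_bdry_iff norm_mult a norm_power)
      have 2: "(\<integral>w. cmod (a k w * (w powi int N * f w)) \<partial>circle_measure q) \<le> (\<integral>z. cmod (f z) \<partial>circle_measure q)"
      proof (rule integral_mono)
        show "integrable (circle_measure q) (\<lambda>w. cmod (a k w * (w powi int N * f w)))"
          using gi by (simp add: integrable_bdry_iff)
        show "integrable (circle_measure q) (\<lambda>w. cmod (f w))" using fiq by simp
        fix w assume "w \<in> space (circle_measure q)"
        then have w: "cmod w = q" by simp
        have "Re (poly (P k) w) \<le> 2" using Re_poly_le_of_circle[of "P k" 2 w] P2[of _ k] w q1 by simp
        then have "cmod (a k w) \<le> exp (S * 2)" using S by (simp add: a)
        moreover have "q ^ N = exp (- (L * real N))"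
          using q0 by (simp add: L_def ln_div exp_of_nat_mult mult.commute)
        moreover have "L * real N \<ge> 2 * S" using N(1) L by (simp add: field_simps)
        ultimately have "cmod (a k w) * q ^ N \<le> exp (S * 2) * exp (- (2 * S))"
          by (intro mult_mono) auto
        then have "cmod (a k w) * q ^ N \<le> 1" by (simp add: exp_add[symmetric])
        then have "cmod (a k w) * q ^ N * cmod (f w) \<le> 1 * cmod (f w)" by (rule mult_right_mono) simp
        then show "cmod (a k w * (w powi int N * f w)) \<le> cmod (f w)"
          by (simp add: norm_mult norm_power w mult.assoc)
      qed
      show ?thesis unfolding integral_bdry[OF gi] using 1 2 by simp
    qed
    have Isplit: "I = (\<integral>t. cmod (f (cis t)) \<partial>angle_measure) + (\<integral>z. cmod (f z) \<partial>circle_measure q)"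
      unfolding I_def using integral_bdry[OF integrable_norm[OF fi]] fm1
      by (simp add: integral_circle_measure)
    have "\<forall>\<^sub>F k in sequentially. (\<integral>t. exp (S * Re (poly (P k) (cis t))) * cmod (f (cis t)) \<partial>angle_measure)
        < (\<integral>t. cmod (f (cis t)) \<partial>angle_measure) + 1"
      by (rule order_tendstoD(2)[OF lim1]) simp
    moreover have "\<forall>\<^sub>F k in sequentially. e / 2 < 2 * pi * Re (poly (P k) 0)"
      by (rule order_tendstoD(1)[OF meanlim]) (use e in simp)
    ultimately have "\<forall>\<^sub>F k in sequentially. (\<integral>t. exp (S * Re (poly (P k) (cis t))) * cmod (f (cis t)) \<partial>angle_measure)
        < (\<integral>t. cmod (f (cis t)) \<partial>angle_measure) + 1 \<and> e / 2 < 2 * pi * Re (poly (P k) 0)"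
      by eventually_elim simp
    then obtain k where k: "(\<integral>t. exp (S * Re (poly (P k) (cis t))) * cmod (f (cis t)) \<partial>angle_measure)
        < (\<integral>t. cmod (f (cis t)) \<partial>angle_measure) + 1" "e / 2 < 2 * pi * Re (poly (P k) 0)"
      by (auto simp: eventually_sequentially)
    have mk: "m \<le> Re (poly (P k) 0)" using k(2) by (simp add: m_def field_simps)
    obtain z where z: "cmod z = r" "Re (poly (P k) 0) \<le> Re (poly (P k) z)"
      by (rule Re_poly_mean_le[OF rq(2)])
    have "exp (S * m / 2) * (r * d) \<le> cmod (a k z * (z powi int N * F z))"
    proof -
      have "r ^ N = exp (- (l * real N))"
        using rq by (simp add: l_def ln_div exp_of_nat_mult mult.commute)
      moreover have "l * real N \<le> S * m / 2 + l"
      proof -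
        have "l * real N \<le> l * (2 * S / L + 1)" using N(2) l by (intro mult_left_mono) auto
        also have "\<dots> = l * (2 * S / L) + l" by (simp add: algebra_simps)
        also have "l * (2 * S / L) \<le> (m * L / 4) * (2 * S / L)" using l S L by (intro mult_right_mono) auto
        also have "\<dots> = S * m / 2" using L by (simp add: field_simps)
        finally show ?thesis by simp
      qed
      moreover have "r = exp (- l)" using rq by (simp add: l_def ln_div)
      ultimately have rN: "exp (- (S * m / 2)) * r \<le> r ^ N"
        by (simp add: exp_add[symmetric])
      have "S * m \<le> S * Re (poly (P k) z)" using S mk z(2) by (intro mult_left_mono) auto
      then have aN: "exp (S * m) \<le> cmod (a k z)" by (simp add: a)
      have "exp (S * m / 2) * (r * d) = exp (S * m) * (exp (- (S * m / 2)) * r) * d"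
        by (simp add: exp_add[symmetric] mult.assoc[symmetric])
      also have "\<dots> \<le> cmod (a k z) * r ^ N * cmod (F z)"
        using aN rN d z(1) rq by (intro mult_mono) auto
      also have "\<dots> = cmod (a k z * (z powi int N * F z))"
        by (simp add: norm_mult norm_power z(1))
      finally show ?thesis .
    qed
    also have "\<dots> \<le> eval_const (cmod z) * (\<integral>w. cmod (a k w * (w powi int N * f w)) \<partial>M)"
      unfolding a_def by (rule extends_exp_poly_eval_bound[OF f F rann[OF z(1)]])
    also have "\<dots> \<le> eval_const r * (I + 1)"
      unfolding z(1) using bound[of k] k(1) Isplit eval_const_nonneg[OF rq(1) r(2)] by (intro mult_left_mono) auto
    finally show ?thesis .
  qed
  \<comment> \<open>In \<open>main\<close> the right-hand side does not depend on \<open>S\<close>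
    while the left-hand side is unbounded.\<close>
  have "filterlim (\<lambda>S. exp (S * m / 2) * (r * d)) at_top at_top"
  proof (rule filterlim_at_top_mult_tendsto_pos[OF tendsto_const])
    show "0 < r * d" using rq d by simp
    have "filterlim (\<lambda>S. (m / 2) * S) at_top at_top"
      by (rule filterlim_tendsto_pos_mult_at_top[OF tendsto_const _ filterlim_ident]) (use m in simp)
    then have "filterlim (\<lambda>S. exp ((m / 2) * S)) at_top at_top"
      by (rule filterlim_compose[OF exp_at_top])
    then show "filterlim (\<lambda>S. exp (S * m / 2)) at_top at_top" by (simp add: mult.commute)
  qed
  then have "\<forall>\<^sub>F S in at_top. eval_const r * (I + 1) < exp (S * m / 2) * (r * d)"
    by (simp add: filterlim_at_top_dense)
  from eventually_happens'[OF trivial_limit_at_top_linorder eventually_conj[OF this eventually_gt_at_top[of 0]]]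
  obtain S where "eval_const r * (I + 1) < exp (S * m / 2) * (r * d)" "0 < S" by blast
  with main[of S] show False by simp
qed

text \<open>The reflection \<open>z \<mapsto> q / cnj z\<close> exchanges the two boundary circles.\<close>

lemma reflect_Hardy0:
  assumes f: "f \<in> Hardy0 q"
  defines "g \<equiv> (\<lambda>z. cnj (f (of_real q / cnj z)))"
  shows "g \<in> Hardy0 q"
proof -
  have fsi: "square_integrable M f" by (rule Hardy0_square_integrable[OF f])
  have fi: "integrable M f" by (rule integrable_of_square_integrable[OF fsi])
  have fm: "f \<in> borel_measurable M" using fi by auto
  have refl_bdry: "of_real q / cnj z \<in> bdry q" if "z \<in> bdry q" for z
    using that q0 by (auto simp: bdry_def norm_divide)
  have refl_m: "(\<lambda>z. of_real q / cnj z) \<in> measurable M M"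
  proof -
    have "continuous_on (bdry q) (\<lambda>z. of_real q / cnj z)" by (intro continuous_intros) auto
    then have "(\<lambda>z. of_real q / cnj z) \<in> borel_measurable M" by (rule borel_measurable_bdry_continuous)
    then have "(\<lambda>z. of_real q / cnj z) \<in> measurable M (restrict_space borel (bdry q))"
      by (rule measurable_restrict_space2[rotated]) (use refl_bdry in auto)
    then show ?thesis by (simp cong: measurable_cong_sets)
  qed
  have gm: "g \<in> borel_measurable M"
    unfolding g_def by (rule measurable_compose[OF measurable_compose[OF refl_m fm] borel_measurable_continuous_onI])
      (intro continuous_intros)
  have g1: "g (cis t) = cnj (f (of_real q * cis t))" for t
    by (simp add: g_def cis_cnj divide_inverse)
  have gq: "g (of_real q * cis t) = cnj (f (cis t))" for t
    using q0 by (simp add: g_def cis_cnj divide_inverse mult.assoc[symmetric])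
  have fc: "f \<in> borel_measurable (circle_measure r)" and gc: "g \<in> borel_measurable (circle_measure r)"
    if "r = 1 \<or> r = q" for r using borel_measurable_bdry_circle that fm gm by auto
  have gsi: "square_integrable M g"
    unfolding square_integrable_def
  proof (intro conjI gm)
    have fx: "integrable angle_measure (\<lambda>t. (cmod (f (of_real r * cis t)))\<^sup>2)" if r: "r = 1 \<or> r = q" for r
    proof -
      have "integrable (circle_measure r) (\<lambda>z. (cmod (f z))\<^sup>2)"
        using square_integrable_integrable[OF fsi] r by (auto simp: integrable_bdry_iff)
      then show ?thesis using fc[OF r] r q0 by (subst (asm) integrable_circle_measure_iff) auto
    qed
    have "integrable (circle_measure 1) (\<lambda>z. (cmod (g z))\<^sup>2)"
      using fx[of q] gc[of 1] by (subst integrable_circle_measure_iff) (auto simp: g1)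
    moreover have "integrable (circle_measure q) (\<lambda>z. (cmod (g z))\<^sup>2)"
      using fx[of 1] gc[of q] q0 by (subst integrable_circle_measure_iff) (auto simp: gq)
    ultimately show "integrable M (\<lambda>z. (cmod (g z))\<^sup>2)" by (simp add: integrable_bdry_iff)
  qed
  have pm: "(\<lambda>z. h z * z powi n) \<in> borel_measurable (circle_measure r)"
    if "h \<in> borel_measurable M" "r = 1 \<or> r = q" for h n r
    by (rule borel_measurable_bdry_circle[OF borel_measurable_continuous_mult[OF that(1) continuous_on_powi_bdry] that(2)])
  \<comment> \<open>The factor \<open>q powi n\<close> is the same in both directions, so the
    relation between the circles for \<open>f\<close> at \<open>- n\<close> turns into the one for
    \<open>g\<close> at \<open>n\<close>.\<close>
  have moment: "(\<integral>z. g z * z powi n \<partial>circle_measure r) = of_real (q powi n) * cnj (\<integral>z. f z * z powi (- n) \<partial>circle_measure s)"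
    if rs: "r = 1 \<and> s = q \<or> r = q \<and> s = 1" for n r s
  proof -
    have r: "r = 1 \<or> r = q" "0 < r" and s: "s = 1 \<or> s = q" "0 < s" using rs q0 by auto
    have "(\<integral>z. g z * z powi n \<partial>circle_measure r) = (\<integral>t. g (of_real r * cis t) * (of_real r * cis t) powi n \<partial>angle_measure)"
      by (rule integral_circle_measure[OF r(2) pm[OF gm r(1)]])
    also have "\<dots> = (\<integral>t. of_real (q powi n) * cnj (f (of_real s * cis t) * (of_real s * cis t) powi (- n)) \<partial>angle_measure)"
    proof (rule Bochner_Integration.integral_cong)
      fix t
      have "cnj (cis t) powi (- n) = cis t powi n"
        by (simp add: cis_cnj cis_power_int)
      then have c: "cnj ((of_real s * cis t) powi (- n)) = of_real (s powi (- n)) * cis t powi n"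
        by (simp add: power_int_mult_distrib)
      have 1: "of_real (q powi n) * cnj (f (of_real s * cis t) * (of_real s * cis t) powi (- n))
          = of_real (q powi n * s powi (- n)) * cis t powi n * cnj (f (of_real s * cis t))"
        unfolding complex_cnj_mult c by (simp add: mult_ac)
      have 2: "q powi n * s powi (- n) = r powi n"
        using rs q0 by (auto simp: power_int_minus)
      have 3: "g (of_real r * cis t) = cnj (f (of_real s * cis t))"
        using rs by (auto simp: g1 gq)
      show "g (of_real r * cis t) * (of_real r * cis t) powi n
          = of_real (q powi n) * cnj (f (of_real s * cis t) * (of_real s * cis t) powi (- n))"
        unfolding 1 2 3 by (simp add: power_int_mult_distrib mult_ac)
    qed simp
    also have "\<dots> = of_real (q powi n) * cnj (\<integral>t. f (of_real s * cis t) * (of_real s * cis t) powi (- n) \<partial>angle_measure)"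
      by (simp only: integral_mult_right_zero Bochner_Integration.integral_cnj)
    also have "(\<integral>t. f (of_real s * cis t) * (of_real s * cis t) powi (- n) \<partial>angle_measure) = (\<integral>z. f z * z powi (- n) \<partial>circle_measure s)"
      by (rule integral_circle_measure[OF s(2) pm[OF fm s(1)], symmetric])
    finally show ?thesis .
  qed
  have "balanced g"
    unfolding balanced_def
  proof (intro conjI allI)
    show "integrable M g" by (rule integrable_of_square_integrable[OF gsi])
    fix n
    show "(\<integral>z. g z * z powi n \<partial>circle_measure 1) = (\<integral>z. g z * z powi n \<partial>circle_measure q)"
      using moment[of 1 q n] moment[of q 1 n] Hardy0_balanced[OF f] by (simp add: balanced_def)
  qed
  with gsi show ?thesis by (simp add: Hardy0_iff)
qed

lemma AE_circle_eq_0_iff: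
  fixes f :: "complex \<Rightarrow> complex"
  assumes "f \<in> borel_measurable M" "r = 1 \<or> r = q"
  shows "(AE z in circle_measure r. f z = 0) \<longleftrightarrow> (AE t in angle_measure. f (of_real r * cis t) = 0)"
    "(AE z in circle_measure r. f z \<noteq> 0) \<longleftrightarrow> (AE t in angle_measure. f (of_real r * cis t) \<noteq> 0)"
proof -
  have fm: "f \<in> borel_measurable (circle_measure r)" by (rule borel_measurable_bdry_circle[OF assms])
  have r: "0 < r" using assms q0 by auto
  have "{z \<in> sphere 0 r. f z = 0} = f -` {0} \<inter> space (circle_measure r)"
    "{z \<in> sphere 0 r. f z \<noteq> 0} = f -` (- {0}) \<inter> space (circle_measure r)" by auto
  then have "{z \<in> sphere 0 r. f z = 0} \<in> sets (circle_measure r)"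
    "{z \<in> sphere 0 r. f z \<noteq> 0} \<in> sets (circle_measure r)"
    using measurable_sets[OF fm, of "{0}"] measurable_sets[OF fm, of "- {0}"] by simp_all
  then show "(AE z in circle_measure r. f z = 0) \<longleftrightarrow> (AE t in angle_measure. f (of_real r * cis t) = 0)"
    "(AE z in circle_measure r. f z \<noteq> 0) \<longleftrightarrow> (AE t in angle_measure. f (of_real r * cis t) \<noteq> 0)"
    by (simp_all only: AE_circle_measure_iff[OF r])
qed

text \<open>The inner circle is reduced to the outer one by reflection, which preserves the space
  and carries zero sets of one circle to the other.\<close>

lemma Hardy0_nonvanishing:
  assumes f: "f \<in> Hardy0 q" and nz: "\<not> (AE z in M. f z = 0)"
  shows "AE z in M. f z \<noteq> 0"
proof -
  define g where "g = (\<lambda>z. cnj (f (of_real q / cnj z)))"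
  have g: "g \<in> Hardy0 q" unfolding g_def by (rule reflect_Hardy0[OF f])
  have fm: "f \<in> borel_measurable M" and gm: "g \<in> borel_measurable M"
    using Hardy0_square_integrable f g by (auto simp: square_integrable_def)
  have g1: "g (of_real 1 * cis t) = 0 \<longleftrightarrow> f (of_real q * cis t) = 0" for t
    by (simp add: g_def cis_cnj divide_inverse)
  have gq: "g (of_real q * cis t) = 0 \<longleftrightarrow> f (of_real 1 * cis t) = 0" for t
    using q0 by (simp add: g_def cis_cnj divide_inverse mult.assoc[symmetric])
  have "AE z in circle_measure 1. f z \<noteq> 0"
    using Hardy0_nonvanishing_outer[OF f] nz by blast
  moreover have "AE z in circle_measure q. f z \<noteq> 0"
  proof (rule ccontr)
    assume "\<not> (AE z in circle_measure q. f z \<noteq> 0)"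
    then have "\<not> (AE z in circle_measure 1. g z \<noteq> 0)"
      using AE_circle_eq_0_iff(2)[OF fm, of q] AE_circle_eq_0_iff(2)[OF gm, of 1] by (simp only: g1) simp
    from Hardy0_nonvanishing_outer[OF g this] have "AE z in M. g z = 0" .
    then have "AE z in M. f z = 0"
      unfolding AE_bdry_iff
      using AE_circle_eq_0_iff(1)[OF fm, of q] AE_circle_eq_0_iff(1)[OF gm, of 1]
        AE_circle_eq_0_iff(1)[OF fm, of 1] AE_circle_eq_0_iff(1)[OF gm, of q] by (simp only: g1 gq) simp
    with nz show False ..
  qed
  ultimately show ?thesis by (simp add: AE_bdry_iff)
qed

end

section \<open>Invertible functions are outer\<close>

text \<open>A function \<open>E\<close> of modulus at most 1 satisfies
  \<open>(cmod (1 - E))\<^sup>2 \<le> 2 - 2 * Re E\<close>, so closeness to 1 in \<open>L2\<close>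
  is governed by the mean of \<open>E\<close>. That mean is its value at 0, the real number
  \<open>exp (- Re (poly P 0))\<close>.\<close>

lemma exp_minus_poly_close_to_1:
  assumes P: "\<And>z. cmod z = 1 \<Longrightarrow> 0 \<le> Re (poly P z)" and Im: "Im (poly P 0) = 0" and r: "0 < r" "r \<le> 1"
  shows "(\<integral>t. (cmod (1 - exp (- poly P (of_real r * cis t))))\<^sup>2 \<partial>angle_measure) \<le> 4 * pi * Re (poly P 0)"
proof -
  let ?E = "\<lambda>t. exp (- poly P (of_real r * cis t))"
  have E1: "cmod (?E t) \<le> 1" for t
  proof -
    have "Re (poly (- P) (of_real r * cis t)) \<le> 0"
      by (rule Re_poly_le_of_circle) (use P r in \<open>auto simp: norm_mult\<close>)
    then show ?thesis by simp
  qed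
  have Ei: "integrable angle_measure ?E"
    by (intro angle_integral_continuous(1) continuous_intros)
  have mean: "(\<integral>t. ?E t \<partial>angle_measure) = 2 * pi * exp (- poly P 0)"
    using angle_integral_holomorphic[of "\<lambda>z. exp (- poly P z)" r] r by (simp add: holomorphic_intros)
  have "(\<integral>t. (cmod (1 - ?E t))\<^sup>2 \<partial>angle_measure) \<le> (\<integral>t. 2 - 2 * Re (?E t) \<partial>angle_measure)"
  proof (rule integral_mono)
    show "integrable angle_measure (\<lambda>t. (cmod (1 - ?E t))\<^sup>2)"
      by (intro angle_integral_continuous(1) continuous_intros)
    show "integrable angle_measure (\<lambda>t. 2 - 2 * Re (?E t))"
      by (intro angle_integral_continuous(1) continuous_intros)
    fix t
    have "(cmod (1 - ?E t))\<^sup>2 = 1 - 2 * Re (?E t) + (cmod (?E t))\<^sup>2"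
      unfolding cmod_power2 by (simp add: power2_eq_square algebra_simps)
    moreover have "(cmod (?E t))\<^sup>2 \<le> 1" using E1[of t] by (intro power_le_one) auto
    ultimately show "(cmod (1 - ?E t))\<^sup>2 \<le> 2 - 2 * Re (?E t)" by simp
  qed
  also have "\<dots> = 4 * pi - 2 * Re (\<integral>t. ?E t \<partial>angle_measure)"
    using Ei integral_Re[OF Ei] measure_angle_measure by (simp add: integrable_Re)
  also have "\<dots> = 4 * pi * (1 - exp (- Re (poly P 0)))"
    unfolding mean using Im by (simp add: Re_exp algebra_simps)
  also have "\<dots> \<le> 4 * pi * Re (poly P 0)"
    using exp_ge_add_one_self[of "- Re (poly P 0)"] by (intro mult_left_mono) auto
  finally show ?thesis .
qed

lemma exp_minus_mult_le:
  fixes w x :: real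
  assumes "0 \<le> w" "0 \<le> x"
  shows "exp (- w) * x \<le> x" "(exp (- w) * x)\<^sup>2 \<le> x\<^sup>2"
proof -
  show "exp (- w) * x \<le> x" using assms by (intro mult_left_le_one_le) auto
  then show "(exp (- w) * x)\<^sup>2 \<le> x\<^sup>2" by (rule power_mono) (use assms in simp)
qed

lemma closure_annulus_subset: "closure (annulus q) \<subseteq> {z. q \<le> cmod z \<and> cmod z \<le> 1}"
proof (rule closure_minimal)
  show "annulus q \<subseteq> {z. q \<le> cmod z \<and> cmod z \<le> 1}" by (auto simp: annulus_def)
  have "{z::complex. q \<le> cmod z \<and> cmod z \<le> 1} = cmod -` {q..1}" by auto
  then show "closed {z::complex. q \<le> cmod z \<and> cmod z \<le> 1}"
    by (auto intro!: closed_vimage continuous_intros)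
qed

context annulus_boundary
begin

lemma annulus_algebraI:
  assumes "a holomorphic_on - {0}"
  shows "a \<in> annulus_algebra q"
  unfolding annulus_algebra_def
proof (intro CollectI conjI)
  show "continuous_on (closure (annulus q)) a"
    by (rule continuous_on_subset[OF holomorphic_on_imp_continuous_on[OF assms]])
       (use closure_annulus_subset[of q] q0 in auto)
  show "a analytic_on annulus q"
    unfolding analytic_on_open[OF open_annulus]
    by (rule holomorphic_on_subset[OF assms]) (use annulusD(3) in auto)
qed

lemma square_integrable_param:
  assumes "square_integrable M h" "r = 1 \<or> r = q"
  shows "square_integrable angle_measure (\<lambda>t. h (of_real r * cis t))"
    "(l2norm angle_measure (\<lambda>t. h (of_real r * cis t)))\<^sup>2 = (\<integral>z. (cmod (h z))\<^sup>2 \<partial>circle_measure r)"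
proof -
  have r: "0 < r" using assms q0 by auto
  have hm: "h \<in> borel_measurable (circle_measure r)"
    by (rule borel_measurable_bdry_circle[OF square_integrable_measurable[OF assms(1)] assms(2)])
  then have hm2: "(\<lambda>z. (cmod (h z))\<^sup>2) \<in> borel_measurable (circle_measure r)" by measurable
  have hi: "integrable (circle_measure r) (\<lambda>z. (cmod (h z))\<^sup>2)"
    using square_integrable_integrable[OF assms(1)] assms(2) by (auto simp: integrable_bdry_iff)
  have "(\<lambda>t. of_real r * cis t) \<in> measurable angle_measure (circle_measure r)"
    using measurable_circle_param[OF r] by (simp cong: measurable_cong_sets)
  from measurable_compose[OF this hm] have "(\<lambda>t. h (of_real r * cis t)) \<in> borel_measurable angle_measure" .
  then show "square_integrable angle_measure (\<lambda>t. h (of_real r * cis t))"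
    using hi integrable_circle_measure_iff[OF r hm2] by (simp add: square_integrable_def)
  show "(l2norm angle_measure (\<lambda>t. h (of_real r * cis t)))\<^sup>2 = (\<integral>z. (cmod (h z))\<^sup>2 \<partial>circle_measure r)"
    using integral_circle_measure[OF r hm2] by (simp add: l2norm_power2)
qed

lemma l2norm_bdry_split:
  assumes "square_integrable M h"
  shows "(l2norm M h)\<^sup>2 = (l2norm angle_measure (\<lambda>t. h (cis t)))\<^sup>2 + (l2norm angle_measure (\<lambda>t. h (of_real q * cis t)))\<^sup>2"
  using square_integrable_param(2)[OF assms, of 1] square_integrable_param(2)[OF assms, of q]
    integral_bdry[OF square_integrable_integrable[OF assms]]
  by (simp add: l2norm_power2[of M])

text \<open>If \<open>p\<close> is a Laurent polynomial close to \<open>1 / G\<close>, then \<open>p * G\<close> is close to \<open>1\<close> in the mean, but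
  not in \<open>L\<^sup>2\<close>. Multiplication by a bounded analytic function of modulus about
  \<open>1 / max 1 \<bar>p * G\<bar>\<close>, which is itself close to \<open>1\<close>, brings the \<open>L\<^sup>2\<close> norm down to that of \<open>1\<close>.\<close>

lemma invertible_approx_1:
  assumes G: "G \<in> Hardy0 q" and b: "b \<in> Hardy0 q" and Gb: "AE z in M. G z * b z = 1" and \<theta>: "0 < \<theta>" "\<theta> \<le> 1"
  obtains a where "a \<in> annulus_algebra q" "(l2norm M (\<lambda>z. 1 - a z * G z))\<^sup>2 \<le> (5 + 4 * sqrt (32 * pi)) * \<theta>"
proof -
  \<comment> \<open>The multipliers will be within a multiple of \<open>sqrt \<eta>\<close> of 1;
    the square makes the final bound linear in \<open>\<theta>\<close>.\<close>
  define \<eta> where "\<eta> = \<theta>\<^sup>2"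
  have \<eta>: "0 < \<eta>" "\<eta> \<le> \<theta>" using \<theta> by (auto simp: \<eta>_def power2_eq_square mult_le_cancel_left1)
  note Gsi = Hardy0_square_integrable[OF G] and bsi = Hardy0_square_integrable[OF b]
  define K where "K = 1 + l2norm M G"
  have K: "0 < K" by (simp add: K_def add_pos_nonneg)
  obtain p where p: "p \<in> laurent_polys" and pb: "l2norm M (\<lambda>z. b z - p z) < \<eta> / K"
    using Hardy0_laurent_approx[OF b, of "\<eta> / K"] \<eta> K by auto
  have pc: "continuous_on (bdry q) p" by (intro continuous_on_laurent_poly p) simp
  define h where "h z = p z * G z" for z
  have hsi: "square_integrable M h" unfolding h_def by (rule square_integrable_continuous_mult[OF Gsi pc])
  have hm[measurable]: "h \<in> borel_measurable M" by (rule square_integrable_measurable[OF hsi])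
  have h1: "(\<integral>z. cmod (1 - h z) \<partial>M) \<le> \<eta>"
  proof -
    have "(\<integral>z. cmod (1 - h z) \<partial>M) = (\<integral>z. cmod (b z - p z) * cmod (G z) \<partial>M)"
    proof (rule integral_cong_AE)
      show "AE z in M. cmod (1 - h z) = cmod (b z - p z) * cmod (G z)"
        using Gb by eventually_elim (simp add: h_def norm_mult[symmetric] algebra_simps)
      have [measurable]: "G \<in> borel_measurable M" "b \<in> borel_measurable M" "p \<in> borel_measurable M"
        using Gsi bsi borel_measurable_bdry_continuous[OF pc] by (auto simp: square_integrable_def)
      show "(\<lambda>z. cmod (b z - p z) * cmod (G z)) \<in> borel_measurable M" by measurable
    qed measurable
    also have "\<dots> \<le> l2norm M (\<lambda>z. b z - p z) * l2norm M G"
      by (intro L2_Cauchy_Schwarz square_integrable_diff bsi Gsi square_integrable_laurent p)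
    also have "\<dots> \<le> (\<eta> / K) * K"
      using pb K \<eta> by (intro mult_mono) (auto simp: K_def)
    finally show ?thesis using K by simp
  qed
  \<comment> \<open>The positive part of \<open>ln \<bar>h\<bar>\<close>: the factor
    \<open>exp (- v z)\<close> cuts the modulus of \<open>h\<close> down to at most 1, and
    \<open>ln x \<le> x - 1\<close> bounds the integral of \<open>v\<close> by the mean distance of
    \<open>h\<close> from 1.\<close>
  define v where "v z = ln (max 1 (cmod (h z)))" for z
  have v0: "0 \<le> v z" for z by (simp add: v_def)
  have v1: "v z \<le> cmod (1 - h z)" for z
  proof -
    have "v z \<le> max 1 (cmod (h z)) - 1" unfolding v_def by (rule ln_le_minus_one) simp
    also have "\<dots> \<le> cmod (1 - h z)"
      using norm_triangle_ineq2[of "h z" 1] by (simp add: norm_minus_commute max_def)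
    finally show ?thesis .
  qed
  have vm[measurable]: "v \<in> borel_measurable M" unfolding v_def by measurable
  have h1i: "integrable M (\<lambda>z. cmod (1 - h z))"
    using integrable_of_square_integrable[OF hsi] by simp
  have vi: "integrable M v"
    by (rule Bochner_Integration.integrable_bound[OF h1i]) (use v0 v1 in auto)
  have vint: "(\<integral>z. v z \<partial>M) \<le> \<eta>"
    using integral_mono[OF vi h1i v1] h1 by simp
  \<comment> \<open>Polynomial approximation needs a bounded exponent. Truncating \<open>v\<close>
    at a large \<open>T\<close> costs only \<open>\<eta>\<close> in the squared norm.\<close>
  have "(\<lambda>T. \<integral>z. (cmod (of_real (exp (- min (v z) (real T))) * h z))\<^sup>2 \<partial>M) \<longlonglongrightarrow> (\<integral>z. (cmod (of_real (exp (- v z)) * h z))\<^sup>2 \<partial>M)"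
  proof (rule integral_dominated_convergence[where w = "\<lambda>z. (cmod (h z))\<^sup>2"])
    show "integrable M (\<lambda>z. (cmod (h z))\<^sup>2)" by (rule square_integrable_integrable[OF hsi])
    show "AE z in M. (\<lambda>T. (cmod (of_real (exp (- min (v z) (real T))) * h z))\<^sup>2) \<longlonglongrightarrow> (cmod (of_real (exp (- v z)) * h z))\<^sup>2"
    proof (rule AE_I2)
      fix z
      obtain n0 where n0: "v z \<le> real n0" using real_arch_simple by blast
      have "\<forall>\<^sub>F T in sequentially. v z = min (v z) (real T)"
        using eventually_ge_at_top[of n0] by eventually_elim (use n0 in auto)
      then have "(\<lambda>T. min (v z) (real T)) \<longlonglongrightarrow> v z"
        by (rule Lim_transform_eventually[OF tendsto_const])
      then show "(\<lambda>T. (cmod (of_real (exp (- min (v z) (real T))) * h z))\<^sup>2) \<longlonglongrightarrow> (cmod (of_real (exp (- v z)) * h z))\<^sup>2"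
        by (intro tendsto_intros)
    qed
    show "AE z in M. norm ((cmod (of_real (exp (- min (v z) (real T))) * h z))\<^sup>2) \<le> (cmod (h z))\<^sup>2" for T
      using v0 exp_minus_mult_le(2) by (intro AE_I2) (simp add: norm_mult)
  qed measurable
  moreover have "(\<integral>z. (cmod (of_real (exp (- v z)) * h z))\<^sup>2 \<partial>M) \<le> 4 * pi"
  proof -
    have "(\<integral>z. (cmod (of_real (exp (- v z)) * h z))\<^sup>2 \<partial>M) \<le> (\<integral>z. 1 \<partial>M)"
    proof (rule integral_mono')
      fix z
      have "exp (- v z) * cmod (h z) \<le> 1" by (simp add: v_def exp_minus field_simps)
      then show "(cmod (of_real (exp (- v z)) * h z))\<^sup>2 \<le> 1"
        by (auto simp: norm_mult intro: power_le_one)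
    qed auto
    then show ?thesis by (simp add: measure_bdry)
  qed
  ultimately have "\<forall>\<^sub>F T in sequentially. (\<integral>z. (cmod (of_real (exp (- min (v z) (real T))) * h z))\<^sup>2 \<partial>M) < 4 * pi + \<eta>"
    by (intro order_tendstoD(2)) (use \<eta> in auto)
  then obtain T :: nat where T: "(\<integral>z. (cmod (of_real (exp (- min (v z) (real T))) * h z))\<^sup>2 \<partial>M) < 4 * pi + \<eta>"
    by (auto simp: eventually_sequentially)
  define u where "u z = min (v z) (real T)" for z
  have u0: "0 \<le> u z" "u z \<le> T" "u z \<le> v z" for z using v0 by (auto simp: u_def)
  have um[measurable]: "u \<in> borel_measurable M" unfolding u_def by measurable
  define h' where "h' z = of_real (exp (- u z)) * h z" for z
  have h'si: "square_integrable M h'"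
  proof (rule square_integrable_bound[OF hsi, where C = 1])
    show "h' \<in> borel_measurable M" unfolding h'_def by measurable
    show "AE z in M. cmod (h' z) \<le> 1 * cmod (h z)"
      using u0(1) exp_minus_mult_le(1) by (intro AE_I2) (simp add: h'_def norm_mult)
  qed
  have h'n: "(l2norm M h')\<^sup>2 < 4 * pi + \<eta>" using T by (simp add: l2norm_power2 h'_def u_def)
  \<comment> \<open>One polynomial for each boundary circle, with real part close to the truncated
    exponent on that circle. Small \<open>Re (poly P 0)\<close> keeps the multiplier near 1, and the
    last clause keeps the squared norm of the product under control.\<close>
  have circ: "\<exists>P. (\<forall>z. cmod z = 1 \<longrightarrow> 0 \<le> Re (poly P z)) \<and> Im (poly P 0) = 0 \<and> 2 * pi * Re (poly P 0) \<le> 2 * \<eta>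
      \<and> (\<integral>t. (exp (- Re (poly P (cis t))) * cmod (h (of_real r * cis t)))\<^sup>2 \<partial>angle_measure)
        \<le> (l2norm angle_measure (\<lambda>t. h' (of_real r * cis t)))\<^sup>2 + \<eta>"
    if r: "r = 1 \<or> r = q" for r
  proof -
    have r0: "0 < r" using r q0 by auto
    have par: "(\<lambda>t. of_real r * cis t) \<in> measurable angle_measure (circle_measure r)"
      using measurable_circle_param[OF r0] by (simp cong: measurable_cong_sets)
    have um': "u \<in> borel_measurable (circle_measure r)" and vm': "v \<in> borel_measurable (circle_measure r)"
      by (rule borel_measurable_bdry_circle[OF um r], rule borel_measurable_bdry_circle[OF vm r])
    have ut[measurable]: "(\<lambda>t. u (of_real r * cis t)) \<in> borel_measurable angle_measure"
      by (rule measurable_compose[OF par um'])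
    have hsit: "square_integrable angle_measure (\<lambda>t. h (of_real r * cis t))"
      by (rule square_integrable_param(1)[OF hsi r])
    have ht[measurable]: "(\<lambda>t. h (of_real r * cis t)) \<in> borel_measurable angle_measure"
      by (rule square_integrable_measurable[OF hsit])
    obtain P where P0: "\<And>k z. cmod z = 1 \<Longrightarrow> 0 \<le> Re (poly (P k) z)"
      and PT: "\<And>k z. cmod z = 1 \<Longrightarrow> Re (poly (P k) z) \<le> real T + 1"
      and Plim: "AE t in angle_measure. (\<lambda>k. Re (poly (P k) (cis t))) \<longlonglongrightarrow> u (of_real r * cis t)"
      and PI: "\<And>k. Im (poly (P k) 0) = 0"
      by (rule bounded_measurable_Re_poly_approx[OF ut]) (use u0 in auto)
    have Pm[measurable]: "(\<lambda>t. Re (poly (P k) (cis t))) \<in> borel_measurable angle_measure" for k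
      by (intro continuous_on_borel_measurable_angle continuous_intros)
    have "(\<lambda>k. 2 * pi * Re (poly (P k) 0)) \<longlonglongrightarrow> (\<integral>t. u (of_real r * cis t) \<partial>angle_measure)"
      unfolding mean_Re_poly[symmetric]
    proof (rule integral_dominated_convergence[where w = "\<lambda>_. real T + 1"])
      show "AE t in angle_measure. norm (Re (poly (P k) (cis t))) \<le> real T + 1" for k
        using P0[of "cis _" k] PT[of "cis _" k] by (intro AE_I2) simp
      show "integrable angle_measure (\<lambda>_. real T + 1)" by simp
    qed (use Plim in measurable)
    moreover have "(\<integral>t. u (of_real r * cis t) \<partial>angle_measure) \<le> \<eta>"
    proof -
      have vir: "integrable (circle_measure r) v" using vi r by (auto simp: integrable_bdry_iff)
      have vit: "integrable angle_measure (\<lambda>t. v (of_real r * cis t))"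
        using vir integrable_circle_measure_iff[OF r0 vm'] by simp
      have "(\<integral>t. u (of_real r * cis t) \<partial>angle_measure) \<le> (\<integral>t. v (of_real r * cis t) \<partial>angle_measure)"
        by (rule integral_mono') (use vit u0 v0 in auto)
      also have "\<dots> = (\<integral>z. v z \<partial>circle_measure r)" by (rule integral_circle_measure[OF r0 vm', symmetric])
      also have "\<dots> \<le> (\<integral>z. v z \<partial>M)" by (rule integral_circle_le_bdry[OF vi v0 r])
      finally show ?thesis using vint by simp
    qed
    ultimately have e1: "\<forall>\<^sub>F k in sequentially. 2 * pi * Re (poly (P k) 0) < 2 * \<eta>"
      by (intro order_tendstoD(2)) (use \<eta> in auto)
    have "(\<lambda>k. \<integral>t. (exp (- Re (poly (P k) (cis t))) * cmod (h (of_real r * cis t)))\<^sup>2 \<partial>angle_measure)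
        \<longlonglongrightarrow> (\<integral>t. (exp (- u (of_real r * cis t)) * cmod (h (of_real r * cis t)))\<^sup>2 \<partial>angle_measure)"
    proof (rule integral_dominated_convergence[where w = "\<lambda>t. (cmod (h (of_real r * cis t)))\<^sup>2"])
      show "integrable angle_measure (\<lambda>t. (cmod (h (of_real r * cis t)))\<^sup>2)"
        by (rule square_integrable_integrable[OF hsit])
      show "AE t in angle_measure. (\<lambda>k. (exp (- Re (poly (P k) (cis t))) * cmod (h (of_real r * cis t)))\<^sup>2)
          \<longlonglongrightarrow> (exp (- u (of_real r * cis t)) * cmod (h (of_real r * cis t)))\<^sup>2"
        using Plim by eventually_elim (intro tendsto_intros)
      show "AE t in angle_measure. norm ((exp (- Re (poly (P k) (cis t))) * cmod (h (of_real r * cis t)))\<^sup>2)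
          \<le> (cmod (h (of_real r * cis t)))\<^sup>2" for k
        using P0[of "cis _" k] exp_minus_mult_le(2) by (intro AE_I2) simp
    qed measurable
    also have "(\<integral>t. (exp (- u (of_real r * cis t)) * cmod (h (of_real r * cis t)))\<^sup>2 \<partial>angle_measure)
        = (l2norm angle_measure (\<lambda>t. h' (of_real r * cis t)))\<^sup>2"
      by (simp add: l2norm_power2 h'_def norm_mult)
    finally have e2: "\<forall>\<^sub>F k in sequentially. (\<integral>t. (exp (- Re (poly (P k) (cis t))) * cmod (h (of_real r * cis t)))\<^sup>2 \<partial>angle_measure)
        < (l2norm angle_measure (\<lambda>t. h' (of_real r * cis t)))\<^sup>2 + \<eta>"
      by (intro order_tendstoD(2)) (use \<eta> in auto)
    from eventually_conj[OF e1 e2] obtain k where k: "2 * pi * Re (poly (P k) 0) < 2 * \<eta>"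
      "(\<integral>t. (exp (- Re (poly (P k) (cis t))) * cmod (h (of_real r * cis t)))\<^sup>2 \<partial>angle_measure)
        < (l2norm angle_measure (\<lambda>t. h' (of_real r * cis t)))\<^sup>2 + \<eta>"
      by (auto simp: eventually_sequentially)
    with P0 PI show ?thesis by (intro exI[of _ "P k"]) auto
  qed
  obtain P where P: "\<And>z. cmod z = 1 \<Longrightarrow> 0 \<le> Re (poly P z)" "Im (poly P 0) = 0" "2 * pi * Re (poly P 0) \<le> 2 * \<eta>"
    "(\<integral>t. (exp (- Re (poly P (cis t))) * cmod (h (cis t)))\<^sup>2 \<partial>angle_measure)
        \<le> (l2norm angle_measure (\<lambda>t. h' (cis t)))\<^sup>2 + \<eta>"
    using circ[of 1] by auto
  obtain Q where Q: "\<And>z. cmod z = 1 \<Longrightarrow> 0 \<le> Re (poly Q z)" "Im (poly Q 0) = 0" "2 * pi * Re (poly Q 0) \<le> 2 * \<eta>"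
    "(\<integral>t. (exp (- Re (poly Q (cis t))) * cmod (h (of_real q * cis t)))\<^sup>2 \<partial>angle_measure)
        \<le> (l2norm angle_measure (\<lambda>t. h' (of_real q * cis t)))\<^sup>2 + \<eta>"
    using circ[of q] by auto
  define A where "A z = exp (- poly P z)" for z
  \<comment> \<open>The substitution \<open>q / z\<close> exchanges the circles and conjugating the
    coefficients compensates the conjugation this involves: on the inner circle the modulus of
    \<open>B\<close> is \<open>exp (- Re (poly Q (cis t)))\<close>. Thus \<open>A\<close> shapes the
    outer circle, \<open>B\<close> the inner one, and neither exceeds modulus 1 on the
    other.\<close>
  define B where "B z = exp (- poly (map_poly cnj Q) (of_real q / z))" for z
  have B_eq: "B (of_real r * cis t) = cnj (exp (- poly Q (of_real s * cis t)))" if "r * s = q" "r \<noteq> 0" for r s t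
  proof -
    have "of_real q / (of_real r * cis t) = cnj (of_real s * cis t)"
      using that(2) by (simp add: that(1)[symmetric] cis_cnj divide_inverse mult_ac)
    then show ?thesis by (simp add: B_def poly_cnj[symmetric] exp_cnj)
  qed
  have le1: "cmod (exp (- poly R z)) \<le> 1" if "\<And>z. cmod z = 1 \<Longrightarrow> 0 \<le> Re (poly R z)" "cmod z \<le> 1" for R z
  proof -
    have "Re (poly (- R) z) \<le> 0" by (rule Re_poly_le_of_circle) (use that in auto)
    then show ?thesis by simp
  qed
  have polar: "z = of_real r * cis (Arg2pi z)" if "cmod z = r" for z r
    using polar_Arg2pi[of z] that by simp
  have A1: "cmod (A z) \<le> 1" if "z \<in> bdry q" for z
    unfolding A_def by (rule le1) (use P(1) that q1 in \<open>auto simp: bdry_def\<close>)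
  have B1: "cmod (B z) \<le> 1" if "z \<in> bdry q" for z
  proof -
    obtain r s where rs: "cmod z = r" "r * s = q" "r \<noteq> 0" "0 < s" "s \<le> 1"
    proof (cases "cmod z = 1")
      case True
      then show ?thesis using q0 q1 by (intro that[of 1 q]) auto
    next
      case False
      then have "cmod z = q" using \<open>z \<in> bdry q\<close> by (auto simp: bdry_def)
      then show ?thesis using q0 by (intro that[of q 1]) auto
    qed
    have "B z = cnj (exp (- poly Q (of_real s * cis (Arg2pi z))))"
      using B_eq[OF rs(2,3), of "Arg2pi z"] polar[OF rs(1)] by simp
    then show ?thesis using le1[OF Q(1), of "of_real s * cis (Arg2pi z)"] rs by (simp add: norm_mult)
  qed
  have Bhol: "B holomorphic_on - {0}" and Ahol: "A holomorphic_on - {0}"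
    unfolding A_def B_def by (intro holomorphic_intros; simp)+
  have Ac: "continuous_on (bdry q) A" and Bc: "continuous_on (bdry q) B"
    by (rule continuous_on_subset[OF holomorphic_on_imp_continuous_on[OF Ahol]],
        use zero_notin_bdry in blast,
        rule continuous_on_subset[OF holomorphic_on_imp_continuous_on[OF Bhol]],
        use zero_notin_bdry in blast)
  define a where "a z = p z * (A z * B z)" for z
  have ahol: "a holomorphic_on - {0}"
    unfolding a_def by (intro holomorphic_on_mult holomorphic_on_laurent_poly p Ahol Bhol) simp
  have aG: "a z * G z = A z * B z * h z" for z by (simp add: a_def h_def mult_ac)
  define f where "f z = A z * B z * h z" for z
  have fsi: "square_integrable M f"
    unfolding f_def by (rule square_integrable_continuous_mult[OF hsi continuous_on_mult[OF Ac Bc]])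
  \<comment> \<open>Stated for a generic multiplier: on either circle both \<open>A\<close> and
    \<open>B\<close> look, up to conjugation, like \<open>exp (- poly R z)\<close> on a circle of
    radius at most 1, and each of the two circles contributes \<open>4 * \<eta>\<close>.\<close>
  have close: "l2norm M (\<lambda>z. 1 - C z) \<le> sqrt (8 * \<eta>)"
    if Cc: "continuous_on (bdry q) C" and eq: "\<And>r. r = 1 \<or> r = q \<Longrightarrow> \<exists>s. 0 < s \<and> s \<le> 1 \<and> (\<forall>t. cmod (1 - C (of_real r * cis t)) = cmod (1 - exp (- poly R (of_real s * cis t))))"
      and R: "\<And>z. cmod z = 1 \<Longrightarrow> 0 \<le> Re (poly R z)" "Im (poly R 0) = 0" "2 * pi * Re (poly R 0) \<le> 2 * \<eta>" for C R
  proof -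
    have one: "(l2norm angle_measure (\<lambda>t. 1 - C (of_real r * cis t)))\<^sup>2 \<le> 4 * \<eta>" if r: "r = 1 \<or> r = q" for r
    proof -
      obtain s where s: "0 < s" "s \<le> 1" "\<And>t. cmod (1 - C (of_real r * cis t)) = cmod (1 - exp (- poly R (of_real s * cis t)))"
        using eq[OF r] by blast
      show ?thesis unfolding l2norm_power2 s(3)
        using exp_minus_poly_close_to_1[OF R(1,2) s(1,2)] R(3) by simp
    qed
    have si: "square_integrable M (\<lambda>z. 1 - C z)"
      by (intro square_integrable_continuous continuous_intros Cc)
    have "(l2norm M (\<lambda>z. 1 - C z))\<^sup>2 \<le> 8 * \<eta>"
      unfolding l2norm_bdry_split[OF si] using one[of 1] one[of q] by simp
    then show ?thesis by (rule real_le_rsqrt)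
  qed
  have cA: "l2norm M (\<lambda>z. 1 - A z) \<le> sqrt (8 * \<eta>)"
  proof (rule close[OF Ac _ P(1-3)])
    fix r assume "r = 1 \<or> r = q"
    then show "\<exists>s. 0 < s \<and> s \<le> 1 \<and> (\<forall>t. cmod (1 - A (of_real r * cis t)) = cmod (1 - exp (- poly P (of_real s * cis t))))"
      using q0 q1 by (intro exI[of _ r]) (auto simp: A_def)
  qed
  have cB: "l2norm M (\<lambda>z. 1 - B z) \<le> sqrt (8 * \<eta>)"
  proof (rule close[OF Bc _ Q(1-3)])
    fix r assume r: "r = 1 \<or> r = q"
    then have "r * (q / r) = q" "r \<noteq> 0" using q0 by auto
    then have "cmod (1 - B (of_real r * cis t)) = cmod (1 - exp (- poly Q (of_real (q / r) * cis t)))" for t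
      using complex_mod_cnj[of "1 - exp (- poly Q (of_real (q / r) * cis t))"] B_eq[of r "q / r" t] by simp
    then show "\<exists>s. 0 < s \<and> s \<le> 1 \<and> (\<forall>t. cmod (1 - B (of_real r * cis t)) = cmod (1 - exp (- poly Q (of_real s * cis t))))"
      using q0 q1 r by (intro exI[of _ "q / r"]) auto
  qed
  \<comment> \<open>On each circle the multiplier belonging to the other one is bounded by 1 and
    discarded. One \<open>\<eta>\<close> comes from each circle and one from the truncation.\<close>
  have fnorm: "(l2norm M f)\<^sup>2 \<le> 4 * pi + 3 * \<eta>"
  proof -
    have "(l2norm angle_measure (\<lambda>t. f (cis t)))\<^sup>2 \<le> (\<integral>t. (exp (- Re (poly P (cis t))) * cmod (h (cis t)))\<^sup>2 \<partial>angle_measure)"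
      unfolding l2norm_power2
    proof (rule integral_mono)
      show "integrable angle_measure (\<lambda>t. (cmod (f (cis t)))\<^sup>2)"
        using square_integrable_integrable[OF square_integrable_param(1)[OF fsi, of 1]] by simp
      have "square_integrable angle_measure (\<lambda>t. of_real (exp (- Re (poly P (cis t)))) * h (cis t))"
      proof (rule square_integrable_bound[where C = 1])
        show hs: "square_integrable angle_measure (\<lambda>t. h (cis t))"
          using square_integrable_param(1)[OF hsi, of 1] by simp
        show "(\<lambda>t. of_real (exp (- Re (poly P (cis t)))) * h (cis t)) \<in> borel_measurable angle_measure"
          by (intro borel_measurable_times square_integrable_measurable[OF hs] continuous_on_borel_measurable_angle continuous_intros)
        show "AE t in angle_measure. cmod (of_real (exp (- Re (poly P (cis t)))) * h (cis t)) \<le> 1 * cmod (h (cis t))"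
          using P(1)[of "cis _"] exp_minus_mult_le(1) by (intro AE_I2) (simp add: norm_mult)
      qed
      from square_integrable_integrable[OF this]
      show "integrable angle_measure (\<lambda>t. (exp (- Re (poly P (cis t))) * cmod (h (cis t)))\<^sup>2)"
        by (simp add: norm_mult)
      fix t
      have "cis t \<in> bdry q" by (simp add: bdry_def)
      then have "cmod (A (cis t)) * cmod (B (cis t)) * cmod (h (cis t)) \<le> cmod (A (cis t)) * 1 * cmod (h (cis t))"
        using B1 by (intro mult_mono) auto
      then have "cmod (f (cis t)) \<le> exp (- Re (poly P (cis t))) * cmod (h (cis t))"
        by (simp add: f_def norm_mult A_def)
      then show "(cmod (f (cis t)))\<^sup>2 \<le> (exp (- Re (poly P (cis t))) * cmod (h (cis t)))\<^sup>2"
        by (rule power_mono) simp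
    qed
    moreover have "(l2norm angle_measure (\<lambda>t. f (of_real q * cis t)))\<^sup>2 \<le> (\<integral>t. (exp (- Re (poly Q (cis t))) * cmod (h (of_real q * cis t)))\<^sup>2 \<partial>angle_measure)"
      unfolding l2norm_power2
    proof (rule integral_mono)
      show "integrable angle_measure (\<lambda>t. (cmod (f (of_real q * cis t)))\<^sup>2)"
        using square_integrable_integrable[OF square_integrable_param(1)[OF fsi, of q]] by simp
      have "square_integrable angle_measure (\<lambda>t. of_real (exp (- Re (poly Q (cis t)))) * h (of_real q * cis t))"
      proof (rule square_integrable_bound[where C = 1])
        show hs: "square_integrable angle_measure (\<lambda>t. h (of_real q * cis t))"
          using square_integrable_param(1)[OF hsi, of q] by simp
        show "(\<lambda>t. of_real (exp (- Re (poly Q (cis t)))) * h (of_real q * cis t)) \<in> borel_measurable angle_measure"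
          by (intro borel_measurable_times square_integrable_measurable[OF hs] continuous_on_borel_measurable_angle continuous_intros)
        show "AE t in angle_measure. cmod (of_real (exp (- Re (poly Q (cis t)))) * h (of_real q * cis t)) \<le> 1 * cmod (h (of_real q * cis t))"
          using Q(1)[of "cis _"] exp_minus_mult_le(1) by (intro AE_I2) (simp add: norm_mult)
      qed
      from square_integrable_integrable[OF this]
      show "integrable angle_measure (\<lambda>t. (exp (- Re (poly Q (cis t))) * cmod (h (of_real q * cis t)))\<^sup>2)"
        by (simp add: norm_mult)
      fix t
      have "of_real q * cis t \<in> bdry q" using q0 by (simp add: bdry_def norm_mult)
      then have "cmod (A (of_real q * cis t)) * cmod (B (of_real q * cis t)) * cmod (h (of_real q * cis t))
          \<le> 1 * cmod (B (of_real q * cis t)) * cmod (h (of_real q * cis t))"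
        using A1 by (intro mult_mono) auto
      moreover have "cmod (B (of_real q * cis t)) = exp (- Re (poly Q (cis t)))"
        using B_eq[of q 1 t] q0 by simp
      ultimately have "cmod (f (of_real q * cis t)) \<le> exp (- Re (poly Q (cis t))) * cmod (h (of_real q * cis t))"
        by (simp add: f_def norm_mult)
      then show "(cmod (f (of_real q * cis t)))\<^sup>2 \<le> (exp (- Re (poly Q (cis t))) * cmod (h (of_real q * cis t)))\<^sup>2"
        by (rule power_mono) simp
    qed
    ultimately show ?thesis
      using P(4) Q(4) h'n unfolding l2norm_bdry_split[OF fsi] l2norm_bdry_split[OF h'si] by simp
  qed
  have f1: "(\<integral>z. cmod (1 - f z) \<partial>M) \<le> \<eta> + 2 * sqrt (32 * pi) * \<theta>"
  proof -
    have Ai: "integrable M (\<lambda>z. cmod (1 - A z))" and Bi: "integrable M (\<lambda>z. cmod (1 - B z))"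
      by (intro integrable_norm integrable_of_square_integrable square_integrable_continuous continuous_intros Ac Bc)+
    have "(\<integral>z. cmod (1 - f z) \<partial>M) \<le> (\<integral>z. cmod (1 - h z) + (cmod (1 - A z) + cmod (1 - B z)) \<partial>M)"
    proof (rule integral_mono)
      show "integrable M (\<lambda>z. cmod (1 - f z))"
        using integrable_of_square_integrable[OF fsi] by simp
      show "integrable M (\<lambda>z. cmod (1 - h z) + (cmod (1 - A z) + cmod (1 - B z)))"
        using h1i Ai Bi by simp
      fix z assume "z \<in> space M"
      then have z: "z \<in> bdry q" by simp
      have "1 - f z = (A z * B z) * (1 - h z) + ((1 - A z) + A z * (1 - B z))"
        by (simp add: f_def algebra_simps)
      then have "cmod (1 - f z) \<le> cmod ((A z * B z) * (1 - h z)) + (cmod (1 - A z) + cmod (A z * (1 - B z)))"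
        by (metis add_left_mono norm_triangle_ineq order_trans)
      also have "cmod (A z * (1 - B z)) \<le> cmod (1 - B z)"
        using A1[OF z] by (simp add: norm_mult mult_left_le_one_le)
      also have "cmod ((A z * B z) * (1 - h z)) \<le> cmod (1 - h z)"
      proof -
        have "cmod (A z) * cmod (B z) \<le> 1 * 1" by (intro mult_mono A1 B1 z) auto
        then show ?thesis unfolding norm_mult by (intro mult_left_le_one_le) auto
      qed
      finally show "cmod (1 - f z) \<le> cmod (1 - h z) + (cmod (1 - A z) + cmod (1 - B z))" by simp
    qed
    also have "\<dots> = (\<integral>z. cmod (1 - h z) \<partial>M) + ((\<integral>z. cmod (1 - A z) \<partial>M) + (\<integral>z. cmod (1 - B z) \<partial>M))"
      using h1i Ai Bi by simp
    also have "\<dots> \<le> \<eta> + (sqrt (4 * pi) * sqrt (8 * \<eta>) + sqrt (4 * pi) * sqrt (8 * \<eta>))"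
    proof (intro add_mono h1)
      have si: "square_integrable M (\<lambda>z. 1 - A z)" "square_integrable M (\<lambda>z. 1 - B z)"
        by (intro square_integrable_continuous continuous_intros Ac Bc)+
      show "(\<integral>z. cmod (1 - A z) \<partial>M) \<le> sqrt (4 * pi) * sqrt (8 * \<eta>)"
        by (rule order_trans[OF L1_le_l2norm_bdry[OF si(1)] mult_left_mono[OF cA]]) simp
      show "(\<integral>z. cmod (1 - B z) \<partial>M) \<le> sqrt (4 * pi) * sqrt (8 * \<eta>)"
        by (rule order_trans[OF L1_le_l2norm_bdry[OF si(2)] mult_left_mono[OF cB]]) simp
    qed
    also have "sqrt (4 * pi) * sqrt (8 * \<eta>) = sqrt (32 * pi) * \<theta>"
      using \<theta> by (simp add: real_sqrt_mult[symmetric] \<eta>_def) (simp add: real_sqrt_mult)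
    finally show ?thesis by (simp add: mult_ac)
  qed
  \<comment> \<open>Expanding the square, the total masses \<open>4 * pi\<close> cancel: the squared
    norm of \<open>f\<close> contributes \<open>3 * \<eta>\<close> and twice the mean error
    contributes \<open>2 * \<eta> + 4 * sqrt (32 * pi) * \<theta>\<close>. This is the origin of the
    constant in the statement.\<close>
  have "(l2norm M (\<lambda>z. 1 - f z))\<^sup>2 = (l2norm M (\<lambda>z. 1 + - f z))\<^sup>2" by simp
  also have "\<dots> = (l2norm M (\<lambda>z. 1))\<^sup>2 + (l2norm M f)\<^sup>2 + 2 * Re (\<integral>z. 1 * cnj (- f z) \<partial>M)"
    by (subst l2norm_power2_add) (auto intro: square_integrable_bounded square_integrable_uminus fsi simp: l2norm_uminus)
  also have "(l2norm M (\<lambda>z. 1))\<^sup>2 = 4 * pi" by (simp add: l2norm_power2 measure_bdry)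
  also have "Re (\<integral>z. 1 * cnj (- f z) \<partial>M) \<le> - 4 * pi + (\<integral>z. cmod (1 - f z) \<partial>M)"
  proof -
    have fi: "integrable M f" by (rule integrable_of_square_integrable[OF fsi])
    have "Re (\<integral>z. 1 - f z \<partial>M) \<le> (\<integral>z. cmod (1 - f z) \<partial>M)"
      using complex_Re_le_cmod integral_norm_bound order_trans by blast
    moreover have "Re (\<integral>z. 1 - f z \<partial>M) = 4 * pi - Re (\<integral>z. f z \<partial>M)"
      using fi by (simp add: measure_bdry)
    moreover have "(\<integral>z. 1 * cnj (- f z) \<partial>M) = - cnj (\<integral>z. f z \<partial>M)" by simp
    ultimately show ?thesis by simp
  qed
  finally have "(l2norm M (\<lambda>z. 1 - f z))\<^sup>2 \<le> 5 * \<theta> + 4 * sqrt (32 * pi) * \<theta>"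
    using fnorm f1 \<eta> by simp
  moreover have "(\<lambda>z. 1 - a z * G z) = (\<lambda>z. 1 - f z)" by (simp add: aG f_def)
  ultimately have "(l2norm M (\<lambda>z. 1 - a z * G z))\<^sup>2 \<le> (5 + 4 * sqrt (32 * pi)) * \<theta>"
    by (simp only: distrib_right)
  with annulus_algebraI[OF ahol] show ?thesis by (rule that)
qed

end

section \<open>Logarithmic means and the index\<close>

text \<open>On the strip \<open>K\<close> has a primitive, whose increment over one period is a
  constant by periodicity of \<open>K\<close>. That increment is \<open>\<i>\<close> times the
  integral over any vertical segment of length \<open>2 * pi\<close>.\<close>

lemma strip_periodic_mean:
  fixes K :: "complex \<Rightarrow> complex" and a b :: real
  defines "S \<equiv> {w. a < Re w \<and> Re w < b}"
  assumes hol: "K holomorphic_on S" and per: "\<And>w. w \<in> S \<Longrightarrow> K (w + 2 * pi * \<i>) = K w"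
  obtains c where "\<And>x. a < x \<Longrightarrow> x < b \<Longrightarrow> (\<integral>t. K (of_real x + \<i> * of_real t) \<partial>angle_measure) = c"
proof -
  have S_eq: "S = {w. a < Re w} \<inter> {w. Re w < b}" by (auto simp: S_def)
  have opn: "open S" unfolding S_eq by (intro open_Int open_halfspace_Re_gt open_halfspace_Re_lt)
  have conv: "convex S" unfolding S_eq by (intro convex_Int convex_halfspace_Re_gt convex_halfspace_Re_lt)
  obtain \<Phi> where \<Phi>0: "\<And>w. w \<in> S \<Longrightarrow> (\<Phi> has_field_derivative K w) (at w within S)"
    by (rule holomorphic_convex_primitive'[OF conv opn hol]) (rule that)
  have \<Phi>: "(\<Phi> has_field_derivative K w) (at w)" if "w \<in> S" for w
    using \<Phi>0[OF that] at_within_open[OF that opn] by simp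
  have shift: "w + 2 * pi * \<i> \<in> S" if "w \<in> S" for w using that by (simp add: S_def)
  have "((\<lambda>w. \<Phi> (w + 2 * pi * \<i>) - \<Phi> w) has_field_derivative 0) (at w within S)" if w: "w \<in> S" for w
  proof -
    have "((\<lambda>w. \<Phi> (w + 2 * pi * \<i>)) has_field_derivative K (w + 2 * pi * \<i>) * 1) (at w)"
      by (rule DERIV_chain2[where g = "\<lambda>w. w + 2 * pi * \<i>", OF \<Phi>[OF shift[OF w]]])
         (auto intro!: derivative_eq_intros)
    from DERIV_diff[OF this \<Phi>[OF w]] have "((\<lambda>w. \<Phi> (w + 2 * pi * \<i>) - \<Phi> w) has_field_derivative 0) (at w)"
      by (simp only: per[OF w] mult_1_right diff_self)
    then show ?thesis by (rule has_field_derivative_at_within)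
  qed
  from has_field_derivative_zero_constant[OF conv this]
  obtain d where d: "\<And>w. w \<in> S \<Longrightarrow> \<Phi> (w + 2 * pi * \<i>) - \<Phi> w = d" by blast
  show ?thesis
  proof (rule that[of "- \<i> * d"])
    fix x assume x: "a < x" "x < b"
    have inS: "of_real x + \<i> * of_real t \<in> S" for t using x by (simp add: S_def)
    have "((\<lambda>t. \<i> * K (of_real x + \<i> * of_real t)) has_integral
        \<Phi> (of_real x + \<i> * of_real (2 * pi)) - \<Phi> (of_real x + \<i> * of_real 0)) {0..2*pi}"
    proof (rule fundamental_theorem_of_calculus)
      fix t :: real
      have "((\<lambda>z. \<Phi> (of_real x + \<i> * z)) has_field_derivative K (of_real x + \<i> * of_real t) * \<i>) (at (of_real t))"
        by (rule DERIV_chain2[where g = "\<lambda>z. of_real x + \<i> * z", OF \<Phi>[OF inS]])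
           (auto intro!: derivative_eq_intros)
      from has_vector_derivative_real_field[OF this]
      show "((\<lambda>t. \<Phi> (of_real x + \<i> * of_real t)) has_vector_derivative \<i> * K (of_real x + \<i> * of_real t)) (at t within {0..2*pi})"
        by (simp add: mult.commute)
    qed simp
    moreover have "\<Phi> (of_real x + \<i> * of_real (2 * pi)) - \<Phi> (of_real x + \<i> * of_real 0) = d"
      using d[OF inS[of 0]] by (simp add: mult_ac)
    ultimately have "((\<lambda>t. \<i> * K (of_real x + \<i> * of_real t)) has_integral d) {0..2*pi}" by simp
    from has_integral_mult_right[OF this, of "- \<i>"]
    have int: "((\<lambda>t. K (of_real x + \<i> * of_real t)) has_integral - \<i> * d) {0..2*pi}"
      by (simp add: mult.assoc[symmetric])
    have "continuous_on {0..2*pi} (\<lambda>t. K (of_real x + \<i> * of_real t))"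
      by (rule continuous_on_compose2[OF holomorphic_on_imp_continuous_on[OF hol]])
         (use inS in \<open>auto intro!: continuous_intros\<close>)
    then show "(\<integral>t. K (of_real x + \<i> * of_real t) \<partial>angle_measure) = - \<i> * d"
      using int by (simp add: angle_integral_continuous(2) integral_unique)
  qed
qed

context annulus_boundary
begin

section \<open>Means of analytic functions over concentric circles\<close>

lemma exp_strip_annulus:
  assumes "ln q < Re w" "Re w < 0"
  shows "exp w \<in> annulus q"
proof -
  have "q = exp (ln q)" using q0 by simp
  also have "\<dots> < exp (Re w)" using assms by simp
  finally show ?thesis using assms by (simp add: annulus_def)
qed

lemma exp_ln_polar: "0 < s \<Longrightarrow> exp (of_real (ln s) + \<i> * of_real t) = of_real s * cis t"
  by (simp add: exp_add cis_conv_exp exp_of_real)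

lemma radii_to_outer:
  obtains s :: "nat \<Rightarrow> real" where "\<And>k. q < s k \<and> s k < 1" "s \<longlonglongrightarrow> 1"
proof -
  define x where "x k = 1 / real (k + 2)" for k
  have x: "0 < x k" "x k < 1" for k by (simp_all add: x_def)
  have x0: "x \<longlonglongrightarrow> 0"
    unfolding x_def by (rule LIMSEQ_ignore_initial_segment[OF lim_1_over_n])
  show ?thesis
  proof (rule that[of "\<lambda>k. 1 - (1 - q) * x k"])
    fix k
    have "0 < (1 - q) * x k" using q1 x(1) by simp
    moreover have "(1 - q) * x k < (1 - q) * 1" using q1 x(2) by (intro mult_strict_left_mono) auto
    ultimately show "q < 1 - (1 - q) * x k \<and> 1 - (1 - q) * x k < 1" by simp
  next
    from tendsto_diff[OF tendsto_const tendsto_mult[OF tendsto_const x0]]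
    have "(\<lambda>k. 1 - (1 - q) * x k) \<longlonglongrightarrow> 1 - (1 - q) * 0" .
    then show "(\<lambda>k. 1 - (1 - q) * x k) \<longlonglongrightarrow> 1" by simp
  qed
qed

lemma radii_to_inner:
  obtains s :: "nat \<Rightarrow> real" where "\<And>k. q < s k \<and> s k < 1" "s \<longlonglongrightarrow> q"
proof -
  obtain s :: "nat \<Rightarrow> real" where s: "\<And>k. q < s k \<and> s k < 1" "s \<longlonglongrightarrow> 1" by (rule radii_to_outer) (rule that)
  show ?thesis
  proof (rule that[of "\<lambda>k. q + (1 - s k)"])
    show "q < q + (1 - s k) \<and> q + (1 - s k) < 1" for k using s(1)[of k] by auto
    have "(\<lambda>k. q + (1 - s k)) \<longlonglongrightarrow> q + (1 - 1)" by (intro tendsto_intros s)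
    then show "(\<lambda>k. q + (1 - s k)) \<longlonglongrightarrow> q" by simp
  qed
qed

text \<open>In the coordinate \<open>w\<close> with \<open>z = exp w\<close> circles become vertical
  segments of one period, so this is the statement about strips.\<close>

lemma annulus_mean_const:
  assumes "h holomorphic_on annulus q"
  obtains c where "\<And>s. q < s \<Longrightarrow> s < 1 \<Longrightarrow> (\<integral>t. h (of_real s * cis t) \<partial>angle_measure) = c"
proof -
  have "(\<lambda>w. h (exp w)) holomorphic_on {w. ln q < Re w \<and> Re w < 0}"
    using holomorphic_on_compose_gen[OF holomorphic_on_exp assms, of "{w. ln q < Re w \<and> Re w < 0}"] exp_strip_annulus
    by (auto simp: o_def)
  then obtain c where c: "\<And>x. ln q < x \<Longrightarrow> x < 0 \<Longrightarrow> (\<integral>t. h (exp (of_real x + \<i> * of_real t)) \<partial>angle_measure) = c"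
    by (rule strip_periodic_mean) (auto simp: exp_add mult.commute)
  show ?thesis
  proof (rule that)
    fix s assume "q < s" "s < 1"
    then show "(\<integral>t. h (of_real s * cis t) \<partial>angle_measure) = c"
      using c[of "ln s"] q0 by (simp add: exp_ln_polar)
  qed
qed

text \<open>Means over interior circles do not depend on the radius, and continuity up to the
  boundary carries this to both boundary circles by dominated convergence.\<close>

lemma annulus_algebra_mean:
  assumes "a \<in> annulus_algebra q"
  shows "(\<integral>z. a z \<partial>circle_measure 1) = (\<integral>z. a z \<partial>circle_measure q)"
proof -
  have cont: "continuous_on (closure (annulus q)) a" and hol: "a holomorphic_on annulus q"
    using assms by (auto simp: annulus_algebra_def analytic_imp_holomorphic)
  obtain c where c: "\<And>s. q < s \<Longrightarrow> s < 1 \<Longrightarrow> (\<integral>t. a (of_real s * cis t) \<partial>angle_measure) = c"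
    by (rule annulus_mean_const[OF hol]) (rule that)
  have "bounded (annulus q)" by (rule bounded_subset[OF bounded_ball[of 0 1]]) (auto simp: annulus_def)
  then have "compact (closure (annulus q))" by simp
  then obtain C where C: "\<And>z. z \<in> closure (annulus q) \<Longrightarrow> cmod (a z) \<le> C"
    using compact_imp_bounded[OF compact_continuous_image[OF cont]] by (metis bounded_iff imageI)
  have main: "(\<integral>z. a z \<partial>circle_measure r) = c" "sphere 0 r \<subseteq> closure (annulus q)"
    if s: "\<And>k. q < s k \<and> s k < 1" "s \<longlonglongrightarrow> r" and r: "0 < r" for s :: "nat \<Rightarrow> real" and r
  proof -
    have sann: "of_real (s k) * cis t \<in> annulus q" for k t
    proof -
      have "0 < s k" using s(1)[of k] q0 by simp
      then show ?thesis using s(1)[of k] by (simp add: annulus_def norm_mult)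
    qed
    have slim: "(\<lambda>k. of_real (s k) * cis t) \<longlonglongrightarrow> of_real r * cis t" for t
      by (intro tendsto_intros s)
    have rcl: "of_real r * cis t \<in> closure (annulus q)" for t
      unfolding closure_sequential by (intro exI[of _ "\<lambda>k. of_real (s k) * cis t"] conjI allI sann slim)
    show sub: "sphere 0 r \<subseteq> closure (annulus q)"
    proof
      fix z :: complex assume "z \<in> sphere 0 r"
      then show "z \<in> closure (annulus q)" using rcl[of "Arg2pi z"] polar_Arg2pi[of z] by simp
    qed
    have am: "a \<in> borel_measurable (circle_measure r)"
      by (rule borel_measurable_circle_continuous[OF continuous_on_subset[OF cont sub]])
    have "(\<lambda>k. \<integral>t. a (of_real (s k) * cis t) \<partial>angle_measure) \<longlonglongrightarrow> (\<integral>t. a (of_real r * cis t) \<partial>angle_measure)"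
    proof (rule integral_dominated_convergence[where w = "\<lambda>_. C"])
      have ac: "continuous_on UNIV (\<lambda>t. a (of_real u * cis t))" if "\<And>t. of_real u * cis t \<in> closure (annulus q)" for u
        by (rule continuous_on_compose2[OF cont]) (use that in \<open>auto intro!: continuous_intros\<close>)
      show "(\<lambda>t. a (of_real r * cis t)) \<in> borel_measurable angle_measure"
        by (intro continuous_on_borel_measurable_angle ac rcl)
      show "(\<lambda>t. a (of_real (s k) * cis t)) \<in> borel_measurable angle_measure" for k
        by (intro continuous_on_borel_measurable_angle ac subsetD[OF closure_subset sann])
      show "AE t in angle_measure. (\<lambda>k. a (of_real (s k) * cis t)) \<longlonglongrightarrow> a (of_real r * cis t)"
        by (rule AE_I2, rule continuous_on_tendsto_compose[OF cont slim rcl])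
           (simp add: subsetD[OF closure_subset sann])
      show "AE t in angle_measure. norm (a (of_real (s k) * cis t)) \<le> C" for k
        by (intro AE_I2 C subsetD[OF closure_subset sann])
    qed simp
    then have "(\<lambda>k::nat. c) \<longlonglongrightarrow> (\<integral>t. a (of_real r * cis t) \<partial>angle_measure)"
      using c s(1) by simp
    then show "(\<integral>z. a z \<partial>circle_measure r) = c"
      unfolding integral_circle_measure[OF r am] by (simp add: LIMSEQ_const_iff)
  qed
  obtain s where s: "\<And>k::nat. q < s k \<and> s k < 1" "s \<longlonglongrightarrow> 1" by (rule radii_to_outer) (rule that)
  obtain s' where s': "\<And>k::nat. q < s' k \<and> s' k < 1" "s' \<longlonglongrightarrow> q" by (rule radii_to_inner) (rule that)
  show ?thesis using main(1)[OF s] main(1)[OF s' q0] by simp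
qed

text \<open>The integer \<open>n\<close> is the winding number of \<open>F\<close> along a circle: a
  logarithm of \<open>F (exp w)\<close> exists on the strip and grows by
  \<open>2 * pi * \<i> * n\<close> over one period.\<close>

lemma zero_free_log_mean:
  assumes hol: "F holomorphic_on annulus q" and nz: "\<And>z. z \<in> annulus q \<Longrightarrow> F z \<noteq> 0"
  obtains n :: int and c :: real
  where "\<And>s. q < s \<Longrightarrow> s < 1 \<Longrightarrow> (\<integral>t. ln (cmod (F (of_real s * cis t))) \<partial>angle_measure) = 2 * pi * of_int n * ln s + c"
proof -
  define S where "S = {w. ln q < Re w \<and> Re w < 0}"
  have S_eq: "S = {w. ln q < Re w} \<inter> {w. Re w < 0}" by (auto simp: S_def)
  have opn: "open S" unfolding S_eq by (intro open_Int open_halfspace_Re_gt open_halfspace_Re_lt)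
  have conv: "convex S" unfolding S_eq by (intro convex_Int convex_halfspace_Re_gt convex_halfspace_Re_lt)
  have Fe: "(\<lambda>w. F (exp w)) holomorphic_on S"
    using holomorphic_on_compose_gen[OF holomorphic_on_exp hol, of S] exp_strip_annulus
    by (auto simp: o_def S_def)
  obtain L where Lhol: "L holomorphic_on S" and L: "\<And>w. w \<in> S \<Longrightarrow> F (exp w) = exp (L w)"
  proof (rule contractible_imp_holomorphic_log[OF Fe convex_imp_contractible[OF conv]])
    show "F (exp z) \<noteq> 0" if "z \<in> S" for z using that nz exp_strip_annulus by (auto simp: S_def)
  qed auto
  have shift: "w + 2 * pi * \<i> \<in> S" if "w \<in> S" for w using that by (simp add: S_def)
  define D where "D w = L (w + 2 * pi * \<i>) - L w" for w
  have D: "\<exists>n::int. D w = of_int n * (2 * pi * \<i>)" if w: "w \<in> S" for w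
  proof -
    have "exp (L (w + 2 * pi * \<i>)) = exp (L w)"
      using L[OF w] L[OF shift[OF w]] by (simp add: exp_add mult.commute)
    then have "exp (D w) = 1" by (simp add: D_def exp_diff)
    then obtain n :: int where "Re (D w) = 0" "Im (D w) = of_int (2 * n) * pi"
      unfolding exp_eq_1 by blast
    then have "D w = of_int n * (2 * pi * \<i>)" by (simp add: complex_eq_iff)
    then show ?thesis ..
  qed
  have Dc: "continuous_on S D"
    unfolding D_def using holomorphic_on_imp_continuous_on[OF Lhol] shift
    by (intro continuous_on_diff continuous_on_compose2[OF holomorphic_on_imp_continuous_on[OF Lhol], of S "\<lambda>w. w + 2 * pi * \<i>"])
       (auto intro!: continuous_intros)
  \<comment> \<open>The increment is continuous with values in a discrete set, distinct values being
    at distance at least \<open>2 * pi\<close>.\<close>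
  have "D constant_on S"
  proof (rule continuous_discrete_range_constant[OF convex_connected[OF conv] Dc])
    fix w assume w: "w \<in> S"
    show "\<exists>e>0. \<forall>y. y \<in> S \<and> D y \<noteq> D w \<longrightarrow> e \<le> norm (D y - D w)"
    proof (intro exI[of _ 1] conjI allI impI)
      fix y assume y: "y \<in> S \<and> D y \<noteq> D w"
      obtain n m :: int where nm: "D w = of_int n * (2 * pi * \<i>)" "D y = of_int m * (2 * pi * \<i>)"
        using D w y by metis
      then have "n \<noteq> m" using y by auto
      then have "1 \<le> \<bar>m - n\<bar>" by linarith
      then have "1 \<le> \<bar>real_of_int (m - n)\<bar>" by linarith
      have "D y - D w = of_int (m - n) * (2 * pi * \<i>)" unfolding nm by (simp add: left_diff_distrib)
      then have "norm (D y - D w) = \<bar>real_of_int (m - n)\<bar> * (2 * pi)"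
        by (simp only: norm_mult norm_of_int) simp
      also have "\<dots> \<ge> 1 * 1"
        using \<open>1 \<le> \<bar>real_of_int (m - n)\<bar>\<close> pi_ge_two by (intro mult_mono) auto
      finally show "1 \<le> norm (D y - D w)" by simp
    qed simp
  qed
  then obtain d where d: "\<And>w. w \<in> S \<Longrightarrow> D w = d" by (auto simp: constant_on_def)
  have "of_real (ln q / 2) \<in> S" using q0 q1 by (simp add: S_def)
  then obtain n :: int where n: "d = of_int n * (2 * pi * \<i>)" using D d by metis
  \<comment> \<open>Removing the linear part makes the logarithm periodic, so its mean does not
    depend on the circle; the real part of the removed term is the multiple of \<open>ln s\<close>
    in the conclusion.\<close>
  define K where "K w = L w - of_int n * w" for w
  have Khol: "K holomorphic_on S" unfolding K_def by (intro holomorphic_intros Lhol)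
  have Kper: "K (w + 2 * pi * \<i>) = K w" if w: "w \<in> S" for w
    using d[OF w] n by (simp add: K_def D_def algebra_simps)
  obtain c where c: "\<And>x. ln q < x \<Longrightarrow> x < 0 \<Longrightarrow> (\<integral>t. K (of_real x + \<i> * of_real t) \<partial>angle_measure) = c"
    by (rule strip_periodic_mean[OF Khol[unfolded S_def] Kper[unfolded S_def]]) (assumption, rule that)
  show ?thesis
  proof (rule that[of n "Re c"])
    fix s assume s: "q < s" "s < 1"
    then have s0: "0 < s" and ls: "ln q < ln s" "ln s < 0" using q0 by auto
    have inS: "of_real (ln s) + \<i> * of_real t \<in> S" for t using ls by (simp add: S_def)
    have Ki: "integrable angle_measure (\<lambda>t. K (of_real (ln s) + \<i> * of_real t))"
    proof (intro angle_integral_continuous(1) continuous_on_compose2[OF holomorphic_on_imp_continuous_on[OF Khol]])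
      show "continuous_on {0..2*pi} (\<lambda>t. of_real (ln s) + \<i> * of_real t)" by (intro continuous_intros)
    qed (use inS in auto)
    have eq: "ln (cmod (F (of_real s * cis t))) = Re (K (of_real (ln s) + \<i> * of_real t)) + of_int n * ln s" for t
    proof -
      have "F (of_real s * cis t) = exp (L (of_real (ln s) + \<i> * of_real t))"
        using L[OF inS[of t]] by (simp add: exp_ln_polar[OF s0])
      then show ?thesis by (simp add: K_def)
    qed
    show "(\<integral>t. ln (cmod (F (of_real s * cis t))) \<partial>angle_measure) = 2 * pi * of_int n * ln s + Re c"
      unfolding eq using Ki c[OF ls] integral_Re[OF Ki] measure_angle_measure
      by (simp add: integrable_Re)
  qed
qed

section \<open>Convergence to boundary values in the mean\<close>

lemma laurent_parseval:
  assumes F: "finite F" and r: "0 < r"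
  shows "(\<integral>z. (cmod (\<Sum>n\<in>F. c n * z powi n))\<^sup>2 \<partial>circle_measure r) = 2 * pi * (\<Sum>n\<in>F. (cmod (c n))\<^sup>2 * r powi (2 * n))"
proof -
  let ?p = "\<lambda>z. \<Sum>n\<in>F. c n * z powi n"
  interpret C: finite_measure "circle_measure r" by (rule finite_measure_circle_measure[OF r])
  have L: "?p \<in> laurent_polys" by (rule laurent_polysI[OF F])
  have pc: "continuous_on (sphere 0 r) ?p" by (rule continuous_on_laurent_poly[OF L]) (use r in auto)
  have int: "integrable (circle_measure r) f" if "continuous_on (sphere 0 r) f" for f :: "complex \<Rightarrow> complex"
  proof -
    have "bounded (f ` sphere 0 r)" by (intro compact_imp_bounded compact_continuous_image that compact_sphere)
    then obtain B where "\<And>z. z \<in> sphere 0 r \<Longrightarrow> cmod (f z) \<le> B" unfolding bounded_iff by (metis imageI)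
    then show ?thesis
      by (intro C.integrable_const_bound[of _ B] borel_measurable_circle_continuous that) auto
  qed
  have "complex_of_real (\<integral>z. (cmod (?p z))\<^sup>2 \<partial>circle_measure r) = (\<integral>z. ?p z * cnj (?p z) \<partial>circle_measure r)"
    by (simp only: complex_norm_square integral_complex_of_real[symmetric])
  also have "\<dots> = (\<integral>z. (\<Sum>n\<in>F. cnj (c n) * (?p z * cnj (z powi n))) \<partial>circle_measure r)"
    by (simp add: sum_distrib_left mult_ac)
  also have "\<dots> = (\<Sum>n\<in>F. \<integral>z. cnj (c n) * (?p z * cnj (z powi n)) \<partial>circle_measure r)"
    by (intro Bochner_Integration.integral_sum int continuous_on_mult continuous_on_const pc continuous_on_cnj continuous_on_powi_sphere r)
  also have "\<dots> = (\<Sum>n\<in>F. of_real (2 * pi * ((cmod (c n))\<^sup>2 * r powi (2 * n))))"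
  proof (rule sum.cong[OF refl])
    fix n assume n: "n \<in> F"
    have "(\<integral>z. cnj (c n) * (?p z * cnj (z powi n)) \<partial>circle_measure r)
        = (\<integral>z. (cnj (c n) * of_real (r powi (2 * n))) * (?p z * z powi (- n)) \<partial>circle_measure r)"
    proof (rule Bochner_Integration.integral_cong)
      fix z assume "z \<in> space (circle_measure r)"
      then show "cnj (c n) * (?p z * cnj (z powi n)) = (cnj (c n) * of_real (r powi (2 * n))) * (?p z * z powi (- n))"
        by (subst cnj_powi_sphere[OF _ r]) (simp_all add: mult_ac)
    qed simp
    also have "\<dots> = (cnj (c n) * of_real (r powi (2 * n))) * (2 * pi * c n)"
      by (simp only: integral_mult_right_zero laurent_coeff_moment[OF F n r])
    also have "\<dots> = of_real (2 * pi * ((cmod (c n))\<^sup>2 * r powi (2 * n)))"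
      by (simp add: complex_norm_square mult_ac flip: of_real_power)
    finally show "(\<integral>z. cnj (c n) * (?p z * cnj (z powi n)) \<partial>circle_measure r)
        = of_real (2 * pi * ((cmod (c n))\<^sup>2 * r powi (2 * n)))" .
  qed
  also have "\<dots> = of_real (2 * pi * (\<Sum>n\<in>F. (cmod (c n))\<^sup>2 * r powi (2 * n)))"
    by (simp add: sum_distrib_left)
  finally show ?thesis using of_real_eq_iff by blast
qed

lemma continuous_circle_square_integrable:
  assumes "continuous_on (sphere 0 s) f" "0 < s"
  shows "square_integrable angle_measure (\<lambda>t. f (of_real s * cis t))"
proof -
  have "bounded (f ` sphere 0 s)" by (intro compact_imp_bounded compact_continuous_image assms compact_sphere)
  then obtain B where B: "\<And>z. z \<in> sphere 0 s \<Longrightarrow> cmod (f z) \<le> B" unfolding bounded_iff by (metis imageI)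
  have "continuous_on UNIV (\<lambda>t. f (of_real s * cis t))"
    by (rule continuous_on_compose2[OF assms(1)]) (use assms(2) in \<open>auto simp: norm_mult intro!: continuous_intros\<close>)
  then show ?thesis
    by (intro angle.square_integrable_bounded[of _ B] continuous_on_borel_measurable_angle AE_I2 B)
       (use assms(2) in \<open>simp_all add: norm_mult\<close>)
qed

text \<open>Parseval on all three circles together with
  \<open>s powi (2 * n) \<le> 1 + q powi (2 * n)\<close>, where the first summand suffices for
  \<open>n \<ge> 0\<close> and the second for \<open>n < 0\<close>. The bound is uniform in the
  radius.\<close>

lemma laurent_circle_norm_le:
  assumes p: "p \<in> laurent_polys" and s: "q \<le> s" "s \<le> 1"
  shows "l2norm angle_measure (\<lambda>t. p (of_real s * cis t)) \<le> l2norm M p"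
proof (rule power2_le_imp_le)
  obtain c F where F: "p = (\<lambda>z. \<Sum>n\<in>F. c n * z powi n)" "finite F"
    using p unfolding laurent_polys_def by auto
  have s0: "0 < s" using s q0 by simp
  have pc: "continuous_on (sphere 0 s) p" by (rule continuous_on_laurent_poly[OF p]) (use s0 in auto)
  have "(\<lambda>z. (cmod (p z))\<^sup>2) \<in> borel_measurable (circle_measure s)"
    by (intro borel_measurable_circle_continuous continuous_intros pc)
  from integral_circle_measure[OF s0 this]
  have "(l2norm angle_measure (\<lambda>t. p (of_real s * cis t)))\<^sup>2 = (\<integral>z. (cmod (p z))\<^sup>2 \<partial>circle_measure s)"
    by (simp add: l2norm_power2)
  also have "\<dots> = 2 * pi * (\<Sum>n\<in>F. (cmod (c n))\<^sup>2 * s powi (2 * n))"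
    unfolding F(1) by (rule laurent_parseval[OF F(2) s0])
  also have "\<dots> \<le> 2 * pi * (\<Sum>n\<in>F. (cmod (c n))\<^sup>2 * 1 powi (2 * n) + (cmod (c n))\<^sup>2 * q powi (2 * n))"
  proof (intro mult_left_mono sum_mono)
    fix n
    have "s powi (2 * n) \<le> 1 + q powi (2 * n)"
    proof (cases "0 \<le> n")
      case True
      have "s powi (2 * n) \<le> 1" using s s0 True by (simp add: power_int_def power_le_one)
      moreover have "0 \<le> q powi (2 * n)" using q0 by simp
      ultimately show ?thesis by linarith
    next
      case False
      have "inverse s ^ nat (- (2 * n)) \<le> inverse q ^ nat (- (2 * n))"
        using s s0 q0 by (intro power_mono le_imp_inverse_le) auto
      then show ?thesis using False by (simp add: power_int_def)
    qed
    then have "(cmod (c n))\<^sup>2 * s powi (2 * n) \<le> (cmod (c n))\<^sup>2 * (1 + q powi (2 * n))"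
      by (rule mult_left_mono) simp
    then show "(cmod (c n))\<^sup>2 * s powi (2 * n) \<le> (cmod (c n))\<^sup>2 * 1 powi (2 * n) + (cmod (c n))\<^sup>2 * q powi (2 * n)"
      by (simp add: algebra_simps)
  qed simp
  also have "\<dots> = (\<integral>z. (cmod (p z))\<^sup>2 \<partial>circle_measure 1) + (\<integral>z. (cmod (p z))\<^sup>2 \<partial>circle_measure q)"
    unfolding F(1) laurent_parseval[OF F(2) zero_less_one] laurent_parseval[OF F(2) q0]
    by (simp only: sum.distrib distrib_left)
  also have "\<dots> = (l2norm M p)\<^sup>2"
    unfolding l2norm_power2
    by (rule integral_bdry[symmetric, OF square_integrable_integrable[OF square_integrable_laurent[OF p]]])
  finally show "(l2norm angle_measure (\<lambda>t. p (of_real s * cis t)))\<^sup>2 \<le> (l2norm M p)\<^sup>2" .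
qed simp

lemma circle_subset_annulus: "q < s \<Longrightarrow> s < 1 \<Longrightarrow> of_real s * cis t \<in> annulus q"
  using q0 by (simp add: annulus_def norm_mult)

lemma extends_bound:
  assumes "extends f F" "p \<in> laurent_polys" "z \<in> annulus q"
  shows "cmod (F z - p z) \<le> eval_const (cmod z) * (\<integral>w. cmod (f w - p w) \<partial>M)"
  using assms unfolding extends_def by blast

lemma extends_circle_square_integrable:
  assumes "extends f F" "q < s" "s < 1"
  shows "square_integrable angle_measure (\<lambda>t. F (of_real s * cis t))"
proof -
  have "F holomorphic_on annulus q" using assms(1) by (simp add: extends_def)
  then have "continuous_on (sphere 0 s) F"
    by (rule continuous_on_subset[OF holomorphic_on_imp_continuous_on])
       (use assms in \<open>auto simp: annulus_def\<close>)
  then show ?thesis by (rule continuous_circle_square_integrable) (use assms q0 in simp)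
qed

lemma laurent_circle_square_integrable:
  assumes "p \<in> laurent_polys" "0 < s"
  shows "square_integrable angle_measure (\<lambda>t. p (of_real s * cis t))"
  by (intro continuous_circle_square_integrable continuous_on_laurent_poly assms) (use assms in auto)

text \<open>A limit of the bound for Laurent polynomials. The polynomial \<open>p\<close> is
  subtracted on both sides to make the lemma usable in density arguments; \<open>p = 0\<close>
  bounds the circle norms of \<open>F\<close> itself.\<close>

lemma extends_circle_norm_le:
  assumes f: "f \<in> Hardy0 q" and F: "extends f F" and p: "p \<in> laurent_polys" and s: "q < s" "s < 1"
  shows "l2norm angle_measure (\<lambda>t. F (of_real s * cis t) - p (of_real s * cis t)) \<le> l2norm M (\<lambda>z. f z - p z)"
proof -
  have s0: "0 < s" using s q0 by simp
  obtain u where u: "\<And>k. u k \<in> laurent_polys" and l2: "(\<lambda>k. l2norm M (\<lambda>z. f z - u k z)) \<longlonglongrightarrow> 0"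
    and L1: "(\<lambda>k. \<integral>z. cmod (f z - u k z) \<partial>M) \<longlonglongrightarrow> 0"
    by (rule Hardy0_laurent_L1_approx[OF f]) (rule that)
  let ?e = "\<lambda>k. \<integral>z. cmod (f z - u k z) \<partial>M"
  note si = extends_circle_square_integrable[OF F s] laurent_circle_square_integrable[OF u s0]
    laurent_circle_square_integrable[OF p s0]
  note fsi = Hardy0_square_integrable[OF f] square_integrable_laurent[OF u] square_integrable_laurent[OF p]
  have bd: "l2norm angle_measure (\<lambda>t. F (of_real s * cis t) - p (of_real s * cis t))
      \<le> (eval_const s * ?e k) * l2norm angle_measure (\<lambda>t. 1) + (l2norm M (\<lambda>z. f z - u k z) + l2norm M (\<lambda>z. f z - p z))" for k
  proof -
    have "l2norm angle_measure (\<lambda>t. F (of_real s * cis t) - p (of_real s * cis t))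
        \<le> l2norm angle_measure (\<lambda>t. F (of_real s * cis t) - u k (of_real s * cis t))
        + l2norm angle_measure (\<lambda>t. u k (of_real s * cis t) - p (of_real s * cis t))"
      by (rule l2norm_triangle_diff[OF si(1) si(2)[of k] si(3)])
    also have "l2norm angle_measure (\<lambda>t. F (of_real s * cis t) - u k (of_real s * cis t))
        \<le> (eval_const s * ?e k) * l2norm angle_measure (\<lambda>t. 1)"
    proof (rule l2norm_mono)
      show "square_integrable angle_measure (\<lambda>t. 1)" by (rule angle.square_integrable_bounded[of _ 1]) auto
      show "(\<lambda>t. F (of_real s * cis t) - u k (of_real s * cis t)) \<in> borel_measurable angle_measure"
        by (rule square_integrable_measurable[OF square_integrable_diff[OF si(1) si(2)]])
      show "AE t in angle_measure. cmod (F (of_real s * cis t) - u k (of_real s * cis t)) \<le> (eval_const s * ?e k) * cmod 1"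
      proof (rule AE_I2)
        fix t
        have "cmod (of_real s * cis t) = s" using s0 by (simp add: norm_mult)
        with extends_bound[OF F u[of k] circle_subset_annulus[OF s, of t]]
        show "cmod (F (of_real s * cis t) - u k (of_real s * cis t)) \<le> (eval_const s * ?e k) * cmod 1" by simp
      qed
      show "0 \<le> eval_const s * ?e k" using eval_const_nonneg[OF s] by simp
    qed
    also have "l2norm angle_measure (\<lambda>t. u k (of_real s * cis t) - p (of_real s * cis t)) \<le> l2norm M (\<lambda>z. u k z - p z)"
      by (rule laurent_circle_norm_le[OF laurent_polys_diff[OF u p]]) (use s in auto)
    also have "l2norm M (\<lambda>z. u k z - p z) \<le> l2norm M (\<lambda>z. u k z - f z) + l2norm M (\<lambda>z. f z - p z)"
      by (rule l2norm_triangle_diff[OF fsi(2) fsi(1) fsi(3)])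
    also have "l2norm M (\<lambda>z. u k z - f z) = l2norm M (\<lambda>z. f z - u k z)" by (rule l2norm_minus_commute)
    finally show ?thesis by simp
  qed
  have "(\<lambda>k. (eval_const s * ?e k) * l2norm angle_measure (\<lambda>t. 1) + (l2norm M (\<lambda>z. f z - u k z) + l2norm M (\<lambda>z. f z - p z)))
      \<longlonglongrightarrow> (eval_const s * 0) * l2norm angle_measure (\<lambda>t. 1) + (0 + l2norm M (\<lambda>z. f z - p z))"
    by (intro tendsto_intros L1 l2)
  then have "(\<lambda>k. (eval_const s * ?e k) * l2norm angle_measure (\<lambda>t. 1) + (l2norm M (\<lambda>z. f z - u k z) + l2norm M (\<lambda>z. f z - p z)))
      \<longlonglongrightarrow> l2norm M (\<lambda>z. f z - p z)" by simp
  then show ?thesis by (rule tendsto_lowerbound) (use bd in auto)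
qed

text \<open>The substitute for pointwise boundary limits. For a Laurent polynomial it is plain
  continuity, and the norm bound on circles, being uniform in the radius, extends it to the closure
  by a three-term estimate.\<close>

lemma extends_radial_limit:
  assumes f: "f \<in> Hardy0 q" and F: "extends f F"
    and s: "\<And>k. q < s k \<and> s k < 1" "s \<longlonglongrightarrow> r" and r: "r = 1 \<or> r = q"
  shows "(\<lambda>k. l2norm angle_measure (\<lambda>t. F (of_real (s k) * cis t) - f (of_real r * cis t))) \<longlonglongrightarrow> 0"
proof (rule LIMSEQ_I)
  fix e :: real assume e: "0 < e"
  have r0: "0 < r" using r q0 by auto
  have s0: "0 < s k" for k using s(1)[of k] q0 by simp
  obtain p where p: "p \<in> laurent_polys" "l2norm M (\<lambda>z. f z - p z) < e / 3"
    using Hardy0_laurent_approx[OF f, of "e / 3"] e by auto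
  note fsi = Hardy0_square_integrable[OF f]
  note psi = square_integrable_laurent[OF p(1)]
  define A where "A = cball (0::complex) 1 - ball 0 q"
  have "compact A" unfolding A_def by (intro compact_diff compact_cball open_ball)
  moreover have pA: "continuous_on A p" by (rule continuous_on_laurent_poly[OF p(1)]) (use q0 in \<open>auto simp: A_def\<close>)
  ultimately obtain C where C: "\<And>z. z \<in> A \<Longrightarrow> cmod (p z) \<le> C"
    using compact_imp_bounded[OF compact_continuous_image] by (metis bounded_iff imageI)
  have inA: "of_real (s k) * cis t \<in> A" "of_real r * cis t \<in> A" for k t
    using s(1)[of k] s0[of k] r q0 q1 by (auto simp: A_def norm_mult)
  have "(\<lambda>k. \<integral>t. (cmod (p (of_real (s k) * cis t) - p (of_real r * cis t)))\<^sup>2 \<partial>angle_measure) \<longlonglongrightarrow> (\<integral>t. 0 \<partial>angle_measure)"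
  proof (rule integral_dominated_convergence[where w = "\<lambda>_. (C + C)\<^sup>2"])
    note m = square_integrable_measurable[OF laurent_circle_square_integrable[OF p(1)]]
    show "(\<lambda>t. (cmod (p (of_real (s k) * cis t) - p (of_real r * cis t)))\<^sup>2) \<in> borel_measurable angle_measure" for k
    proof -
      have [measurable]: "(\<lambda>t. p (of_real (s k) * cis t)) \<in> borel_measurable angle_measure"
        "(\<lambda>t. p (of_real r * cis t)) \<in> borel_measurable angle_measure"
        by (rule m[OF s0], rule m[OF r0])
      show ?thesis by measurable
    qed
    show "AE t in angle_measure. (\<lambda>k. (cmod (p (of_real (s k) * cis t) - p (of_real r * cis t)))\<^sup>2) \<longlonglongrightarrow> 0"
    proof (rule AE_I2)
      fix t
      have "(\<lambda>k. p (of_real (s k) * cis t)) \<longlonglongrightarrow> p (of_real r * cis t)"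
        by (rule continuous_on_tendsto_compose[OF pA]) (use inA in \<open>auto intro!: tendsto_intros s\<close>)
      then have "(\<lambda>k. (cmod (p (of_real (s k) * cis t) - p (of_real r * cis t)))\<^sup>2) \<longlonglongrightarrow> (cmod (p (of_real r * cis t) - p (of_real r * cis t)))\<^sup>2"
        by (intro tendsto_intros)
      then show "(\<lambda>k. (cmod (p (of_real (s k) * cis t) - p (of_real r * cis t)))\<^sup>2) \<longlonglongrightarrow> 0" by simp
    qed
    show "AE t in angle_measure. norm ((cmod (p (of_real (s k) * cis t) - p (of_real r * cis t)))\<^sup>2) \<le> (C + C)\<^sup>2" for k
    proof (rule AE_I2)
      fix t
      have "cmod (p (of_real (s k) * cis t) - p (of_real r * cis t)) \<le> C + C"
        by (rule order_trans[OF norm_triangle_ineq4 add_mono[OF C C]]) (use inA in auto)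
      from power_mono[OF this norm_ge_zero, of 2]
      show "norm ((cmod (p (of_real (s k) * cis t) - p (of_real r * cis t)))\<^sup>2) \<le> (C + C)\<^sup>2"
        by (simp only: real_norm_def abs_power2)
    qed
  qed auto
  then have "(\<lambda>k. sqrt (\<integral>t. (cmod (p (of_real (s k) * cis t) - p (of_real r * cis t)))\<^sup>2 \<partial>angle_measure)) \<longlonglongrightarrow> sqrt 0"
    by (intro tendsto_real_sqrt) simp
  then have "(\<lambda>k. l2norm angle_measure (\<lambda>t. p (of_real (s k) * cis t) - p (of_real r * cis t))) \<longlonglongrightarrow> 0"
    by (simp add: l2norm_def)
  from order_tendstoD(2)[OF this, of "e / 3"] e
  obtain N where N: "\<And>k. k \<ge> N \<Longrightarrow> l2norm angle_measure (\<lambda>t. p (of_real (s k) * cis t) - p (of_real r * cis t)) < e / 3"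
    by (auto simp: eventually_sequentially)
  show "\<exists>N. \<forall>k\<ge>N. norm (l2norm angle_measure (\<lambda>t. F (of_real (s k) * cis t) - f (of_real r * cis t)) - 0) < e"
  proof (intro exI[of _ N] allI impI)
    fix k assume k: "N \<le> k"
    have sk: "q < s k" "s k < 1" using s(1) by auto
    note si = extends_circle_square_integrable[OF F sk] laurent_circle_square_integrable[OF p(1) s0[of k]]
      laurent_circle_square_integrable[OF p(1) r0] square_integrable_param(1)[OF fsi r]
    have "l2norm angle_measure (\<lambda>t. F (of_real (s k) * cis t) - f (of_real r * cis t))
        \<le> l2norm angle_measure (\<lambda>t. F (of_real (s k) * cis t) - p (of_real (s k) * cis t))
        + l2norm angle_measure (\<lambda>t. p (of_real (s k) * cis t) - f (of_real r * cis t))"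
      by (rule l2norm_triangle_diff[OF si(1,2,4)])
    also have "l2norm angle_measure (\<lambda>t. p (of_real (s k) * cis t) - f (of_real r * cis t))
        \<le> l2norm angle_measure (\<lambda>t. p (of_real (s k) * cis t) - p (of_real r * cis t))
        + l2norm angle_measure (\<lambda>t. p (of_real r * cis t) - f (of_real r * cis t))"
      by (rule l2norm_triangle_diff[OF si(2,3,4)])
    also have "l2norm angle_measure (\<lambda>t. p (of_real r * cis t) - f (of_real r * cis t)) \<le> l2norm M (\<lambda>z. p z - f z)"
    proof (rule power2_le_imp_le)
      have d: "square_integrable M (\<lambda>z. p z - f z)" by (rule square_integrable_diff[OF psi fsi])
      show "(l2norm angle_measure (\<lambda>t. p (of_real r * cis t) - f (of_real r * cis t)))\<^sup>2 \<le> (l2norm M (\<lambda>z. p z - f z))\<^sup>2"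
        unfolding square_integrable_param(2)[OF d r] l2norm_power2[of M]
        by (rule integral_circle_le_bdry[OF square_integrable_integrable[OF d] _ r]) simp
    qed simp
    also have "l2norm M (\<lambda>z. p z - f z) = l2norm M (\<lambda>z. f z - p z)" by (rule l2norm_minus_commute)
    finally have "l2norm angle_measure (\<lambda>t. F (of_real (s k) * cis t) - f (of_real r * cis t)) < e"
      using extends_circle_norm_le[OF f F p(1) sk] p(2) N[OF k] by simp
    then show "norm (l2norm angle_measure (\<lambda>t. F (of_real (s k) * cis t) - f (of_real r * cis t)) - 0) < e" by simp
  qed
qed

text \<open>Products of approximating Laurent polynomials are, off 0, Laurent polynomials that tend
  to \<open>G * b = 1\<close> in the mean on the boundary. The evaluation bound for their difference
  from 1 transfers the identity to the annulus.\<close>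

lemma extends_mult_eq_1:
  assumes G: "G \<in> Hardy0 q" "extends G G'" and b: "b \<in> Hardy0 q" "extends b b'"
    and Gb: "AE z in M. G z * b z = 1" and z: "z \<in> annulus q"
  shows "G' z * b' z = 1"
proof -
  obtain p where p: "\<And>k. p k \<in> laurent_polys" and pl2: "(\<lambda>k. l2norm M (\<lambda>z. G z - p k z)) \<longlonglongrightarrow> 0"
    and pL1: "(\<lambda>k. \<integral>z. cmod (G z - p k z) \<partial>M) \<longlonglongrightarrow> 0"
    by (rule Hardy0_laurent_L1_approx[OF G(1)]) (rule that)
  obtain u where u: "\<And>k. u k \<in> laurent_polys" and ul2: "(\<lambda>k. l2norm M (\<lambda>z. b z - u k z)) \<longlonglongrightarrow> 0"
    and uL1: "(\<lambda>k. \<integral>z. cmod (b z - u k z) \<partial>M) \<longlonglongrightarrow> 0"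
    by (rule Hardy0_laurent_L1_approx[OF b(1)]) (rule that)
  note Gsi = Hardy0_square_integrable[OF G(1)] and bsi = Hardy0_square_integrable[OF b(1)]
  have psi: "square_integrable M (p k)" and usi: "square_integrable M (u k)" for k
    by (intro square_integrable_laurent p u)+
  have bd: "cmod (p k z * u k z - 1) \<le> eval_const (cmod z) *
      (l2norm M (\<lambda>w. G w - p k w) * (l2norm M b + l2norm M (\<lambda>w. b w - u k w)) + l2norm M G * l2norm M (\<lambda>w. b w - u k w))" for k
  proof -
    obtain t where t: "t \<in> laurent_polys" "\<And>w. w \<noteq> 0 \<Longrightarrow> t w = p k w * u k w"
      using laurent_polys_mult[OF p u] by blast
    have 1: "cmod (t z - 1) \<le> eval_const (cmod z) * (\<integral>w. cmod (t w - 1) \<partial>M)"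
      by (rule laurent_eval_bound[OF laurent_polys_diff[OF t(1) laurent_polys_const] z])
    have "(\<integral>w. cmod (t w - 1) \<partial>M) \<le> (\<integral>w. cmod (G w - p k w) * cmod (u k w) + cmod (G w) * cmod (b w - u k w) \<partial>M)"
    proof (rule integral_mono_AE)
      show "integrable M (\<lambda>w. cmod (t w - 1))"
        using integrable_of_square_integrable[OF square_integrable_laurent[OF t(1)]] by simp
      show "integrable M (\<lambda>w. cmod (G w - p k w) * cmod (u k w) + cmod (G w) * cmod (b w - u k w))"
        by (intro Bochner_Integration.integrable_add square_integrable_norm_mult square_integrable_diff Gsi bsi psi usi)
      show "AE w in M. cmod (t w - 1) \<le> cmod (G w - p k w) * cmod (u k w) + cmod (G w) * cmod (b w - u k w)"
        using Gb AE_space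
      proof eventually_elim
        case (elim w)
        then have "w \<noteq> 0" using zero_notin_bdry by auto
        then have "t w - 1 = - ((G w - p k w) * u k w + G w * (b w - u k w))"
          using elim(1) by (simp add: t(2) algebra_simps)
        then have "cmod (t w - 1) = cmod ((G w - p k w) * u k w + G w * (b w - u k w))"
          by (simp only: norm_minus_cancel)
        then show ?case by (metis norm_mult norm_triangle_ineq)
      qed
    qed
    also have "\<dots> = (\<integral>w. cmod (G w - p k w) * cmod (u k w) \<partial>M) + (\<integral>w. cmod (G w) * cmod (b w - u k w) \<partial>M)"
      by (intro Bochner_Integration.integral_add square_integrable_norm_mult square_integrable_diff Gsi bsi psi usi)
    also have "\<dots> \<le> l2norm M (\<lambda>w. G w - p k w) * l2norm M (u k) + l2norm M G * l2norm M (\<lambda>w. b w - u k w)"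
      by (intro add_mono L2_Cauchy_Schwarz square_integrable_diff Gsi bsi psi usi)
    also have "\<dots> \<le> l2norm M (\<lambda>w. G w - p k w) * (l2norm M b + l2norm M (\<lambda>w. b w - u k w)) + l2norm M G * l2norm M (\<lambda>w. b w - u k w)"
    proof (intro add_right_mono mult_left_mono l2norm_nonneg)
      have "l2norm M (u k) \<le> l2norm M b + l2norm M (\<lambda>w. u k w - b w)"
        using l2norm_triangle[OF bsi square_integrable_diff[OF usi[of k] bsi]] by simp
      then show "l2norm M (u k) \<le> l2norm M b + l2norm M (\<lambda>w. b w - u k w)"
        by (simp only: l2norm_minus_commute[of M b "u k"])
    qed
    finally have 2: "(\<integral>w. cmod (t w - 1) \<partial>M) \<le> l2norm M (\<lambda>w. G w - p k w) * (l2norm M b + l2norm M (\<lambda>w. b w - u k w)) + l2norm M G * l2norm M (\<lambda>w. b w - u k w)" .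
    from order_trans[OF 1 mult_left_mono[OF 2 eval_const_nonneg[OF annulusD(1)[OF z] annulusD(2)[OF z]]]]
    show ?thesis unfolding t(2)[OF annulusD(3)[OF z]] .
  qed
  have "(\<lambda>k. eval_const (cmod z) *
      (l2norm M (\<lambda>w. G w - p k w) * (l2norm M b + l2norm M (\<lambda>w. b w - u k w)) + l2norm M G * l2norm M (\<lambda>w. b w - u k w)))
      \<longlonglongrightarrow> eval_const (cmod z) * (0 * (l2norm M b + 0) + l2norm M G * 0)"
    by (intro tendsto_intros pl2 ul2)
  then have "(\<lambda>k. p k z * u k z - 1) \<longlonglongrightarrow> 0"
    by (intro Lim_null_comparison[OF always_eventually[OF allI[OF bd]]]) simp
  moreover have "(\<lambda>k. p k z * u k z - 1) \<longlonglongrightarrow> G' z * b' z - 1"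
    by (intro tendsto_intros extends_tendsto[OF G(2) p pL1 z] extends_tendsto[OF b(2) u uL1 z])
  ultimately have "G' z * b' z - 1 = 0" using LIMSEQ_unique by blast
  then show ?thesis by simp
qed

text \<open>From \<open>ln t \<le> t - 1\<close> for both quotients. The form is chosen because for
  moduli of an invertible function the numbers \<open>1 / x\<close> and \<open>1 / y\<close> are
  moduli of its inverse and hence square integrable.\<close>

lemma abs_ln_diff_le:
  fixes x y :: real
  assumes "0 < x" "0 < y"
  shows "\<bar>ln x - ln y\<bar> \<le> \<bar>x - y\<bar> * (1 / x + 1 / y)"
proof -
  have "ln x - ln y = ln (x / y)" "ln y - ln x = ln (y / x)" using assms by (simp_all add: ln_div)
  then have "ln x - ln y \<le> x / y - 1" "ln y - ln x \<le> y / x - 1"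
    using assms by (simp_all only: ln_le_minus_one divide_pos_pos)
  moreover have "x / y - 1 = (x - y) * (1 / y)" "y / x - 1 = (y - x) * (1 / x)"
    using assms by (simp_all add: field_simps)
  moreover have "(x - y) * (1 / y) \<le> \<bar>x - y\<bar> * (1 / y)" "(y - x) * (1 / x) \<le> \<bar>x - y\<bar> * (1 / x)"
    using assms by (intro mult_right_mono; simp)+
  moreover have "0 \<le> \<bar>x - y\<bar> * (1 / y)" "0 \<le> \<bar>x - y\<bar> * (1 / x)" using assms by simp_all
  ultimately show ?thesis unfolding distrib_left by linarith
qed

lemma abs_ln_le: "0 < x \<Longrightarrow> \<bar>ln x\<bar> \<le> x + 1 / x" for x :: real
proof -
  assume x: "0 < x"
  have "ln x \<le> x - 1" "ln (1 / x) \<le> 1 / x - 1" using x by (intro ln_le_minus_one; simp)+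
  moreover have "0 < 1 / x" "ln (1 / x) = - ln x" using x by (simp_all add: ln_div)
  ultimately show ?thesis using x unfolding abs_le_iff by linarith
qed

text \<open>Large values of the modulus are controlled by \<open>G\<close> and small ones by its
  inverse \<open>b\<close>, since \<open>\<bar>ln x\<bar> \<le> x + 1 / x\<close>.\<close>

lemma invertible_log_integrable:
  assumes G: "square_integrable M G" and b: "square_integrable M b" and Gb: "AE z in M. G z * b z = 1"
  shows "integrable M (\<lambda>z. ln (cmod (G z)))"
proof (rule Bochner_Integration.integrable_bound)
  show "integrable M (\<lambda>z. cmod (G z) + cmod (b z))"
    using integrable_of_square_integrable[OF G] integrable_of_square_integrable[OF b] by simp
  have [measurable]: "G \<in> borel_measurable M" by (rule square_integrable_measurable[OF G])
  show "(\<lambda>z. ln (cmod (G z))) \<in> borel_measurable M" by measurable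
  show "AE z in M. norm (ln (cmod (G z))) \<le> norm (cmod (G z) + cmod (b z))"
    using Gb
  proof eventually_elim
    case (elim z)
    then have "G z \<noteq> 0" by auto
    moreover have "cmod (G z) * cmod (b z) = 1" using elim by (simp add: norm_mult[symmetric])
    ultimately have "cmod (b z) = 1 / cmod (G z)" by (simp add: field_simps)
    then show ?case using abs_ln_le[of "cmod (G z)"] \<open>G z \<noteq> 0\<close> by simp
  qed
qed

text \<open>Inside the annulus the extension of \<open>G\<close> has no zeros and the logarithmic
  means are affine in \<open>ln s\<close> with slope \<open>2 * pi * of_int n\<close>. The work lies
  in passing to the boundary although the logarithm is unbounded.\<close>

lemma invertible_log_mean:
  assumes G: "G \<in> Hardy0 q" and b: "b \<in> Hardy0 q" and Gb: "AE z in M. G z * b z = 1"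
  obtains n :: int where
    "(\<integral>z. ln (cmod (G z)) \<partial>circle_measure 1) - (\<integral>z. ln (cmod (G z)) \<partial>circle_measure q) = 2 * pi * of_int n * ln q"
proof -
  note Gsi = Hardy0_square_integrable[OF G] and bsi = Hardy0_square_integrable[OF b]
  obtain G' b' where G': "extends G G'" and b': "extends b b'"
    using Hardy0_extends[OF G] Hardy0_extends[OF b] by metis
  have one: "G' z * b' z = 1" if "z \<in> annulus q" for z
    by (rule extends_mult_eq_1[OF G G' b b' Gb that])
  have "G' holomorphic_on annulus q" using G' by (simp add: extends_def)
  moreover have "G' z \<noteq> 0" if "z \<in> annulus q" for z using one[OF that] by auto
  ultimately obtain n :: int and c :: real where
    nc: "\<And>s. q < s \<Longrightarrow> s < 1 \<Longrightarrow> (\<integral>t. ln (cmod (G' (of_real s * cis t))) \<partial>angle_measure) = 2 * pi * of_int n * ln s + c"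
    by (rule zero_free_log_mean) (assumption, rule that)
  have main: "(\<integral>z. ln (cmod (G z)) \<partial>circle_measure r) = 2 * pi * of_int n * ln r + c"
    if s: "\<And>k. q < s k \<and> s k < 1" "s \<longlonglongrightarrow> r" and r: "r = 1 \<or> r = q" for s :: "nat \<Rightarrow> real" and r
  proof -
    have r0: "0 < r" using r q0 by auto
    have s0: "0 < s k" for k using s(1)[of k] q0 by simp
    note Gr = square_integrable_param(1)[OF Gsi r] and br = square_integrable_param(1)[OF bsi r]
    have Gs: "square_integrable angle_measure (\<lambda>t. G' (of_real (s k) * cis t))"
      and bs: "square_integrable angle_measure (\<lambda>t. b' (of_real (s k) * cis t))" for k
      using extends_circle_square_integrable[OF G'] extends_circle_square_integrable[OF b'] s(1) by auto
    have AEr: "AE t in angle_measure. G (of_real r * cis t) * b (of_real r * cis t) = 1"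
    proof -
      have "AE z in circle_measure r. G z * b z = 1" using Gb r by (auto simp: AE_bdry_iff)
      then show ?thesis by (rule AE_circle_measure_param[OF r0])
    qed
    have lnG: "integrable M (\<lambda>z. ln (cmod (G z)))"
      by (rule invertible_log_integrable[OF Gsi bsi Gb])
    then have lnGr: "integrable (circle_measure r) (\<lambda>z. ln (cmod (G z)))"
      using r by (auto simp: integrable_bdry_iff)
    have lnGt: "integrable angle_measure (\<lambda>t. ln (cmod (G (of_real r * cis t))))"
      using integrable_circle_measure_iff[OF r0 borel_measurable_integrable[OF lnGr]] lnGr by simp
    have lnGs: "integrable angle_measure (\<lambda>t. ln (cmod (G' (of_real (s k) * cis t))))" for k
    proof (rule angle_integral_continuous(1))
      have "continuous_on (annulus q) G'"
        using G' by (intro holomorphic_on_imp_continuous_on) (simp add: extends_def)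
      then have "continuous_on {0..2*pi} (\<lambda>t. G' (of_real (s k) * cis t))"
        by (rule continuous_on_compose2) (use circle_subset_annulus s(1) in \<open>auto intro!: continuous_intros\<close>)
      moreover have "G' (of_real (s k) * cis t) \<noteq> 0" for t
        using one[OF circle_subset_annulus[of "s k" t]] s(1)[of k] by auto
      ultimately show "continuous_on {0..2*pi} (\<lambda>t. ln (cmod (G' (of_real (s k) * cis t))))"
        by (intro continuous_intros) auto
    qed
    define E where "E k = l2norm angle_measure (\<lambda>t. G' (of_real (s k) * cis t) - G (of_real r * cis t))" for k
    have E: "E \<longlonglongrightarrow> 0" unfolding E_def by (rule extends_radial_limit[OF G G' s r])
    \<comment> \<open>The factor \<open>1 / x + 1 / y\<close> in the estimate for logarithms is the
      sum of the moduli of \<open>b'\<close> and \<open>b\<close> on the two circles. Their norms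
      are bounded independently of \<open>k\<close>, so Cauchy-Schwarz leaves a fixed multiple of
      \<open>E k\<close>.\<close>
    have bd: "\<bar>(2 * pi * of_int n * ln (s k) + c) - (\<integral>t. ln (cmod (G (of_real r * cis t))) \<partial>angle_measure)\<bar>
        \<le> E k * (l2norm M b + l2norm angle_measure (\<lambda>t. b (of_real r * cis t)))" for k
    proof -
      have dsi: "square_integrable angle_measure (\<lambda>t. G' (of_real (s k) * cis t) - G (of_real r * cis t))"
        by (rule square_integrable_diff[OF Gs Gr])
      have "\<bar>(2 * pi * of_int n * ln (s k) + c) - (\<integral>t. ln (cmod (G (of_real r * cis t))) \<partial>angle_measure)\<bar>
          = \<bar>\<integral>t. ln (cmod (G' (of_real (s k) * cis t))) - ln (cmod (G (of_real r * cis t))) \<partial>angle_measure\<bar>"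
        using nc[of "s k"] s(1)[of k] lnGs lnGt by simp
      also have "\<dots> \<le> (\<integral>t. \<bar>ln (cmod (G' (of_real (s k) * cis t))) - ln (cmod (G (of_real r * cis t)))\<bar> \<partial>angle_measure)"
        by (rule integral_abs_bound)
      also have "\<dots> \<le> (\<integral>t. cmod (G' (of_real (s k) * cis t) - G (of_real r * cis t)) * cmod (b' (of_real (s k) * cis t))
          + cmod (G' (of_real (s k) * cis t) - G (of_real r * cis t)) * cmod (b (of_real r * cis t)) \<partial>angle_measure)"
      proof (rule integral_mono_AE)
        show "integrable angle_measure (\<lambda>t. \<bar>ln (cmod (G' (of_real (s k) * cis t))) - ln (cmod (G (of_real r * cis t)))\<bar>)"
          using lnGs lnGt by simp
        show "integrable angle_measure (\<lambda>t. cmod (G' (of_real (s k) * cis t) - G (of_real r * cis t)) * cmod (b' (of_real (s k) * cis t))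
          + cmod (G' (of_real (s k) * cis t) - G (of_real r * cis t)) * cmod (b (of_real r * cis t)))"
          by (intro Bochner_Integration.integrable_add square_integrable_norm_mult dsi bs br)
        show "AE t in angle_measure. \<bar>ln (cmod (G' (of_real (s k) * cis t))) - ln (cmod (G (of_real r * cis t)))\<bar>
            \<le> cmod (G' (of_real (s k) * cis t) - G (of_real r * cis t)) * cmod (b' (of_real (s k) * cis t))
              + cmod (G' (of_real (s k) * cis t) - G (of_real r * cis t)) * cmod (b (of_real r * cis t))"
          using AEr
        proof eventually_elim
          case (elim t)
          define x y where "x = cmod (G' (of_real (s k) * cis t))" and "y = cmod (G (of_real r * cis t))"
          have 1: "x * cmod (b' (of_real (s k) * cis t)) = 1"
            using one[OF circle_subset_annulus[of "s k" t]] s(1)[of k] by (simp add: x_def norm_mult[symmetric])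
          have 2: "y * cmod (b (of_real r * cis t)) = 1"
            using elim by (simp add: y_def norm_mult[symmetric])
          have xy: "0 < x" "0 < y" using 1 2 by (auto simp: x_def y_def)
          have inv: "cmod (b' (of_real (s k) * cis t)) = 1 / x" "cmod (b (of_real r * cis t)) = 1 / y"
            using 1 2 xy by (simp_all add: field_simps)
          have "\<bar>ln x - ln y\<bar> \<le> \<bar>x - y\<bar> * (1 / x + 1 / y)" by (rule abs_ln_diff_le[OF xy])
          also have "\<dots> \<le> cmod (G' (of_real (s k) * cis t) - G (of_real r * cis t)) * (1 / x + 1 / y)"
            unfolding x_def y_def by (intro mult_right_mono norm_triangle_ineq3) auto
          finally show ?case unfolding inv by (simp add: x_def y_def distrib_left)
        qed
      qed
      also have "\<dots> = (\<integral>t. cmod (G' (of_real (s k) * cis t) - G (of_real r * cis t)) * cmod (b' (of_real (s k) * cis t)) \<partial>angle_measure)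
          + (\<integral>t. cmod (G' (of_real (s k) * cis t) - G (of_real r * cis t)) * cmod (b (of_real r * cis t)) \<partial>angle_measure)"
        by (intro Bochner_Integration.integral_add square_integrable_norm_mult dsi bs br)
      also have "\<dots> \<le> E k * l2norm angle_measure (\<lambda>t. b' (of_real (s k) * cis t)) + E k * l2norm angle_measure (\<lambda>t. b (of_real r * cis t))"
        unfolding E_def by (intro add_mono L2_Cauchy_Schwarz dsi bs br)
      also have "l2norm angle_measure (\<lambda>t. b' (of_real (s k) * cis t)) \<le> l2norm M b"
        using extends_circle_norm_le[OF b b' laurent_polys_0, of "s k"] s(1)[of k] by simp
      finally show ?thesis by (simp add: distrib_left E_def mult_left_mono)
    qed
    have "(\<lambda>k. (2 * pi * of_int n * ln (s k) + c) - (\<integral>t. ln (cmod (G (of_real r * cis t))) \<partial>angle_measure)) \<longlonglongrightarrow> 0"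
    proof (rule Lim_null_comparison)
      show "\<forall>\<^sub>F k in sequentially. norm ((2 * pi * of_int n * ln (s k) + c) - (\<integral>t. ln (cmod (G (of_real r * cis t))) \<partial>angle_measure))
          \<le> E k * (l2norm M b + l2norm angle_measure (\<lambda>t. b (of_real r * cis t)))"
        using bd by simp
      show "(\<lambda>k. E k * (l2norm M b + l2norm angle_measure (\<lambda>t. b (of_real r * cis t)))) \<longlonglongrightarrow> 0"
        by (rule tendsto_mult_left_zero[OF E])
    qed
    moreover have "(\<lambda>k. (2 * pi * of_int n * ln (s k) + c) - (\<integral>t. ln (cmod (G (of_real r * cis t))) \<partial>angle_measure))
        \<longlonglongrightarrow> (2 * pi * of_int n * ln r + c) - (\<integral>t. ln (cmod (G (of_real r * cis t))) \<partial>angle_measure)"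
      by (intro tendsto_intros s) (use r0 in simp)
    ultimately have "(2 * pi * of_int n * ln r + c) - (\<integral>t. ln (cmod (G (of_real r * cis t))) \<partial>angle_measure) = 0"
      using LIMSEQ_unique by blast
    then show ?thesis
      using integral_circle_measure[OF r0 borel_measurable_integrable[OF lnGr]] by simp
  qed
  obtain s where s: "\<And>k::nat. q < s k \<and> s k < 1" "s \<longlonglongrightarrow> 1" by (rule radii_to_outer) (rule that)
  obtain s' where s': "\<And>k::nat. q < s' k \<and> s' k < 1" "s' \<longlonglongrightarrow> q" by (rule radii_to_inner) (rule that)
  \<comment> \<open>On the outer circle the logarithm of the radius is 0, so the difference is minus
    the term of the inner circle; hence the witness \<open>- n\<close>.\<close>
  show ?thesis using main[OF s] main[OF s'] by (intro that[of "- n"]) simp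
qed

end

section \<open>Toeplitz kernels\<close>

lemma cmod_chi_pow: "cmod (chi_pow \<alpha> z) = cmod z powr \<alpha>"
  by (simp add: chi_pow_def norm_mult)

text \<open>Includes exponent 0, because \<open>0 powr 0\<close> is 0.\<close>

lemma chi_pow_eq_0_iff: "chi_pow \<alpha> z = 0 \<longleftrightarrow> z = 0"
  by (simp add: chi_pow_def)

lemma chi_pow_add: "chi_pow (\<alpha> + \<beta>) z = chi_pow \<alpha> z * chi_pow \<beta> z"
  by (simp add: chi_pow_def powr_add cis_mult[symmetric] distrib_right)

lemma borel_measurable_chi_pow: "chi_pow \<alpha> \<in> borel_measurable borel"
proof -
  have "(\<lambda>x. cis (\<alpha> * x)) \<in> borel_measurable borel"
    by (intro borel_measurable_continuous_onI continuous_intros)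
  then have "(\<lambda>z. cis (\<alpha> * Arg2pi z)) \<in> borel_measurable borel"
    by (rule measurable_compose[OF borel_measurable_Arg2pi])
  then show ?thesis unfolding chi_pow_def[abs_def] by measurable
qed

text \<open>For \<open>\<gamma> \<noteq> 0\<close> the imaginary part of the mean is
  \<open>(1 - cos (\<gamma> * (2 * pi))) / \<gamma>\<close>, which vanishes only at integers. The
  mean of the branch on a circle is thus an invariant that detects its exponent.\<close>

lemma mean_chi_pow_nonzero:
  assumes "\<bar>\<gamma>\<bar> < 1"
  shows "(\<integral>t. cis (\<gamma> * t) \<partial>angle_measure) \<noteq> 0"
proof (cases "\<gamma> = 0")
  case True
  then show ?thesis by (simp add: measure_angle_measure scaleR_conv_of_real)
next
  case False
  have "((\<lambda>t. sin (\<gamma> * t)) has_integral - cos (\<gamma> * (2 * pi)) / \<gamma> - - cos (\<gamma> * 0) / \<gamma>) {0..2*pi}"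
  proof (rule fundamental_theorem_of_calculus)
    fix t
    have "((\<lambda>t. - cos (\<gamma> * t) / \<gamma>) has_real_derivative sin (\<gamma> * t)) (at t within {0..2*pi})"
      using False by (auto intro!: derivative_eq_intros)
    then show "((\<lambda>t. - cos (\<gamma> * t) / \<gamma>) has_vector_derivative sin (\<gamma> * t)) (at t within {0..2*pi})"
      by (simp add: has_real_derivative_iff_has_vector_derivative)
  qed simp
  then have "integral {0..2*pi} (\<lambda>t. sin (\<gamma> * t)) = (1 - cos (\<gamma> * (2 * pi))) / \<gamma>"
    by (simp add: integral_unique diff_divide_distrib)
  moreover have "cos (\<gamma> * (2 * pi)) \<noteq> 1"
  proof
    assume "cos (\<gamma> * (2 * pi)) = 1"
    then obtain n :: int where "\<gamma> * (2 * pi) = of_int n * 2 * pi" by (auto simp: cos_one_2pi_int)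
    then have n: "\<gamma> = of_int n" by simp
    then have "\<bar>n\<bar> < 1" using assms by linarith
    with n False show False by simp
  qed
  ultimately have nz: "(\<integral>t. sin (\<gamma> * t) \<partial>angle_measure) \<noteq> 0"
    using False by (subst angle_integral_continuous(2)) (auto intro!: continuous_intros)
  have "integrable angle_measure (\<lambda>t. cis (\<gamma> * t))"
    by (intro angle_integral_continuous(1) continuous_intros)
  then have "Im (\<integral>t. cis (\<gamma> * t) \<partial>angle_measure) = (\<integral>t. sin (\<gamma> * t) \<partial>angle_measure)"
    using integral_Im by fastforce
  with nz show ?thesis by auto
qed

context annulus_boundary
begin

lemma bdry_cases:
  assumes "z \<in> bdry q"
  obtains "cmod z = 1" | "cmod z = q"
  using assms by (auto simp: bdry_def)

lemma cmod_chi_pow_bdry: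
  assumes "z \<in> bdry q" "0 \<le> \<alpha>"
  shows "cmod (chi_pow \<alpha> z) \<le> 1" "q powr \<alpha> \<le> cmod (chi_pow \<alpha> z)"
  using assms q0 q1 by (auto simp: bdry_def cmod_chi_pow powr_le1)

lemma chi_pow_measurable [measurable]: "chi_pow \<alpha> \<in> borel_measurable M"
  using measurable_restrict_space1[OF borel_measurable_chi_pow, where \<Omega> = "bdry q"]
    measurable_cong_sets[OF sets_bdry_measure refl] by blast

lemma Hardy_iff:
  "g \<in> Hardy q \<alpha> \<longleftrightarrow> square_integrable M g \<and> (\<exists>G\<in>Hardy0 q. AE z in M. g z = chi_pow \<alpha> z * G z)"
  by (simp add: Hardy_def L2_bdry_iff)

lemma Hardy_square_integrable: "g \<in> Hardy q \<alpha> \<Longrightarrow> square_integrable M g"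
  by (simp add: Hardy_iff)

lemma square_integrable_chi_pow_mult:
  assumes "square_integrable M G" "0 \<le> \<alpha>"
  shows "square_integrable M (\<lambda>z. chi_pow \<alpha> z * G z)"
proof (rule square_integrable_bound[OF assms(1)])
  have [measurable]: "G \<in> borel_measurable M" by (rule square_integrable_measurable[OF assms(1)])
  show "(\<lambda>z. chi_pow \<alpha> z * G z) \<in> borel_measurable M" by measurable
  show "AE z in M. cmod (chi_pow \<alpha> z * G z) \<le> 1 * cmod (G z)"
  proof (rule AE_I2)
    fix z assume "z \<in> space M"
    then show "cmod (chi_pow \<alpha> z * G z) \<le> 1 * cmod (G z)"
      unfolding norm_mult using cmod_chi_pow_bdry(1)[OF _ assms(2)] by (intro mult_right_mono) auto
  qed
qed

lemma chi_pow_mult_Hardy: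
  "G \<in> Hardy0 q \<Longrightarrow> 0 \<le> \<alpha> \<Longrightarrow> (\<lambda>z. chi_pow \<alpha> z * G z) \<in> Hardy q \<alpha>"
  unfolding Hardy_iff by (intro conjI square_integrable_chi_pow_mult Hardy0_square_integrable bexI[of _ G]) auto

lemma Hardy0_add: "f \<in> Hardy0 q \<Longrightarrow> g \<in> Hardy0 q \<Longrightarrow> (\<lambda>z. f z + g z) \<in> Hardy0 q"
  by (simp add: Hardy0_iff square_integrable_add balanced_add)

lemma Hardy0_cmult: "f \<in> Hardy0 q \<Longrightarrow> (\<lambda>z. c * f z) \<in> Hardy0 q"
  by (simp add: Hardy0_iff square_integrable_cmult balanced_cmult)

lemma Hardy0_powi_mult: "f \<in> Hardy0 q \<Longrightarrow> (\<lambda>z. z powi n * f z) \<in> Hardy0 q"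
  by (simp add: Hardy0_iff square_integrable_continuous_mult balanced_powi_mult continuous_on_powi_bdry)

lemma Hardy0_closed:
  assumes f: "square_integrable M f" and lim: "\<And>e. 0 < e \<Longrightarrow> \<exists>s\<in>Hardy0 q. l2norm M (\<lambda>z. f z - s z) < e"
  shows "f \<in> Hardy0 q"
proof -
  have "balanced f"
  proof (rule balanced_limit[OF integrable_of_square_integrable[OF f]])
    fix e :: real assume e: "0 < e"
    obtain s where s: "s \<in> Hardy0 q" "l2norm M (\<lambda>z. f z - s z) < e / sqrt (4 * pi)"
      using lim[of "e / sqrt (4 * pi)"] e by auto
    have "(\<integral>z. cmod (f z - s z) \<partial>M) \<le> sqrt (4 * pi) * l2norm M (\<lambda>z. f z - s z)"
      by (intro L1_le_l2norm_bdry square_integrable_diff f Hardy0_square_integrable s)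
    also have "\<dots> < sqrt (4 * pi) * (e / sqrt (4 * pi))" by (rule mult_strict_left_mono[OF s(2)]) simp
    finally show "\<exists>g. balanced g \<and> (\<integral>z. cmod (f z - g z) \<partial>M) < e"
      using Hardy0_balanced[OF s(1)] by (intro exI[of _ s]) simp
  qed
  with f show ?thesis by (simp add: Hardy0_iff)
qed

lemma Hardy_add:
  assumes "f \<in> Hardy q \<alpha>" "g \<in> Hardy q \<alpha>"
  shows "(\<lambda>z. f z + g z) \<in> Hardy q \<alpha>"
proof -
  obtain F G where FG: "F \<in> Hardy0 q" "AE z in M. f z = chi_pow \<alpha> z * F z"
    "G \<in> Hardy0 q" "AE z in M. g z = chi_pow \<alpha> z * G z"
    using assms unfolding Hardy_iff by blast
  have "AE z in M. f z + g z = chi_pow \<alpha> z * (F z + G z)"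
    using FG(2,4) by eventually_elim (simp add: distrib_left)
  with Hardy0_add[OF FG(1,3)] assms show ?thesis
    unfolding Hardy_iff by (intro conjI square_integrable_add bexI[of _ "\<lambda>z. F z + G z"]) auto
qed

lemma Hardy_cmult:
  assumes "f \<in> Hardy q \<alpha>"
  shows "(\<lambda>z. c * f z) \<in> Hardy q \<alpha>"
proof -
  obtain F where F: "F \<in> Hardy0 q" "AE z in M. f z = chi_pow \<alpha> z * F z"
    using assms unfolding Hardy_iff by blast
  have "AE z in M. c * f z = chi_pow \<alpha> z * (c * F z)"
    using F(2) by eventually_elim simp
  with Hardy0_cmult[OF F(1)] assms show ?thesis
    unfolding Hardy_iff by (intro conjI square_integrable_cmult bexI[of _ "\<lambda>z. c * F z"]) auto
qed

lemma Hardy_0: "(\<lambda>z. 0) \<in> Hardy q \<alpha>"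
  unfolding Hardy_iff
  by (intro conjI bexI[of _ "\<lambda>z. 0"] laurent_in_Hardy0[OF laurent_polys_0]) auto

text \<open>On the boundary the modulus of \<open>chi_pow \<alpha>\<close> lies between
  \<open>q powr \<alpha>\<close> and 1, so division by it preserves norm convergence and the case of
  index 0 applies.\<close>

lemma Hardy_closed:
  assumes \<alpha>: "0 \<le> \<alpha>" and f: "square_integrable M f"
    and lim: "\<And>e. 0 < e \<Longrightarrow> \<exists>s\<in>Hardy q \<alpha>. l2norm M (\<lambda>z. f z - s z) < e"
  shows "f \<in> Hardy q \<alpha>"
proof -
  define F where "F z = f z / chi_pow \<alpha> z" for z
  have [measurable]: "f \<in> borel_measurable M" by (rule square_integrable_measurable[OF f])
  have Fm[measurable]: "F \<in> borel_measurable M" unfolding F_def by measurable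
  define B where "B = inverse (q powr \<alpha>)"
  have B: "0 < B" using q0 by (simp add: B_def)
  have inv: "cmod (inverse (chi_pow \<alpha> z)) \<le> B" if "z \<in> bdry q" for z
    using cmod_chi_pow_bdry(2)[OF that \<alpha>] q0 unfolding B_def norm_inverse by (intro le_imp_inverse_le) auto
  have Fsi: "square_integrable M F"
  proof (rule square_integrable_bound[OF f Fm])
    show "AE z in M. cmod (F z) \<le> B * cmod (f z)"
    proof (rule AE_I2)
      fix z assume "z \<in> space M"
      then have "cmod (f z) * cmod (inverse (chi_pow \<alpha> z)) \<le> cmod (f z) * B"
        by (intro mult_left_mono inv) auto
      then show "cmod (F z) \<le> B * cmod (f z)"
        by (simp add: F_def divide_inverse norm_mult norm_inverse mult.commute)
    qed
  qed
  have "F \<in> Hardy0 q"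
  proof (rule Hardy0_closed[OF Fsi])
    fix e :: real assume e: "0 < e"
    obtain s where s: "s \<in> Hardy q \<alpha>" "l2norm M (\<lambda>z. f z - s z) < e / B"
      using lim[of "e / B"] e B by auto
    obtain S where S: "S \<in> Hardy0 q" "AE z in M. s z = chi_pow \<alpha> z * S z"
      using s(1) unfolding Hardy_iff by blast
    have "l2norm M (\<lambda>z. F z - S z) \<le> B * l2norm M (\<lambda>z. f z - s z)"
    proof (rule l2norm_mono)
      show "square_integrable M (\<lambda>z. f z - s z)" by (intro square_integrable_diff f Hardy_square_integrable[OF s(1)])
      show "(\<lambda>z. F z - S z) \<in> borel_measurable M"
        using Fm square_integrable_measurable[OF Hardy0_square_integrable[OF S(1)]] by measurable
      show "AE z in M. cmod (F z - S z) \<le> B * cmod (f z - s z)"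
        using S(2) AE_space
      proof eventually_elim
        case (elim z)
        then have z: "z \<in> bdry q" "chi_pow \<alpha> z \<noteq> 0" using zero_notin_bdry by (auto simp: chi_pow_eq_0_iff)
        have "F z - S z = (f z - s z) * inverse (chi_pow \<alpha> z)"
          using elim(1) z(2) by (simp add: F_def field_simps)
        then have "cmod (F z - S z) = cmod (f z - s z) * cmod (inverse (chi_pow \<alpha> z))" by (simp only: norm_mult)
        also have "\<dots> \<le> cmod (f z - s z) * B" by (intro mult_left_mono inv z) auto
        finally show ?case by (simp add: mult.commute)
      qed
      show "0 \<le> B" using B by simp
    qed
    also have "\<dots> < B * (e / B)" by (rule mult_strict_left_mono[OF s(2) B])
    finally show "\<exists>s\<in>Hardy0 q. l2norm M (\<lambda>z. F z - s z) < e" using S(1) B by auto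
  qed
  moreover have "AE z in M. f z = chi_pow \<alpha> z * F z"
  proof (rule AE_I2)
    fix z assume "z \<in> space M"
    then have "chi_pow \<alpha> z \<noteq> 0" using zero_notin_bdry by (auto simp: chi_pow_eq_0_iff)
    then show "f z = chi_pow \<alpha> z * F z" by (simp add: F_def)
  qed
  ultimately show ?thesis using f unfolding Hardy_iff by blast
qed

section \<open>Toeplitz operators and the weight equation\<close>

lemma Linf_mult_square_integrable:
  assumes "\<phi> \<in> Linf_real_bdry q" "square_integrable M g"
  shows "square_integrable M (\<lambda>z. complex_of_real (\<phi> z) * g z)"
proof -
  obtain C where C: "AE z in M. \<bar>\<phi> z\<bar> \<le> C" and [measurable]: "\<phi> \<in> borel_measurable M"
    using assms(1) by (auto simp: Linf_real_bdry_def)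
  have [measurable]: "g \<in> borel_measurable M" by (rule square_integrable_measurable[OF assms(2)])
  show ?thesis
  proof (rule square_integrable_bound[OF assms(2)])
    show "AE z in M. cmod (complex_of_real (\<phi> z) * g z) \<le> C * cmod (g z)"
      using C by eventually_elim (simp add: norm_mult mult_right_mono)
  qed measurable
qed

text \<open>The projection is given by a choice operator, so its existence must be established
  before anything can be said about its value. Afterwards every statement about kernels is one about
  inner products; for the converse direction the projection is tested against itself.\<close>

lemma toeplitz_eq_0_iff:
  assumes \<phi>: "\<phi> \<in> Linf_real_bdry q" and \<alpha>: "0 \<le> \<alpha>" and g: "g \<in> Hardy q \<alpha>"
  shows "(AE z in M. toeplitz q \<phi> \<alpha> g z = 0) \<longleftrightarrow>
    (\<forall>k\<in>Hardy q \<alpha>. (\<integral>z. complex_of_real (\<phi> z) * g z * cnj (k z) \<partial>M) = 0)"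
proof -
  define f where "f z = complex_of_real (\<phi> z) * g z" for z
  have f: "square_integrable M f"
    unfolding f_def by (rule Linf_mult_square_integrable[OF \<phi> Hardy_square_integrable[OF g]])
  define P where "P h \<longleftrightarrow> h \<in> Hardy q \<alpha> \<and> (\<forall>k\<in>Hardy q \<alpha>. (\<integral>z. (f z - h z) * cnj (k z) \<partial>M) = 0)" for h
  define h where "h = toeplitz q \<phi> \<alpha> g"
  have h_eq: "h = (SOME h. P h)"
    by (simp add: h_def toeplitz_def Hardy_proj_def P_def L2_inner_def f_def[abs_def])
  have "\<exists>h. P h"
  proof -
    obtain h where "h \<in> Hardy q \<alpha>" "\<And>k. k \<in> Hardy q \<alpha> \<Longrightarrow> (\<integral>z. (f z - h z) * cnj (k z) \<partial>M) = 0"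
    proof (rule L2_projection[of "Hardy q \<alpha>" f])
      show "Hardy q \<alpha> \<noteq> {}" using Hardy_0 by blast
      show "square_integrable M f" by (rule f)
      fix h assume "h \<in> Hardy q \<alpha>" "\<And>k. k \<in> Hardy q \<alpha> \<Longrightarrow> (\<integral>z. (f z - h z) * cnj (k z) \<partial>M) = 0"
      then show thesis by (rule that)
    qed (auto intro: Hardy_square_integrable Hardy_add Hardy_cmult Hardy_closed[OF \<alpha>])
    then show ?thesis unfolding P_def by blast
  qed
  then have "P h" unfolding h_eq by (rule someI_ex)
  then have h: "h \<in> Hardy q \<alpha>" and orth: "\<And>k. k \<in> Hardy q \<alpha> \<Longrightarrow> (\<integral>z. (f z - h z) * cnj (k z) \<partial>M) = 0"
    by (auto simp: P_def)
  have hsi: "square_integrable M h" by (rule Hardy_square_integrable[OF h])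
  have fk: "(\<integral>z. f z * cnj (k z) \<partial>M) = (\<integral>z. h z * cnj (k z) \<partial>M)" if k: "k \<in> Hardy q \<alpha>" for k
  proof -
    have ksi: "square_integrable M (\<lambda>z. cnj (k z))"
      by (rule square_integrable_cnj[OF Hardy_square_integrable[OF k]])
    show ?thesis
      using orth[OF k] square_integrable_mult[OF f ksi] square_integrable_mult[OF hsi ksi]
      by (simp add: left_diff_distrib)
  qed
  show ?thesis
    unfolding h_def[symmetric] f_def[symmetric]
  proof
    assume "AE z in M. h z = 0"
    then show "\<forall>k\<in>Hardy q \<alpha>. (\<integral>z. f z * cnj (k z) \<partial>M) = 0"
      by (auto simp: fk intro!: integral_eq_zero_AE elim!: eventually_mono)
  next
    assume *: "\<forall>k\<in>Hardy q \<alpha>. (\<integral>z. f z * cnj (k z) \<partial>M) = 0"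
    then have "(\<integral>z. h z * cnj (h z) \<partial>M) = 0" using fk[OF h] h by auto
    then have "complex_of_real (\<integral>z. (cmod (h z))\<^sup>2 \<partial>M) = 0"
      by (simp only: complex_norm_square integral_complex_of_real[symmetric])
    then have "l2norm M h = 0" by (simp add: l2norm_def)
    then show "AE z in M. h z = 0" by (rule l2norm_zero_AE[OF hsi])
  qed
qed

text \<open>The right-hand side of the weight equation up to the factor \<open>c\<close>. On the
  boundary it takes just two opposite values, \<open>- ln q / 2\<close> on the outer circle and
  \<open>ln q / 2\<close> on the inner one, and only these matter.\<close>

definition log_weight :: "complex \<Rightarrow> real" where
  "log_weight z = ln (cmod (z * complex_of_real (q powr (-1/2))))"

lemma log_weight_circle:
  "cmod z = 1 \<Longrightarrow> log_weight z = - ln q / 2" "cmod z = q \<Longrightarrow> log_weight z = ln q / 2"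
  using q0 by (auto simp: log_weight_def norm_mult ln_mult ln_powr)

lemma log_weight_nonzero: "z \<in> bdry q \<Longrightarrow> log_weight z \<noteq> 0"
  using q0 q1 by (elim bdry_cases) (auto simp: log_weight_circle)

lemma log_weight_measurable [measurable]: "log_weight \<in> borel_measurable M"
proof -
  have "continuous_on (bdry q) (\<lambda>z. ln (cmod (z * complex_of_real (q powr (-1/2)))))"
    using q0 by (intro continuous_intros) (auto simp: bdry_def)
  then show ?thesis unfolding log_weight_def[abs_def] by (rule borel_measurable_bdry_continuous)
qed

lemma orthogonal_imp_log_weight:
  assumes \<phi>: "\<phi> \<in> Linf_real_bdry q" and \<phi>0: "\<not> (AE z in M. \<phi> z = 0)" and \<alpha>: "0 \<le> \<alpha>"
    and g: "g \<in> Hardy q \<alpha>" and g0: "\<not> (AE z in M. g z = 0)"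
    and orth: "\<And>k. k \<in> Hardy q \<alpha> \<Longrightarrow> (\<integral>z. complex_of_real (\<phi> z) * g z * cnj (k z) \<partial>M) = 0"
  obtains c :: real where "c \<noteq> 0" "AE z in M. \<phi> z * (cmod (g z))\<^sup>2 = c * log_weight z"
proof -
  obtain G where G: "G \<in> Hardy0 q" and gG: "AE z in M. g z = chi_pow \<alpha> z * G z"
    using g unfolding Hardy_iff by blast
  note gsi = Hardy_square_integrable[OF g]
  have [measurable]: "\<phi> \<in> borel_measurable M" "g \<in> borel_measurable M"
    using \<phi> square_integrable_measurable[OF gsi] by (auto simp: Linf_real_bdry_def)
  define u where "u z = complex_of_real (\<phi> z * (cmod (g z))\<^sup>2)" for z
  have u_eq: "u z = complex_of_real (\<phi> z) * g z * cnj (g z)" for z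
    by (simp add: u_def complex_norm_square mult.assoc del: of_real_power)
  have ui: "integrable M u"
    unfolding u_eq[abs_def]
    by (intro square_integrable_mult Linf_mult_square_integrable \<phi> gsi square_integrable_cnj)
  \<comment> \<open>The function \<open>z powi n * g z\<close> belongs to the same Hardy space and
    is an admissible test function.\<close>
  have 1: "(\<integral>z. u z * cnj (z powi n) \<partial>M) = 0" for n
  proof -
    have "(\<lambda>z. z powi n * g z) \<in> Hardy q \<alpha>"
      unfolding Hardy_iff
    proof (intro conjI bexI)
      show "square_integrable M (\<lambda>z. z powi n * g z)"
        by (rule square_integrable_continuous_mult[OF gsi continuous_on_powi_bdry])
      show "(\<lambda>z. z powi n * G z) \<in> Hardy0 q" by (rule Hardy0_powi_mult[OF G])
      show "AE z in M. z powi n * g z = chi_pow \<alpha> z * (z powi n * G z)"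
        using gG by eventually_elim simp
    qed
    from orth[OF this] show ?thesis unfolding u_eq by (simp add: mult_ac)
  qed
  have 2: "(\<integral>z. u z * z powi n \<partial>M) = 0" for n
  proof -
    have "(\<integral>z. u z * z powi n \<partial>M) = (\<integral>z. cnj (u z * cnj (z powi n)) \<partial>M)" by (simp add: u_def)
    also have "\<dots> = cnj (\<integral>z. u z * cnj (z powi n) \<partial>M)" by (rule Bochner_Integration.integral_cnj)
    finally show ?thesis using 1 by simp
  qed
  obtain k where k: "AE z in circle_measure 1. u z = k" "AE z in circle_measure q. u z = - k"
    using annihilator_laurent_cnj[OF ui 2 1] by blast
  \<comment> \<open>Solves \<open>c * (- ln q / 2) = Re k\<close> on the outer circle; the inner
    circle then receives \<open>- Re k\<close> automatically.\<close>
  define c where "c = - 2 * Re k / ln q"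
  have lnq: "ln q \<noteq> 0" using q0 q1 by simp
  have eq: "AE z in M. \<phi> z * (cmod (g z))\<^sup>2 = c * log_weight z"
    unfolding AE_bdry_iff
  proof
    show "AE z in circle_measure 1. \<phi> z * (cmod (g z))\<^sup>2 = c * log_weight z"
      using k(1) AE_space
    proof eventually_elim
      case (elim z)
      then have "Re k = \<phi> z * (cmod (g z))\<^sup>2" "log_weight z = - ln q / 2"
        by (auto simp: u_def log_weight_circle)
      then show ?case using lnq by (simp add: c_def)
    qed
    show "AE z in circle_measure q. \<phi> z * (cmod (g z))\<^sup>2 = c * log_weight z"
      using k(2) AE_space
    proof eventually_elim
      case (elim z)
      from elim(1) have "Re (- k) = \<phi> z * (cmod (g z))\<^sup>2" by (metis Re_complex_of_real u_def)
      moreover have lw: "log_weight z = ln q / 2" using elim(2) by (simp add: log_weight_circle)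
      have "c * log_weight z = Re (- k)" unfolding lw using lnq by (simp add: c_def)
      ultimately show ?case by simp
    qed
  qed
  have "c \<noteq> 0"
  proof
    assume "c = 0"
    \<comment> \<open>If \<open>c\<close> were 0, the symbol would have to vanish wherever
      \<open>g\<close> does not, that is almost everywhere.\<close>
    then have \<phi>g: "AE z in M. \<phi> z = 0 \<or> g z = 0" using eq by simp
    have "\<not> (AE z in M. G z = 0)"
    proof
      assume "AE z in M. G z = 0"
      with gG have "AE z in M. g z = 0" by eventually_elim simp
      with g0 show False ..
    qed
    from Hardy0_nonvanishing[OF G this] gG \<phi>g AE_space have "AE z in M. \<phi> z = 0"
    proof eventually_elim
      case (elim z)
      then have "z \<noteq> 0" using zero_notin_bdry by auto
      then show ?case using elim by (auto simp: chi_pow_eq_0_iff)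
    qed
    with \<phi>0 show False ..
  qed
  with eq show ?thesis by (intro that)
qed

text \<open>The weight equation expresses \<open>1 / G\<close> as a bounded multiple of
  \<open>cnj G\<close>, because \<phi> is bounded and the right-hand side has constant nonzero
  modulus. Orthogonality then supplies the coefficient relation.\<close>

lemma orthogonal_imp_invertible:
  assumes \<phi>: "\<phi> \<in> Linf_real_bdry q" and \<alpha>: "0 \<le> \<alpha>" and G: "G \<in> Hardy0 q"
    and gG: "AE z in M. g z = chi_pow \<alpha> z * G z" and gsi: "square_integrable M g"
    and orth: "\<And>k. k \<in> Hardy q \<alpha> \<Longrightarrow> (\<integral>z. complex_of_real (\<phi> z) * g z * cnj (k z) \<partial>M) = 0"
    and c: "c \<noteq> 0" "AE z in M. \<phi> z * (cmod (g z))\<^sup>2 = c * log_weight z"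
  obtains b where "b \<in> Hardy0 q" "AE z in M. G z * b z = 1"
proof -
  note Gsi = Hardy0_square_integrable[OF G]
  obtain C where C: "AE z in M. \<bar>\<phi> z\<bar> \<le> C" and [measurable]: "\<phi> \<in> borel_measurable M"
    using \<phi> by (auto simp: Linf_real_bdry_def)
  have Gm[measurable]: "G \<in> borel_measurable M" and [measurable]: "g \<in> borel_measurable M"
    using square_integrable_measurable Gsi gsi by auto
  have cGm[measurable]: "(\<lambda>z. cnj (G z)) \<in> borel_measurable M"
    by (rule square_integrable_measurable[OF square_integrable_cnj[OF Gsi]])
  have id_m[measurable]: "(\<lambda>z. cmod z) \<in> borel_measurable M"
    by (intro borel_measurable_bdry_continuous continuous_intros)
  define k where "k z = c * log_weight z" for z
  define \<kappa> where "\<kappa> = - c * ln q / 2"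
  have \<kappa>: "\<kappa> \<noteq> 0" using c(1) q0 q1 by (simp add: \<kappa>_def)
  have k1: "k z = \<kappa>" if "cmod z = 1" for z using that by (simp add: k_def \<kappa>_def log_weight_circle)
  have kq: "k z = - \<kappa>" if "cmod z = q" for z using that by (simp add: k_def \<kappa>_def log_weight_circle)
  have kabs: "\<bar>k z\<bar> = \<bar>\<kappa>\<bar>" "k z \<noteq> 0" if "z \<in> bdry q" for z
    using that k1[of z] kq[of z] \<kappa> by (auto elim: bdry_cases)
  have km[measurable]: "k \<in> borel_measurable M" unfolding k_def[abs_def] by measurable
  \<comment> \<open>Obtained by solving the weight equation for \<open>1 / G\<close> with
    \<open>\<bar>g\<bar> = \<bar>chi_pow \<alpha>\<bar> * \<bar>G\<bar>\<close>. In this form square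
    integrability is visible, which it would not be for the quotient.\<close>
  define b where "b z = complex_of_real (\<phi> z * (cmod (chi_pow \<alpha> z))\<^sup>2 / k z) * cnj (G z)" for z
  have bm[measurable]: "b \<in> borel_measurable M" unfolding b_def[abs_def] by measurable
  have bsi: "square_integrable M b"
  proof (rule square_integrable_bound[OF Gsi bm])
    show "AE z in M. cmod (b z) \<le> (C / \<bar>\<kappa>\<bar>) * cmod (G z)"
      using C AE_space
    proof eventually_elim
      case (elim z)
      then have z: "z \<in> bdry q" by simp
      have "(cmod (chi_pow \<alpha> z))\<^sup>2 \<le> 1" using cmod_chi_pow_bdry(1)[OF z \<alpha>] by (simp add: power_le_one)
      then have "\<bar>\<phi> z\<bar> * (cmod (chi_pow \<alpha> z))\<^sup>2 \<le> C * 1" using elim by (intro mult_mono) auto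
      then have "\<bar>\<phi> z\<bar> * (cmod (chi_pow \<alpha> z))\<^sup>2 / \<bar>\<kappa>\<bar> \<le> C / \<bar>\<kappa>\<bar>"
        by (intro divide_right_mono) auto
      then have "\<bar>\<phi> z\<bar> * (cmod (chi_pow \<alpha> z))\<^sup>2 / \<bar>\<kappa>\<bar> * cmod (G z) \<le> C / \<bar>\<kappa>\<bar> * cmod (G z)"
        by (rule mult_right_mono) simp
      then show ?case using kabs(1)[OF z] by (simp add: b_def norm_mult norm_divide norm_power abs_mult)
    qed
  qed
  have Gb: "AE z in M. G z * b z = 1"
    using c(2) gG AE_space
  proof eventually_elim
    case (elim z)
    then have z: "z \<in> bdry q" by simp
    have "\<phi> z * (cmod (chi_pow \<alpha> z))\<^sup>2 * (cmod (G z))\<^sup>2 = k z"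
      using elim(1,2) by (simp add: k_def norm_mult power_mult_distrib mult.assoc)
    moreover have "G z * b z = complex_of_real (\<phi> z * (cmod (chi_pow \<alpha> z))\<^sup>2 / k z) * (G z * cnj (G z))"
      by (simp add: b_def mult_ac)
    ultimately have "G z * b z = complex_of_real (k z / k z)"
      unfolding complex_norm_square[symmetric] of_real_mult[symmetric] by simp
    then show ?case using kabs(2)[OF z] by simp
  qed
  \<comment> \<open>The complex conjugate of orthogonality to
    \<open>chi_pow \<alpha> z * z powi n\<close>. Since \<open>k\<close> is \<kappa> on the outer
    circle and \<open>- \<kappa>\<close> on the inner one, the moments of \<open>b\<close> on the
    two circles agree.\<close>
  have kb: "(\<integral>z. complex_of_real (k z) * (b z * z powi n) \<partial>M) = 0" for n
  proof -
    have "(\<lambda>z. chi_pow \<alpha> z * z powi n) \<in> Hardy q \<alpha>"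
      by (rule chi_pow_mult_Hardy[OF laurent_in_Hardy0[OF laurent_polys_powi] \<alpha>])
    from orth[OF this] have "0 = cnj (\<integral>z. complex_of_real (\<phi> z) * g z * cnj (chi_pow \<alpha> z * z powi n) \<partial>M)" by simp
    also have "\<dots> = (\<integral>z. cnj (complex_of_real (\<phi> z) * g z * cnj (chi_pow \<alpha> z * z powi n)) \<partial>M)"
      by (rule Bochner_Integration.integral_cnj[symmetric])
    also have "\<dots> = (\<integral>z. complex_of_real (k z) * (b z * z powi n) \<partial>M)"
    proof (rule integral_cong_AE)
      have pm[measurable]: "(\<lambda>z. z powi n) \<in> borel_measurable M"
        by (intro borel_measurable_bdry_continuous continuous_on_powi_bdry)
      have "square_integrable M (\<lambda>z. cnj (g z))" by (rule square_integrable_cnj[OF gsi])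
      then have [measurable]: "(\<lambda>z. cnj (g z)) \<in> borel_measurable M" by (rule square_integrable_measurable)
      show "(\<lambda>z. cnj (complex_of_real (\<phi> z) * g z * cnj (chi_pow \<alpha> z * z powi n))) \<in> borel_measurable M"
        unfolding complex_cnj_mult complex_cnj_cnj complex_cnj_complex_of_real by measurable
      show "(\<lambda>z. complex_of_real (k z) * (b z * z powi n)) \<in> borel_measurable M" by measurable
      show "AE z in M. cnj (complex_of_real (\<phi> z) * g z * cnj (chi_pow \<alpha> z * z powi n)) = complex_of_real (k z) * (b z * z powi n)"
        using gG AE_space
      proof eventually_elim
        case (elim z)
        then have z: "z \<in> bdry q" by simp
        have "complex_of_real (k z) * b z = complex_of_real (\<phi> z) * complex_of_real ((cmod (chi_pow \<alpha> z))\<^sup>2) * cnj (G z)"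
          using kabs(2)[OF z] by (simp add: b_def)
        also have "\<dots> = complex_of_real (\<phi> z) * (chi_pow \<alpha> z * cnj (chi_pow \<alpha> z)) * cnj (G z)"
          by (simp only: complex_norm_square)
        finally have kb_z: "complex_of_real (k z) * b z
            = complex_of_real (\<phi> z) * (chi_pow \<alpha> z * cnj (chi_pow \<alpha> z)) * cnj (G z)" .
        show ?case unfolding elim(1) mult.assoc[symmetric] kb_z by (simp add: mult_ac)
      qed
    qed
    finally show ?thesis by simp
  qed
  have "balanced b"
    unfolding balanced_def
  proof (intro conjI allI)
    show bi: "integrable M b" by (rule integrable_of_square_integrable[OF bsi])
    fix n
    have i: "integrable M (\<lambda>z. b z * z powi n)"
      by (rule integrable_continuous_mult[OF bi continuous_on_powi_bdry])
    have ik: "integrable M (\<lambda>z. complex_of_real (k z) * (b z * z powi n))"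
    proof (rule Bochner_Integration.integrable_bound[OF integrable_mult_right[OF i, of "complex_of_real \<kappa>"]])
      have pm[measurable]: "(\<lambda>z. z powi n) \<in> borel_measurable M"
        by (intro borel_measurable_bdry_continuous continuous_on_powi_bdry)
      show "(\<lambda>z. complex_of_real (k z) * (b z * z powi n)) \<in> borel_measurable M" by measurable
      show "AE z in M. norm (complex_of_real (k z) * (b z * z powi n)) \<le> norm (complex_of_real \<kappa> * (b z * z powi n))"
        by (rule AE_I2) (simp add: norm_mult kabs)
    qed
    have "0 = (\<integral>z. complex_of_real (k z) * (b z * z powi n) \<partial>circle_measure 1)
        + (\<integral>z. complex_of_real (k z) * (b z * z powi n) \<partial>circle_measure q)"
      using integral_bdry[OF ik] kb[of n] by simp
    also have "(\<integral>z. complex_of_real (k z) * (b z * z powi n) \<partial>circle_measure 1) = (\<integral>z. complex_of_real \<kappa> * (b z * z powi n) \<partial>circle_measure 1)"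
      by (rule Bochner_Integration.integral_cong) (auto simp: k1)
    also have "(\<integral>z. complex_of_real (k z) * (b z * z powi n) \<partial>circle_measure q) = (\<integral>z. complex_of_real (- \<kappa>) * (b z * z powi n) \<partial>circle_measure q)"
      by (rule Bochner_Integration.integral_cong) (auto simp: kq)
    finally have "0 = complex_of_real \<kappa> * ((\<integral>z. b z * z powi n \<partial>circle_measure 1) - (\<integral>z. b z * z powi n \<partial>circle_measure q))"
      by (simp add: right_diff_distrib)
    then show "(\<integral>z. b z * z powi n \<partial>circle_measure 1) = (\<integral>z. b z * z powi n \<partial>circle_measure q)"
      using \<kappa> by simp
  qed
  with bsi Gb show ?thesis by (intro that[of b]) (simp_all add: Hardy0_iff)
qed

lemma bdry_subset_closure: "bdry q \<subseteq> closure (annulus q)"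
proof
  fix z assume z: "z \<in> bdry q"
  have r: "z \<in> closure (annulus q)"
    if s: "\<And>k. q < s k \<and> s k < 1" "s \<longlonglongrightarrow> cmod z" for s :: "nat \<Rightarrow> real"
  proof -
    have "(\<lambda>k. of_real (s k) * cis (Arg2pi z)) \<longlonglongrightarrow> of_real (cmod z) * cis (Arg2pi z)"
      by (intro tendsto_intros s)
    moreover have "of_real (s k) * cis (Arg2pi z) \<in> annulus q" for k
      by (rule circle_subset_annulus) (use s(1) in auto)
    ultimately show ?thesis
      unfolding closure_sequential polar_Arg2pi[symmetric]
      by (intro exI[of _ "\<lambda>k. of_real (s k) * cis (Arg2pi z)"] conjI allI)
  qed
  obtain s where s: "\<And>k::nat. q < s k \<and> s k < 1" "s \<longlonglongrightarrow> 1" by (rule radii_to_outer) (rule that)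
  obtain s' where s': "\<And>k::nat. q < s' k \<and> s' k < 1" "s' \<longlonglongrightarrow> q" by (rule radii_to_inner) (rule that)
  from z show "z \<in> closure (annulus q)"
    using r[OF s(1)] r[OF s'(1)] s(2) s'(2) by (elim bdry_cases) auto
qed

lemma annulus_algebra_continuous_bdry: "a \<in> annulus_algebra q \<Longrightarrow> continuous_on (bdry q) a"
  using continuous_on_subset[OF _ bdry_subset_closure] by (auto simp: annulus_algebra_def)

lemma annulus_algebra_laurent_mult:
  assumes "a \<in> annulus_algebra q" "p \<in> laurent_polys"
  shows "(\<lambda>z. p z * a z) \<in> annulus_algebra q"
proof -
  have "p \<in> annulus_algebra q"
    by (rule annulus_algebraI[OF holomorphic_on_laurent_poly[OF assms(2)]]) simp
  with assms(1) show ?thesis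
    by (auto simp: annulus_algebra_def intro!: continuous_intros analytic_intros)
qed

text \<open>It is enough to approximate 1 by multiples \<open>a * G\<close>: a function
  \<open>chi_pow \<alpha> * f\<close> is then approximated by \<open>(p * a) * g\<close> with
  \<open>p\<close> a Laurent polynomial near \<open>f\<close>. Boundedness of \<open>p\<close> is
  what permits choosing \<open>a\<close> after \<open>p\<close>.\<close>

lemma invertible_is_outer:
  assumes \<alpha>: "0 \<le> \<alpha>" and g: "g \<in> Hardy q \<alpha>" and G: "G \<in> Hardy0 q" and gG: "AE z in M. g z = chi_pow \<alpha> z * G z"
    and b: "b \<in> Hardy0 q" and Gb: "AE z in M. G z * b z = 1"
  shows "is_outer q \<alpha> g"
  unfolding is_outer_def
proof (intro conjI g subsetI)
  fix h assume h: "h \<in> Hardy q \<alpha>"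
  obtain f where f: "f \<in> Hardy0 q" and hf: "AE z in M. h z = chi_pow \<alpha> z * f z"
    using h unfolding Hardy_iff by blast
  note hsi = Hardy_square_integrable[OF h] and gsi = Hardy_square_integrable[OF g]
    and Gsi = Hardy0_square_integrable[OF G] and fsi = Hardy0_square_integrable[OF f]
  show "h \<in> L2_closure q {(\<lambda>z. a z * g z) |a. a \<in> annulus_algebra q}"
    unfolding L2_closure_def L2_bdry_iff L2_norm_eq
  proof (intro CollectI conjI hsi allI impI)
    fix e :: real assume e: "0 < e"
    obtain p where p: "p \<in> laurent_polys" and fp: "l2norm M (\<lambda>z. f z - p z) < e / 2"
      using Hardy0_laurent_approx[OF f, of "e / 2"] e by auto
    have pc: "continuous_on (bdry q) p" by (intro continuous_on_laurent_poly p) simp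
    obtain C where C: "0 < C" "\<And>z. z \<in> bdry q \<Longrightarrow> cmod (p z) \<le> C"
      by (rule continuous_bdry_bounded[OF pc]) (rule that)
    define K where "K = 5 + 4 * sqrt (32 * pi)"
    have K: "0 < K" by (simp add: K_def add_pos_nonneg)
    \<comment> \<open>The error budget \<open>e\<close> is split in two halves: one for
      \<open>f - p\<close>, and \<open>C * d = e / 2\<close> for the defect of \<open>a * G\<close>.
      The bound \<open>\<theta>\<close> is half of what \<open>d\<^sup>2 / K\<close> would allow,
      which makes the inequality strict.\<close>
    define d where "d = e / (2 * C)"
    have d: "0 < d" using e C by (simp add: d_def)
    define \<theta> where "\<theta> = min 1 (d\<^sup>2 / (2 * K))"
    have \<theta>: "0 < \<theta>" "\<theta> \<le> 1" using d K by (auto simp: \<theta>_def)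
    obtain a where a: "a \<in> annulus_algebra q" "(l2norm M (\<lambda>z. 1 - a z * G z))\<^sup>2 \<le> K * \<theta>"
      by (rule invertible_approx_1[OF G b Gb \<theta>]) (rule that, assumption, simp only: K_def)
    have "K * \<theta> \<le> K * (d\<^sup>2 / (2 * K))" using K by (intro mult_left_mono) (auto simp: \<theta>_def)
    also have "\<dots> < d\<^sup>2" using K d by simp
    finally have "(l2norm M (\<lambda>z. 1 - a z * G z))\<^sup>2 < d\<^sup>2" using a(2) by simp
    then have ad: "l2norm M (\<lambda>z. 1 - a z * G z) < d" by (rule power_less_imp_less_base) (use d in simp)
    have ac: "continuous_on (bdry q) a" by (rule annulus_algebra_continuous_bdry[OF a(1)])
    have aGsi: "square_integrable M (\<lambda>z. a z * G z)" by (rule square_integrable_continuous_mult[OF Gsi ac])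
    have 1: "square_integrable M (\<lambda>z. 1 - a z * G z)"
      by (intro square_integrable_diff aGsi square_integrable_continuous continuous_intros)
    have "l2norm M (\<lambda>z. h z - (p z * a z) * g z) \<le> 1 * l2norm M (\<lambda>z. f z - p z * (a z * G z))"
    proof (rule l2norm_mono)
      show "square_integrable M (\<lambda>z. f z - p z * (a z * G z))"
        by (intro square_integrable_diff fsi square_integrable_continuous_mult aGsi pc)
      show "(\<lambda>z. h z - (p z * a z) * g z) \<in> borel_measurable M"
        by (intro square_integrable_measurable square_integrable_diff hsi
            square_integrable_continuous_mult gsi continuous_on_mult pc ac)
      show "AE z in M. cmod (h z - (p z * a z) * g z) \<le> 1 * cmod (f z - p z * (a z * G z))"
        using hf gG AE_space
      proof eventually_elim
        case (elim z)
        then have z: "z \<in> bdry q" by simp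
        have "h z - (p z * a z) * g z = chi_pow \<alpha> z * (f z - p z * (a z * G z))"
          unfolding elim(1,2) by (simp add: algebra_simps)
        then show ?case
          using cmod_chi_pow_bdry(1)[OF z \<alpha>] by (simp add: norm_mult mult_left_le_one_le)
      qed
    qed simp
    also have "1 * l2norm M (\<lambda>z. f z - p z * (a z * G z)) \<le> l2norm M (\<lambda>z. f z - p z) + l2norm M (\<lambda>z. p z - p z * (a z * G z))" (is "_ \<le> ?rhs")
      using l2norm_triangle_diff[OF fsi square_integrable_laurent[OF p] square_integrable_continuous_mult[OF aGsi pc]] by simp
    finally have A1: "l2norm M (\<lambda>z. h z - (p z * a z) * g z) \<le> ?rhs" .
    have A2: "l2norm M (\<lambda>z. p z - p z * (a z * G z)) \<le> C * l2norm M (\<lambda>z. 1 - a z * G z)"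
    proof (rule l2norm_mono[OF 1])
      show "(\<lambda>z. p z - p z * (a z * G z)) \<in> borel_measurable M"
        by (intro square_integrable_measurable square_integrable_diff square_integrable_laurent p
            square_integrable_continuous_mult aGsi pc)
      show "AE z in M. cmod (p z - p z * (a z * G z)) \<le> C * cmod (1 - a z * G z)"
      proof (rule AE_I2)
        fix z assume z: "z \<in> space M"
        have "p z - p z * (a z * G z) = p z * (1 - a z * G z)" by (simp add: right_diff_distrib)
        then show "cmod (p z - p z * (a z * G z)) \<le> C * cmod (1 - a z * G z)"
          using C(2)[of z] z by (simp add: norm_mult mult_right_mono)
      qed
    qed (use C in simp)
    have "C * l2norm M (\<lambda>z. 1 - a z * G z) < C * d" by (intro mult_strict_left_mono ad C)
    moreover have "C * d = e / 2" using C by (simp add: d_def)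
    ultimately have "l2norm M (\<lambda>z. h z - (p z * a z) * g z) < e"
      using A1 A2 fp by linarith
    then show "\<exists>s\<in>{(\<lambda>z. a z * g z) |a. a \<in> annulus_algebra q}. l2norm M (\<lambda>z. h z - s z) < e"
      using annulus_algebra_laurent_mult[OF a(1) p]
      by (intro bexI[of _ "\<lambda>z. (p z * a z) * g z"]) auto
  qed
qed

text \<open>On multiples \<open>a * g\<close> the integrand is
  \<open>c * log_weight * cnj a\<close>, of constant weight on each circle with opposite signs, and
  the means of \<open>a\<close> over the two circles agree. Outerness makes these multiples dense,
  and the pairing is continuous.\<close>

lemma outer_log_weight_imp_orthogonal:
  assumes \<phi>: "\<phi> \<in> Linf_real_bdry q" and out: "is_outer q \<alpha> g"
    and eq: "AE z in M. \<phi> z * (cmod (g z))\<^sup>2 = c * log_weight z" and h: "h \<in> Hardy q \<alpha>"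
  shows "(\<integral>z. complex_of_real (\<phi> z) * g z * cnj (h z) \<partial>M) = 0"
proof -
  have g: "g \<in> Hardy q \<alpha>" using out by (simp add: is_outer_def)
  note gsi = Hardy_square_integrable[OF g] and hsi = Hardy_square_integrable[OF h]
  define f where "f z = complex_of_real (\<phi> z) * g z" for z
  have fsi: "square_integrable M f" unfolding f_def by (rule Linf_mult_square_integrable[OF \<phi> gsi])
  define \<kappa> where "\<kappa> = - c * ln q / 2"
  have k1: "c * log_weight z = \<kappa>" if "cmod z = 1" for z using that by (simp add: \<kappa>_def log_weight_circle)
  have kq: "c * log_weight z = - \<kappa>" if "cmod z = q" for z using that by (simp add: \<kappa>_def log_weight_circle)
  have zero: "(\<integral>z. f z * cnj (a z * g z) \<partial>M) = 0" if a: "a \<in> annulus_algebra q" for a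
  proof -
    have ac: "continuous_on (bdry q) a" by (rule annulus_algebra_continuous_bdry[OF a])
    have agsi: "square_integrable M (\<lambda>z. a z * g z)" by (rule square_integrable_continuous_mult[OF gsi ac])
    have i: "integrable M (\<lambda>z. f z * cnj (a z * g z))"
      by (rule square_integrable_mult[OF fsi square_integrable_cnj[OF agsi]])
    have am: "(\<lambda>z. cnj (a z)) \<in> borel_measurable M"
      by (intro borel_measurable_bdry_continuous continuous_on_cnj ac)
    have one: "(\<integral>z. f z * cnj (a z * g z) \<partial>circle_measure r) = of_real s * cnj (\<integral>z. a z \<partial>circle_measure r)"
      if r: "r = 1 \<or> r = q" and s: "\<And>z. cmod z = r \<Longrightarrow> c * log_weight z = s" for r s
    proof -
      have "(\<integral>z. f z * cnj (a z * g z) \<partial>circle_measure r) = (\<integral>z. of_real s * cnj (a z) \<partial>circle_measure r)"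
      proof (rule integral_cong_AE)
        show "(\<lambda>z. f z * cnj (a z * g z)) \<in> borel_measurable (circle_measure r)"
          by (rule borel_measurable_bdry_circle[OF borel_measurable_integrable[OF i] r])
        show "(\<lambda>z. of_real s * cnj (a z)) \<in> borel_measurable (circle_measure r)"
          using borel_measurable_bdry_circle[OF am r] by measurable
        have "AE z in circle_measure r. \<phi> z * (cmod (g z))\<^sup>2 = c * log_weight z"
          using eq r by (auto simp: AE_bdry_iff)
        then show "AE z in circle_measure r. f z * cnj (a z * g z) = of_real s * cnj (a z)"
          using AE_space
        proof eventually_elim
          case (elim z)
          then have "\<phi> z * (cmod (g z))\<^sup>2 = s" using s by simp
          moreover have "f z * cnj (a z * g z) = complex_of_real (\<phi> z) * (g z * cnj (g z)) * cnj (a z)"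
            by (simp add: f_def mult_ac)
          ultimately show ?case
            unfolding complex_norm_square[symmetric] of_real_mult[symmetric] by simp
        qed
      qed
      then show ?thesis by simp
    qed
    have "(\<integral>z. f z * cnj (a z * g z) \<partial>circle_measure 1) = of_real \<kappa> * cnj (\<integral>z. a z \<partial>circle_measure 1)"
      "(\<integral>z. f z * cnj (a z * g z) \<partial>circle_measure q) = of_real (- \<kappa>) * cnj (\<integral>z. a z \<partial>circle_measure q)"
      by (rule one; simp add: k1 kq)+
    then show ?thesis
      using integral_bdry[OF i] annulus_algebra_mean[OF a] by simp
  qed
  have "cmod (\<integral>z. f z * cnj (h z) \<partial>M) \<le> 0 + e" if e: "0 < e" for e
  proof -
    define K where "K = 1 + l2norm M f"
    have K: "0 < K" by (simp add: K_def add_pos_nonneg)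
    have "h \<in> L2_closure q {(\<lambda>z. a z * g z) |a. a \<in> annulus_algebra q}"
      using out h by (auto simp: is_outer_def)
    then have "\<exists>s\<in>{(\<lambda>z. a z * g z) |a. a \<in> annulus_algebra q}. l2norm M (\<lambda>z. h z - s z) < e / K"
      using e K unfolding L2_closure_def L2_norm_eq by (simp only: mem_Collect_eq) auto
    then obtain a where a: "a \<in> annulus_algebra q" and ha: "l2norm M (\<lambda>z. h z - a z * g z) < e / K" by auto
    have agsi: "square_integrable M (\<lambda>z. a z * g z)"
      by (rule square_integrable_continuous_mult[OF gsi annulus_algebra_continuous_bdry[OF a]])
    have dsi: "square_integrable M (\<lambda>z. cnj (h z - a z * g z))"
      by (intro square_integrable_cnj square_integrable_diff hsi agsi)
    have "(\<integral>z. f z * cnj (h z) \<partial>M) = (\<integral>z. f z * cnj (h z - a z * g z) + f z * cnj (a z * g z) \<partial>M)"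
      by (simp add: right_diff_distrib)
    also have "\<dots> = (\<integral>z. f z * cnj (h z - a z * g z) \<partial>M) + (\<integral>z. f z * cnj (a z * g z) \<partial>M)"
      by (intro Bochner_Integration.integral_add square_integrable_mult fsi dsi square_integrable_cnj agsi)
    finally have "(\<integral>z. f z * cnj (h z) \<partial>M) = (\<integral>z. f z * cnj (h z - a z * g z) \<partial>M)" using zero[OF a] by simp
    then have "cmod (\<integral>z. f z * cnj (h z) \<partial>M) \<le> l2norm M f * l2norm M (\<lambda>z. cnj (h z - a z * g z))"
      using L2_Cauchy_Schwarz_complex[OF fsi dsi] by simp
    also have "l2norm M (\<lambda>z. cnj (h z - a z * g z)) = l2norm M (\<lambda>z. h z - a z * g z)"
      unfolding l2norm_def complex_mod_cnj ..
    also have "l2norm M f * l2norm M (\<lambda>z. h z - a z * g z) \<le> K * (e / K)"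
      using ha by (intro mult_mono) (auto simp: K_def intro: less_imp_le)
    finally show ?thesis using K by simp
  qed
  then have "cmod (\<integral>z. f z * cnj (h z) \<partial>M) \<le> 0" by (rule field_le_epsilon)
  then show ?thesis by (simp add: f_def)
qed

text \<open>Two representations of \<open>g\<close> make \<open>chi_pow (\<alpha> - \<beta>)\<close>
  a product of two functions of index 0, so its means over the two circles agree. The means differ
  by the factor \<open>q powr (\<alpha> - \<beta>)\<close>, which must therefore be 1.\<close>

lemma index_unique:
  assumes G: "G \<in> Hardy0 q" and gG: "AE z in M. g z = chi_pow \<alpha> z * G z"
    and b: "b \<in> Hardy0 q" and Gb: "AE z in M. G z * b z = 1"
    and g: "g \<in> Hardy q \<beta>" and \<alpha>: "0 \<le> \<alpha>" "\<alpha> < 1" and \<beta>: "0 \<le> \<beta>" "\<beta> < 1"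
  shows "\<alpha> = \<beta>"
proof -
  obtain F where F: "F \<in> Hardy0 q" and gF: "AE z in M. g z = chi_pow \<beta> z * F z"
    using g unfolding Hardy_iff by blast
  define \<gamma> where "\<gamma> = \<alpha> - \<beta>"
  have "AE z in M. chi_pow \<gamma> z = F z * b z"
    using gG gF Gb AE_space
  proof eventually_elim
    case (elim z)
    then have z: "z \<noteq> 0" using zero_notin_bdry by auto
    have "chi_pow \<beta> z * chi_pow \<gamma> z = chi_pow \<alpha> z"
      by (simp add: chi_pow_add[symmetric] \<gamma>_def)
    also have "\<dots> = chi_pow \<alpha> z * G z * b z" using elim(3) by (simp add: mult.assoc)
    also have "\<dots> = chi_pow \<beta> z * (F z * b z)" using elim(1,2) by (simp add: mult.assoc)
    finally show ?case using z by (simp add: chi_pow_eq_0_iff)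
  qed
  from balanced_cong_AE[OF balanced_mult[OF F b] this chi_pow_measurable] have "balanced (chi_pow \<gamma>)" .
  then have eq: "(\<integral>z. chi_pow \<gamma> z * z powi 0 \<partial>circle_measure 1) = (\<integral>z. chi_pow \<gamma> z * z powi 0 \<partial>circle_measure q)"
    unfolding balanced_def by blast
  have mom: "(\<integral>z. chi_pow \<gamma> z * z powi 0 \<partial>circle_measure r) = of_real (r powr \<gamma>) * (\<integral>t. cis (\<gamma> * t) \<partial>angle_measure)"
    if r: "r = 1 \<or> r = q" for r
  proof -
    have r0: "0 < r" using r q0 by auto
    have "(\<integral>z. chi_pow \<gamma> z * z powi 0 \<partial>circle_measure r) = (\<integral>t. chi_pow \<gamma> (of_real r * cis t) \<partial>angle_measure)"
      using integral_circle_measure[OF r0 borel_measurable_bdry_circle[OF chi_pow_measurable r]] by simp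
    also have "\<dots> = (\<integral>t. of_real (r powr \<gamma>) * cis (\<gamma> * t) \<partial>angle_measure)"
    proof (rule Bochner_Integration.integral_cong)
      fix t assume "t \<in> space angle_measure"
      then have "Arg2pi (of_real r * cis t) = t" using r0 by (intro Arg2pi_cis) auto
      then show "chi_pow \<gamma> (of_real r * cis t) = of_real (r powr \<gamma>) * cis (\<gamma> * t)"
        using r0 by (simp add: chi_pow_def norm_mult)
    qed simp
    finally show ?thesis by simp
  qed
  have "(\<integral>t. cis (\<gamma> * t) \<partial>angle_measure) \<noteq> 0"
    by (rule mean_chi_pow_nonzero) (use \<alpha> \<beta> in \<open>simp add: \<gamma>_def abs_if\<close>)
  with eq mom[of 1] mom[of q] have "complex_of_real (q powr \<gamma>) = 1" by simp
  then have "q powr \<gamma> = 1" by (simp only: of_real_eq_1_iff)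
  then have "\<gamma> = 0" using q0 q1 by (simp add: powr_eq_one_iff_gen)
  then show ?thesis by (simp add: \<gamma>_def)
qed

text \<open>Taking logarithms of moduli in the weight equation gives
  \<open>ln \<bar>\<phi>\<bar> = ln \<kappa> - 2 * ln \<bar>g\<bar>\<close>. In the difference of
  the two means \<open>\<kappa>\<close> cancels, the branch contributes
  \<open>4 * pi * \<alpha> * ln q\<close>, and \<open>G\<close> contributes an integer multiple of
  \<open>4 * pi * ln q\<close>.\<close>

lemma index_formula:
  assumes G: "G \<in> Hardy0 q" and gG: "AE z in M. g z = chi_pow \<alpha> z * G z"
    and b: "b \<in> Hardy0 q" and Gb: "AE z in M. G z * b z = 1"
    and \<phi>m: "\<phi> \<in> borel_measurable M"
    and c: "c \<noteq> 0" "AE z in M. \<phi> z * (cmod (g z))\<^sup>2 = c * log_weight z"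
  shows "integrable (circle_measure 1) (\<lambda>z. ln \<bar>\<phi> z\<bar>)" "integrable (circle_measure q) (\<lambda>z. ln \<bar>\<phi> z\<bar>)"
    "[\<alpha> = 1 / (4 * pi * ln q) *
      ((\<integral>z. ln \<bar>\<phi> z\<bar> \<partial>circle_measure 1) - (\<integral>z. ln \<bar>\<phi> z\<bar> \<partial>circle_measure q))] (rmod 1)"
proof -
  have lnq: "ln q < 0" using q0 q1 by simp
  \<comment> \<open>The common modulus of \<open>c * log_weight\<close> on both circles.\<close>
  define \<kappa> where "\<kappa> = \<bar>c * ln q / 2\<bar>"
  have \<kappa>: "0 < \<kappa>" using c(1) lnq by (simp add: \<kappa>_def)
  have lnG: "integrable M (\<lambda>z. ln (cmod (G z)))"
    by (rule invertible_log_integrable[OF Hardy0_square_integrable[OF G] Hardy0_square_integrable[OF b] Gb])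
  have main: "integrable (circle_measure r) (\<lambda>z. ln \<bar>\<phi> z\<bar>) \<and>
      (\<integral>z. ln \<bar>\<phi> z\<bar> \<partial>circle_measure r) = 2 * pi * (ln \<kappa> - 2 * \<alpha> * ln r) - 2 * (\<integral>z. ln (cmod (G z)) \<partial>circle_measure r)"
    if r: "r = 1 \<or> r = q" for r
  proof -
    have r0: "0 < r" using r q0 by auto
    interpret C: finite_measure "circle_measure r" by (rule finite_measure_circle_measure[OF r0])
    have lnGr: "integrable (circle_measure r) (\<lambda>z. ln (cmod (G z)))"
      using lnG r by (auto simp: integrable_bdry_iff)
    have AEs: "AE z in circle_measure r. \<phi> z * (cmod (g z))\<^sup>2 = c * log_weight z"
      "AE z in circle_measure r. g z = chi_pow \<alpha> z * G z" "AE z in circle_measure r. G z * b z = 1"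
      using c(2) gG Gb r by (auto simp: AE_bdry_iff)
    have eq: "AE z in circle_measure r. ln \<bar>\<phi> z\<bar> = (ln \<kappa> - 2 * \<alpha> * ln r) - 2 * ln (cmod (G z))"
      using AEs AE_space
    proof eventually_elim
      case (elim z)
      then have z: "cmod z = r" by simp
      have G0: "G z \<noteq> 0" using elim(3) by auto
      have gm: "cmod (g z) = r powr \<alpha> * cmod (G z)" using elim(2) z by (simp add: norm_mult cmod_chi_pow)
      have "cmod z = 1 \<or> cmod z = q" using z r by simp
      then have "\<bar>log_weight z\<bar> = \<bar>ln q / 2\<bar>"
      proof
        assume "cmod z = 1"
        then show ?thesis unfolding log_weight_circle(1)[OF \<open>cmod z = 1\<close>] by simp
      next
        assume "cmod z = q"
        then show ?thesis unfolding log_weight_circle(2)[OF \<open>cmod z = q\<close>] by simp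
      qed
      then have "\<bar>\<phi> z\<bar> * (cmod (g z))\<^sup>2 = \<kappa>"
        using arg_cong[OF elim(1), of abs] by (simp add: abs_mult \<kappa>_def)
      then have "\<bar>\<phi> z\<bar> = \<kappa> / (cmod (g z))\<^sup>2" using G0 gm r0 by (simp add: field_simps)
      then have "ln \<bar>\<phi> z\<bar> = ln \<kappa> - 2 * ln (cmod (g z))"
        using \<kappa> G0 gm r0 by (simp add: ln_div ln_realpow)
      also have "ln (cmod (g z)) = \<alpha> * ln r + ln (cmod (G z))"
        unfolding gm using G0 r0 by (simp add: ln_mult ln_powr)
      finally show ?case by simp
    qed
    have \<phi>r: "(\<lambda>z. ln \<bar>\<phi> z\<bar>) \<in> borel_measurable (circle_measure r)"
    proof (rule borel_measurable_bdry_circle[OF _ r])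
      show "(\<lambda>z. ln \<bar>\<phi> z\<bar>) \<in> borel_measurable M" using \<phi>m by measurable
    qed
    have ri: "integrable (circle_measure r) (\<lambda>z. (ln \<kappa> - 2 * \<alpha> * ln r) - 2 * ln (cmod (G z)))"
      using lnGr by simp
    have "AE z in circle_measure r. (ln \<kappa> - 2 * \<alpha> * ln r) - 2 * ln (cmod (G z)) = ln \<bar>\<phi> z\<bar>"
      using eq by eventually_elim (rule sym)
    then have 1: "integrable (circle_measure r) (\<lambda>z. ln \<bar>\<phi> z\<bar>)"
      by (rule integrable_cong_AE_imp[OF ri \<phi>r])
    have "(\<integral>z. ln \<bar>\<phi> z\<bar> \<partial>circle_measure r) = (\<integral>z. (ln \<kappa> - 2 * \<alpha> * ln r) - 2 * ln (cmod (G z)) \<partial>circle_measure r)"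
      by (rule integral_cong_AE[OF \<phi>r borel_measurable_integrable[OF ri] eq])
    also have "\<dots> = 2 * pi * (ln \<kappa> - 2 * \<alpha> * ln r) - 2 * (\<integral>z. ln (cmod (G z)) \<partial>circle_measure r)"
      using lnGr measure_circle_measure[OF r0] by simp
    finally show ?thesis using 1 by blast
  qed
  show "integrable (circle_measure 1) (\<lambda>z. ln \<bar>\<phi> z\<bar>)" "integrable (circle_measure q) (\<lambda>z. ln \<bar>\<phi> z\<bar>)"
    using main by blast+
  obtain n :: int where n: "(\<integral>z. ln (cmod (G z)) \<partial>circle_measure 1) - (\<integral>z. ln (cmod (G z)) \<partial>circle_measure q) = 2 * pi * of_int n * ln q"
    by (rule invertible_log_mean[OF G b Gb]) (rule that)
  have "(\<integral>z. ln \<bar>\<phi> z\<bar> \<partial>circle_measure 1) - (\<integral>z. ln \<bar>\<phi> z\<bar> \<partial>circle_measure q)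
      = 4 * pi * \<alpha> * ln q - 2 * ((\<integral>z. ln (cmod (G z)) \<partial>circle_measure 1) - (\<integral>z. ln (cmod (G z)) \<partial>circle_measure q))"
  proof -
    have "(\<integral>z. ln \<bar>\<phi> z\<bar> \<partial>circle_measure 1) = 2 * pi * ln \<kappa> - 2 * (\<integral>z. ln (cmod (G z)) \<partial>circle_measure 1)"
      using main[OF disjI1[OF refl]] by simp
    moreover have "(\<integral>z. ln \<bar>\<phi> z\<bar> \<partial>circle_measure q) = 2 * pi * (ln \<kappa> - 2 * \<alpha> * ln q) - 2 * (\<integral>z. ln (cmod (G z)) \<partial>circle_measure q)"
      using main[OF disjI2[OF refl]] by blast
    ultimately show ?thesis by (simp add: right_diff_distrib)
  qed
  also have "\<dots> = (4 * pi * ln q) * (\<alpha> - of_int n)" unfolding n by (simp add: algebra_simps)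
  finally have "1 / (4 * pi * ln q) * ((\<integral>z. ln \<bar>\<phi> z\<bar> \<partial>circle_measure 1) - (\<integral>z. ln \<bar>\<phi> z\<bar> \<partial>circle_measure q))
      = \<alpha> + of_int (- n) * 1" using lnq by simp
  then show "[\<alpha> = 1 / (4 * pi * ln q) *
      ((\<integral>z. ln \<bar>\<phi> z\<bar> \<partial>circle_measure 1) - (\<integral>z. ln \<bar>\<phi> z\<bar> \<partial>circle_measure q))] (rmod 1)"
    unfolding rcong_altdef by blast
qed

lemma toeplitz_kernel_outer:
  assumes \<phi>: "\<phi> \<in> Linf_real_bdry q" and \<phi>0: "\<not> (AE z in M. \<phi> z = 0)" and \<alpha>: "0 \<le> \<alpha>"
    and g: "g \<in> Hardy q \<alpha>" and g0: "\<not> (AE z in M. g z = 0)" and T: "AE z in M. toeplitz q \<phi> \<alpha> g z = 0"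
  shows "is_outer q \<alpha> g" "\<exists>c. c \<noteq> 0 \<and> (AE z in M. \<phi> z * (cmod (g z))\<^sup>2 = c * log_weight z)"
proof -
  have orth: "(\<integral>z. complex_of_real (\<phi> z) * g z * cnj (k z) \<partial>M) = 0" if "k \<in> Hardy q \<alpha>" for k
    using T that unfolding toeplitz_eq_0_iff[OF \<phi> \<alpha> g] by blast
  obtain c where c: "c \<noteq> 0" "AE z in M. \<phi> z * (cmod (g z))\<^sup>2 = c * log_weight z"
    by (rule orthogonal_imp_log_weight[OF \<phi> \<phi>0 \<alpha> g g0 orth]) (assumption, rule that)
  obtain G where G: "G \<in> Hardy0 q" "AE z in M. g z = chi_pow \<alpha> z * G z"
    using g unfolding Hardy_iff by blast
  obtain b where b: "b \<in> Hardy0 q" "AE z in M. G z * b z = 1"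
    by (rule orthogonal_imp_invertible[OF \<phi> \<alpha> G Hardy_square_integrable[OF g] orth c]) (assumption, rule that)
  show "is_outer q \<alpha> g" by (rule invertible_is_outer[OF \<alpha> g G b])
  show "\<exists>c. c \<noteq> 0 \<and> (AE z in M. \<phi> z * (cmod (g z))\<^sup>2 = c * log_weight z)" using c by blast
qed

text \<open>Outerness and the weight equation yield orthogonality, and orthogonality in turn yields
  an inverse of \<open>G\<close>. So the results on invertible functions determine the index
  although only outerness is assumed.\<close>

lemma outer_log_weight_index:
  assumes \<phi>: "\<phi> \<in> Linf_real_bdry q" and \<alpha>: "0 \<le> \<alpha>" "\<alpha> < 1" and out: "is_outer q \<alpha> g"
    and c: "c \<noteq> 0" "AE z in M. \<phi> z * (cmod (g z))\<^sup>2 = c * log_weight z"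
  shows "AE z in M. toeplitz q \<phi> \<alpha> g z = 0" "\<And>\<beta>. has_index q g \<beta> \<longleftrightarrow> \<beta> = \<alpha>"
    "integrable (circle_measure 1) (\<lambda>z. ln \<bar>\<phi> z\<bar>)" "integrable (circle_measure q) (\<lambda>z. ln \<bar>\<phi> z\<bar>)"
    "[\<alpha> = 1 / (4 * pi * ln q) *
      ((\<integral>z. ln \<bar>\<phi> z\<bar> \<partial>circle_measure 1) - (\<integral>z. ln \<bar>\<phi> z\<bar> \<partial>circle_measure q))] (rmod 1)"
proof -
  have g: "g \<in> Hardy q \<alpha>" using out by (simp add: is_outer_def)
  note orth = outer_log_weight_imp_orthogonal[OF \<phi> out c(2)]
  show "AE z in M. toeplitz q \<phi> \<alpha> g z = 0"
    unfolding toeplitz_eq_0_iff[OF \<phi> \<alpha>(1) g] using orth by blast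
  obtain G where G: "G \<in> Hardy0 q" "AE z in M. g z = chi_pow \<alpha> z * G z"
    using g unfolding Hardy_iff by blast
  obtain b where b: "b \<in> Hardy0 q" "AE z in M. G z * b z = 1"
    by (rule orthogonal_imp_invertible[OF \<phi> \<alpha>(1) G Hardy_square_integrable[OF g] orth c]) (assumption, rule that)
  \<comment> \<open>If \<open>g\<close> vanished almost everywhere, the nonzero weight would make
    the whole boundary a null set, against its mass \<open>4 * pi\<close>.\<close>
  have g0: "\<not> (AE z in M. g z = 0)"
  proof
    assume "AE z in M. g z = 0"
    with c(2) AE_space have "AE z in M. False"
    proof eventually_elim
      case (elim z)
      then show ?case using c(1) log_weight_nonzero[of z] by simp
    qed
    then have "AE z in M. z \<notin> space M" by eventually_elim simp
    then have "space M \<in> null_sets M" by (simp only: AE_iff_null_sets[OF sets.top])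
    from null_setsD1[OF this] have "measure M (bdry q) = 0" by (simp add: measure_def)
    then show False using measure_bdry by simp
  qed
  show "has_index q g \<beta> \<longleftrightarrow> \<beta> = \<alpha>" for \<beta>
    using index_unique[OF G b, of \<beta>] g g0 \<alpha> by (auto simp: has_index_def)
  have \<phi>m: "\<phi> \<in> borel_measurable M" using \<phi> by (simp add: Linf_real_bdry_def)
  show "integrable (circle_measure 1) (\<lambda>z. ln \<bar>\<phi> z\<bar>)" "integrable (circle_measure q) (\<lambda>z. ln \<bar>\<phi> z\<bar>)"
    "[\<alpha> = 1 / (4 * pi * ln q) *
      ((\<integral>z. ln \<bar>\<phi> z\<bar> \<partial>circle_measure 1) - (\<integral>z. ln \<bar>\<phi> z\<bar> \<partial>circle_measure q))] (rmod 1)"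
    by (rule index_formula[OF G b \<phi>m c])+
qed

text \<open>Values of the operator are chosen representatives, so linearity is established through
  the orthogonality relations.\<close>

lemma toeplitz_kernel_add_mult:
  assumes \<phi>: "\<phi> \<in> Linf_real_bdry q" and \<alpha>: "0 \<le> \<alpha>"
    and "f \<in> toeplitz_eigenspace q \<phi> \<alpha> 0" "g \<in> toeplitz_eigenspace q \<phi> \<alpha> 0"
  shows "(\<lambda>z. f z + s * g z) \<in> toeplitz_eigenspace q \<phi> \<alpha> 0"
proof -
  have f: "f \<in> Hardy q \<alpha>" "AE z in M. toeplitz q \<phi> \<alpha> f z = 0"
    and g: "g \<in> Hardy q \<alpha>" "AE z in M. toeplitz q \<phi> \<alpha> g z = 0"
    using assms(3,4) by (auto simp: toeplitz_eigenspace_def)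
  have h: "(\<lambda>z. f z + s * g z) \<in> Hardy q \<alpha>" by (intro Hardy_add Hardy_cmult f g)
  have "(\<integral>z. complex_of_real (\<phi> z) * (f z + s * g z) * cnj (k z) \<partial>M) = 0" if k: "k \<in> Hardy q \<alpha>" for k
  proof -
    have i: "integrable M (\<lambda>z. complex_of_real (\<phi> z) * f z * cnj (k z))"
      "integrable M (\<lambda>z. complex_of_real (\<phi> z) * g z * cnj (k z))"
      by (intro square_integrable_mult Linf_mult_square_integrable \<phi> square_integrable_cnj
          Hardy_square_integrable[OF f(1)] Hardy_square_integrable[OF g(1)] Hardy_square_integrable[OF k])+
    have "(\<integral>z. complex_of_real (\<phi> z) * (f z + s * g z) * cnj (k z) \<partial>M)
        = (\<integral>z. complex_of_real (\<phi> z) * f z * cnj (k z) + s * (complex_of_real (\<phi> z) * g z * cnj (k z)) \<partial>M)"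
      by (simp add: algebra_simps)
    also have "\<dots> = (\<integral>z. complex_of_real (\<phi> z) * f z * cnj (k z) \<partial>M) + s * (\<integral>z. complex_of_real (\<phi> z) * g z * cnj (k z) \<partial>M)"
      using i by simp
    also have "\<dots> = 0"
      using f(2) g(2) k unfolding toeplitz_eq_0_iff[OF \<phi> \<alpha> f(1)] toeplitz_eq_0_iff[OF \<phi> \<alpha> g(1)] by simp
    finally show ?thesis .
  qed
  then have "AE z in M. toeplitz q \<phi> \<alpha> (\<lambda>z. f z + s * g z) z = 0"
    unfolding toeplitz_eq_0_iff[OF \<phi> \<alpha> h] by blast
  with h show ?thesis by (simp add: toeplitz_eigenspace_def)
qed

text \<open>The ratio \<open>u\<close> of two elements of the kernel is constant since \<open>\<bar>u\<bar>\<close>, \<open>\<bar>u + 1\<bar>\<close> and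
  \<open>\<bar>u + \<i>\<bar>\<close> are.\<close>

lemma dim_toeplitz_kernel_le_one:
  assumes \<phi>: "\<phi> \<in> Linf_real_bdry q" and \<phi>0: "\<not> (AE z in M. \<phi> z = 0)" and \<alpha>: "0 \<le> \<alpha>"
  shows "dim_le_one q (toeplitz_eigenspace q \<phi> \<alpha> 0)"
proof -
  let ?E = "toeplitz_eigenspace q \<phi> \<alpha> 0"
  have zero: "(\<lambda>z. 0) \<in> ?E"
    using toeplitz_eq_0_iff[OF \<phi> \<alpha> Hardy_0] by (simp add: toeplitz_eigenspace_def Hardy_0)
  show ?thesis
  proof (cases "\<forall>e\<in>?E. AE z in M. e z = 0")
    case True
    then show ?thesis unfolding dim_le_one_def using zero by (intro bexI[of _ "\<lambda>z. 0"]) auto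
  next
    case False
    then obtain e where e: "e \<in> ?E" "\<not> (AE z in M. e z = 0)" by blast
    \<comment> \<open>The constant is allowed to be 0 here, so that the zero element of the kernel
      is covered.\<close>
    have weight: "\<exists>c. AE z in M. \<phi> z * (cmod (h z))\<^sup>2 = c * log_weight z" if h: "h \<in> ?E" for h
    proof (cases "AE z in M. h z = 0")
      case True
      then have "AE z in M. \<phi> z * (cmod (h z))\<^sup>2 = 0 * log_weight z" by eventually_elim simp
      then show ?thesis by blast
    next
      case False
      then show ?thesis
        using toeplitz_kernel_outer(2)[OF \<phi> \<phi>0 \<alpha> _ False] h by (auto simp: toeplitz_eigenspace_def)
    qed
    obtain ce where ce: "ce \<noteq> 0" "AE z in M. \<phi> z * (cmod (e z))\<^sup>2 = ce * log_weight z"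
      using toeplitz_kernel_outer(2)[OF \<phi> \<phi>0 \<alpha> _ e(2)] e(1) by (auto simp: toeplitz_eigenspace_def)
    have ratio: "\<exists>A. AE z in M. (cmod (h z))\<^sup>2 = A * (cmod (e z))\<^sup>2" if h: "h \<in> ?E" for h
    proof -
      obtain ch where ch: "AE z in M. \<phi> z * (cmod (h z))\<^sup>2 = ch * log_weight z" using weight[OF h] by blast
      have "AE z in M. (cmod (h z))\<^sup>2 = (ch / ce) * (cmod (e z))\<^sup>2"
        using ch ce(2) AE_space
      proof eventually_elim
        case (elim z)
        then have w: "log_weight z \<noteq> 0" using log_weight_nonzero by simp
        then have \<phi>z: "\<phi> z \<noteq> 0" using elim(2) ce(1) by auto
        have "\<phi> z * (cmod (h z))\<^sup>2 = (ch / ce) * (ce * log_weight z)" using elim(1) ce(1) by simp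
        also have "\<dots> = \<phi> z * ((ch / ce) * (cmod (e z))\<^sup>2)" unfolding elim(2)[symmetric] by simp
        finally show ?case unfolding mult_left_cancel[OF \<phi>z] .
      qed
      then show ?thesis by blast
    qed
    have "\<exists>c. AE z in M. f z = c * e z" if f: "f \<in> ?E" for f
    proof -
      obtain A where A: "AE z in M. (cmod (f z))\<^sup>2 = A * (cmod (e z))\<^sup>2" using ratio[OF f] by blast
      obtain B where B: "AE z in M. (cmod (f z + 1 * e z))\<^sup>2 = B * (cmod (e z))\<^sup>2"
        using ratio[OF toeplitz_kernel_add_mult[OF \<phi> \<alpha> f e(1)]] by blast
      obtain D where D: "AE z in M. (cmod (f z + \<i> * e z))\<^sup>2 = D * (cmod (e z))\<^sup>2"
        using ratio[OF toeplitz_kernel_add_mult[OF \<phi> \<alpha> f e(1)]] by blast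
      \<comment> \<open>From \<open>\<bar>u + 1\<bar>\<^sup>2 = \<bar>u\<bar>\<^sup>2 + 2 * Re u +
        1\<close> and \<open>\<bar>u + \<i>\<bar>\<^sup>2 = \<bar>u\<bar>\<^sup>2 + 2 * Im u +
        1\<close>, solved for the two parts of \<open>u\<close>.\<close>
      have "AE z in M. f z = Complex ((B - A - 1) / 2) ((D - A - 1) / 2) * e z"
        using A B D ce(2) AE_space
      proof eventually_elim
        case (elim z)
        have e0: "e z \<noteq> 0" using elim(4,5) ce(1) log_weight_nonzero[of z] by auto
        define u where "u = f z / e z"
        have fz: "f z = u * e z" using e0 by (simp add: u_def)
        have e2: "(cmod (e z))\<^sup>2 \<noteq> 0" using e0 by simp
        have "(cmod (u * e z))\<^sup>2 = A * (cmod (e z))\<^sup>2" using elim(1) fz by simp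
        then have 1: "(cmod u)\<^sup>2 = A" using e2 by (simp add: norm_mult power_mult_distrib)
        have "u * e z + 1 * e z = (u + 1) * e z" by (simp add: distrib_right)
        then have "(cmod ((u + 1) * e z))\<^sup>2 = B * (cmod (e z))\<^sup>2" using elim(2) fz by simp
        then have 2: "(cmod (u + 1))\<^sup>2 = B" using e2 by (simp add: norm_mult power_mult_distrib)
        have "u * e z + \<i> * e z = (u + \<i>) * e z" by (simp add: distrib_right)
        then have "(cmod ((u + \<i>) * e z))\<^sup>2 = D * (cmod (e z))\<^sup>2" using elim(3) fz by simp
        then have 3: "(cmod (u + \<i>))\<^sup>2 = D" using e2 by (simp add: norm_mult power_mult_distrib)
        have "Re u = (B - A - 1) / 2" "Im u = (D - A - 1) / 2"
          using 1 2 3 unfolding cmod_power2 by (auto simp: power2_eq_square algebra_simps)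
        then have "u = Complex ((B - A - 1) / 2) ((D - A - 1) / 2)" by (simp add: complex_eq_iff)
        then show ?case using fz by simp
      qed
      then show ?thesis by blast
    qed
    then show ?thesis unfolding dim_le_one_def using e(1) by blast
  qed
qed

end

theorem theorem2p1:
  fixes q :: real and \<phi> :: "complex \<Rightarrow> real"
  assumes "0 < q" and "q < 1" and "\<phi> \<in> Linf_real_bdry q"
  shows
    "(\<not> (AE z in bdry_measure q. \<phi> z = 0) \<longrightarrow>
       (\<forall>\<alpha> g. 0 \<le> \<alpha> \<and> \<alpha> < 1 \<and> g \<in> Hardy q \<alpha> \<and> \<not> (AE z in bdry_measure q. g z = 0) \<and>
          (AE z in bdry_measure q. toeplitz q \<phi> \<alpha> g z = 0) \<longrightarrow>
          is_outer q \<alpha> g \<and>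
          (\<exists>c::real. c \<noteq> 0 \<and> (AE z in bdry_measure q.
             \<phi> z * (cmod (g z))\<^sup>2 = c * ln (cmod (z * complex_of_real (q powr (-1/2)))))))) \<and>
     (\<forall>\<alpha> g. 0 \<le> \<alpha> \<and> \<alpha> < 1 \<and> is_outer q \<alpha> g \<and>
          (\<exists>c::real. c \<noteq> 0 \<and> (AE z in bdry_measure q.
             \<phi> z * (cmod (g z))\<^sup>2 = c * ln (cmod (z * complex_of_real (q powr (-1/2)))))) \<longrightarrow>
          (AE z in bdry_measure q. toeplitz q \<phi> \<alpha> g z = 0) \<and>
          (\<forall>\<beta>. has_index q g \<beta> \<longleftrightarrow> \<beta> = \<alpha>) \<and>
          integrable (circle_measure 1) (\<lambda>z. ln \<bar>\<phi> z\<bar>) \<and>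
          integrable (circle_measure q) (\<lambda>z. ln \<bar>\<phi> z\<bar>) \<and>
          [\<alpha> = 1 / (4 * pi * ln q) *
             ((\<integral>z. ln \<bar>\<phi> z\<bar> \<partial>circle_measure 1) - (\<integral>z. ln \<bar>\<phi> z\<bar> \<partial>circle_measure q))] (rmod 1)) \<and>
     (\<not> (AE z in bdry_measure q. \<phi> z = 0) \<longrightarrow>
       (\<forall>\<alpha> \<beta>. 0 \<le> \<alpha> \<and> \<alpha> < 1 \<and> 0 \<le> \<beta> \<and> \<beta> < 1 \<and>
          toeplitz_eigenvalue q \<phi> \<alpha> 0 \<and> toeplitz_eigenvalue q \<phi> \<beta> 0 \<longrightarrow> \<alpha> = \<beta>) \<and>
       (\<forall>\<alpha>. 0 \<le> \<alpha> \<and> \<alpha> < 1 \<longrightarrow> dim_le_one q (toeplitz_eigenspace q \<phi> \<alpha> 0)))"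
proof -
  interpret annulus_boundary q by unfold_locales (use assms in auto)
  note \<phi> = assms(3)
  have i: "is_outer q \<alpha> g \<and> (\<exists>c::real. c \<noteq> 0 \<and> (AE z in M. \<phi> z * (cmod (g z))\<^sup>2 = c * log_weight z))"
    if "\<not> (AE z in M. \<phi> z = 0)"
      "0 \<le> \<alpha> \<and> \<alpha> < 1 \<and> g \<in> Hardy q \<alpha> \<and> \<not> (AE z in M. g z = 0) \<and> (AE z in M. toeplitz q \<phi> \<alpha> g z = 0)" for \<alpha> g
    using toeplitz_kernel_outer[OF \<phi> that(1)] that(2) by blast
  have ii: "(AE z in M. toeplitz q \<phi> \<alpha> g z = 0) \<and> (\<forall>\<beta>. has_index q g \<beta> \<longleftrightarrow> \<beta> = \<alpha>) \<and>
      integrable (circle_measure 1) (\<lambda>z. ln \<bar>\<phi> z\<bar>) \<and> integrable (circle_measure q) (\<lambda>z. ln \<bar>\<phi> z\<bar>) \<and>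
      [\<alpha> = 1 / (4 * pi * ln q) *
        ((\<integral>z. ln \<bar>\<phi> z\<bar> \<partial>circle_measure 1) - (\<integral>z. ln \<bar>\<phi> z\<bar> \<partial>circle_measure q))] (rmod 1)"
    if "0 \<le> \<alpha> \<and> \<alpha> < 1 \<and> is_outer q \<alpha> g \<and> (\<exists>c::real. c \<noteq> 0 \<and> (AE z in M. \<phi> z * (cmod (g z))\<^sup>2 = c * log_weight z))" for \<alpha> g
  proof -
    from that obtain c where c: "c \<noteq> 0" "AE z in M. \<phi> z * (cmod (g z))\<^sup>2 = c * log_weight z" by blast
    from that have "0 \<le> \<alpha>" "\<alpha> < 1" "is_outer q \<alpha> g" by blast+
    note facts = outer_log_weight_index[OF \<phi> this c]
    show ?thesis by (intro conjI allI facts)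
  qed
  have iii: "\<alpha> = \<beta>"
    if \<phi>0: "\<not> (AE z in M. \<phi> z = 0)" and \<alpha>: "0 \<le> \<alpha>" "\<alpha> < 1" and \<beta>: "0 \<le> \<beta>" "\<beta> < 1"
      and ev: "toeplitz_eigenvalue q \<phi> \<alpha> 0" "toeplitz_eigenvalue q \<phi> \<beta> 0" for \<alpha> \<beta>
  proof -
    let ?x = "1 / (4 * pi * ln q) * ((\<integral>z. ln \<bar>\<phi> z\<bar> \<partial>circle_measure 1) - (\<integral>z. ln \<bar>\<phi> z\<bar> \<partial>circle_measure q))"
    \<comment> \<open>The right-hand side depends on the symbol alone, so any two indices with
      nontrivial kernel are congruent to each other; in the half-open unit interval congruent
      numbers coincide.\<close>
    have cong: "[\<gamma> = ?x] (rmod 1)" if \<gamma>: "0 \<le> \<gamma>" "\<gamma> < 1" and ev: "toeplitz_eigenvalue q \<phi> \<gamma> 0" for \<gamma>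
    proof -
      obtain f where "f \<in> Hardy q \<gamma>" "\<not> (AE z in M. f z = 0)" "AE z in M. toeplitz q \<phi> \<gamma> f z = 0"
        using ev by (auto simp: toeplitz_eigenvalue_def toeplitz_eigenspace_def)
      with i[OF \<phi>0, of \<gamma> f] ii[of \<gamma> f] \<gamma> show ?thesis by blast
    qed
    have "[\<alpha> = \<beta>] (rmod 1)"
      using rcong_trans[OF cong[OF \<alpha> ev(1)] rcong_sym[OF cong[OF \<beta> ev(2)]]] .
    then obtain n :: int where n: "\<beta> = \<alpha> + of_int n * 1" unfolding rcong_altdef by blast
    then have "\<bar>real_of_int n\<bar> < 1" using \<alpha> \<beta> by linarith
    then have "n = 0" by linarith
    with n show ?thesis by simp
  qed
  have iv: "dim_le_one q (toeplitz_eigenspace q \<phi> \<alpha> 0)"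
    if "\<not> (AE z in M. \<phi> z = 0)" "0 \<le> \<alpha>" for \<alpha>
    by (rule dim_toeplitz_kernel_le_one[OF \<phi> that])
  show ?thesis
    unfolding log_weight_def[symmetric]
    using i ii iii iv by (intro conjI impI allI) blast+
qed

end
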